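(* Let $n\ge1$ and let $\mathbf w^0$ be the vector with $\mathbf w^0_0=1$ and $\mathbf w^0_i=0$ for $0\neq i\in\mathbb Z/(n+1)\mathbb Z$. For every $\mathbf v$, the irreducible components of $\tilde{\mathcal L}(\mathbf v,\mathbf w^0)$ are precisely those $X_f$ where $f\in\tilde Z_{\mathbf V}$ is such that, for some Young diagram $Y\in\mathcal Y$, $f(k',k)$ equals the multiplicity of $(k',k)$ in $A_Y$ for all $(k',k)\in Z$ (in particular $f(k',k)=0$ for $(k',k)\notin A_Y$). Denote the component corresponding to such an $f$ by $X_Y$. Then $Y\leftrightarrow X_Y$ is a one-to-one correspondence between the set $\mathcal Y$ and the set of irreducible components of $\bigcup_{\mathbf v}\tilde{\mathcal L}(\mathbf v,\mathbf w^0)$ (i.e. the disjoint union over all $\mathbf v$ of the sets of irreducible components of $\tilde{\mathcal L}(\mathbf v,\mathbf w^0)$).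
   Context: Quiver. $I=\mathbb Z/(n+1)\mathbb Z$. For every $i\in I$ there is an arrow $i\to i-1$ (with $\mathrm{out}=i$, $\mathrm{in}=i-1$) and an opposite arrow $i\leftarrow i-1$ (with $\mathrm{out}=i-1$, $\mathrm{in}=i$). $\Omega$ is the set of arrows $i\to i-1$, $\bar\Omega$ the set of arrows $i\leftarrow i-1$, $H=\Omega\sqcup\bar\Omega$, and $h\mapsto\bar h$ interchanges $i\to i-1$ and $i\leftarrow i-1$. $\varepsilon(h)=1$ for $h\in\Omega$, $\varepsilon(h)=-1$ for $h\in\bar\Omega$. For a finite-dimensional $I$-graded complex vector space $\mathbf V=\bigoplus_i\mathbf V_i$ of graded dimension $\mathbf v$, let $\mathbf E_{\mathbf V}=\bigoplus_{h\in H}\mathrm{Hom}(\mathbf V_{\mathrm{out}(h)},\mathbf V_{\mathrm{in}(h)})$, let $\mathbf E_{\mathbf V,\Omega}$, $\mathbf E_{\mathbf V,\bar\Omega}$ be the subspaces of $x$ with $x_h=0$ for $h\notin\Omega$, resp. $h\notin\bar\Omega$, and let $G_{\mathbf V}=\prod_i\mathrm{Aut}(\mathbf V_i)$ act by $(gx)_h=g_{\mathrm{in}(h)}x_hg_{\mathrm{out}(h)}^{-1}$. Put $\langle x,y\rangle=\sum_{h\in H}\varepsilon(h)\,\mathrm{tr}(x_hy_{\bar h})$ and $\psi_i(x)=\sum_{h\in H,\ \mathrm{in}(h)=i}\varepsilon(h)x_hx_{\bar h}\in\mathrm{End}(\mathbf V_i)$. $x\in\mathbf E_{\mathbf V}$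 is nilpotent if for some $N\ge1$ all compositions $x_{h_1}\cdots x_{h_N}$ along composable sequences of $N$ arrows vanish. $\tilde\Lambda_{\mathbf V}$ is the set of all $x=x'+x''$ with $x'\in\mathbf E_{\mathbf V,\Omega}$, $x''\in\mathbf E_{\mathbf V,\bar\Omega}$, such that $x'$ is nilpotent and $\psi_i(x)=0$ for all $i$ (no nilpotency is imposed on $x''$). Orbits. For integers $k'\le k$ let $x(k',k)$ be the representation of $(I,\Omega)$ with basis $e_r$ ($k'\le r\le k$), $e_r$ of degree $r$ mod $n+1$, $e_r\mapsto e_{r-1}$, $e_{k'-1}=0$. $Z$ is the set of pairs of integers $(k'\le k)$ up to simultaneous translation by multiples of $n+1$; $\tilde Z$ is the set of finitely supported functions $Z\to\mathbb N$ ($\mathbb N\ni0$); $\tilde Z_{\mathbf V}$ is the subset of those $f$ with $\sum_{(k',k)\in Z}f(k',k)\,\#\{r : k'\le r\le k,\ r\equiv i \bmod (n+1)\}=\dim\mathbf V_i$ for all $i$. For $f\in\tilde Z_{\mathbf V}$, $\mathcal O_f\subset\mathbf E_{\mathbf V,\Omega}$ is the $G_{\mathbf V}$-orbit of representations isomorphic to $\bigoplus x(k',k)^{\oplus f(k',k)}$; $\mathcal C_f\subset\mathbf E_{\mathbf V}$ is its conormal bundle, i.e. the set of $x'+x''$ with $x'\in\mathcal O_f$, $x''\in\mathbf E_{\mathbf V,\bar\Omega}$ orthogonal under $\langle\,,\rangle$ to the tangent space of $\mathcal O_f$ at $x'$; $\bar{\mathcal C}_f$ is its closure. Varieties. For $I$-graded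 $\mathbf V,\mathbf W$ of graded dimensions $\mathbf v,\mathbf w$, let $\tilde\Lambda(\mathbf v,\mathbf w)=\tilde\Lambda_{\mathbf V}\times\bigoplus_i\mathrm{Hom}(\mathbf V_i,\mathbf W_i)$ with $G_{\mathbf V}$-action $g(x,j)=(gx,(j_ig_i^{-1}))$; $\tilde\Lambda(\mathbf v,\mathbf w)^{\mathrm{st}}$ is the set of $(x,j)$ such that the only graded subspace $\mathbf S\subset\mathbf V$ with $x(\mathbf S)\subset\mathbf S$ and $j(\mathbf S)=0$ is $0$; $\tilde{\mathcal L}(\mathbf v,\mathbf w)=\tilde\Lambda(\mathbf v,\mathbf w)^{\mathrm{st}}/G_{\mathbf V}$. Put $X_f=\big((\bar{\mathcal C}_f\times\bigoplus_i\mathrm{Hom}(\mathbf V_i,\mathbf W_i))\cap\tilde\Lambda(\mathbf v,\mathbf w)^{\mathrm{st}}\big)/G_{\mathbf V}$. Young diagrams. $\mathcal Y$ is the set of Young diagrams $Y=[l_1,\dots,l_s]$ (weakly decreasing sequences of positive integers; $s=0$ for the empty diagram). $A_Y$ is the multiset of the pairs $(1-i,l_i-i)$, $1\le i\le s$, taken in $Z$; the multiplicity of an element of $Z$ in $A_Y$ is the number of indices $i$ for which $(1-i,l_i-i)$ represents it. *)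

theory Defs
  imports
    "HOL-Analysis.Abstract_Topology"
    "HOL-Library.Multiset"
    "Jordan_Normal_Form.VS_Connect"
    "Jordan_Normal_Form.Gauss_Jordan_Elimination"
begin

section \<open>Topological preliminaries\<close>

subsection \<open>Irreducible components\<close>

definition irreducible_in :: "'p topology \<Rightarrow> 'p set \<Rightarrow> bool" where
  "irreducible_in X S \<longleftrightarrow>
     S \<subseteq> topspace X \<and> S \<noteq> {} \<and>
     (\<forall>A B. closedin X A \<longrightarrow> closedin X B \<longrightarrow> S \<subseteq> A \<union> B \<longrightarrow> S \<subseteq> A \<or> S \<subseteq> B)"

definition irreducible_components :: "'p topology \<Rightarrow> 'p set set" where
  "irreducible_components X =
     {S. irreducible_in X S \<and> (\<forall>T. irreducible_in X T \<longrightarrow> S \<subseteq> T \<longrightarrow> T = S)}"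

subsection \<open>Zariski topology\<close>

text \<open>
  \<open>poly_funs F\<close> is the algebra of polynomial functions in the coordinate functions \<open>F\<close>.
\<close>

inductive_set poly_funs :: "('p \<Rightarrow> complex) set \<Rightarrow> ('p \<Rightarrow> complex) set"
  for F :: "('p \<Rightarrow> complex) set"
where
  const: "(\<lambda>_. a) \<in> poly_funs F"
| coord: "f \<in> F \<Longrightarrow> f \<in> poly_funs F"
| add: "p \<in> poly_funs F \<Longrightarrow> q \<in> poly_funs F \<Longrightarrow> (\<lambda>z. p z + q z) \<in> poly_funs F"
| mult: "p \<in> poly_funs F \<Longrightarrow> q \<in> poly_funs F \<Longrightarrow> (\<lambda>z. p z * q z) \<in> poly_funs F"

definition zariski :: "'p set \<Rightarrow> ('p \<Rightarrow> complex) set \<Rightarrow> 'p topology" where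
  "zariski S F = topology (\<lambda>U. \<exists>P \<subseteq> poly_funs F. U = S - {z \<in> S. \<forall>p\<in>P. p z = 0})"

lemma istopology_zariski:
  "istopology (\<lambda>U. \<exists>P \<subseteq> poly_funs F. U = S - {z \<in> S. \<forall>p\<in>P. p z = 0})"
  unfolding istopology_def
proof (intro conjI allI impI)
  fix U V
  assume "\<exists>P \<subseteq> poly_funs F. U = S - {z \<in> S. \<forall>p\<in>P. p z = 0}"
    and "\<exists>P \<subseteq> poly_funs F. V = S - {z \<in> S. \<forall>p\<in>P. p z = 0}"
  then obtain P Q where P: "P \<subseteq> poly_funs F" "U = S - {z \<in> S. \<forall>p\<in>P. p z = 0}"
    and Q: "Q \<subseteq> poly_funs F" "V = S - {z \<in> S. \<forall>p\<in>Q. p z = 0}"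
    by blast
  let ?R = "{(\<lambda>z. p z * q z) | p q. p \<in> P \<and> q \<in> Q}"
  have "?R \<subseteq> poly_funs F"
    using P(1) Q(1) by (auto intro: poly_funs.mult)
  moreover have "z \<in> U \<inter> V \<longleftrightarrow> z \<in> S - {z \<in> S. \<forall>p\<in>?R. p z = 0}" for z
  proof -
    have "(\<forall>r\<in>?R. r z = 0) \<longleftrightarrow> (\<forall>p\<in>P. \<forall>q\<in>Q. p z = 0 \<or> q z = 0)" (is "?l \<longleftrightarrow> ?r")
    proof
      assume l: ?l
      show ?r
      proof (intro ballI)
        fix p q
        assume "p \<in> P" "q \<in> Q"
        then have "(\<lambda>z. p z * q z) \<in> ?R"
          by blast
        with l have "p z * q z = 0"
          by (rule bspec)
        then show "p z = 0 \<or> q z = 0"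
          by simp
      qed
    next
      assume ?r
      then show ?l
        by auto
    qed
    then show ?thesis
      by (simp only: P(2) Q(2) Int_iff Diff_iff mem_Collect_eq) fast
  qed
  then have "U \<inter> V = S - {z \<in> S. \<forall>p\<in>?R. p z = 0}"
    by (intro equalityI subsetI) simp_all
  ultimately show "\<exists>P \<subseteq> poly_funs F. U \<inter> V = S - {z \<in> S. \<forall>p\<in>P. p z = 0}"
    by blast
next
  fix \<K>
  assume "\<forall>K\<in>\<K>. \<exists>P \<subseteq> poly_funs F. K = S - {z \<in> S. \<forall>p\<in>P. p z = 0}"
  from bchoice[OF this] obtain P where
    "\<forall>K\<in>\<K>. P K \<subseteq> poly_funs F \<and> K = S - {z \<in> S. \<forall>p\<in>P K. p z = 0}"
    by (elim exE)
  note P = this[THEN bspec, THEN conjunct1] this[THEN bspec, THEN conjunct2]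
  have "z \<in> \<Union>\<K> \<longleftrightarrow> z \<in> S \<and> (\<exists>K\<in>\<K>. \<exists>p\<in>P K. p z \<noteq> 0)" for z
  proof -
    have "z \<in> K \<longleftrightarrow> z \<in> S \<and> (\<exists>p\<in>P K. p z \<noteq> 0)" if "K \<in> \<K>" for K
      by (subst P(2)[OF that]) blast
    then show ?thesis
      by blast
  qed
  then have "\<Union>\<K> = S - {z \<in> S. \<forall>p\<in>\<Union>(P ` \<K>). p z = 0}"
    by auto
  moreover have "\<Union>(P ` \<K>) \<subseteq> poly_funs F"
    using P(1) by blast
  ultimately show "\<exists>P \<subseteq> poly_funs F. \<Union>\<K> = S - {z \<in> S. \<forall>p\<in>P. p z = 0}"
    by blast
qed

lemma openin_zariski:
  "openin (zariski S F) U \<longleftrightarrow> (\<exists>P \<subseteq> poly_funs F. U = S - {z \<in> S. \<forall>p\<in>P. p z = 0})"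
  unfolding zariski_def topology_inverse'[OF istopology_zariski] ..

lemma topspace_zariski [simp]: "topspace (zariski S F) = S"
proof
  obtain P :: "('a \<Rightarrow> complex) set" where "topspace (zariski S F) = S - {z \<in> S. \<forall>p\<in>P. p z = 0}"
    using openin_topspace[of "zariski S F"] unfolding openin_zariski by (elim exE conjE)
  then show "topspace (zariski S F) \<subseteq> S"
    by (simp only: Diff_subset)
  have "{\<lambda>_. 1} \<subseteq> poly_funs F" "S = S - {z \<in> S. \<forall>p\<in>{\<lambda>_. 1 :: complex}. p z = 0}"
    by (simp_all add: poly_funs.const)
  then have "openin (zariski S F) S"
    unfolding openin_zariski by (intro exI conjI)
  then show "S \<subseteq> topspace (zariski S F)"
    by (rule openin_subset)
qed

lemma closedin_zariski:
  "closedin (zariski S F) C \<longleftrightarrow> (\<exists>P \<subseteq> poly_funs F. C = {z \<in> S. \<forall>p\<in>P. p z = 0})"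
proof -
  have "C \<subseteq> S \<and> S - C = S - D \<longleftrightarrow> C = D" if "D \<subseteq> S" for D
    using that by blast
  then have *: "(C = {z \<in> S. \<forall>p\<in>P. p z = 0}) \<longleftrightarrow>
      C \<subseteq> S \<and> S - C = S - {z \<in> S. \<forall>p\<in>P. p z = 0}" for P :: "('a \<Rightarrow> complex) set"
    by (simp only: Collect_restrict)
  show ?thesis
    unfolding closedin_def openin_zariski topspace_zariski by (simp only: *) iprover
qed

subsection \<open>Quotient topology\<close>

definition quotient_topology :: "'p topology \<Rightarrow> ('p \<Rightarrow> 'q) \<Rightarrow> 'q topology" where
  "quotient_topology X \<pi> =
     topology (\<lambda>U. U \<subseteq> \<pi> ` topspace X \<and> openin X {x \<in> topspace X. \<pi> x \<in> U})"

lemma istopology_quotient: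
  "istopology (\<lambda>U. U \<subseteq> \<pi> ` topspace X \<and> openin X {x \<in> topspace X. \<pi> x \<in> U})"
  unfolding istopology_def
proof (intro conjI allI impI)
  fix S T
  assume "S \<subseteq> \<pi> ` topspace X \<and> openin X {x \<in> topspace X. \<pi> x \<in> S}"
    and "T \<subseteq> \<pi> ` topspace X \<and> openin X {x \<in> topspace X. \<pi> x \<in> T}"
  then have "openin X ({x \<in> topspace X. \<pi> x \<in> S} \<inter> {x \<in> topspace X. \<pi> x \<in> T})"
    by blast
  then show "openin X {x \<in> topspace X. \<pi> x \<in> S \<inter> T}"
    by (rule back_subst[where P = "openin X"]) blast
next
  fix \<K>
  assume "\<forall>K\<in>\<K>. K \<subseteq> \<pi> ` topspace X \<and> openin X {x \<in> topspace X. \<pi> x \<in> K}"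
  then have "openin X (\<Union>K\<in>\<K>. {x \<in> topspace X. \<pi> x \<in> K})"
    by blast
  then show "openin X {x \<in> topspace X. \<pi> x \<in> \<Union>\<K>}"
    by (rule back_subst[where P = "openin X"]) blast
qed blast+

lemma openin_quotient_topology:
  "openin (quotient_topology X \<pi>) U \<longleftrightarrow>
     U \<subseteq> \<pi> ` topspace X \<and> openin X {x \<in> topspace X. \<pi> x \<in> U}"
  unfolding quotient_topology_def topology_inverse'[OF istopology_quotient] ..

lemma topspace_quotient_topology [simp]:
  "topspace (quotient_topology X \<pi>) = \<pi> ` topspace X"
proof
  show "topspace (quotient_topology X \<pi>) \<subseteq> \<pi> ` topspace X"
    using openin_topspace[of "quotient_topology X \<pi>"] unfolding openin_quotient_topology by blast
  have "{x \<in> topspace X. \<pi> x \<in> \<pi> ` topspace X} = topspace X"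
    by blast
  then have "openin (quotient_topology X \<pi>) (\<pi> ` topspace X)"
    unfolding openin_quotient_topology by simp
  then show "\<pi> ` topspace X \<subseteq> topspace (quotient_topology X \<pi>)"
    by (rule openin_subset)
qed

lemma quotient_map_quotient_topology: "quotient_map X (quotient_topology X \<pi>) \<pi>"
  by (auto simp: quotient_map_def openin_quotient_topology)


section \<open>Representations of the cyclic quiver\<close>

text \<open>
  The vertex set \<open>\<int>/(n+1)\<int>\<close> is represented by the residues \<open>0, \<dots>, n\<close>, with arithmetic
  modulo \<open>n+1\<close>.  \<open>Down i\<close> is the arrow \<open>i \<rightarrow> i-1\<close> and \<open>Up i\<close> is the opposite arrow
  \<open>i \<leftarrow> i-1\<close>.
\<close>

datatype arrow = Down int | Up int

definition vertices :: "nat \<Rightarrow> int set" where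
  "vertices n = {0..int n}"

definition residue :: "nat \<Rightarrow> int \<Rightarrow> int" where
  "residue n r = r mod (int n + 1)"

definition Omega :: "nat \<Rightarrow> arrow set" where
  "Omega n = Down ` vertices n"

definition Omega_bar :: "nat \<Rightarrow> arrow set" where
  "Omega_bar n = Up ` vertices n"

definition arrows :: "nat \<Rightarrow> arrow set" where
  "arrows n = Omega n \<union> Omega_bar n"

fun out_vertex :: "nat \<Rightarrow> arrow \<Rightarrow> int" where
  "out_vertex n (Down i) = i"
| "out_vertex n (Up i) = residue n (i - 1)"

fun in_vertex :: "nat \<Rightarrow> arrow \<Rightarrow> int" where
  "in_vertex n (Down i) = residue n (i - 1)"
| "in_vertex n (Up i) = i"

fun bar :: "arrow \<Rightarrow> arrow" where
  "bar (Down i) = Up i"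
| "bar (Up i) = Down i"

fun eps :: "arrow \<Rightarrow> complex" where
  "eps (Down i) = 1"
| "eps (Up i) = - 1"

text \<open>
  A graded dimension \<open>v\<close> is a function on the vertices; the graded vector space of dimension
  \<open>v\<close> is taken to be the sum of the coordinate spaces \<open>carrier_vec (v i)\<close>, so that
  linear maps are matrices.  All families are extensional, so that equal families are equal
  functions.
\<close>

definition dim_vectors :: "nat \<Rightarrow> (int \<Rightarrow> nat) set" where
  "dim_vectors n = vertices n \<rightarrow>\<^sub>E UNIV"

type_synonym rep = "arrow \<Rightarrow> complex mat"

definition rep_space :: "nat \<Rightarrow> (int \<Rightarrow> nat) \<Rightarrow> rep set" where
  "rep_space n v =
     (\<Pi>\<^sub>E h \<in> arrows n. carrier_mat (v (in_vertex n h)) (v (out_vertex n h)))"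

definition rep_add :: "nat \<Rightarrow> rep \<Rightarrow> rep \<Rightarrow> rep" where
  "rep_add n x y = (\<lambda>h\<in>arrows n. x h + y h)"

definition rep_scale :: "nat \<Rightarrow> complex \<Rightarrow> rep \<Rightarrow> rep" where
  "rep_scale n t x = (\<lambda>h\<in>arrows n. t \<cdot>\<^sub>m x h)"

definition rep_supported :: "nat \<Rightarrow> (int \<Rightarrow> nat) \<Rightarrow> arrow set \<Rightarrow> rep set" where
  "rep_supported n v A =
     {x \<in> rep_space n v.
        \<forall>h \<in> arrows n - A. x h = 0\<^sub>m (v (in_vertex n h)) (v (out_vertex n h))}"

definition gauge_group :: "nat \<Rightarrow> (int \<Rightarrow> nat) \<Rightarrow> (int \<Rightarrow> complex mat) set" where
  "gauge_group n v = (\<Pi>\<^sub>E i \<in> vertices n. {g \<in> carrier_mat (v i) (v i). invertible_mat g})"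

definition form :: "nat \<Rightarrow> rep \<Rightarrow> rep \<Rightarrow> complex" where
  "form n x y =
     (\<Sum>h\<in>arrows n. eps h * (let A = x h * y (bar h) in \<Sum>k<dim_row A. A $$ (k, k)))"

definition psi :: "nat \<Rightarrow> (int \<Rightarrow> nat) \<Rightarrow> rep \<Rightarrow> int \<Rightarrow> complex mat" where
  "psi n v x i =
     finsum (module_mat TYPE(complex) (v i) (v i))
       (\<lambda>h. eps h \<cdot>\<^sub>m (x h * x (bar h))) {h \<in> arrows n. in_vertex n h = i}"

fun path_product :: "rep \<Rightarrow> arrow list \<Rightarrow> complex mat" where
  "path_product x [h] = x h"
| "path_product x (h # h' # hs) = x h * path_product x (h' # hs)"

definition composable :: "nat \<Rightarrow> arrow list \<Rightarrow> bool" where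
  "composable n hs \<longleftrightarrow>
     set hs \<subseteq> arrows n \<and> successively (\<lambda>h h'. out_vertex n h = in_vertex n h') hs"

definition nilpotent_rep :: "nat \<Rightarrow> (int \<Rightarrow> nat) \<Rightarrow> rep \<Rightarrow> bool" where
  "nilpotent_rep n v x \<longleftrightarrow>
     (\<exists>N\<ge>1. \<forall>hs. length hs = N \<longrightarrow> composable n hs \<longrightarrow>
        path_product x hs = 0\<^sub>m (v (in_vertex n (hd hs))) (v (out_vertex n (last hs))))"

definition Lambda_tilde :: "nat \<Rightarrow> (int \<Rightarrow> nat) \<Rightarrow> rep set" where
  "Lambda_tilde n v =
     {rep_add n x' x'' | x' x''.
        x' \<in> rep_supported n v (Omega n) \<and> x'' \<in> rep_supported n v (Omega_bar n) \<and>
        nilpotent_rep n v x' \<and>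
        (\<forall>i\<in>vertices n. psi n v (rep_add n x' x'') i = 0\<^sub>m (v i) (v i))}"

definition rep_coords :: "nat \<Rightarrow> (int \<Rightarrow> nat) \<Rightarrow> (rep \<Rightarrow> complex) set" where
  "rep_coords n v =
     {(\<lambda>x. x h $$ (a, b)) | h a b.
        h \<in> arrows n \<and> a < v (in_vertex n h) \<and> b < v (out_vertex n h)}"


section \<open>Orbits and conormal bundles\<close>

definition segment_class :: "nat \<Rightarrow> int \<times> int \<Rightarrow> (int \<times> int) set" where
  "segment_class n s = {(fst s + t * (int n + 1), snd s + t * (int n + 1)) | t. True}"

definition segments :: "nat \<Rightarrow> (int \<times> int) set set" where
  "segments n = segment_class n ` {(k', k). k' \<le> k}"

definition segment_rep :: "(int \<times> int) set \<Rightarrow> int \<times> int" where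
  "segment_rep c = (SOME s. s \<in> c)"

definition segment_range :: "(int \<times> int) set \<Rightarrow> int set" where
  "segment_range c = {fst (segment_rep c)..snd (segment_rep c)}"

definition Z_tilde :: "nat \<Rightarrow> ((int \<times> int) set \<Rightarrow> nat) set" where
  "Z_tilde n = {f. finite {c. f c \<noteq> 0} \<and> {c. f c \<noteq> 0} \<subseteq> segments n}"

definition graded_dim :: "nat \<Rightarrow> ((int \<times> int) set \<Rightarrow> nat) \<Rightarrow> int \<Rightarrow> nat" where
  "graded_dim n f =
     (\<lambda>i\<in>vertices n. \<Sum>c | f c \<noteq> 0. f c * card {r \<in> segment_range c. residue n r = i})"

definition Z_tilde_V :: "nat \<Rightarrow> (int \<Rightarrow> nat) \<Rightarrow> ((int \<times> int) set \<Rightarrow> nat) set" where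
  "Z_tilde_V n v = {f \<in> Z_tilde n. \<forall>i\<in>vertices n. graded_dim n f i = v i}"

text \<open>
  The standard basis of \<open>\<Oplus> x(k',k)\<^bsup>\<oplus> f(k',k)\<^esup>\<close>: the triple \<open>(c, m, r)\<close> stands for the
  basis vector \<open>e\<^sub>r\<close> of the \<open>m\<close>-th copy of the representation attached to the class \<open>c\<close>.
  A representation is isomorphic to this direct sum iff its space has a graded basis with
  the same indices on which the arrows act by the same formulas.
\<close>

definition sum_basis ::
  "nat \<Rightarrow> ((int \<times> int) set \<Rightarrow> nat) \<Rightarrow> ((int \<times> int) set \<times> nat \<times> int) set" where
  "sum_basis n f = {(c, m, r). c \<in> segments n \<and> m < f c \<and> r \<in> segment_range c}"

definition iso_to_sum :: "nat \<Rightarrow> (int \<Rightarrow> nat) \<Rightarrow> ((int \<times> int) set \<Rightarrow> nat) \<Rightarrow> rep \<Rightarrow> bool" where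
  "iso_to_sum n v f x \<longleftrightarrow>
     (\<exists>e :: (int \<times> int) set \<times> nat \<times> int \<Rightarrow> complex vec.
        (\<forall>i\<in>vertices n.
           let B = {(c, m, r) \<in> sum_basis n f. residue n r = i}
           in inj_on e B \<and>
              vectorspace.basis class_ring (module_vec TYPE(complex) (v i)) (e ` B)) \<and>
        (\<forall>(c, m, r) \<in> sum_basis n f.
           x (Down (residue n r)) *\<^sub>v e (c, m, r) =
             (if r = fst (segment_rep c) then 0\<^sub>v (v (residue n (r - 1)))
              else e (c, m, r - 1))))"

definition orbit_of :: "nat \<Rightarrow> (int \<Rightarrow> nat) \<Rightarrow> ((int \<times> int) set \<Rightarrow> nat) \<Rightarrow> rep set" where
  "orbit_of n v f = {x \<in> rep_supported n v (Omega n). iso_to_sum n v f x}"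

text \<open>
  The tangent space at \<open>x \<in> S\<close> of a locally closed subvariety \<open>S\<close> of the affine space of all
  representations: the common kernel of the differentials at \<open>x\<close> of the polynomials
  vanishing on \<open>S\<close>.
\<close>

definition tangent_space :: "nat \<Rightarrow> (int \<Rightarrow> nat) \<Rightarrow> rep set \<Rightarrow> rep \<Rightarrow> rep set" where
  "tangent_space n v S x =
     {y \<in> rep_space n v.
        \<forall>p \<in> poly_funs (rep_coords n v). (\<forall>z\<in>S. p z = 0) \<longrightarrow>
          ((\<lambda>t. p (rep_add n x (rep_scale n t y))) has_field_derivative 0) (at 0)}"

definition conormal :: "nat \<Rightarrow> (int \<Rightarrow> nat) \<Rightarrow> ((int \<times> int) set \<Rightarrow> nat) \<Rightarrow> rep set" where
  "conormal n v f =
     {rep_add n x' x'' | x' x''.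
        x' \<in> orbit_of n v f \<and> x'' \<in> rep_supported n v (Omega_bar n) \<and>
        (\<forall>y \<in> tangent_space n v (orbit_of n v f) x'. form n x'' y = 0)}"

definition conormal_closure :: "nat \<Rightarrow> (int \<Rightarrow> nat) \<Rightarrow> ((int \<times> int) set \<Rightarrow> nat) \<Rightarrow> rep set" where
  "conormal_closure n v f = zariski (rep_space n v) (rep_coords n v) closure_of conormal n v f"


section \<open>The varieties of stable points modulo the group\<close>

definition framing_space ::
  "nat \<Rightarrow> (int \<Rightarrow> nat) \<Rightarrow> (int \<Rightarrow> nat) \<Rightarrow> (int \<Rightarrow> complex mat) set" where
  "framing_space n v w = (\<Pi>\<^sub>E i \<in> vertices n. carrier_mat (w i) (v i))"

type_synonym framed_rep = "rep \<times> (int \<Rightarrow> complex mat)"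

definition gauge_act :: "nat \<Rightarrow> (int \<Rightarrow> complex mat) \<Rightarrow> framed_rep \<Rightarrow> framed_rep" where
  "gauge_act n g xj =
     ((\<lambda>h\<in>arrows n. g (in_vertex n h) * fst xj h * the (mat_inverse (g (out_vertex n h)))),
      (\<lambda>i\<in>vertices n. snd xj i * the (mat_inverse (g i))))"

definition gauge_orbit :: "nat \<Rightarrow> (int \<Rightarrow> nat) \<Rightarrow> framed_rep \<Rightarrow> framed_rep set" where
  "gauge_orbit n v xj = {gauge_act n g xj | g. g \<in> gauge_group n v}"

definition stable :: "nat \<Rightarrow> (int \<Rightarrow> nat) \<Rightarrow> (int \<Rightarrow> nat) \<Rightarrow> framed_rep \<Rightarrow> bool" where
  "stable n v w xj \<longleftrightarrow>
     (\<forall>S :: int \<Rightarrow> complex vec set.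
        (\<forall>i\<in>vertices n.
           VectorSpace.subspace class_ring (S i) (module_vec TYPE(complex) (v i))) \<longrightarrow>
        (\<forall>h\<in>arrows n. \<forall>u \<in> S (out_vertex n h). fst xj h *\<^sub>v u \<in> S (in_vertex n h)) \<longrightarrow>
        (\<forall>i\<in>vertices n. \<forall>u \<in> S i. snd xj i *\<^sub>v u = 0\<^sub>v (w i)) \<longrightarrow>
        (\<forall>i\<in>vertices n. S i = {0\<^sub>v (v i)}))"

definition Lambda_stable :: "nat \<Rightarrow> (int \<Rightarrow> nat) \<Rightarrow> (int \<Rightarrow> nat) \<Rightarrow> framed_rep set" where
  "Lambda_stable n v w =
     {xj \<in> Lambda_tilde n v \<times> framing_space n v w. stable n v w xj}"

definition framed_coords ::
  "nat \<Rightarrow> (int \<Rightarrow> nat) \<Rightarrow> (int \<Rightarrow> nat) \<Rightarrow> (framed_rep \<Rightarrow> complex) set" where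
  "framed_coords n v w =
     {(\<lambda>xj. p (fst xj)) | p. p \<in> rep_coords n v} \<union>
     {(\<lambda>xj. snd xj i $$ (a, b)) | i a b. i \<in> vertices n \<and> a < w i \<and> b < v i}"

text \<open>
  The underlying space of the geometric quotient: its points are the orbits, and it carries the
  quotient of the Zariski topology of the stable locus.
\<close>

definition L_tilde :: "nat \<Rightarrow> (int \<Rightarrow> nat) \<Rightarrow> (int \<Rightarrow> nat) \<Rightarrow> framed_rep set topology" where
  "L_tilde n v w =
     quotient_topology
       (subtopology
          (zariski (rep_space n v \<times> framing_space n v w) (framed_coords n v w))
          (Lambda_stable n v w))
       (gauge_orbit n v)"

definition X_var ::
  "nat \<Rightarrow> (int \<Rightarrow> nat) \<Rightarrow> (int \<Rightarrow> nat) \<Rightarrow> ((int \<times> int) set \<Rightarrow> nat) \<Rightarrow> framed_rep set set" where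
  "X_var n v w f =
     gauge_orbit n v ` ((conormal_closure n v f \<times> framing_space n v w) \<inter> Lambda_stable n v w)"

definition w0 :: "nat \<Rightarrow> int \<Rightarrow> nat" where
  "w0 n = (\<lambda>i\<in>vertices n. if i = 0 then 1 else 0)"


section \<open>Young diagrams\<close>

definition young_diagrams :: "nat list set" where
  "young_diagrams = {Y. sorted_wrt (\<ge>) Y \<and> (\<forall>l\<in>set Y. 0 < l)}"

text \<open>List positions start at 0, so row \<open>i\<close> of \<open>Y\<close> has length \<open>Y ! (i - 1)\<close>.\<close>

definition A_multiset :: "nat \<Rightarrow> nat list \<Rightarrow> (int \<times> int) set multiset" where
  "A_multiset n Y =
     image_mset (\<lambda>i. segment_class n (1 - int i, int (Y ! (i - 1)) - int i))
       (mset_set {1..length Y})"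

text \<open>
  \<open>f_Y\<close> has only one possible graded dimension, so the component attached to \<open>Y\<close> lies in
  the variety for that dimension.
\<close>

definition f_Y :: "nat \<Rightarrow> nat list \<Rightarrow> (int \<times> int) set \<Rightarrow> nat" where
  "f_Y n Y = count (A_multiset n Y)"

definition v_Y :: "nat \<Rightarrow> nat list \<Rightarrow> int \<Rightarrow> nat" where
  "v_Y n Y = graded_dim n (f_Y n Y)"

definition X_Y :: "nat \<Rightarrow> nat list \<Rightarrow> framed_rep set set" where
  "X_Y n Y = X_var n (v_Y n Y) (w0 n) (f_Y n Y)"

end

theory Submission
  imports Defs "HOL-Library.Function_Algebras"
    "Jordan_Normal_Form.DL_Rank"
begin

text \<open>
  The proof works in the dual space. With this framing a point is a triple of a nilpotent \<open>x'\<close>, an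
  \<open>x''\<close> and a row vector \<open>j\<close>; the moment map equation says that \<open>x'\<close> and \<open>x''\<close> commute, and
  stability says that the words \<open>j x''^m x'^k\<close> span the dual of the graded space. So the dual is a
  cyclic module over the polynomials in two variables, and such a module has a Young diagram: with
  \<open>d k\<close> the least \<open>m\<close> for which the word \<open>(k, m)\<close> is a combination of the words \<open>(k, m')\<close>,
  \<open>m' < m\<close>, and of words multiplied by \<open>x'^(k+1)\<close>, the numbers \<open>d 0 \<ge> d 1 \<ge> ...\<close> are the column
  lengths of a diagram \<open>Y\<close>, and the words at the boxes \<open>(k, m)\<close> of \<open>Y\<close> are a basis
  (\<open>card_boxes_residue\<close>). The words in the first column can be corrected so that they generate
  Jordan strings of \<open>x'\<close> whose lengths are exactly the rows of \<open>Y\<close> (\<open>row_generator\<close>). Since the box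
  \<open>(k, m)\<close> has degree \<open>k - m\<close>, the representation \<open>x'\<close> lies in the orbit attached to \<open>A_Y\<close>
  (\<open>stable_orbit\<close>). Hence the stable locus is covered by the sets attached to the finitely many
  diagrams \<open>Y\<close> of graded dimension \<open>v\<close> (\<open>stable_cover\<close>).

  The conormal space at \<open>x'\<close> consists of the \<open>x''\<close> that commute with \<open>x'\<close> (\<open>conormal_eq\<close>).
  Therefore the conormal bundle of an orbit is the image of an irreducible set, an open subset of a
  linear space, under a rational map (\<open>CF_prime\<close>). Its stable points form a nonempty open subset: shifting the
  boxes of \<open>Y\<close> to the right and downwards gives a stable point at which the words at the boxes are the
  standard basis (\<open>word_det_base\<close>), and where these words are independent, the point is stable
  (\<open>word_det_separating\<close>). So each of the sets in the cover is closed and irreducible.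

  No two of them are comparable, because all conormal bundles have the same dimension. This is used
  in the following form: one more than \<open>dimF\<close> polynomials satisfy an algebraic relation on a conormal bundle
  (\<open>CF_dependent\<close>), while some \<open>dimF\<close> polynomials satisfy none (\<open>coordF_independent\<close>). If the
  closure of the bundle of \<open>Y'\<close> contains the bundle of \<open>Y \<noteq> Y'\<close>, then the determinant of the words
  at the boxes of \<open>Y'\<close> vanishes on the smaller bundle but not on the larger one: where it does not
  vanish, the powers of \<open>x'\<close> have at least the ranks prescribed by \<open>Y'\<close>
  (\<open>tail_count_le_of_chart\<close>). Dividing a relation on the larger bundle by a power of this
  determinant yields a relation on the smaller one that does not exist (\<open>closure_incomparable\<close>).

  A finite cover by pairwise incomparable closed irreducible sets is the decomposition into
  irreducible components (\<open>irreducible_components_eqI\<close>). The sets are unions of gauge orbits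
  (\<open>KY_saturated\<close>), so all this passes to the quotient (\<open>components_L_tilde\<close>).
\<close>

section \<open>Irreducible components of a finite union\<close>

lemma irreducible_in_finite_cover:
  assumes "finite I" "irreducible_in X T" "\<And>y. y \<in> I \<Longrightarrow> closedin X (C y)" "T \<subseteq> (\<Union>y\<in>I. C y)"
  shows "\<exists>y\<in>I. T \<subseteq> C y"
  using assms(1,3,4)
proof (induction I)
  case empty
  then show ?case using assms(2) by (simp add: irreducible_in_def)
next
  case (insert a I)
  have "closedin X (\<Union>y\<in>I. C y)"
    using insert by (intro closedin_Union) auto
  then have "T \<subseteq> C a \<or> T \<subseteq> (\<Union>y\<in>I. C y)"
    using assms(2) insert(4,5) unfolding irreducible_in_def by auto
  then show ?case using insert by auto
qed

lemma irreducible_components_eqI: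
  assumes fin: "finite I"
    and closed: "\<And>y. y \<in> I \<Longrightarrow> closedin X (C y)"
    and irr: "\<And>y. y \<in> I \<Longrightarrow> irreducible_in X (C y)"
    and cover: "topspace X \<subseteq> (\<Union>y\<in>I. C y)"
    and incomparable: "\<And>y z. y \<in> I \<Longrightarrow> z \<in> I \<Longrightarrow> C y \<subseteq> C z \<Longrightarrow> y = z"
  shows "irreducible_components X = C ` I"
proof -
  have sub: "\<exists>y\<in>I. T \<subseteq> C y" if "irreducible_in X T" for T
    using irreducible_in_finite_cover[OF fin that, of C] closed cover that
    by (auto simp: irreducible_in_def)
  show ?thesis
  proof (intro equalityI subsetI)
    fix T assume T: "T \<in> irreducible_components X"
    then have "irreducible_in X T" unfolding irreducible_components_def by auto
    then obtain y where "y \<in> I" "T \<subseteq> C y" using sub by blast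
    with T irr show "T \<in> C ` I" unfolding irreducible_components_def by auto
  next
    fix T assume "T \<in> C ` I"
    then obtain y where y: "y \<in> I" "T = C y" by auto
    have "T' = T" if "irreducible_in X T'" "T \<subseteq> T'" for T'
    proof -
      obtain z where z: "z \<in> I" "T' \<subseteq> C z" using sub \<open>irreducible_in X T'\<close> by auto
      then have "y = z" using incomparable y that by auto
      then show ?thesis using y z that by auto
    qed
    then show "T \<in> irreducible_components X"
      using y irr by (auto simp: irreducible_components_def)
  qed
qed

section \<open>Polynomial and rational functions\<close>

text \<open>The closure properties that polynomial and rational functions have in common. A
  statement about composing with a polynomial map is proved once for every algebra of functions that
  contains the entries, and then used for polynomial functions, for rational functions along a
  curve, and for functions that have a derivative.\<close>

definition subalg :: "('u \<Rightarrow> complex) set \<Rightarrow> bool" where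
  "subalg R \<longleftrightarrow> (\<forall>a. (\<lambda>_. a) \<in> R) \<and>
     (\<forall>f\<in>R. \<forall>g\<in>R. (\<lambda>u. f u + g u) \<in> R \<and> (\<lambda>u. f u * g u) \<in> R)"

lemma subalg_const: "subalg R \<Longrightarrow> (\<lambda>_. a) \<in> R"
  and subalg_add: "subalg R \<Longrightarrow> f \<in> R \<Longrightarrow> g \<in> R \<Longrightarrow> (\<lambda>u. f u + g u) \<in> R"
  and subalg_mult: "subalg R \<Longrightarrow> f \<in> R \<Longrightarrow> g \<in> R \<Longrightarrow> (\<lambda>u. f u * g u) \<in> R"
  by (auto simp: subalg_def)

lemma subalg_poly_funs: "subalg (poly_funs F)"
  by (auto simp: subalg_def intro: poly_funs.intros)

lemma subalg_diff:
  assumes "subalg R" "f \<in> R" "g \<in> R"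
  shows "(\<lambda>u. f u - g u) \<in> R"
proof -
  have "(\<lambda>u. f u + (\<lambda>_. -1) u * g u) \<in> R"
    by (intro subalg_add subalg_mult subalg_const assms)
  then show ?thesis by simp
qed

lemma subalg_sum:
  assumes "subalg R" "\<And>i. i \<in> I \<Longrightarrow> f i \<in> R"
  shows "(\<lambda>u. \<Sum>i\<in>I. f i u) \<in> R"
  using assms(2)
  by (induction I rule: infinite_finite_induct)
     (auto intro: subalg_const[OF assms(1)] subalg_add[OF assms(1)])

lemma subalg_prod:
  assumes "subalg R" "\<And>i. i \<in> I \<Longrightarrow> f i \<in> R"
  shows "(\<lambda>u. \<Prod>i\<in>I. f i u) \<in> R"
  using assms(2)
  by (induction I rule: infinite_finite_induct)
     (auto intro: subalg_const[OF assms(1)] subalg_mult[OF assms(1)])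

lemma subalg_power:
  assumes "subalg R" "f \<in> R"
  shows "(\<lambda>u. f u ^ k) \<in> R"
  using subalg_prod[OF assms(1), of "{..<k}" "\<lambda>_. f"] assms(2) by simp

lemma subalg_det:
  assumes "subalg R" "\<And>a b. a < k \<Longrightarrow> b < k \<Longrightarrow> f a b \<in> R"
  shows "(\<lambda>u. det (mat k k (\<lambda>(a, b). f a b u))) \<in> R"
proof -
  have "(\<lambda>u. \<Sum>p | p permutes {0..<k}. signof p * (\<Prod>i = 0..<k. f i (p i) u)) \<in> R"
    by (intro subalg_sum subalg_mult subalg_const subalg_prod assms)
       (auto simp: permutes_in_image dest: permutes_in_image)
  also have "(\<lambda>u. \<Sum>p | p permutes {0..<k}. signof p * (\<Prod>i = 0..<k. f i (p i) u))
      = (\<lambda>u. det (mat k k (\<lambda>(a, b). f a b u)))"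
    by (auto simp: det_def intro!: ext sum.cong prod.cong arg_cong2[where f = "(*)"]
        dest!: permutes_in_image)
  finally show ?thesis .
qed

text \<open>The adjugate stands for the inverse matrix wherever no denominators are wanted.\<close>

lemma subalg_adj_mat:
  assumes "subalg R" "\<And>a b. a < k \<Longrightarrow> b < k \<Longrightarrow> f a b \<in> R" "a < k" "b < k"
  shows "(\<lambda>u. adj_mat (mat k k (\<lambda>(a, b). f a b u)) $$ (a, b)) \<in> R"
proof -
  have eq: "adj_mat (mat k k (\<lambda>(a, b). f a b u)) $$ (a, b) = (-1) ^ (b + a) *
      det (mat (k - 1) (k - 1) (\<lambda>(i, j). f (if i < b then i else Suc i) (if j < a then j else Suc j) u))" for u
    using assms(3,4) unfolding adj_mat_def cofactor_def mat_delete_def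
    by (auto intro!: arg_cong[where f = det] eq_matI)
  show ?thesis unfolding eq
    by (intro subalg_mult subalg_const subalg_det assms) auto
qed

text \<open>The way in which every polynomial dependence below is established: it suffices to treat
  the coordinate functions.\<close>

lemma poly_funs_comp:
  assumes "p \<in> poly_funs F" "subalg R" "\<And>f. f \<in> F \<Longrightarrow> (\<lambda>u. f (\<phi> u)) \<in> R"
  shows "(\<lambda>u. p (\<phi> u)) \<in> R"
  using assms(1)
  by induction (auto intro: subalg_const subalg_add subalg_mult assms)

text \<open>Only the values where \<open>\<delta>\<close> does not vanish matter, so that
  \<open>f\<close> may be given by any expression elsewhere, for instance by one that divides by
  zero.\<close>

definition rational_funs :: "('u \<Rightarrow> complex) set \<Rightarrow> ('u \<Rightarrow> complex) \<Rightarrow> ('u \<Rightarrow> complex) set" where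
  "rational_funs F \<delta> = {f. \<exists>k. \<exists>p\<in>poly_funs F. \<forall>u. \<delta> u \<noteq> 0 \<longrightarrow> f u * \<delta> u ^ k = p u}"

lemma rational_funsI:
  "p \<in> poly_funs F \<Longrightarrow> (\<And>u. \<delta> u \<noteq> 0 \<Longrightarrow> f u * \<delta> u ^ k = p u) \<Longrightarrow> f \<in> rational_funs F \<delta>"
  by (auto simp: rational_funs_def)

lemma poly_imp_rational: "p \<in> poly_funs F \<Longrightarrow> p \<in> rational_funs F \<delta>"
  by (rule rational_funsI[where k = 0]) auto

lemma subalg_rational_funs:
  assumes \<delta>: "\<delta> \<in> poly_funs F"
  shows "subalg (rational_funs F \<delta>)"
  unfolding subalg_def
proof (intro conjI allI ballI)
  fix f g assume "f \<in> rational_funs F \<delta>" "g \<in> rational_funs F \<delta>"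
  then obtain k p l q where p: "p \<in> poly_funs F" "\<And>u. \<delta> u \<noteq> 0 \<Longrightarrow> f u * \<delta> u ^ k = p u"
    and q: "q \<in> poly_funs F" "\<And>u. \<delta> u \<noteq> 0 \<Longrightarrow> g u * \<delta> u ^ l = q u"
    unfolding rational_funs_def by auto
  note I = subalg_add subalg_mult subalg_power subalg_poly_funs p(1) q(1) \<delta>
  show "(\<lambda>u. f u + g u) \<in> rational_funs F \<delta>"
  proof (rule rational_funsI[where k = "k + l"])
    show "(\<lambda>u. p u * \<delta> u ^ l + q u * \<delta> u ^ k) \<in> poly_funs F" by (intro I)
  qed (simp add: p(2)[symmetric] q(2)[symmetric] power_add algebra_simps)
  show "(\<lambda>u. f u * g u) \<in> rational_funs F \<delta>"
  proof (rule rational_funsI[where k = "k + l"])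
    show "(\<lambda>u. p u * q u) \<in> poly_funs F" by (intro I)
  qed (simp add: p(2)[symmetric] q(2)[symmetric] power_add algebra_simps)
qed (auto intro: poly_imp_rational poly_funs.const)

text \<open>Irreducibility and density are always proved along curves: a polynomial in one variable
  that has infinitely many zeros is zero.\<close>

abbreviation curve_funs :: "(complex \<Rightarrow> complex) set" where
  "curve_funs \<equiv> poly_funs {\<lambda>t. t}"

lemma curve_funs_poly: "p \<in> curve_funs \<Longrightarrow> \<exists>P. p = poly P"
proof (induction rule: poly_funs.induct)
  case (const a)
  show ?case by (rule exI[of _ "[:a:]"]) auto
next
  case (coord f)
  then show ?case by (intro exI[of _ "[:0, 1:]"]) auto
next
  case (add p q)
  then obtain P Q where "p = poly P" "q = poly Q" by auto
  then show ?case by (intro exI[of _ "P + Q"]) auto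
next
  case (mult p q)
  then obtain P Q where "p = poly P" "q = poly Q" by auto
  then show ?case by (intro exI[of _ "P * Q"]) auto
qed

lemma curve_funs_finite_zeros:
  assumes "p \<in> curve_funs" "p t \<noteq> 0"
  shows "finite {t. p t = 0}"
proof -
  obtain P where "p = poly P" using curve_funs_poly assms by blast
  moreover have "P \<noteq> 0" using calculation assms(2) by auto
  ultimately show ?thesis using poly_roots_finite[of P] by simp
qed

lemma rational_curve_finite_zeros:
  assumes "\<delta> \<in> curve_funs" "f \<in> rational_funs {\<lambda>t. t} \<delta>" "\<delta> t \<noteq> 0" "f t \<noteq> 0"
  shows "finite {t. \<delta> t = 0 \<or> f t = 0}"
proof -
  obtain k p where p: "p \<in> curve_funs" "\<And>u. \<delta> u \<noteq> 0 \<Longrightarrow> f u * \<delta> u ^ k = p u"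
    using assms(2) unfolding rational_funs_def by auto
  have "p t \<noteq> 0" using p(2)[of t] assms by auto
  then have "finite ({t. \<delta> t = 0} \<union> {t. p t = 0})"
    using curve_funs_finite_zeros assms p by auto
  then show ?thesis by (rule finite_subset[rotated]) (use p(2) in fastforce)
qed

lemma rational_curve_vanishes:
  assumes "\<delta> \<in> curve_funs" "f \<in> rational_funs {\<lambda>t. t} \<delta>" "\<delta> t \<noteq> 0"
    and "finite {s. \<delta> s \<noteq> 0 \<and> f s \<noteq> 0}"
  shows "f t = 0"
proof (rule ccontr)
  assume "f t \<noteq> 0"
  then have "finite ({t. \<delta> t = 0 \<or> f t = 0} \<union> {s. \<delta> s \<noteq> 0 \<and> f s \<noteq> 0})"
    using rational_curve_finite_zeros[OF assms(1-3)] assms(4) by auto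
  moreover have "{t. \<delta> t = 0 \<or> f t = 0} \<union> {s. \<delta> s \<noteq> 0 \<and> f s \<noteq> 0} = UNIV" by auto
  ultimately show False using infinite_UNIV_char_0[where 'a = complex] by simp
qed

lemma curve_funs_isCont: "p \<in> curve_funs \<Longrightarrow> isCont p t"
  using curve_funs_poly by fastforce

section \<open>Linear algebra of function spaces\<close>

interpretation fs: vector_space "\<lambda>(c :: complex) (f :: 'k \<Rightarrow> complex) k. c * f k"
  by unfold_locales (auto simp: algebra_simps plus_fun_def)

lemma sum_fun_apply: "(\<Sum>i\<in>I. f i) k = (\<Sum>i\<in>I. f i k :: complex)"
  by (induction I rule: infinite_finite_induct) auto

text \<open>Stated for indexed families, where a repeated vector is itself a dependence.\<close>

lemma family_dependent:
  fixes f :: "'i \<Rightarrow> 'k \<Rightarrow> complex"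
  assumes "finite I" "finite B" "card B < card I" "\<And>i. i \<in> I \<Longrightarrow> f i \<in> fs.span B"
  shows "\<exists>c. (\<exists>i\<in>I. c i \<noteq> 0) \<and> (\<forall>k. (\<Sum>i\<in>I. c i * f i k) = 0)"
proof (cases "inj_on f I")
  case False
  then obtain i j where ij: "i \<in> I" "j \<in> I" "i \<noteq> j" "f i = f j" unfolding inj_on_def by auto
  define c where "c = (\<lambda>l. if l = i then 1 else if l = j then -1 else 0 :: complex)"
  have "(\<Sum>l\<in>I. c l * f l k) = 0" for k
  proof -
    have "(\<Sum>l\<in>I. c l * f l k) = (\<Sum>l\<in>{i, j}. c l * f l k)"
      using ij assms(1) by (intro sum.mono_neutral_right) (auto simp: c_def)
    then show ?thesis using ij by (simp add: c_def)
  qed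
  then show ?thesis using ij by (intro exI[of _ c]) (auto simp: c_def)
next
  case True
  have "fs.dependent (f ` I)"
  proof (rule ccontr)
    assume "\<not> fs.dependent (f ` I)"
    then have "card (f ` I) \<le> card B"
      using fs.independent_span_bound[OF assms(2)] assms(4) by auto
    then show False using assms(3) card_image[OF True] by simp
  qed
  then obtain u where u: "\<exists>v\<in>f ` I. u v \<noteq> 0" "(\<Sum>v\<in>f ` I. (\<lambda>k. u v * v k)) = 0"
    unfolding fs.dependent_finite[OF finite_imageI[OF assms(1)]] by blast
  have "(\<Sum>i\<in>I. u (f i) * f i k) = 0" for k
    using fun_cong[OF u(2), of k] by (simp add: sum_fun_apply sum.reindex[OF True])
  then show ?thesis using u(1) by (intro exI[of _ "\<lambda>i. u (f i)"]) auto
qed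

definition unit_fun :: "'k \<Rightarrow> 'k \<Rightarrow> complex" where
  "unit_fun k = (\<lambda>l. if l = k then 1 else 0)"

definition supported :: "'k set \<Rightarrow> ('k \<Rightarrow> complex) set" where
  "supported K = {f. \<forall>k. k \<notin> K \<longrightarrow> f k = 0}"

lemma supportedD: "f \<in> supported K \<Longrightarrow> f k \<noteq> 0 \<Longrightarrow> k \<in> K"
  by (auto simp: supported_def)

lemma supported_subspace: "fs.subspace (supported K)"
  by (auto simp: fs.subspace_def supported_def zero_fun_def)

lemma supported_expand:
  assumes "finite K" "f \<in> supported K"
  shows "f = (\<Sum>k\<in>K. (\<lambda>l. f k * unit_fun k l))"
proof
  fix l
  show "f l = (\<Sum>k\<in>K. (\<lambda>l. f k * unit_fun k l)) l"
    using assms by (cases "l \<in> K") (auto simp: sum_fun_apply unit_fun_def supported_def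
        if_distrib sum.If_cases cong: if_cong)
qed

lemma span_unit_funs:
  assumes "finite K"
  shows "fs.span (unit_fun ` K) = supported K"
proof (intro equalityI subsetI)
  fix f assume "f \<in> fs.span (unit_fun ` K)"
  moreover have "unit_fun ` K \<subseteq> supported K" by (auto simp: supported_def unit_fun_def)
  ultimately show "f \<in> supported K" using fs.span_minimal[OF _ supported_subspace] by blast
next
  fix f assume "f \<in> supported K"
  show "f \<in> fs.span (unit_fun ` K)"
    by (subst supported_expand[OF assms \<open>f \<in> supported K\<close>])
       (intro fs.span_sum fs.span_scale fs.span_base, auto)
qed

section \<open>Algebraic dependence\<close>

definition monom_fun :: "nat \<Rightarrow> (nat \<Rightarrow> nat) \<Rightarrow> (nat \<Rightarrow> complex) \<Rightarrow> complex" where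
  "monom_fun D \<beta> u = (\<Prod>i<D. u i ^ \<beta> i)"

definition box_monoms :: "nat \<Rightarrow> nat \<Rightarrow> ((nat \<Rightarrow> complex) \<Rightarrow> complex) set" where
  "box_monoms D e = monom_fun D ` ({..<D} \<rightarrow>\<^sub>E {..e})"

abbreviation coord_funs :: "nat \<Rightarrow> ((nat \<Rightarrow> complex) \<Rightarrow> complex) set" where
  "coord_funs D \<equiv> (\<lambda>i u. u i) ` {..<D}"

lemma card_box_monoms: "finite (box_monoms D e)" "card (box_monoms D e) \<le> (e + 1) ^ D"
proof -
  have f: "finite ({..<D} \<rightarrow>\<^sub>E {..e})" by (intro finite_PiE) auto
  show "finite (box_monoms D e)" unfolding box_monoms_def using f by blast
  show "card (box_monoms D e) \<le> (e + 1) ^ D" unfolding box_monoms_def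
    using card_image_le[OF f, of "monom_fun D"] by (simp add: card_PiE)
qed

lemma box_monoms_mono: "e \<le> e' \<Longrightarrow> fs.span (box_monoms D e) \<subseteq> fs.span (box_monoms D e')"
  unfolding box_monoms_def by (intro fs.span_mono image_mono PiE_mono) auto

lemma box_span_mult:
  assumes "p \<in> fs.span (box_monoms D e)" "q \<in> fs.span (box_monoms D e')"
  shows "(\<lambda>u. p u * q u) \<in> fs.span (box_monoms D (e + e'))"
proof -
  let ?S = "fs.span (box_monoms D (e + e'))"
  have mon: "(\<lambda>u. p u * q u) \<in> ?S" if p: "p \<in> box_monoms D e" and q: "q \<in> box_monoms D e'" for p q
  proof -
    obtain \<beta> \<gamma> where "p = monom_fun D \<beta>" "\<beta> \<in> {..<D} \<rightarrow>\<^sub>E {..e}" "q = monom_fun D \<gamma>" "\<gamma> \<in> {..<D} \<rightarrow>\<^sub>E {..e'}"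
      using p q unfolding box_monoms_def by auto
    then have "(\<lambda>u. p u * q u) = monom_fun D (\<lambda>i\<in>{..<D}. \<beta> i + \<gamma> i)"
      and "(\<lambda>i\<in>{..<D}. \<beta> i + \<gamma> i) \<in> {..<D} \<rightarrow>\<^sub>E {..e + e'}"
      by (auto simp: monom_fun_def power_add prod.distrib fun_eq_iff intro!: add_mono)
    then show ?thesis by (auto simp: box_monoms_def intro: fs.span_base)
  qed
  note c = fs.subspace_def zero_fun_def plus_fun_def
  have one: "(\<lambda>u. p u * q u) \<in> ?S" if p: "p \<in> box_monoms D e" and q: "q \<in> fs.span (box_monoms D e')" for p q
    using q
  proof (induction rule: fs.span_induct_alt)
    case base
    then show ?case using fs.span_zero by (simp add: zero_fun_def)
  next
    case (step c x y)
    then have "(\<lambda>k. c * (p k * x k)) + (\<lambda>u. p u * y u) \<in> ?S"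
      using mon[OF p step(1)] by (intro fs.span_add fs.span_scale) auto
    then show ?case by (simp add: plus_fun_def algebra_simps)
  qed
  show ?thesis using assms(1)
  proof (induction rule: fs.span_induct_alt)
    case base
    then show ?case using fs.span_zero by (simp add: zero_fun_def)
  next
    case (step c x y)
    then have "(\<lambda>k. c * (x k * q k)) + (\<lambda>u. y u * q u) \<in> ?S"
      using one[OF step(1) assms(2)] by (intro fs.span_add fs.span_scale) auto
    then show ?case by (simp add: plus_fun_def algebra_simps)
  qed
qed

lemma box_span_one: "(\<lambda>_. 1) \<in> fs.span (box_monoms D e)"
proof -
  have "(\<lambda>_. 1) = monom_fun D (\<lambda>i\<in>{..<D}. 0)" by (auto simp: monom_fun_def)
  then show ?thesis unfolding box_monoms_def by (intro fs.span_base image_eqI[of _ _ "\<lambda>i\<in>{..<D}. 0"]) auto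
qed

lemma box_span_power:
  assumes "p \<in> fs.span (box_monoms D e)"
  shows "(\<lambda>u. p u ^ k) \<in> fs.span (box_monoms D (k * e))"
  by (induction k) (use box_span_one box_span_mult[OF assms] in auto)

lemma box_span_prod:
  assumes "finite I" "\<And>i. i \<in> I \<Longrightarrow> p i \<in> fs.span (box_monoms D (e i))"
  shows "(\<lambda>u. \<Prod>i\<in>I. p i u) \<in> fs.span (box_monoms D (\<Sum>i\<in>I. e i))"
  using assms by (induction I) (auto intro: box_span_one box_span_mult)

text \<open>Bounding the degree in each variable separately makes the number of monomials a power
  and the counting below immediate.\<close>

lemma poly_funs_box:
  assumes "p \<in> poly_funs (coord_funs D)"
  shows "\<exists>e. p \<in> fs.span (box_monoms D e)"
  using assms
proof (induction rule: poly_funs.induct)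
  case (const a)
  then show ?case using fs.span_scale[OF box_span_one[of D 0], of a] by auto
next
  case (coord f)
  then obtain i where i: "i < D" "f = (\<lambda>u. u i)" by auto
  define \<beta> where "\<beta> = (\<lambda>j\<in>{..<D}. if j = i then 1 else 0 :: nat)"
  have "(\<Prod>j<D. u j ^ \<beta> j) = u i" for u :: "nat \<Rightarrow> complex"
  proof -
    have "(\<Prod>j<D. u j ^ \<beta> j) = (\<Prod>j<D. if j = i then u j else 1)"
      by (intro prod.cong) (auto simp: \<beta>_def)
    also have "\<dots> = u i" using i by (simp add: prod.delta')
    finally show ?thesis .
  qed
  then have "f = monom_fun D \<beta>" unfolding i by (auto simp: monom_fun_def)
  moreover have "\<beta> \<in> {..<D} \<rightarrow>\<^sub>E {..1}" by (auto simp: \<beta>_def)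
  ultimately show ?case by (auto simp: box_monoms_def intro!: exI[of _ 1] fs.span_base)
next
  case (add p q)
  then obtain e e' where "p \<in> fs.span (box_monoms D e)" "q \<in> fs.span (box_monoms D e')" by auto
  then have "p \<in> fs.span (box_monoms D (e + e'))" "q \<in> fs.span (box_monoms D (e + e'))"
    using box_monoms_mono[of e "e + e'"] box_monoms_mono[of e' "e + e'"] by auto
  then show ?case using fs.span_add by (fastforce simp: plus_fun_def)
next
  case (mult p q)
  then show ?case using box_span_mult by blast
qed

abbreviation exponents :: "nat \<Rightarrow> nat \<Rightarrow> (nat \<Rightarrow> nat) set" where
  "exponents D d \<equiv> {..<D} \<rightarrow>\<^sub>E {..d}"

text \<open>Counting: after clearing denominators, the monomials of degree at most \<open>d\<close>
  in each of \<open>D + 1\<close> polynomials lie in a space of dimension of order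
  \<open>d ^ D\<close>, and there are \<open>(d + 1) ^ (D + 1)\<close> of them.\<close>

theorem algebraic_dependence:
  fixes G :: "nat \<Rightarrow> (nat \<Rightarrow> complex) \<Rightarrow> complex"
  assumes \<delta>: "\<delta> \<in> poly_funs (coord_funs D)"
    and G: "\<And>i. i \<le> D \<Longrightarrow> G i \<in> rational_funs (coord_funs D) \<delta>"
  shows "\<exists>d c. (\<exists>\<alpha>\<in>exponents (Suc D) d. c \<alpha> \<noteq> 0) \<and>
     (\<forall>u. \<delta> u \<noteq> 0 \<longrightarrow> (\<Sum>\<alpha>\<in>exponents (Suc D) d. c \<alpha> * (\<Prod>i<Suc D. G i u ^ \<alpha> i)) = 0)"
proof -
  have "\<forall>i\<in>{..D}. \<exists>k. \<exists>p\<in>poly_funs (coord_funs D). \<forall>u. \<delta> u \<noteq> 0 \<longrightarrow> G i u * \<delta> u ^ k = p u"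
    using G unfolding rational_funs_def by auto
  then obtain k where "\<forall>i\<in>{..D}. \<exists>p\<in>poly_funs (coord_funs D). \<forall>u. \<delta> u \<noteq> 0 \<longrightarrow> G i u * \<delta> u ^ k i = p u"
    by (auto dest: bchoice)
  then obtain p where p: "\<And>i. i \<le> D \<Longrightarrow> p i \<in> poly_funs (coord_funs D)"
     "\<And>i u. i \<le> D \<Longrightarrow> \<delta> u \<noteq> 0 \<Longrightarrow> G i u * \<delta> u ^ k i = p i u"
    by (auto dest!: bchoice simp: Bex_def)
  \<comment> \<open>A common denominator \<open>\<Delta>\<close> for all the
    \<open>G i\<close>.\<close>
  define K where "K = (\<Sum>i\<le>D. k i)"
  have K: "k i \<le> K" if "i \<le> D" for i unfolding K_def using that by (intro member_le_sum) auto
  define \<Delta> where "\<Delta> = (\<lambda>u. \<delta> u ^ K)"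
  define g where "g = (\<lambda>i u. p i u * \<delta> u ^ (K - k i))"
  have Gg: "G i u * \<Delta> u = g i u" if "i \<le> D" "\<delta> u \<noteq> 0" for i u
    using K[OF that(1)] p(2)[OF that] unfolding \<Delta>_def g_def
    by (metis le_add_diff_inverse mult.assoc power_add)
  have gpoly: "g i \<in> poly_funs (coord_funs D)" if "i \<le> D" for i
    unfolding g_def by (intro subalg_mult subalg_power subalg_poly_funs p(1) that \<delta>)
  have \<Delta>poly: "\<Delta> \<in> poly_funs (coord_funs D)"
    unfolding \<Delta>_def by (intro subalg_power subalg_poly_funs \<delta>)
  obtain e1 where e1: "\<Delta> \<in> fs.span (box_monoms D e1)" using poly_funs_box[OF \<Delta>poly] by auto
  have "\<forall>i\<in>{..D}. \<exists>e. g i \<in> fs.span (box_monoms D e)" using poly_funs_box gpoly by auto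
  then obtain e2 where e2: "\<And>i. i \<le> D \<Longrightarrow> g i \<in> fs.span (box_monoms D (e2 i))"
    by (auto dest!: bchoice)
  define e where "e = e1 + (\<Sum>i\<le>D. e2 i)"
  have e\<Delta>: "\<Delta> \<in> fs.span (box_monoms D e)" using e1 box_monoms_mono[of e1 e] by (auto simp: e_def)
  have eg: "g i \<in> fs.span (box_monoms D e)" if "i \<le> D" for i
  proof -
    have "e2 i \<le> e" unfolding e_def using that by (intro trans_le_add2 member_le_sum) auto
    then show ?thesis using e2[OF that] box_monoms_mono by blast
  qed
  \<comment> \<open>With this \<open>d\<close> the dimension is at most
    \<open>d * (d + 1) ^ D\<close>, less than the number of monomials.\<close>
  define d where "d = (e * Suc D + 1) ^ D"
  \<comment> \<open>Monomials in the numerators, homogenized by \<open>\<Delta>\<close> so that all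
    of them carry the same denominator.\<close>
  define M where "M = (\<lambda>\<alpha> u. (\<Prod>i<Suc D. g i u ^ \<alpha> i) * \<Delta> u ^ (Suc D * d - (\<Sum>i<Suc D. \<alpha> i)))"
  let ?E = "exponents (Suc D) d"
  have \<alpha>sum: "(\<Sum>i<Suc D. \<alpha> i) \<le> Suc D * d" if "\<alpha> \<in> ?E" for \<alpha>
    using sum_bounded_above[of "{..<Suc D}" \<alpha> d] PiE_mem[OF that] by auto
  have "M \<alpha> \<in> fs.span (box_monoms D (e * Suc D * d))" if "\<alpha> \<in> ?E" for \<alpha>
  proof -
    have "M \<alpha> \<in> fs.span (box_monoms D ((\<Sum>i<Suc D. \<alpha> i * e) + (Suc D * d - (\<Sum>i<Suc D. \<alpha> i)) * e))"
      unfolding M_def by (intro box_span_mult box_span_prod box_span_power e\<Delta> eg) auto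
    also have "(\<Sum>i<Suc D. \<alpha> i * e) + (Suc D * d - (\<Sum>i<Suc D. \<alpha> i)) * e
       = ((\<Sum>i<Suc D. \<alpha> i) + (Suc D * d - (\<Sum>i<Suc D. \<alpha> i))) * e"
      by (simp only: sum_distrib_right add_mult_distrib)
    also have "\<dots> = e * Suc D * d" using \<alpha>sum[OF that] by (simp add: algebra_simps)
    finally show ?thesis .
  qed
  moreover have "card (box_monoms D (e * Suc D * d)) < card ?E"
  proof -
    have "e * Suc D * d + 1 \<le> (e * Suc D + 1) * (d + 1)" by (simp add: algebra_simps)
    then have "(e * Suc D * d + 1) ^ D \<le> ((e * Suc D + 1) * (d + 1)) ^ D" by (rule power_mono) simp
    also have "\<dots> = d * (d + 1) ^ D" by (simp only: power_mult_distrib d_def)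
    also have "\<dots> < (d + 1) ^ Suc D" by simp
    finally show ?thesis using card_box_monoms(2)[of D "e * Suc D * d"] by (simp add: card_PiE)
  qed
  moreover have "finite ?E" by (intro finite_PiE) auto
  ultimately obtain c where c: "\<exists>\<alpha>\<in>?E. c \<alpha> \<noteq> 0" "\<And>u. (\<Sum>\<alpha>\<in>?E. c \<alpha> * M \<alpha> u) = 0"
    using family_dependent[of ?E "box_monoms D (e * Suc D * d)" M] card_box_monoms(1) by blast
  have "(\<Sum>\<alpha>\<in>?E. c \<alpha> * (\<Prod>i<Suc D. G i u ^ \<alpha> i)) = 0" if u: "\<delta> u \<noteq> 0" for u
  proof -
    have M: "M \<alpha> u = (\<Prod>i<Suc D. G i u ^ \<alpha> i) * \<Delta> u ^ (Suc D * d)" if "\<alpha> \<in> ?E" for \<alpha>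
    proof -
      have "(\<Prod>i<Suc D. g i u ^ \<alpha> i) = (\<Prod>i<Suc D. G i u ^ \<alpha> i * \<Delta> u ^ \<alpha> i)"
        by (intro prod.cong) (use Gg u in \<open>auto simp: power_mult_distrib[symmetric]\<close>)
      also have "\<dots> = (\<Prod>i<Suc D. G i u ^ \<alpha> i) * \<Delta> u ^ (\<Sum>i<Suc D. \<alpha> i)"
        by (simp only: prod.distrib power_sum)
      finally show ?thesis unfolding M_def using \<alpha>sum[OF that]
        by (simp only: mult.assoc power_add[symmetric] le_add_diff_inverse)
    qed
    have "0 = (\<Sum>\<alpha>\<in>?E. c \<alpha> * (\<Prod>i<Suc D. G i u ^ \<alpha> i)) * \<Delta> u ^ (Suc D * d)"
      using c(2)[of u] M by (simp add: sum_distrib_right mult.assoc)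
    then show ?thesis using u by (auto simp: \<Delta>_def)
  qed
  then show ?thesis using c(1) by (intro exI[of _ d] exI[of _ c]) auto
qed

text \<open>Two exponents may differ outside the first \<open>D\<close> places and then give the
  same function; the second hypothesis excludes this.\<close>

lemma polynomial_identity:
  assumes "finite A" "\<And>\<alpha> \<beta>. \<alpha> \<in> A \<Longrightarrow> \<beta> \<in> A \<Longrightarrow> (\<forall>i<D. \<alpha> i = \<beta> i) \<Longrightarrow> \<alpha> = \<beta>"
    and "\<And>w. (\<Sum>\<alpha>\<in>A. c \<alpha> * monom_fun D \<alpha> w) = 0" "\<alpha> \<in> A"
  shows "c \<alpha> = (0 :: complex)"
  using assms
proof (induction D arbitrary: A \<alpha>)
  case 0
  then have "A = {\<alpha>}" by auto
  then show ?case using 0(3) by (auto simp: monom_fun_def)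
next
  case (Suc D)
  have "(\<Sum>\<beta>\<in>{\<beta>\<in>A. \<beta> D = \<alpha> D}. c \<beta> * monom_fun D \<beta> w) = 0" for w
  proof -
    define P where "P = (\<Sum>\<beta>\<in>A. monom (c \<beta> * monom_fun D \<beta> w) (\<beta> D))"
    have "poly P x = 0" for x
    proof -
      have "monom_fun (Suc D) \<beta> (w(D := x)) = monom_fun D \<beta> w * x ^ \<beta> D" for \<beta>
      proof -
        have "(\<Prod>i<D. (w(D := x)) i ^ \<beta> i) = (\<Prod>i<D. w i ^ \<beta> i)" by (intro prod.cong) auto
        then show ?thesis by (simp add: monom_fun_def)
      qed
      then show ?thesis using Suc.prems(3)[of "w(D := x)"]
        by (simp add: P_def poly_sum poly_monom mult.assoc del: fun_upd_apply)
    qed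
    then have "P = 0" using poly_all_0_iff_0 by blast
    then have "coeff P (\<alpha> D) = 0" by simp
    then show ?thesis using Suc.prems(1)
      by (simp add: P_def coeff_sum sum.If_cases Int_def)
  qed
  then show ?case using Suc.prems(1,2,4)
    by (intro Suc.IH[of "{\<beta>\<in>A. \<beta> D = \<alpha> D}"]) (auto simp: less_Suc_eq)
qed

section \<open>Matrices indexed by a finite set\<close>

text \<open>Matrices over an index set \<open>P\<close> are functions on pairs. \<open>mm\<close> is
  the product, \<open>tr P A B\<close> the trace of \<open>A B\<close>, \<open>rm\<close> the
  action on row vectors from the right, \<open>mv\<close> the action on column vectors, and
  \<open>pairing\<close> the product of a row with a column. Indices outside \<open>P\<close> do not
  contribute; where they matter, the matrices are required to be \<open>supported\<close> on pairs
  from \<open>P\<close>.\<close>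

definition mm :: "'a set \<Rightarrow> ('a \<times> 'a \<Rightarrow> complex) \<Rightarrow> ('a \<times> 'a \<Rightarrow> complex) \<Rightarrow> 'a \<times> 'a \<Rightarrow> complex" where
  "mm P A B = (\<lambda>(p, q). \<Sum>r\<in>P. A (p, r) * B (r, q))"

definition one_m :: "'a set \<Rightarrow> 'a \<times> 'a \<Rightarrow> complex" where
  "one_m P = (\<lambda>(p, q). if p = q \<and> p \<in> P then 1 else 0)"

definition tr :: "'a set \<Rightarrow> ('a \<times> 'a \<Rightarrow> complex) \<Rightarrow> ('a \<times> 'a \<Rightarrow> complex) \<Rightarrow> complex" where
  "tr P A B = (\<Sum>p\<in>P. \<Sum>q\<in>P. A (p, q) * B (q, p))"

definition rm :: "'a set \<Rightarrow> ('a \<Rightarrow> complex) \<Rightarrow> ('a \<times> 'a \<Rightarrow> complex) \<Rightarrow> 'a \<Rightarrow> complex" where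
  "rm P \<eta> A = (\<lambda>q. \<Sum>p\<in>P. \<eta> p * A (p, q))"

definition mv :: "'a set \<Rightarrow> ('a \<times> 'a \<Rightarrow> complex) \<Rightarrow> ('a \<Rightarrow> complex) \<Rightarrow> 'a \<Rightarrow> complex" where
  "mv P A U = (\<lambda>p. \<Sum>q\<in>P. A (p, q) * U q)"

definition pairing :: "'a set \<Rightarrow> ('a \<Rightarrow> complex) \<Rightarrow> ('a \<Rightarrow> complex) \<Rightarrow> complex" where
  "pairing P \<eta> U = (\<Sum>p\<in>P. \<eta> p * U p)"

lemma mm_apply: "mm P A B (p, q) = (\<Sum>r\<in>P. A (p, r) * B (r, q))"
  by (simp add: mm_def)

lemma sum_mult_swap:
  fixes f :: "'a \<Rightarrow> complex"
  shows "(\<Sum>r\<in>P. f r * (\<Sum>s\<in>P. g r s * h s)) = (\<Sum>s\<in>P. (\<Sum>r\<in>P. f r * g r s) * h s)"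
proof -
  have "(\<Sum>r\<in>P. f r * (\<Sum>s\<in>P. g r s * h s)) = (\<Sum>r\<in>P. \<Sum>s\<in>P. f r * g r s * h s)"
    by (simp only: sum_distrib_left mult.assoc)
  also have "\<dots> = (\<Sum>s\<in>P. \<Sum>r\<in>P. f r * g r s * h s)" by (rule sum.swap)
  finally show ?thesis by (simp only: sum_distrib_right)
qed

lemma mm_assoc: "mm P (mm P A B) C = mm P A (mm P B C)"
  unfolding mm_def by (rule ext) (simp add: sum_mult_swap[symmetric] split: prod.split)

lemma rm_mm: "rm P (rm P \<eta> A) B = rm P \<eta> (mm P A B)"
  unfolding rm_def mm_def by (rule ext) (simp add: sum_mult_swap[symmetric])

lemma mv_mm: "mv P (mm P A B) U = mv P A (mv P B U)"
  unfolding mv_def mm_def by (rule ext) (simp add: sum_mult_swap[symmetric])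

lemma pairing_rm: "pairing P (rm P \<eta> A) U = pairing P \<eta> (mv P A U)"
  unfolding pairing_def rm_def mv_def by (simp add: sum_mult_swap[symmetric])

lemma tr_commute: "tr P A B = tr P B A"
  unfolding tr_def by (subst sum.swap) (simp add: mult.commute)

lemma tr_mm_left: "tr P (mm P A B) C = tr P A (mm P B C)"
proof -
  have "(\<Sum>q\<in>P. mm P A B (p, q) * C (q, p)) = (\<Sum>r\<in>P. A (p, r) * mm P B C (r, p))" for p
    unfolding mm_def by (simp add: sum_mult_swap[symmetric])
  then show ?thesis unfolding tr_def by simp
qed

lemma tr_cyclic: "tr P A (mm P B C) = tr P B (mm P C A)"
  by (metis tr_commute tr_mm_left)

lemma mm_diff_left: "mm P (\<lambda>k. A k - B k) C = (\<lambda>k. mm P A C k - mm P B C k)"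
  and mm_diff_right: "mm P C (\<lambda>k. A k - B k) = (\<lambda>k. mm P C A k - mm P C B k)"
  and mm_add_left: "mm P (\<lambda>k. A k + B k) C = (\<lambda>k. mm P A C k + mm P B C k)"
  and mm_add_right: "mm P C (\<lambda>k. A k + B k) = (\<lambda>k. mm P C A k + mm P C B k)"
  and mm_scale_left: "mm P (\<lambda>k. c * A k) C = (\<lambda>k. c * mm P A C k)"
  and mm_scale_right: "mm P C (\<lambda>k. c * A k) = (\<lambda>k. c * mm P C A k)"
  and mm_zero_left: "mm P (\<lambda>_. 0) C = (\<lambda>_. 0)"
  and mm_zero_right: "mm P C (\<lambda>_. 0) = (\<lambda>_. 0)"
  unfolding mm_def
  by (auto simp: fun_eq_iff sum_subtractf sum.distrib sum_distrib_left algebra_simps)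

lemma mm_sum_left: "mm P (\<lambda>k. \<Sum>i\<in>I. c i * A i k) C = (\<lambda>k. \<Sum>i\<in>I. c i * mm P (A i) C k)"
  by (induction I rule: infinite_finite_induct)
     (auto simp: mm_zero_left mm_add_left mm_scale_left)

lemma mm_sum_right: "mm P C (\<lambda>k. \<Sum>i\<in>I. c i * A i k) = (\<lambda>k. \<Sum>i\<in>I. c i * mm P C (A i) k)"
  by (induction I rule: infinite_finite_induct)
     (auto simp: mm_zero_right mm_add_right mm_scale_right)

lemma tr_linear:
  "tr P (\<lambda>k. A k - B k) C = tr P A C - tr P B C"
  "tr P C (\<lambda>k. A k - B k) = tr P C A - tr P C B"
  "tr P (\<lambda>k. A k + B k) C = tr P A C + tr P B C"
  "tr P C (\<lambda>k. A k + B k) = tr P C A + tr P C B"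
  "tr P (\<lambda>k. c * A k) C = c * tr P A C"
  "tr P C (\<lambda>k. c * A k) = c * tr P C A"
  "tr P (\<lambda>_. 0) C = 0"
  "tr P C (\<lambda>_. 0) = 0"
  unfolding tr_def by (auto simp: sum_subtractf sum.distrib sum_distrib_left algebra_simps)

lemma tr_sum_right: "tr P C (\<lambda>k. \<Sum>i\<in>I. c i * A i k) = (\<Sum>i\<in>I. c i * tr P C (A i))"
  by (induction I rule: infinite_finite_induct) (auto simp: tr_linear)

lemma sum_one_m:
  assumes "finite P"
  shows "(\<Sum>r\<in>P. f r * one_m P (r, q)) = (if q \<in> P then f q else 0)"
    and "(\<Sum>r\<in>P. one_m P (q, r) * f r) = (if q \<in> P then f q else 0)"
proof -
  have "(\<Sum>r\<in>P. f r * one_m P (r, q)) = (\<Sum>r\<in>P. if r = q then f q else 0)"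
    by (rule sum.cong) (auto simp: one_m_def)
  then show "(\<Sum>r\<in>P. f r * one_m P (r, q)) = (if q \<in> P then f q else 0)"
    using assms by (simp add: sum.delta)
  have "(\<Sum>r\<in>P. one_m P (q, r) * f r) = (\<Sum>r\<in>P. if r = q then f q else 0)"
    by (rule sum.cong) (auto simp: one_m_def)
  then show "(\<Sum>r\<in>P. one_m P (q, r) * f r) = (if q \<in> P then f q else 0)"
    using assms by (simp add: sum.delta)
qed

lemma mm_one:
  assumes "finite P"
  shows "A \<in> supported (P \<times> P) \<Longrightarrow> mm P (one_m P) A = A"
    and "A \<in> supported (P \<times> P) \<Longrightarrow> mm P A (one_m P) = A"
  using assms by (auto simp: mm_def sum_one_m fun_eq_iff supported_def)

lemma rm_one: "finite P \<Longrightarrow> \<eta> \<in> supported P \<Longrightarrow> rm P \<eta> (one_m P) = \<eta>"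
  by (auto simp: rm_def sum_one_m fun_eq_iff supported_def)

lemma mv_one: "finite P \<Longrightarrow> U \<in> supported P \<Longrightarrow> mv P (one_m P) U = U"
  by (auto simp: mv_def sum_one_m fun_eq_iff supported_def)

lemma one_m_supported: "one_m P \<in> supported (P \<times> P)"
  by (auto simp: one_m_def supported_def)

lemma mm_nonzero:
  assumes "mm P A B (p, q) \<noteq> 0"
  obtains r where "r \<in> P" "A (p, r) \<noteq> 0" "B (r, q) \<noteq> 0"
proof -
  obtain r where "r \<in> P" "A (p, r) * B (r, q) \<noteq> 0"
    using assms unfolding mm_def by (auto elim: sum.not_neutral_contains_not_neutral)
  then show ?thesis using that by auto
qed

lemma mm_supported:
  assumes "A \<in> supported K" "B \<in> supported L"
    and "\<And>p r q. (p, r) \<in> K \<Longrightarrow> (r, q) \<in> L \<Longrightarrow> (p, q) \<in> M"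
  shows "mm P A B \<in> supported M"
  unfolding supported_def
proof (intro CollectI allI impI)
  fix k assume "k \<notin> M"
  then show "mm P A B k = 0"
    using supportedD[OF assms(1)] supportedD[OF assms(2)] assms(3)
    by (cases k) (metis mm_nonzero)
qed

lemma rm_nonzero:
  assumes "rm P \<eta> A q \<noteq> 0"
  obtains p where "p \<in> P" "\<eta> p \<noteq> 0" "A (p, q) \<noteq> 0"
proof -
  obtain r where "r \<in> P" "\<eta> r * A (r, q) \<noteq> 0"
    using assms unfolding rm_def by (auto elim: sum.not_neutral_contains_not_neutral)
  then show ?thesis using that by auto
qed

lemma pairing_linear:
  "pairing P (\<lambda>k. A k - B k) C = pairing P A C - pairing P B C"
  "pairing P (\<lambda>k. A k + B k) C = pairing P A C + pairing P B C"
  "pairing P (\<lambda>k. c * A k) C = c * pairing P A C"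
  "pairing P (\<lambda>k. 0) C = 0"
  unfolding pairing_def by (auto simp: sum_subtractf sum.distrib sum_distrib_left algebra_simps)

lemma rm_linear:
  "rm P (\<lambda>k. A k - B k) C = (\<lambda>k. rm P A C k - rm P B C k)"
  "rm P (\<lambda>k. A k + B k) C = (\<lambda>k. rm P A C k + rm P B C k)"
  "rm P (\<lambda>k. c * A k) C = (\<lambda>k. c * rm P A C k)"
  "rm P (\<lambda>k. 0) C = (\<lambda>_. 0)"
  unfolding rm_def
  by (auto simp: fun_eq_iff sum_subtractf sum.distrib sum_distrib_left algebra_simps)

fun mpow :: "'a set \<Rightarrow> ('a \<times> 'a \<Rightarrow> complex) \<Rightarrow> nat \<Rightarrow> 'a \<times> 'a \<Rightarrow> complex" where
  "mpow P A 0 = one_m P"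
| "mpow P A (Suc k) = mm P A (mpow P A k)"

section \<open>The graded vector space as one vector space\<close>

lemma residue_add_left: "residue n (residue n a + b) = residue n (a + b)"
  and residue_diff_left: "residue n (residue n a - b) = residue n (a - b)"
  by (simp_all add: residue_def mod_add_left_eq mod_diff_left_eq)

lemma residue_in_vertices [simp]: "residue n a \<in> vertices n"
  by (auto simp: residue_def vertices_def)
     (metis add.commute pos_mod_bound zless_iff_Suc_zadd zle_add1_eq_le of_nat_Suc of_nat_0_less_iff zero_less_Suc)

lemma residue_vertex: "i \<in> vertices n \<Longrightarrow> residue n i = i"
  by (auto simp: residue_def vertices_def)

lemma finite_vertices [simp]: "finite (vertices n)"
  by (simp add: vertices_def)

text \<open>The index \<open>(i, a)\<close> is the \<open>a\<close>-th basis vector of the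
  component of degree \<open>i\<close>. Writing a representation as one matrix over these indices
  turns sums over arrows into matrix products.\<close>

type_synonym graded_vector = "int \<times> nat \<Rightarrow> complex"
type_synonym graded_matrix = "(int \<times> nat) \<times> (int \<times> nat) \<Rightarrow> complex"

locale graded_space =
  fixes n :: nat and v :: "int \<Rightarrow> nat"
begin

definition P :: "(int \<times> nat) set" where
  "P = Sigma (vertices n) (\<lambda>i. {..<v i})"

abbreviation pd :: "int \<Rightarrow> int" where "pd i \<equiv> residue n (i - 1)"

text \<open>The places where a matrix may be nonzero: \<open>K0\<close> for endomorphisms that keep
  the degree, \<open>KD\<close> for those that lower it by one (the arrows in \<open>Omega\<close>),
  \<open>KU\<close> for those that raise it (the opposite arrows). On a short cycle these sets can
  overlap.\<close>

definition K0 :: "((int \<times> nat) \<times> (int \<times> nat)) set" where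
  "K0 = {(p, q). p \<in> P \<and> q \<in> P \<and> fst p = fst q}"

definition KD :: "((int \<times> nat) \<times> (int \<times> nat)) set" where
  "KD = {(p, q). p \<in> P \<and> q \<in> P \<and> fst p = pd (fst q)}"

definition KU :: "((int \<times> nat) \<times> (int \<times> nat)) set" where
  "KU = {(p, q). p \<in> P \<and> q \<in> P \<and> fst q = pd (fst p)}"

abbreviation "mul \<equiv> mm P"
abbreviation "I1 \<equiv> one_m P"
abbreviation "EG \<equiv> supported K0"
abbreviation "ED \<equiv> supported KD"
abbreviation "EU \<equiv> supported KU"

lemma finite_P [simp]: "finite P"
  unfolding P_def by (intro finite_SigmaI) auto

lemma finite_K [simp]: "finite K0" "finite KD" "finite KU"
  by (rule finite_subset[of _ "P \<times> P"], auto simp: K0_def KD_def KU_def)+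

lemma P_iff: "(i, a) \<in> P \<longleftrightarrow> i \<in> vertices n \<and> a < v i"
  by (auto simp: P_def)

lemma P_vertex: "p \<in> P \<Longrightarrow> fst p \<in> vertices n"
  by (auto simp: P_def)

lemma EG_P: "A \<in> EG \<Longrightarrow> A \<in> supported (P \<times> P)"
  and ED_P: "A \<in> ED \<Longrightarrow> A \<in> supported (P \<times> P)"
  and EU_P: "A \<in> EU \<Longrightarrow> A \<in> supported (P \<times> P)"
  by (auto simp: supported_def K0_def KD_def KU_def)

lemma pd_succ: "i \<in> vertices n \<Longrightarrow> pd (residue n (i + 1)) = i"
  by (simp add: residue_diff_left residue_vertex)

lemma succ_pd: "i \<in> vertices n \<Longrightarrow> residue n (pd i + 1) = i"
  by (simp add: residue_add_left residue_vertex)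

lemma pd_inj: "i \<in> vertices n \<Longrightarrow> j \<in> vertices n \<Longrightarrow> pd i = pd j \<Longrightarrow> i = j"
  by (metis succ_pd)

lemma supportedI: "(\<And>p q. A (p, q) \<noteq> 0 \<Longrightarrow> (p, q) \<in> K) \<Longrightarrow> A \<in> supported K"
  by (auto simp: supported_def)

lemma mul_EG_EG [intro]: "A \<in> EG \<Longrightarrow> B \<in> EG \<Longrightarrow> mul A B \<in> EG"
  by (erule (1) mm_supported) (auto simp: K0_def)

lemma mul_EG_ED [intro]: "A \<in> EG \<Longrightarrow> B \<in> ED \<Longrightarrow> mul A B \<in> ED"
  by (erule (1) mm_supported) (auto simp: K0_def KD_def)

lemma mul_ED_EG [intro]: "A \<in> ED \<Longrightarrow> B \<in> EG \<Longrightarrow> mul A B \<in> ED"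
  by (erule (1) mm_supported) (auto simp: K0_def KD_def)

lemma mul_EG_EU [intro]: "A \<in> EG \<Longrightarrow> B \<in> EU \<Longrightarrow> mul A B \<in> EU"
  by (erule (1) mm_supported) (auto simp: K0_def KU_def)

lemma mul_EU_EG [intro]: "A \<in> EU \<Longrightarrow> B \<in> EG \<Longrightarrow> mul A B \<in> EU"
  by (erule (1) mm_supported) (auto simp: K0_def KU_def)

lemma mul_ED_EU: "A \<in> ED \<Longrightarrow> B \<in> EU \<Longrightarrow> mul A B \<in> EG"
  by (erule (1) mm_supported) (auto simp: K0_def KD_def KU_def)

lemma mul_EU_ED: "A \<in> EU \<Longrightarrow> B \<in> ED \<Longrightarrow> mul A B \<in> EG"
proof (erule (1) mm_supported)
  fix p r q assume "(p, r) \<in> KU" "(r, q) \<in> KD"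
  then have "p \<in> P" "q \<in> P" "pd (fst p) = pd (fst q)" by (auto simp: KU_def KD_def)
  then show "(p, q) \<in> K0" using pd_inj P_vertex by (auto simp: K0_def)
qed

lemma one_EG [simp, intro]: "I1 \<in> EG"
  by (auto simp: one_m_def supported_def K0_def)

lemma one_mul [simp]:
  "A \<in> EG \<Longrightarrow> mul I1 A = A" "A \<in> EG \<Longrightarrow> mul A I1 = A"
  "A \<in> ED \<Longrightarrow> mul I1 A = A" "A \<in> ED \<Longrightarrow> mul A I1 = A"
  "A \<in> EU \<Longrightarrow> mul I1 A = A" "A \<in> EU \<Longrightarrow> mul A I1 = A"
  using mm_one[OF finite_P] EG_P ED_P EU_P by blast+

lemma supported_lin:
  "A \<in> supported K \<Longrightarrow> B \<in> supported K \<Longrightarrow> (\<lambda>k. A k + B k) \<in> supported K"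
  "A \<in> supported K \<Longrightarrow> B \<in> supported K \<Longrightarrow> (\<lambda>k. A k - B k) \<in> supported K"
  "A \<in> supported K \<Longrightarrow> (\<lambda>k. c * A k) \<in> supported K"
  "(\<And>i. i \<in> S \<Longrightarrow> F i \<in> supported K) \<Longrightarrow> (\<lambda>k. \<Sum>i\<in>S. d i * F i k) \<in> supported K"
  by (auto simp: supported_def)

lemma sum_block:
  assumes "i \<in> vertices n" "\<And>r. r \<in> P \<Longrightarrow> f r \<noteq> 0 \<Longrightarrow> fst r = i"
  shows "(\<Sum>r\<in>P. f r) = (\<Sum>c<v i. f (i, c) :: complex)"
proof -
  have "(\<Sum>r\<in>P. f r) = (\<Sum>r\<in>Pair i ` {..<v i}. f r)"
    using assms by (intro sum.mono_neutral_right) (auto simp: P_def)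
  then show ?thesis by (simp add: sum.reindex inj_on_def)
qed

definition blk :: "graded_matrix \<Rightarrow> int \<Rightarrow> complex mat" where
  "blk s i = mat (v i) (v i) (\<lambda>(a, b). s ((i, a), (i, b)))"

text \<open>The product of the determinants of the diagonal blocks; for \<open>s \<in> EG\<close>
  it is nonzero exactly when \<open>s\<close> is invertible.\<close>

definition dlt :: "graded_matrix \<Rightarrow> complex" where
  "dlt s = (\<Prod>i\<in>vertices n. det (blk s i))"

text \<open>The block \<open>i\<close> is the adjugate of the block of \<open>s\<close>, times the
  determinants of the other blocks, so that \<open>s * adjt s = dlt s\<close> holds with the
  same scalar in all blocks.\<close>

definition adjt :: "graded_matrix \<Rightarrow> graded_matrix" where
  "adjt s = (\<lambda>(p, q). if (p, q) \<in> K0 then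
     adj_mat (blk s (fst p)) $$ (snd p, snd q) * (\<Prod>j\<in>vertices n - {fst p}. det (blk s j)) else 0)"

lemma blk_carrier [simp]: "blk s i \<in> carrier_mat (v i) (v i)"
  by (simp add: blk_def)

lemma blk_mul:
  assumes "A \<in> EG" "B \<in> EG" "i \<in> vertices n"
  shows "blk (mul A B) i = blk A i * blk B i"
proof (rule eq_matI)
  fix a b assume "a < dim_row (blk A i * blk B i)" "b < dim_col (blk A i * blk B i)"
  then have ab: "a < v i" "b < v i" by (auto simp: blk_def)
  have "(\<Sum>r\<in>P. A ((i, a), r) * B (r, (i, b))) = (\<Sum>c<v i. A ((i, a), (i, c)) * B ((i, c), (i, b)))"
    using assms by (intro sum_block) (auto dest!: supportedD simp: K0_def)
  then show "blk (mul A B) i $$ (a, b) = (blk A i * blk B i) $$ (a, b)"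
    using ab by (auto simp: blk_def mm_def scalar_prod_def lessThan_atLeast0)
qed (auto simp: blk_def)

lemma blk_eqI:
  assumes "A \<in> EG" "B \<in> EG" "\<And>i. i \<in> vertices n \<Longrightarrow> blk A i = blk B i"
  shows "A = B"
proof
  fix k :: "(int \<times> nat) \<times> (int \<times> nat)"
  obtain i a j b where k: "k = ((i, a), (j, b))" by (metis surj_pair)
  show "A k = B k"
  proof (cases "k \<in> K0")
    case True
    then have "i = j" "i \<in> vertices n" "a < v i" "b < v i" by (auto simp: k K0_def P_def)
    then show ?thesis using arg_cong[OF assms(3)[of i], of "\<lambda>M. M $$ (a, b)"]
      by (simp add: blk_def k)
  qed (use assms(1,2) supportedD in metis)
qed

lemma blk_one: "i \<in> vertices n \<Longrightarrow> blk I1 i = 1\<^sub>m (v i)"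
  by (rule eq_matI) (auto simp: blk_def one_m_def P_iff)

lemma dlt_one [simp]: "dlt I1 = 1"
  by (simp add: dlt_def blk_one)

lemma adjt_EG [simp, intro]: "adjt s \<in> EG"
  by (auto simp: adjt_def supported_def)

lemma blk_adjt: "i \<in> vertices n \<Longrightarrow> blk (adjt s) i = (\<Prod>j\<in>vertices n - {i}. det (blk s j)) \<cdot>\<^sub>m adj_mat (blk s i)"
  using adj_mat(1)[OF blk_carrier, of s i]
  by (intro eq_matI) (auto simp: blk_def adjt_def K0_def P_iff mult.commute)

lemma smult_smult_assoc_mat: "a \<cdot>\<^sub>m (b \<cdot>\<^sub>m (A :: complex mat)) = (a * b) \<cdot>\<^sub>m A"
  by (rule eq_matI) auto

lemma mul_adjt:
  assumes "s \<in> EG"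
  shows "mul s (adjt s) = (\<lambda>k. dlt s * I1 k)" "mul (adjt s) s = (\<lambda>k. dlt s * I1 k)"
proof -
  have d: "(\<Prod>j\<in>vertices n - {i}. det (blk s j)) * det (blk s i) = dlt s" if "i \<in> vertices n" for i
    unfolding dlt_def using that by (subst (2) prod.remove[of _ i]) (auto simp: mult.commute)
  have blk1: "blk (\<lambda>k. dlt s * I1 k) i = dlt s \<cdot>\<^sub>m 1\<^sub>m (v i)" if "i \<in> vertices n" for i
    using blk_one[OF that] by (intro eq_matI) (auto simp: blk_def one_m_def P_iff that)
  note A = adj_mat[OF blk_carrier, of s]
  show "mul s (adjt s) = (\<lambda>k. dlt s * I1 k)"
  proof (rule blk_eqI)
    fix i assume i: "i \<in> vertices n"
    show "blk (mul s (adjt s)) i = blk (\<lambda>k. dlt s * I1 k) i"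
      using A d[OF i] by (simp add: blk_mul assms i blk_adjt blk1 mult_smult_distrib[OF blk_carrier A(1)] smult_smult_assoc_mat)
  qed (use assms in \<open>auto intro: supported_lin\<close>)
  show "mul (adjt s) s = (\<lambda>k. dlt s * I1 k)"
  proof (rule blk_eqI)
    fix i assume i: "i \<in> vertices n"
    show "blk (mul (adjt s) s) i = blk (\<lambda>k. dlt s * I1 k) i"
      using A d[OF i] by (simp add: blk_mul assms i blk_adjt blk1 mult_smult_assoc_mat[OF A(1) blk_carrier] smult_smult_assoc_mat)
  qed (use assms in \<open>auto intro: supported_lin\<close>)
qed

definition inverses :: "graded_matrix \<Rightarrow> graded_matrix \<Rightarrow> bool" where
  "inverses g h \<longleftrightarrow> g \<in> EG \<and> h \<in> EG \<and> mul g h = I1 \<and> mul h g = I1"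

definition minv :: "graded_matrix \<Rightarrow> graded_matrix" where
  "minv s = (\<lambda>k. adjt s k / dlt s)"

lemma inverses_minv:
  assumes "s \<in> EG" "dlt s \<noteq> 0"
  shows "inverses s (minv s)"
proof -
  have e: "minv s = (\<lambda>k. inverse (dlt s) * adjt s k)" by (auto simp: minv_def field_simps)
  show ?thesis unfolding inverses_def e
    using mul_adjt[OF assms(1)] assms
    by (auto intro: supported_lin simp: mm_scale_left mm_scale_right)
qed

lemma inverses_unique:
  assumes "inverses g h" "inverses g h'"
  shows "h = h'"
proof -
  have "h = mul (mul h' g) h" using assms by (simp add: inverses_def)
  also have "\<dots> = h'" using assms unfolding mm_assoc by (simp add: inverses_def)
  finally show ?thesis .
qed

lemma inverses_dlt:
  assumes "inverses g h"
  shows "dlt g \<noteq> 0" "h = minv g"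
proof -
  have "det (blk g i) * det (blk h i) = 1" if "i \<in> vertices n" for i
  proof -
    have "blk g i * blk h i = 1\<^sub>m (v i)"
      using blk_mul[of g h i] assms that blk_one[OF that] by (auto simp: inverses_def)
    then show ?thesis using det_mult[OF blk_carrier blk_carrier, of g i h] by simp
  qed
  then show d: "dlt g \<noteq> 0" unfolding dlt_def by fastforce
  show "h = minv g" using inverses_unique[OF assms inverses_minv] d assms by (auto simp: inverses_def)
qed

lemma inverses_sym: "inverses g h \<Longrightarrow> inverses h g"
  by (auto simp: inverses_def)

lemma inverses_mul: "inverses g h \<Longrightarrow> inverses g' h' \<Longrightarrow> inverses (mul g g') (mul h' h)"
proof -
  assume a: "inverses g h" "inverses g' h'"
  have "mul (mul g g') (mul h' h) = mul g (mul (mul g' h') h)" by (simp only: mm_assoc)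
  moreover have "mul (mul h' h) (mul g g') = mul h' (mul (mul h g) g')" by (simp only: mm_assoc)
  ultimately show ?thesis using a by (auto simp: inverses_def)
qed

lemma inverses_one: "inverses I1 I1"
  by (auto simp: inverses_def)

text \<open>A square matrix without kernel is invertible; block by block, as the kernel of a graded
  endomorphism is spanned by its homogeneous vectors.\<close>

lemma dlt_nonzeroI:
  assumes "s \<in> EG"
    and "\<And>i U. i \<in> vertices n \<Longrightarrow> U \<in> supported ({i} \<times> {..<v i}) \<Longrightarrow> mv P s U = (\<lambda>_. 0) \<Longrightarrow> U = (\<lambda>_. 0)"
  shows "dlt s \<noteq> 0"
proof -
  have "det (blk s i) \<noteq> 0" if i: "i \<in> vertices n" for i
  proof
    assume "det (blk s i) = 0"
    then obtain w where w: "w \<in> carrier_vec (v i)" "w \<noteq> 0\<^sub>v (v i)" "blk s i *\<^sub>v w = 0\<^sub>v (v i)"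
      using det_0_iff_vec_prod_zero[OF blk_carrier] by blast
    define U where "U = (\<lambda>(j, a). if j = i \<and> a < v i then w $ a else 0)"
    have U: "U \<in> supported ({i} \<times> {..<v i})" by (auto simp: U_def supported_def)
    have "mv P s U p = 0" for p
    proof (cases "p \<in> P \<and> fst p = i")
      case False
      then show ?thesis using assms(1)
        by (auto simp: mv_def U_def K0_def intro!: sum.neutral dest: supportedD split: if_splits)
    next
      case True
      then obtain a where p: "p = (i, a)" "a < v i" by (cases p) (auto simp: P_iff)
      have "(\<Sum>r\<in>P. s (p, r) * U r) = (\<Sum>c<v i. s (p, (i, c)) * U (i, c))"
        using i by (intro sum_block) (auto simp: U_def split: if_splits)
      also have "\<dots> = (blk s i *\<^sub>v w) $ a"
        using p w(1) by (auto simp: blk_def U_def scalar_prod_def lessThan_atLeast0 intro!: sum.cong)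
      finally show ?thesis using w(3) p by (simp add: mv_def)
    qed
    then have "U = (\<lambda>_. 0)" by (intro assms(2)[OF i U] ext)
    have "w $ a = 0" if "a < v i" for a
    proof -
      have "w $ a = U (i, a)" using that by (simp add: U_def)
      then show ?thesis using \<open>U = (\<lambda>_. 0)\<close> by simp
    qed
    then have "w = 0\<^sub>v (v i)" using w(1) by auto
    then show False using w(2) by simp
  qed
  then show ?thesis by (simp add: dlt_def)
qed

lemma subalg_dlt:
  assumes "subalg R" "\<And>k. (\<lambda>u. s u k) \<in> R"
  shows "(\<lambda>u. dlt (s u)) \<in> R"
  unfolding dlt_def blk_def by (intro subalg_prod subalg_det assms)

lemma subalg_adjt:
  assumes "subalg R" "\<And>k. (\<lambda>u. s u k) \<in> R"
  shows "(\<lambda>u. adjt (s u) k) \<in> R"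
proof (cases "k \<in> K0")
  case False
  then have "(\<lambda>u. adjt (s u) k) = (\<lambda>_. 0)" by (cases k) (auto simp: adjt_def)
  then show ?thesis using subalg_const[OF assms(1), of 0] by simp
next
  case True
  then obtain i a b where k: "k = ((i, a), (i, b))" "a < v i" "b < v i" by (auto simp: K0_def P_iff)
  have "(\<lambda>u. adj_mat (blk (s u) i) $$ (a, b) * (\<Prod>j\<in>vertices n - {i}. det (blk (s u) j))) \<in> R"
    unfolding blk_def by (intro subalg_mult subalg_adj_mat subalg_prod subalg_det assms k)
  then show ?thesis using True by (simp add: adjt_def k)
qed

lemma subalg_mm:
  assumes "subalg R" "\<And>k. (\<lambda>u. A u k) \<in> R" "\<And>k. (\<lambda>u. B u k) \<in> R"
  shows "(\<lambda>u. mm Q (A u) (B u) k) \<in> R"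
  by (cases k) (auto simp: mm_def intro!: subalg_sum subalg_mult assms)

lemma subalg_tr:
  assumes "subalg R" "\<And>k. (\<lambda>u. A u k) \<in> R" "\<And>k. (\<lambda>u. B u k) \<in> R"
  shows "(\<lambda>u. tr Q (A u) (B u)) \<in> R"
  unfolding tr_def by (intro subalg_sum subalg_mult assms)

lemma subalg_rm:
  assumes "subalg R" "\<And>k. (\<lambda>u. A u k) \<in> R" "\<And>k. (\<lambda>u. B u k) \<in> R"
  shows "(\<lambda>u. rm Q (A u) (B u) k) \<in> R"
  unfolding rm_def by (intro subalg_sum subalg_mult assms)

lemma rational_minv:
  assumes "\<And>k. (\<lambda>u. s u k) \<in> poly_funs F"
  shows "(\<lambda>u. minv (s u) k) \<in> rational_funs F (\<lambda>u. dlt (s u))"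
  by (rule rational_funsI[where k = 1, OF subalg_adjt[OF subalg_poly_funs assms]])
     (simp add: minv_def)

end

section \<open>Framed representations as triples\<close>

lemma in_arrows: "h \<in> arrows n \<longleftrightarrow> (\<exists>i\<in>vertices n. h = Down i \<or> h = Up i)"
  by (auto simp: arrows_def Omega_def Omega_bar_def)

lemma arrows_Down [simp]: "Down i \<in> arrows n \<longleftrightarrow> i \<in> vertices n"
  and arrows_Up [simp]: "Up i \<in> arrows n \<longleftrightarrow> i \<in> vertices n"
  by (auto simp: in_arrows)

lemma zero_vertex [simp]: "0 \<in> vertices n"
  by (simp add: vertices_def)

context graded_space
begin

definition KJ :: "(int \<times> nat) set" where
  "KJ = {p \<in> P. fst p = 0}"

abbreviation "EJ \<equiv> supported KJ"

text \<open>For the dimension vector \<open>w0\<close> the framing is a single row vector on the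
  component of degree \<open>0\<close>. \<open>Xt\<close>, \<open>Zt\<close> and \<open>Jt\<close>
  collect the entries of a framed representation in two matrices and this row, and \<open>rp\<close>
  and \<open>fr\<close> are the inverse maps.\<close>

definition Xt :: "rep \<Rightarrow> graded_matrix" where
  "Xt x = (\<lambda>(p, q). if (p, q) \<in> KD then x (Down (fst q)) $$ (snd p, snd q) else 0)"

definition Zt :: "rep \<Rightarrow> graded_matrix" where
  "Zt x = (\<lambda>(p, q). if (p, q) \<in> KU then x (Up (fst p)) $$ (snd p, snd q) else 0)"

definition Jt :: "(int \<Rightarrow> complex mat) \<Rightarrow> graded_vector" where
  "Jt j = (\<lambda>p. if p \<in> KJ then j 0 $$ (0, snd p) else 0)"

definition rp :: "graded_matrix \<Rightarrow> graded_matrix \<Rightarrow> rep" where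
  "rp X Z = (\<lambda>h\<in>arrows n. case h of
     Down i \<Rightarrow> mat (v (pd i)) (v i) (\<lambda>(a, b). X ((pd i, a), (i, b)))
   | Up i \<Rightarrow> mat (v i) (v (pd i)) (\<lambda>(a, b). Z ((i, a), (pd i, b))))"

definition fr :: "graded_vector \<Rightarrow> int \<Rightarrow> complex mat" where
  "fr J = (\<lambda>i\<in>vertices n. mat (w0 n i) (v i) (\<lambda>(a, b). J (i, b)))"

abbreviation "Rp \<equiv> rep_space n v"
abbreviation "Fr \<equiv> framing_space n v (w0 n)"
abbreviation "RC \<equiv> poly_funs (rep_coords n v)"
abbreviation "FC \<equiv> poly_funs (framed_coords n v (w0 n))"

lemma Xt_ED [simp, intro]: "Xt x \<in> ED"
  and Zt_EU [simp, intro]: "Zt x \<in> EU"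
  and Jt_EJ [simp, intro]: "Jt j \<in> EJ"
  by (auto simp: Xt_def Zt_def Jt_def supported_def)

lemma rp_Rp [simp, intro]: "rp X Z \<in> Rp"
  by (auto simp: rp_def rep_space_def in_arrows)

lemma fr_Fr [simp, intro]: "fr J \<in> Fr"
  by (auto simp: fr_def framing_space_def)

lemma Xt_rp: "X \<in> ED \<Longrightarrow> Xt (rp X Z) = X"
  by (auto simp: Xt_def rp_def fun_eq_iff KD_def P_iff supported_def)

lemma Zt_rp: "Z \<in> EU \<Longrightarrow> Zt (rp X Z) = Z"
  by (auto simp: Zt_def rp_def fun_eq_iff KU_def P_iff supported_def)

lemma Jt_fr: "J \<in> EJ \<Longrightarrow> Jt (fr J) = J"
  by (auto simp: Jt_def fr_def fun_eq_iff KJ_def P_iff supported_def w0_def)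

lemma rp_inverse:
  assumes "x \<in> Rp"
  shows "rp (Xt x) (Zt x) = x"
proof (rule extensionalityI[of _ "arrows n"])
  fix h assume "h \<in> arrows n"
  then obtain i where i: "i \<in> vertices n" "h = Down i \<or> h = Up i" by (auto simp: in_arrows)
  have x: "x h \<in> carrier_mat (v (in_vertex n h)) (v (out_vertex n h))" if "h \<in> arrows n" for h
    using assms that unfolding rep_space_def by (rule PiE_mem)
  from i(2) show "rp (Xt x) (Zt x) h = x h"
  proof
    assume h: "h = Down i"
    have "x (Down i) \<in> carrier_mat (v (pd i)) (v i)" using x[of "Down i"] i(1) by simp
    then show ?thesis unfolding h using i(1)
      by (intro eq_matI) (simp_all add: rp_def Xt_def KD_def P_iff)
  next
    assume h: "h = Up i"
    have "x (Up i) \<in> carrier_mat (v i) (v (pd i))" using x[of "Up i"] i(1) by simp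
    then show ?thesis unfolding h using i(1)
      by (intro eq_matI) (simp_all add: rp_def Zt_def KU_def P_iff)
  qed
qed (use assms in \<open>auto simp: rp_def rep_space_def PiE_def\<close>)

lemma fr_inverse:
  assumes "j \<in> Fr"
  shows "fr (Jt j) = j"
proof (rule extensionalityI[of _ "vertices n"])
  fix i assume i: "i \<in> vertices n"
  then have c: "j i \<in> carrier_mat (w0 n i) (v i)" using assms by (auto simp: framing_space_def)
  then show "fr (Jt j) i = j i"
    using i by (intro eq_matI) (auto simp: fr_def Jt_def KJ_def P_iff w0_def split: if_splits)
qed (use assms in \<open>auto simp: fr_def framing_space_def PiE_def\<close>)

lemma rep_cases:
  assumes "x \<in> Rp"
  obtains X Z where "X \<in> ED" "Z \<in> EU" "x = rp X Z"
  using rp_inverse[OF assms] Xt_ED Zt_EU by metis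

lemma framing_cases:
  assumes "j \<in> Fr"
  obtains J where "J \<in> EJ" "j = fr J"
  using fr_inverse[OF assms] Jt_EJ by metis

text \<open>Regular functions of a representation are polynomials in the entries of its two
  matrices.\<close>

lemma rep_poly_comp:
  assumes "p \<in> RC" "subalg R" "\<And>k. (\<lambda>u. X u k) \<in> R" "\<And>k. (\<lambda>u. Z u k) \<in> R"
  shows "(\<lambda>u. p (rp (X u) (Z u))) \<in> R"
  using assms(1,2)
proof (rule poly_funs_comp)
  fix f assume "f \<in> rep_coords n v"
  then obtain h a b where f: "f = (\<lambda>x. x h $$ (a, b))" "h \<in> arrows n" "a < v (in_vertex n h)" "b < v (out_vertex n h)"
    unfolding rep_coords_def by auto
  then obtain i where "i \<in> vertices n" "h = Down i \<or> h = Up i" by (auto simp: in_arrows)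
  then show "(\<lambda>u. f (rp (X u) (Z u))) \<in> R" using f assms(3,4) by (auto simp: rp_def)
qed

lemma framed_poly_comp:
  assumes "p \<in> FC" "subalg R" "\<And>k. (\<lambda>u. X u k) \<in> R" "\<And>k. (\<lambda>u. Z u k) \<in> R" "\<And>k. (\<lambda>u. J u k) \<in> R"
  shows "(\<lambda>u. p (rp (X u) (Z u), fr (J u))) \<in> R"
  using assms(1,2)
proof (rule poly_funs_comp)
  fix f assume "f \<in> framed_coords n v (w0 n)"
  then consider p where "p \<in> rep_coords n v" "f = (\<lambda>xj. p (fst xj))"
    | i a b where "i \<in> vertices n" "a < w0 n i" "b < v i" "f = (\<lambda>xj. snd xj i $$ (a, b))"
    unfolding framed_coords_def by blast
  then show "(\<lambda>u. f (rp (X u) (Z u), fr (J u))) \<in> R"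
  proof cases
    case 1
    then show ?thesis using rep_poly_comp[OF poly_funs.coord assms(2-4)] by simp
  next
    case 2
    then show ?thesis using assms(5) by (simp add: fr_def)
  qed
qed

lemma Xt_poly: "(\<lambda>x. Xt x k) \<in> RC"
proof (cases "k \<in> KD")
  case True
  then obtain i a b where k: "k = ((pd i, a), (i, b))" "i \<in> vertices n" "a < v (pd i)" "b < v i"
    by (auto simp: KD_def P_iff)
  have "(\<lambda>x. x (Down i) $$ (a, b)) \<in> rep_coords n v" unfolding rep_coords_def using k by force
  then show ?thesis using True by (auto simp: Xt_def k intro: poly_funs.coord)
next
  case False
  then have "(\<lambda>x. Xt x k) = (\<lambda>_. 0)" by (cases k) (auto simp: Xt_def)
  then show ?thesis by (simp add: poly_funs.const)
qed

lemma Zt_poly: "(\<lambda>x. Zt x k) \<in> RC"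
proof (cases "k \<in> KU")
  case True
  then obtain i a b where k: "k = ((i, a), (pd i, b))" "i \<in> vertices n" "a < v i" "b < v (pd i)"
    by (auto simp: KU_def P_iff)
  have "(\<lambda>x. x (Up i) $$ (a, b)) \<in> rep_coords n v" unfolding rep_coords_def using k by force
  then show ?thesis using True by (auto simp: Zt_def k intro: poly_funs.coord)
next
  case False
  then have "(\<lambda>x. Zt x k) = (\<lambda>_. 0)" by (cases k) (auto simp: Zt_def)
  then show ?thesis by (simp add: poly_funs.const)
qed

lemma rep_poly_framed: "p \<in> RC \<Longrightarrow> (\<lambda>xj. p (fst xj)) \<in> FC"
  by (erule poly_funs_comp[OF _ subalg_poly_funs])
     (auto simp: framed_coords_def intro!: poly_funs.coord)

lemma framed_poly_rep:
  assumes "p \<in> FC"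
  shows "(\<lambda>x. p (x, j)) \<in> RC"
  using assms subalg_poly_funs
proof (rule poly_funs_comp)
  fix f assume "f \<in> framed_coords n v (w0 n)"
  then show "(\<lambda>x. f (x, j)) \<in> RC"
    unfolding framed_coords_def by (auto intro: poly_funs.coord poly_funs.const)
qed

lemma Jt_poly: "(\<lambda>xj. Jt (snd xj) k) \<in> FC"
proof (cases "k \<in> KJ")
  case True
  then obtain b where k: "k = (0, b)" "b < v 0" by (cases k) (auto simp: KJ_def P_iff)
  have "(\<lambda>xj. snd xj 0 $$ (0, b)) \<in> framed_coords n v (w0 n)"
    unfolding framed_coords_def using k by (fastforce simp: w0_def)
  then show ?thesis using True by (auto simp: Jt_def k intro: poly_funs.coord)
next
  case False
  then show ?thesis by (simp add: Jt_def poly_funs.const)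
qed

lemmas framed_entries_poly =
  rep_poly_framed[OF Xt_poly] rep_poly_framed[OF Zt_poly] Jt_poly

subsection \<open>The moment map\<close>

lemma psi_eq:
  fixes X Z i
  defines "x \<equiv> rp X Z"
  assumes i: "i \<in> vertices n"
  shows "psi n v x i = 1 \<cdot>\<^sub>m (x (Down (residue n (i + 1))) * x (Up (residue n (i + 1))))
     + (- 1) \<cdot>\<^sub>m (x (Up i) * x (Down i))"
proof -
  let ?s = "residue n (i + 1)"
  let ?M = "module_mat TYPE(complex) (v i) (v i)"
  let ?x = "rp X Z"
  let ?f = "\<lambda>h. eps h \<cdot>\<^sub>m (?x h * ?x (bar h))"
  have s: "?s \<in> vertices n" "pd ?s = i" using pd_succ[OF i] residue_in_vertices by blast+
  have set: "{h \<in> arrows n. in_vertex n h = i} = {Down ?s, Up i}"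
  proof (intro equalityI subsetI)
    fix h assume h: "h \<in> {h \<in> arrows n. in_vertex n h = i}"
    show "h \<in> {Down ?s, Up i}"
    proof (cases h)
      case (Down k)
      then have "k \<in> vertices n" "pd k = i" using h by simp_all
      then have "k = ?s" using succ_pd[of k] by metis
      then show ?thesis using Down by blast
    next
      case (Up k)
      then show ?thesis using h by simp
    qed
  next
    fix h assume "h \<in> {Down ?s, Up i}"
    then have "h = Down ?s \<or> h = Up i" by blast
    then show "h \<in> {h \<in> arrows n. in_vertex n h = i}"
    proof
      assume "h = Down ?s"
      then show ?thesis using s by (metis (mono_tags, lifting) arrows_Down in_vertex.simps(1) mem_Collect_eq)
    next
      assume "h = Up i"
      then show ?thesis using i by simp
    qed
  qed
  have x: "?x (Down ?s) = mat (v i) (v ?s) (\<lambda>(a, b). X ((i, a), (?s, b)))"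
    "?x (Up ?s) = mat (v ?s) (v i) (\<lambda>(a, b). Z ((?s, a), (i, b)))"
    "?x (Up i) = mat (v i) (v (pd i)) (\<lambda>(a, b). Z ((i, a), (pd i, b)))"
    "?x (Down i) = mat (v (pd i)) (v i) (\<lambda>(a, b). X ((pd i, a), (i, b)))"
    using s i unfolding rp_def by simp_all
  have f: "?f (Down ?s) \<in> carrier_mat (v i) (v i)" "?f (Up i) \<in> carrier_mat (v i) (v i)"
    unfolding bar.simps x by auto
  interpret M: abelian_group ?M by (rule abelian_group_mat)
  have "psi n v ?x i = (\<Oplus>\<^bsub>?M\<^esub>h\<in>{Down ?s, Up i}. ?f h)" unfolding psi_def set ..
  also have "\<dots> = ?f (Down ?s) \<oplus>\<^bsub>?M\<^esub> (\<Oplus>\<^bsub>?M\<^esub>h\<in>{Up i}. ?f h)"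
    by (rule M.finsum_insert) (use f in \<open>auto simp: module_mat_simps\<close>)
  also have "(\<Oplus>\<^bsub>?M\<^esub>h\<in>{Up i}. ?f h) = ?f (Up i) \<oplus>\<^bsub>?M\<^esub> (\<Oplus>\<^bsub>?M\<^esub>h\<in>{}. ?f h)"
    by (rule M.finsum_insert) (use f in \<open>auto simp: module_mat_simps\<close>)
  also have "\<dots> = ?f (Up i)"
    using f(2) by (simp add: module_mat_simps M.finsum_empty[unfolded module_mat_simps])
  finally show ?thesis by (simp only: module_mat_simps x_def eps.simps bar.simps)
qed

text \<open>At each vertex one arrow of \<open>Omega\<close> and one opposite arrow come in, with
  opposite signs: the moment map is the diagonal block of a commutator.\<close>

lemma psi_entry:
  assumes "X \<in> ED" "Z \<in> EU" "i \<in> vertices n" "a < v i" "b < v i"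
  shows "psi n v (rp X Z) i $$ (a, b) = mul X Z ((i, a), (i, b)) - mul Z X ((i, a), (i, b))"
proof -
  let ?s = "residue n (i + 1)"
  let ?x = "rp X Z"
  have s: "?s \<in> vertices n" "pd ?s = i" using pd_succ[OF assms(3)] residue_in_vertices by blast+
  have x: "?x (Down ?s) = mat (v i) (v ?s) (\<lambda>(a, b). X ((i, a), (?s, b)))"
    "?x (Up ?s) = mat (v ?s) (v i) (\<lambda>(a, b). Z ((?s, a), (i, b)))"
    "?x (Up i) = mat (v i) (v (pd i)) (\<lambda>(a, b). Z ((i, a), (pd i, b)))"
    "?x (Down i) = mat (v (pd i)) (v i) (\<lambda>(a, b). X ((pd i, a), (i, b)))"
    using s assms(3) unfolding rp_def by simp_all
  have "mul X Z ((i, a), (i, b)) = (\<Sum>c<v ?s. X ((i, a), (?s, c)) * Z ((?s, c), (i, b)))"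
    unfolding mm_apply
  proof (rule sum_block[OF s(1)])
    fix r assume "X ((i, a), r) * Z (r, (i, b)) \<noteq> 0"
    then have "((i, a), r) \<in> KD" using supportedD[OF assms(1)] by fastforce
    then have "i = pd (fst r)" "r \<in> P" unfolding KD_def by simp_all
    then show "fst r = ?s" using succ_pd[OF P_vertex, of r] by metis
  qed
  moreover have "mul Z X ((i, a), (i, b)) = (\<Sum>c<v (pd i). Z ((i, a), (pd i, c)) * X ((pd i, c), (i, b)))"
    unfolding mm_apply
  proof (rule sum_block)
    fix r assume "Z ((i, a), r) * X (r, (i, b)) \<noteq> 0"
    then have "((i, a), r) \<in> KU" using supportedD[OF assms(2)] by fastforce
    then show "fst r = pd i" unfolding KU_def by simp
  qed simp
  moreover have "(?x (Down ?s) * ?x (Up ?s)) $$ (a, b) = (\<Sum>c<v ?s. X ((i, a), (?s, c)) * Z ((?s, c), (i, b)))"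
    unfolding x using assms(4,5) by (simp add: scalar_prod_def lessThan_atLeast0)
  moreover have "(?x (Up i) * ?x (Down i)) $$ (a, b) = (\<Sum>c<v (pd i). Z ((i, a), (pd i, c)) * X ((pd i, c), (i, b)))"
    unfolding x using assms(4,5) by (simp add: scalar_prod_def lessThan_atLeast0)
  moreover have "?x (Down ?s) * ?x (Up ?s) \<in> carrier_mat (v i) (v i)" "?x (Up i) * ?x (Down i) \<in> carrier_mat (v i) (v i)"
    unfolding x by auto
  moreover have "(1 \<cdot>\<^sub>m A + (- 1) \<cdot>\<^sub>m B) $$ (a, b) = A $$ (a, b) - B $$ (a, b)"
    if "A \<in> carrier_mat (v i) (v i)" "B \<in> carrier_mat (v i) (v i)" for A B :: "complex mat"
    using that assms(4,5) by simp
  ultimately show ?thesis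
    unfolding psi_eq[OF assms(3)] by (simp only:)
qed

lemma psi_carrier:
  assumes "i \<in> vertices n"
  shows "psi n v (rp X Z) i \<in> carrier_mat (v i) (v i)"
proof -
  have "psi n v (rp X Z) i \<in> carrier (module_mat TYPE(complex) (v i) (v i))"
    unfolding psi_def
  proof (rule abelian_monoid.finsum_closed)
    show "abelian_monoid (module_mat TYPE(complex) (v i) (v i))"
      using abelian_group_mat abelian_group_def by blast
    have "rp X Z h * rp X Z (bar h) \<in> carrier_mat (v i) (v i)" if "h \<in> arrows n" "in_vertex n h = i" for h
      using that by (cases h) (auto simp: rp_def)
    then show "(\<lambda>h. eps h \<cdot>\<^sub>m (rp X Z h * rp X Z (bar h))) \<in> {h \<in> arrows n. in_vertex n h = i} \<rightarrow>
        carrier (module_mat TYPE(complex) (v i) (v i))"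
      by (simp add: module_mat_simps)
  qed
  then show ?thesis by (simp add: module_mat_simps)
qed

lemma psi_zero_iff:
  assumes "X \<in> ED" "Z \<in> EU"
  shows "(\<forall>i\<in>vertices n. psi n v (rp X Z) i = 0\<^sub>m (v i) (v i)) \<longleftrightarrow> mul X Z = mul Z X"
proof
  assume z: "\<forall>i\<in>vertices n. psi n v (rp X Z) i = 0\<^sub>m (v i) (v i)"
  show "mul X Z = mul Z X"
  proof (rule blk_eqI[OF mul_ED_EU[OF assms] mul_EU_ED[OF assms(2,1)]])
    fix i assume i: "i \<in> vertices n"
    have "mul X Z ((i, a), (i, b)) = mul Z X ((i, a), (i, b))" if "a < v i" "b < v i" for a b
      using psi_entry[OF assms i that] bspec[OF z i] that by simp
    then show "blk (mul X Z) i = blk (mul Z X) i" unfolding blk_def by (intro eq_matI) simp_all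
  qed
next
  assume e: "mul X Z = mul Z X"
  show "\<forall>i\<in>vertices n. psi n v (rp X Z) i = 0\<^sub>m (v i) (v i)"
  proof
    fix i assume i: "i \<in> vertices n"
    have "psi n v (rp X Z) i $$ (a, b) = 0" if "a < v i" "b < v i" for a b
      using psi_entry[OF assms i that] unfolding e by simp
    then show "psi n v (rp X Z) i = 0\<^sub>m (v i) (v i)"
      using psi_carrier[OF i, of X Z] by (intro eq_matI) simp_all
  qed
qed

subsection \<open>Nilpotency\<close>

lemma KD_unique: "(p, q) \<in> KD \<Longrightarrow> i \<in> vertices n \<Longrightarrow> fst p = pd i \<Longrightarrow> fst q = i"
  using pd_inj P_vertex unfolding KD_def by auto

text \<open>Paths that use only arrows of \<open>Omega\<close> are determined by their ends and
  their length, because the degree falls by one in each step; so each path product is a block of a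
  power of the matrix.\<close>

lemma path_product_entry:
  assumes X: "X \<in> ED" and x: "x = rp X (\<lambda>_. 0)"
    and "hs \<noteq> []" "composable n hs"
  shows "path_product x hs \<in> carrier_mat (v (in_vertex n (hd hs))) (v (out_vertex n (last hs))) \<and>
    (\<forall>a b. a < v (in_vertex n (hd hs)) \<longrightarrow> b < v (out_vertex n (last hs)) \<longrightarrow>
      path_product x hs $$ (a, b) = (if set hs \<subseteq> range Down
        then mpow P X (length hs) ((in_vertex n (hd hs), a), (out_vertex n (last hs), b)) else 0))"
  using assms(3,4)
proof (induction hs)
  case (Cons h hs)
  have h: "h \<in> arrows n" using Cons.prems by (auto simp: composable_def)
  have xh: "x h \<in> carrier_mat (v (in_vertex n h)) (v (out_vertex n h))"
    using h unfolding x by (auto simp: rp_def in_arrows)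
  have down: "x (Down i) $$ (a, b) = X ((pd i, a), (i, b))" if "i \<in> vertices n" "a < v (pd i)" "b < v i" for i a b
    using that unfolding x rp_def by simp
  have up: "x (Up i) $$ (a, b) = 0" if "i \<in> vertices n" "a < v i" "b < v (pd i)" for i a b
    using that unfolding x rp_def by simp
  show ?case
  proof (cases "hs = []")
    case True
    show ?thesis
    proof (cases h)
      case (Down i)
      then show ?thesis using True h xh X by (auto simp: down)
    next
      case (Up i)
      then show ?thesis using True h xh by (auto simp: up)
    qed
  next
    case False
    then obtain h' hs' where hs: "hs = h' # hs'" by (cases hs) auto
    let ?p = "path_product x hs"
    have comp: "composable n hs" and hh: "out_vertex n h = in_vertex n (hd hs)"
      using Cons.prems unfolding composable_def hs by auto
    note IH = Cons.IH[OF False comp]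
    have eq: "path_product x (h # hs) = x h * ?p" unfolding hs by simp
    have carr: "x h * ?p \<in> carrier_mat (v (in_vertex n h)) (v (out_vertex n (last hs)))"
      using xh IH hh by (auto intro: mult_carrier_mat)
    have "(x h * ?p) $$ (a, b) = (if set (h # hs) \<subseteq> range Down
        then mpow P X (Suc (length hs)) ((in_vertex n h, a), (out_vertex n (last hs), b)) else 0)"
      if ab: "a < v (in_vertex n h)" "b < v (out_vertex n (last hs))" for a b
    proof -
      have sum: "(x h * ?p) $$ (a, b) = (\<Sum>c<v (out_vertex n h). x h $$ (a, c) * ?p $$ (c, b))"
        using xh IH hh ab by (auto simp: scalar_prod_def lessThan_atLeast0)
      show ?thesis
      proof (cases h)
        case (Up i)
        then have "(\<Sum>c<v (out_vertex n h). x h $$ (a, c) * ?p $$ (c, b)) = 0"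
          using h ab by (intro sum.neutral) (auto simp: up)
        then show ?thesis unfolding sum using Up by auto
      next
        case (Down i)
        have i: "i \<in> vertices n" using Down h by simp
        have "(\<Sum>c<v i. x h $$ (a, c) * ?p $$ (c, b)) = (\<Sum>c<v i. X ((pd i, a), (i, c)) *
            (if set hs \<subseteq> range Down then mpow P X (length hs) ((i, c), (out_vertex n (last hs), b)) else 0))"
          using IH hh Down i ab by (intro sum.cong) (auto simp: down)
        also have "\<dots> = (if set hs \<subseteq> range Down
            then (\<Sum>c<v i. X ((pd i, a), (i, c)) * mpow P X (length hs) ((i, c), (out_vertex n (last hs), b))) else 0)"
          by auto
        also have "(\<Sum>c<v i. X ((pd i, a), (i, c)) * mpow P X (length hs) ((i, c), (out_vertex n (last hs), b)))
            = mpow P X (Suc (length hs)) ((pd i, a), (out_vertex n (last hs), b))"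
          unfolding mpow.simps mm_apply
        proof (rule sum_block[symmetric, OF i])
          fix r assume "X ((pd i, a), r) * mpow P X (length hs) (r, out_vertex n (last hs), b) \<noteq> 0"
          then have "((pd i, a), r) \<in> KD" using X by (auto dest: supportedD)
          then show "fst r = i" using KD_unique[of "(pd i, a)" r i] i by simp
        qed
        finally show ?thesis unfolding sum using Down by auto
      qed
    qed
    then show ?thesis unfolding eq using carr hs by auto
  qed
qed simp

lemma mpow_path:
  assumes X: "X \<in> ED" and "mpow P X (Suc N) (p, q) \<noteq> 0"
  shows "\<exists>hs. length hs = Suc N \<and> composable n hs \<and> set hs \<subseteq> range Down \<and>
    in_vertex n (hd hs) = fst p \<and> out_vertex n (last hs) = fst q \<and> p \<in> P \<and> q \<in> P"
  using assms(2)
proof (induction N arbitrary: p)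
  case 0
  then have "(p, q) \<in> KD" using X by (auto dest: supportedD)
  then show ?case by (intro exI[of _ "[Down (fst q)]"]) (auto simp: KD_def composable_def P_vertex)
next
  case (Suc N)
  then obtain r where r: "r \<in> P" "X (p, r) \<noteq> 0" "mpow P X (Suc N) (r, q) \<noteq> 0"
    by (subst (asm) mpow.simps) (erule mm_nonzero)
  obtain hs where hs: "length hs = Suc N" "composable n hs" "set hs \<subseteq> range Down"
    "in_vertex n (hd hs) = fst r" "out_vertex n (last hs) = fst q" "q \<in> P"
    using Suc.IH[OF r(3)] by auto
  have "(p, r) \<in> KD" using X r by (auto dest: supportedD)
  then show ?case using hs r
    by (intro exI[of _ "Down (fst r) # hs"], cases hs) (auto simp: KD_def composable_def P_vertex)
qed

lemma mpow_zero_mono: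
  assumes "mpow P X N = (\<lambda>_. 0)" "N \<le> M"
  shows "mpow P X M = (\<lambda>_. 0)"
  using assms(2) by (induction rule: dec_induct) (auto simp: assms(1) mm_zero_right)

lemma nilpotent_rep_iff:
  assumes X: "X \<in> ED"
  shows "nilpotent_rep n v (rp X (\<lambda>_. 0)) \<longleftrightarrow> (\<exists>N. mpow P X N = (\<lambda>_. 0))"
proof
  assume "nilpotent_rep n v (rp X (\<lambda>_. 0))"
  then obtain N where N: "N \<ge> 1" "\<And>hs. length hs = N \<Longrightarrow> composable n hs \<Longrightarrow>
        path_product (rp X (\<lambda>_. 0)) hs = 0\<^sub>m (v (in_vertex n (hd hs))) (v (out_vertex n (last hs)))"
    unfolding nilpotent_rep_def by blast
  then obtain M where M: "N = Suc M" by (cases N) auto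
  have "mpow P X N (p, q) = 0" for p q
  proof (rule ccontr)
    assume nz: "mpow P X N (p, q) \<noteq> 0"
    then obtain hs where hs: "length hs = N" "composable n hs" "set hs \<subseteq> range Down"
      "in_vertex n (hd hs) = fst p" "out_vertex n (last hs) = fst q" "p \<in> P" "q \<in> P"
      using mpow_path[OF X, of M p q] unfolding M by auto
    have "snd p < v (fst p)" "snd q < v (fst q)" using hs by (auto simp: P_def)
    then have "path_product (rp X (\<lambda>_. 0)) hs $$ (snd p, snd q) = mpow P X N (p, q)"
      using path_product_entry[OF X refl _ hs(2)] hs M by (cases p; cases q) fastforce
    then show False using N(2)[OF hs(1,2)] nz hs \<open>snd p < _\<close> \<open>snd q < _\<close> by simp
  qed
  then show "\<exists>N. mpow P X N = (\<lambda>_. 0)" by (intro exI[of _ N]) auto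
next
  assume "\<exists>N. mpow P X N = (\<lambda>_. 0)"
  then obtain N where N: "mpow P X (Suc N) = (\<lambda>_. 0)" using mpow_zero_mono[of X _ "Suc _"] by (metis le_SucI order_refl)
  show "nilpotent_rep n v (rp X (\<lambda>_. 0))"
    unfolding nilpotent_rep_def
  proof (intro exI[of _ "Suc N"] conjI allI impI)
    fix hs assume hs: "length hs = Suc N" "composable n hs"
    then have "hs \<noteq> []" by auto
    from path_product_entry[OF X refl this hs(2)] hs N
    show "path_product (rp X (\<lambda>_. 0)) hs = 0\<^sub>m (v (in_vertex n (hd hs))) (v (out_vertex n (last hs)))"
      by (intro eq_matI) (auto simp del: mpow.simps)
  qed simp
qed

subsection \<open>Membership in \<open>Lambda_tilde\<close>\<close>

lemma rep_supported_Omega: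
  "rep_supported n v (Omega n) = {rp X (\<lambda>_. 0) | X. X \<in> ED}"
proof (intro equalityI subsetI)
  fix x assume x: "x \<in> rep_supported n v (Omega n)"
  then have "x \<in> Rp" by (simp add: rep_supported_def)
  have "Zt x = (\<lambda>_. 0)"
  proof -
    have "x (Up i) = 0\<^sub>m (v i) (v (pd i))" if "i \<in> vertices n" for i
      using x that unfolding rep_supported_def by (force simp: Omega_def)
    then show ?thesis by (auto simp: Zt_def KU_def P_iff fun_eq_iff)
  qed
  then have "x = rp (Xt x) (\<lambda>_. 0)" using rp_inverse[OF \<open>x \<in> Rp\<close>] by simp
  then show "x \<in> {rp X (\<lambda>_. 0) | X. X \<in> ED}" using Xt_ED by blast
next
  fix x assume "x \<in> {rp X (\<lambda>_. 0) | X. X \<in> ED}"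
  then obtain X where X: "x = rp X (\<lambda>_. 0)" by auto
  have "x (Up i) = 0\<^sub>m (v i) (v (pd i))" if "i \<in> vertices n" for i
    using that by (intro eq_matI) (auto simp: X rp_def)
  moreover have "h \<in> arrows n - Omega n \<Longrightarrow> \<exists>i\<in>vertices n. h = Up i" for h
    by (auto simp: in_arrows Omega_def)
  ultimately have "\<forall>h\<in>arrows n - Omega n. x h = 0\<^sub>m (v (in_vertex n h)) (v (out_vertex n h))" by force
  then show "x \<in> rep_supported n v (Omega n)" unfolding rep_supported_def X by auto
qed

lemma rep_supported_Omega_bar:
  "rep_supported n v (Omega_bar n) = {rp (\<lambda>_. 0) Z | Z. Z \<in> EU}"
proof (intro equalityI subsetI)
  fix x assume x: "x \<in> rep_supported n v (Omega_bar n)"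
  then have "x \<in> Rp" by (simp add: rep_supported_def)
  have "Xt x = (\<lambda>_. 0)"
  proof -
    have "x (Down i) = 0\<^sub>m (v (pd i)) (v i)" if "i \<in> vertices n" for i
      using x that unfolding rep_supported_def by (force simp: Omega_bar_def)
    then show ?thesis by (auto simp: Xt_def KD_def P_iff fun_eq_iff)
  qed
  then have "x = rp (\<lambda>_. 0) (Zt x)" using rp_inverse[OF \<open>x \<in> Rp\<close>] by simp
  then show "x \<in> {rp (\<lambda>_. 0) Z | Z. Z \<in> EU}" using Zt_EU by blast
next
  fix x assume "x \<in> {rp (\<lambda>_. 0) Z | Z. Z \<in> EU}"
  then obtain Z where Z: "x = rp (\<lambda>_. 0) Z" by auto
  have "x (Down i) = 0\<^sub>m (v (pd i)) (v i)" if "i \<in> vertices n" for i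
    using that by (intro eq_matI) (auto simp: Z rp_def)
  moreover have "h \<in> arrows n - Omega_bar n \<Longrightarrow> \<exists>i\<in>vertices n. h = Down i" for h
    by (auto simp: in_arrows Omega_bar_def)
  ultimately have "\<forall>h\<in>arrows n - Omega_bar n. x h = 0\<^sub>m (v (in_vertex n h)) (v (out_vertex n h))" by force
  then show "x \<in> rep_supported n v (Omega_bar n)" unfolding rep_supported_def Z by auto
qed

lemma rp_linear:
  "rep_add n (rp X Z) (rp X' Z') = rp (\<lambda>k. X k + X' k) (\<lambda>k. Z k + Z' k)"
  "rep_scale n t (rp X Z) = rp (\<lambda>k. t * X k) (\<lambda>k. t * Z k)"
  unfolding rep_add_def rep_scale_def rp_def
  by (rule restrict_ext, auto simp: in_arrows intro!: eq_matI)+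

lemma rep_add_rp: "rep_add n (rp X (\<lambda>_. 0)) (rp (\<lambda>_. 0) Z) = rp X Z"
  by (simp add: rp_linear)

text \<open>Nilpotency refers to the part along \<open>Omega\<close> alone.\<close>

lemma rp_in_Lambda:
  assumes "X \<in> ED" "Z \<in> EU"
  shows "rp X Z \<in> Lambda_tilde n v \<longleftrightarrow> (\<exists>N. mpow P X N = (\<lambda>_. 0)) \<and> mul X Z = mul Z X"
proof
  assume "rp X Z \<in> Lambda_tilde n v"
  then obtain X' Z' where XZ: "X' \<in> ED" "Z' \<in> EU" "rp X Z = rp X' Z'" "nilpotent_rep n v (rp X' (\<lambda>_. 0))"
     "\<forall>i\<in>vertices n. psi n v (rp X' Z') i = 0\<^sub>m (v i) (v i)"
    unfolding Lambda_tilde_def rep_supported_Omega rep_supported_Omega_bar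
    by (auto simp: rep_add_rp)
  then have "X' = X" "Z' = Z" using Xt_rp Zt_rp assms by metis+
  then show "(\<exists>N. mpow P X N = (\<lambda>_. 0)) \<and> mul X Z = mul Z X"
    using XZ nilpotent_rep_iff psi_zero_iff by auto
next
  assume "(\<exists>N. mpow P X N = (\<lambda>_. 0)) \<and> mul X Z = mul Z X"
  then have "nilpotent_rep n v (rp X (\<lambda>_. 0))" "\<forall>i\<in>vertices n. psi n v (rp X Z) i = 0\<^sub>m (v i) (v i)"
    using nilpotent_rep_iff psi_zero_iff assms by auto
  then show "rp X Z \<in> Lambda_tilde n v"
    unfolding Lambda_tilde_def rep_supported_Omega rep_supported_Omega_bar
    using assms rep_add_rp[of X Z] by (intro CollectI exI[of _ "rp X (\<lambda>_. 0)"] exI[of _ "rp (\<lambda>_. 0) Z"]) auto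
qed

lemma Lambda_Rp: "x \<in> Lambda_tilde n v \<Longrightarrow> x \<in> Rp"
  unfolding Lambda_tilde_def rep_supported_Omega rep_supported_Omega_bar by (auto simp: rep_add_rp)

end

section \<open>Stability and words\<close>

lemma pairing_right_linear:
  "pairing P C (\<lambda>k. A k + B k) = pairing P C A + pairing P C B"
  "pairing P C (\<lambda>k. c * A k) = c * pairing P C A"
  "pairing P C (\<lambda>k. 0) = 0"
  unfolding pairing_def by (auto simp: sum.distrib sum_distrib_left algebra_simps)

context graded_space
begin

text \<open>The word \<open>J Z^m X^k\<close>. Words are row vectors, so \<open>X\<close> and
  \<open>Z\<close> act from the right.\<close>

definition word :: "graded_matrix \<Rightarrow> graded_matrix \<Rightarrow>
    graded_vector \<Rightarrow> nat \<Rightarrow> nat \<Rightarrow> graded_vector" where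
  "word X Z J k m = ((\<lambda>\<eta>. rm P \<eta> X) ^^ k) (((\<lambda>\<eta>. rm P \<eta> Z) ^^ m) J)"

lemma word_simps [simp]:
  "word X Z J 0 0 = J"
  "word X Z J (Suc k) m = rm P (word X Z J k m) X"
  by (simp_all add: word_def)

lemma word_0_Suc: "word X Z J 0 (Suc m) = rm P (word X Z J 0 m) Z"
  by (simp add: word_def)

lemma word_Suc_right:
  assumes "mul X Z = mul Z X"
  shows "word X Z J k (Suc m) = rm P (word X Z J k m) Z"
  by (induction k) (simp_all add: word_0_Suc rm_mm assms)

text \<open>The row \<open>J\<close> has degree \<open>0\<close>. Multiplying a row by
  \<open>X\<close>, which lowers degrees, raises its degree by one, and multiplying by
  \<open>Z\<close> lowers it.\<close>

lemma word_homogeneous: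
  assumes X: "X \<in> ED" and Z: "Z \<in> EU" and J: "J \<in> EJ" and nz: "word X Z J k m p \<noteq> 0"
  shows "p \<in> P \<and> fst p = residue n (int k - int m)"
  using nz
proof (induction k arbitrary: p)
  case 0
  then show ?case
  proof (induction m arbitrary: p)
    case 0
    then have "p \<in> KJ" using supportedD[OF J] by simp
    then show ?case by (simp add: KJ_def residue_def)
  next
    case (Suc m)
    then obtain q where q: "q \<in> P" "word X Z J 0 m q \<noteq> 0" "Z (q, p) \<noteq> 0"
      unfolding word_0_Suc by (metis rm_nonzero)
    then have "p \<in> P" "fst p = pd (fst q)" "fst q = residue n (int 0 - int m)"
      using supportedD[OF Z q(3)] Suc.IH[OF q(2)] unfolding KU_def by simp_all
    moreover have "int 0 - int (Suc m) = (int 0 - int m) - 1" by simp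
    ultimately show ?case by (simp only: residue_diff_left simp_thms)
  qed
next
  case (Suc k)
  then obtain q where q: "q \<in> P" "word X Z J k m q \<noteq> 0" "X (q, p) \<noteq> 0"
    unfolding word_simps by (metis rm_nonzero)
  then have p: "p \<in> P" "pd (fst p) = residue n (int k - int m)"
    using supportedD[OF X q(3)] Suc.IH[OF q(2)] unfolding KD_def by simp_all
  have "fst p = residue n (pd (fst p) + 1)" using succ_pd P_vertex p(1) by metis
  then have "fst p = residue n (residue n (int k - int m) + 1)" using p(2) by simp
  moreover have "int (Suc k) - int m = (int k - int m) + 1" by simp
  ultimately show ?case using p(1) by (simp only: residue_add_left simp_thms)
qed

definition blkD :: "graded_matrix \<Rightarrow> int \<Rightarrow> complex mat" where
  "blkD X i = mat (v (pd i)) (v i) (\<lambda>(a, b). X ((pd i, a), (i, b)))"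

definition blkU :: "graded_matrix \<Rightarrow> int \<Rightarrow> complex mat" where
  "blkU Z i = mat (v i) (v (pd i)) (\<lambda>(a, b). Z ((i, a), (pd i, b)))"

lemma rp_blk: "i \<in> vertices n \<Longrightarrow> rp X Z (Down i) = blkD X i"
  "i \<in> vertices n \<Longrightarrow> rp X Z (Up i) = blkU Z i"
  by (auto simp: rp_def blkD_def blkU_def)

text \<open>Stability in the dual space: only homogeneous vectors \<open>U\<close> are tested, since
  the invariant subspaces in the definition of stability are graded.\<close>

definition separating :: "graded_matrix \<Rightarrow> graded_matrix \<Rightarrow>
    graded_vector \<Rightarrow> bool" where
  "separating X Z J \<longleftrightarrow> (\<forall>i\<in>vertices n. \<forall>U\<in>supported ({i} \<times> {..<v i}).
     (\<forall>k m. pairing P (word X Z J k m) U = 0) \<longrightarrow> U = (\<lambda>_. 0))"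

definition lift :: "int \<Rightarrow> complex vec \<Rightarrow> graded_vector" where
  "lift i u = (\<lambda>(j, a). if j = i \<and> a < v i then u $ a else 0)"

lemma lift_supported: "lift i u \<in> supported ({i} \<times> {..<v i})"
  by (auto simp: lift_def supported_def)

lemma lift_zero_iff: "u \<in> carrier_vec (v i) \<Longrightarrow> lift i u = (\<lambda>_. 0) \<longleftrightarrow> u = 0\<^sub>v (v i)"
proof
  assume u: "u \<in> carrier_vec (v i)" and z: "lift i u = (\<lambda>_. 0)"
  have "u $ a = 0" if "a < v i" for a
    using fun_cong[OF z, of "(i, a)"] that by (simp add: lift_def)
  then show "u = 0\<^sub>v (v i)" using u by (intro eq_vecI) auto
qed (auto simp: lift_def fun_eq_iff)

lemma lift_zero: "lift i (0\<^sub>v (v i)) = (\<lambda>_. 0)"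
  by (auto simp: lift_def fun_eq_iff)

lemma lift_vec:
  assumes "U \<in> supported ({i} \<times> {..<v i})"
  shows "lift i (vec (v i) (\<lambda>a. U (i, a))) = U"
proof
  fix p
  show "lift i (vec (v i) (\<lambda>a. U (i, a))) p = U p"
    using supportedD[OF assms, of p] by (cases p) (auto simp: lift_def)
qed

lemma lift_add: "u \<in> carrier_vec (v i) \<Longrightarrow> w \<in> carrier_vec (v i) \<Longrightarrow>
    lift i (u + w) = (\<lambda>k. lift i u k + lift i w k)"
  and lift_scale: "u \<in> carrier_vec (v i) \<Longrightarrow> lift i (c \<cdot>\<^sub>v u) = (\<lambda>k. c * lift i u k)"
  by (auto simp: lift_def fun_eq_iff)

lemma sum_lift:
  assumes "i \<in> vertices n"
  shows "(\<Sum>q\<in>P. f q * lift i u q) = (\<Sum>c<v i. f (i, c) * u $ c)"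
proof -
  have "(\<Sum>q\<in>P. f q * lift i u q) = (\<Sum>c<v i. f (i, c) * lift i u (i, c))"
    using assms by (rule sum_block) (auto simp: lift_def split: if_splits)
  then show ?thesis by (simp add: lift_def)
qed

lemma mv_lift_X:
  assumes X: "X \<in> ED" and i: "i \<in> vertices n" and u: "u \<in> carrier_vec (v i)"
  shows "mv P X (lift i u) = lift (pd i) (rp X Z (Down i) *\<^sub>v u)"
proof
  fix p :: "int \<times> nat"
  obtain j a where p: "p = (j, a)" by (cases p)
  have "mv P X (lift i u) p = (\<Sum>c<v i. X (p, (i, c)) * u $ c)"
    unfolding mv_def by (rule sum_lift[OF i])
  also have "\<dots> = lift (pd i) (rp X Z (Down i) *\<^sub>v u) p"
  proof (cases "j = pd i \<and> a < v (pd i)")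
    case True
    then show ?thesis using i u by (simp add: p lift_def rp_def scalar_prod_def lessThan_atLeast0)
  next
    case False
    then have "X (p, (i, c)) = 0" for c
      using supportedD[OF X, of "(p, (i, c))"] by (auto simp: p KD_def P_iff)
    then show ?thesis using False by (auto simp: p lift_def)
  qed
  finally show "mv P X (lift i u) p = lift (pd i) (rp X Z (Down i) *\<^sub>v u) p" .
qed

lemma mv_lift_Z:
  assumes Z: "Z \<in> EU" and i: "i \<in> vertices n" and u: "u \<in> carrier_vec (v (pd i))"
  shows "mv P Z (lift (pd i) u) = lift i (rp X Z (Up i) *\<^sub>v u)"
proof
  fix p :: "int \<times> nat"
  obtain j a where p: "p = (j, a)" by (cases p)
  have "mv P Z (lift (pd i) u) p = (\<Sum>c<v (pd i). Z (p, (pd i, c)) * u $ c)"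
    unfolding mv_def by (rule sum_lift) simp
  also have "\<dots> = lift i (rp X Z (Up i) *\<^sub>v u) p"
  proof (cases "j = i \<and> a < v i")
    case True
    then show ?thesis using i u by (simp add: p lift_def rp_def scalar_prod_def lessThan_atLeast0)
  next
    case False
    then have "Z (p, (pd i, c)) = 0" for c
      using supportedD[OF Z, of "(p, (pd i, c))"] pd_inj[of i j] i by (auto simp: p KU_def P_iff)
    then show ?thesis using False by (auto simp: p lift_def)
  qed
  finally show "mv P Z (lift (pd i) u) p = lift i (rp X Z (Up i) *\<^sub>v u) p" .
qed

lemma framing_kills_iff:
  assumes J: "J \<in> EJ" and i: "i \<in> vertices n" and u: "u \<in> carrier_vec (v i)"
  shows "fr J i *\<^sub>v u = 0\<^sub>v (w0 n i) \<longleftrightarrow> pairing P J (lift i u) = 0"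
proof -
  have s: "pairing P J (lift i u) = (\<Sum>c<v i. J (i, c) * u $ c)"
    unfolding pairing_def by (rule sum_lift[OF i])
  have f: "fr J i = mat (w0 n i) (v i) (\<lambda>(a, b). J (i, b))" using i by (simp add: fr_def)
  show ?thesis
  proof (cases "i = 0")
    case True
    then have "w0 n i = 1" by (simp add: w0_def)
    moreover have "(mat 1 (v i) (\<lambda>(a, b). J (i, b)) *\<^sub>v u) $ 0 = (\<Sum>c<v i. J (i, c) * u $ c)"
      using u by (simp add: scalar_prod_def lessThan_atLeast0)
    moreover have "w = 0\<^sub>v 1 \<longleftrightarrow> w $ 0 = 0" if "dim_vec w = 1" for w :: "complex vec"
      using that by (auto intro!: eq_vecI)
    ultimately show ?thesis unfolding f s by (simp del: index_mult_mat_vec)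
  next
    case False
    then have "w0 n i = 0" using i by (simp add: w0_def)
    moreover have "J (i, c) = 0" for c using supportedD[OF J, of "(i, c)"] False by (auto simp: KJ_def)
    ultimately show ?thesis unfolding f s by (auto intro!: eq_vecI)
  qed
qed

text \<open>The vectors annihilated by all words form the largest invariant graded subspace in the
  kernel of the framing.\<close>

theorem stable_iff_separating:
  assumes X: "X \<in> ED" and Z: "Z \<in> EU" and J: "J \<in> EJ" and comm: "mul X Z = mul Z X"
  shows "stable n v (w0 n) (rp X Z, fr J) \<longleftrightarrow> separating X Z J"
proof
  assume st: "stable n v (w0 n) (rp X Z, fr J)"
  define S where "S = (\<lambda>j. {u \<in> carrier_vec (v j). \<forall>k m. pairing P (word X Z J k m) (lift j u) = 0})"
  have sub: "VectorSpace.subspace class_ring (S j) (module_vec TYPE(complex) (v j))" for j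
    unfolding VectorSpace.subspace_def LinearCombinations.submodule_def
    using vec_vs vec_module[where n = "v j"]
    by (auto simp: S_def module_vec_simps class_ring_simps lift_add lift_scale pairing_right_linear
        lift_zero)
  have inv: "rp X Z h *\<^sub>v u \<in> S (in_vertex n h)" if h: "h \<in> arrows n" and u: "u \<in> S (out_vertex n h)" for h u
  proof (cases h)
    case (Down i)
    have i: "i \<in> vertices n" and uc: "u \<in> carrier_vec (v i)" and uk: "pairing P (word X Z J k m) (lift i u) = 0" for k m
      using h u Down by (simp_all add: S_def)
    have "pairing P (word X Z J k m) (lift (pd i) (rp X Z (Down i) *\<^sub>v u)) = 0" for k m
      unfolding mv_lift_X[OF X i uc, symmetric] pairing_rm[symmetric] using uk[of "Suc k" m] by simp
    moreover have "rp X Z (Down i) *\<^sub>v u \<in> carrier_vec (v (pd i))"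
      unfolding rp_blk(1)[OF i] blkD_def by (rule mult_mat_vec_carrier[OF mat_carrier uc])
    ultimately show ?thesis by (simp add: S_def Down)
  next
    case (Up i)
    have i: "i \<in> vertices n" and uc: "u \<in> carrier_vec (v (pd i))" and uk: "pairing P (word X Z J k m) (lift (pd i) u) = 0" for k m
      using h u Up by (simp_all add: S_def)
    have "pairing P (word X Z J k m) (lift i (rp X Z (Up i) *\<^sub>v u)) = 0" for k m
      unfolding mv_lift_Z[OF Z i uc, symmetric] pairing_rm[symmetric] word_Suc_right[OF comm, symmetric]
      by (rule uk)
    moreover have "rp X Z (Up i) *\<^sub>v u \<in> carrier_vec (v i)"
      unfolding rp_blk(2)[OF i] blkU_def by (rule mult_mat_vec_carrier[OF mat_carrier uc])
    ultimately show ?thesis by (simp add: S_def Up)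
  qed
  have kill: "fr J i *\<^sub>v u = 0\<^sub>v (w0 n i)" if "i \<in> vertices n" "u \<in> S i" for i u
  proof -
    have "pairing P (word X Z J 0 0) (lift i u) = 0" "u \<in> carrier_vec (v i)"
      using that(2) unfolding S_def by blast+
    then show ?thesis using framing_kills_iff[OF J that(1)] by simp
  qed
  have S0: "S i = {0\<^sub>v (v i)}" if "i \<in> vertices n" for i
    using st[unfolded stable_def, rule_format, of S] sub inv kill that by (simp only: fst_conv snd_conv)
  show "separating X Z J"
    unfolding separating_def
  proof (intro ballI impI)
    fix i U assume i: "i \<in> vertices n" and U: "U \<in> supported ({i} \<times> {..<v i})"
      and k: "\<forall>k m. pairing P (word X Z J k m) U = 0"
    then have "vec (v i) (\<lambda>a. U (i, a)) \<in> S i" by (simp add: S_def lift_vec[OF U])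
    then have "vec (v i) (\<lambda>a. U (i, a)) = 0\<^sub>v (v i)" using S0[OF i] by blast
    then show "U = (\<lambda>_. 0)" using lift_vec[OF U] lift_zero_iff[of "0\<^sub>v (v i)" i] by simp
  qed
next
  assume sep: "separating X Z J"
  show "stable n v (w0 n) (rp X Z, fr J)"
    unfolding stable_def fst_conv snd_conv
  proof (intro allI impI ballI)
    fix S :: "int \<Rightarrow> complex vec set" and i
    assume sub: "\<forall>i\<in>vertices n. VectorSpace.subspace class_ring (S i) (module_vec TYPE(complex) (v i))"
      and inv: "\<forall>h\<in>arrows n. \<forall>u\<in>S (out_vertex n h). rp X Z h *\<^sub>v u \<in> S (in_vertex n h)"
      and kill: "\<forall>i\<in>vertices n. \<forall>u\<in>S i. fr J i *\<^sub>v u = 0\<^sub>v (w0 n i)"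
      and i: "i \<in> vertices n"
    have Sc: "S j \<subseteq> carrier_vec (v j)" and S0: "0\<^sub>v (v j) \<in> S j" if "j \<in> vertices n" for j
    proof -
      have "LinearCombinations.submodule class_ring (S j) (module_vec TYPE(complex) (v j))"
        using sub that unfolding VectorSpace.subspace_def by blast
      from LinearCombinations.submodule.subset[OF this] LinearCombinations.submodule.zero_closed[OF this]
      show "S j \<subseteq> carrier_vec (v j)" "0\<^sub>v (v j) \<in> S j" by (simp_all add: module_vec_simps)
    qed
    have base: "pairing P (word X Z J 0 m) (lift j u) = 0" if "j \<in> vertices n" "u \<in> S j" for j u m
      using that
    proof (induction m arbitrary: j u)
      case 0
      then have "u \<in> carrier_vec (v j)" using Sc by blast
      from framing_kills_iff[OF J 0(1) this] bspec[OF bspec[OF kill 0(1)] 0(2)]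
      show ?case by simp
    next
      case (Suc m)
      define k where "k = residue n (j + 1)"
      have k: "k \<in> vertices n" "pd k = j" using pd_succ[OF Suc.prems(1)] by (simp_all add: k_def)
      have u: "u \<in> carrier_vec (v (pd k))" using Suc.prems Sc k(2) by blast
      have "rp X Z (Up k) *\<^sub>v u \<in> S k" using bspec[OF inv, of "Up k"] k Suc.prems(2) by simp
      then have "pairing P (word X Z J 0 m) (mv P Z (lift (pd k) u)) = 0"
        unfolding mv_lift_Z[OF Z k(1) u, of X] using Suc.IH k(1) by blast
      then show ?case unfolding word_0_Suc pairing_rm k(2) .
    qed
    have all: "pairing P (word X Z J k m) (lift j u) = 0" if "j \<in> vertices n" "u \<in> S j" for j u k m
      using that
    proof (induction k arbitrary: j u)
      case 0
      then show ?case using base by blast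
    next
      case (Suc k)
      have u: "u \<in> carrier_vec (v j)" using Suc.prems Sc by blast
      have "rp X Z (Down j) *\<^sub>v u \<in> S (pd j)" using bspec[OF inv, of "Down j"] Suc.prems by simp
      then show ?case unfolding word_simps pairing_rm mv_lift_X[OF X Suc.prems(1) u, of Z]
        by (intro Suc.IH) simp_all
    qed
    have "u = 0\<^sub>v (v i)" if "u \<in> S i" for u
    proof -
      have "lift i u = (\<lambda>_. 0)"
        using sep[unfolded separating_def] i lift_supported all[OF i that] by blast
      then show ?thesis using lift_zero_iff Sc[OF i] that by blast
    qed
    then show "S i = {0\<^sub>v (v i)}" using S0[OF i] by blast
  qed
qed

theorem Lambda_stable_iff:
  assumes X: "X \<in> ED" and Z: "Z \<in> EU" and J: "J \<in> EJ"
  shows "(rp X Z, fr J) \<in> Lambda_stable n v (w0 n) \<longleftrightarrow>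
    (\<exists>N. mpow P X N = (\<lambda>_. 0)) \<and> mul X Z = mul Z X \<and> separating X Z J"
  unfolding Lambda_stable_def
  using rp_in_Lambda[OF X Z] stable_iff_separating[OF X Z J] by auto

section \<open>The gauge action\<close>

definition Gt :: "(int \<Rightarrow> complex mat) \<Rightarrow> graded_matrix" where
  "Gt g = (\<lambda>(p, q). if (p, q) \<in> K0 then g (fst p) $$ (snd p, snd q) else 0)"

lemma Gt_EG [simp, intro]: "Gt g \<in> EG"
  by (auto simp: Gt_def supported_def)

lemma blk_Gt: "i \<in> vertices n \<Longrightarrow> g i \<in> carrier_mat (v i) (v i) \<Longrightarrow> blk (Gt g) i = g i"
  by (rule eq_matI) (auto simp: blk_def Gt_def K0_def P_iff)

lemma mult_mat_eq:
  "mat m k (\<lambda>(a, c). f a c) * mat k l (\<lambda>(c, b). g c b) = mat m l (\<lambda>(a, b). \<Sum>c<k. f a c * (g c b :: complex))"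
  by (rule eq_matI) (simp_all add: scalar_prod_def lessThan_atLeast0)

lemma left_sum:
  assumes "G \<in> EG" "i \<in> vertices n"
  shows "mul G A ((i, a), q) = (\<Sum>c<v i. G ((i, a), (i, c)) * A ((i, c), q))"
  unfolding mm_apply
proof (rule sum_block[OF assms(2)])
  fix r assume "G ((i, a), r) * A (r, q) \<noteq> 0"
  then have "((i, a), r) \<in> K0" using supportedD[OF assms(1)] by fastforce
  then show "fst r = i" by (simp add: K0_def)
qed

lemma right_sum:
  assumes "H \<in> EG" "i \<in> vertices n"
  shows "mul A H (p, (i, b)) = (\<Sum>c<v i. A (p, (i, c)) * H ((i, c), (i, b)))"
  unfolding mm_apply
proof (rule sum_block[OF assms(2)])
  fix r assume "A (p, r) * H (r, (i, b)) \<noteq> 0"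
  then have "(r, (i, b)) \<in> K0" using supportedD[OF assms(1)] by fastforce
  then show "fst r = i" by (simp add: K0_def)
qed

lemma blk_conj:
  assumes "G \<in> EG" "H \<in> EG" "i \<in> vertices n"
  shows "blkD (mul (mul G X) H) i = blk G (pd i) * blkD X i * blk H i"
    and "blkU (mul (mul G Z) H) i = blk G i * blkU Z i * blk H (pd i)"
  using assms
  by (simp_all add: blk_def blkD_def blkU_def mult_mat_eq left_sum right_sum)

lemma gauge_inverse:
  assumes g: "g \<in> gauge_group n v"
  defines "gi \<equiv> \<lambda>i. the (mat_inverse (g i))"
  shows "inverses (Gt g) (Gt gi)" "i \<in> vertices n \<Longrightarrow> g i \<in> carrier_mat (v i) (v i)"
    "i \<in> vertices n \<Longrightarrow> gi i \<in> carrier_mat (v i) (v i)"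
proof -
  have gc: "g i \<in> carrier_mat (v i) (v i) \<and> invertible_mat (g i)" if "i \<in> vertices n" for i
    using PiE_mem[OF g[unfolded gauge_group_def] that] by simp
  have inv: "g i * gi i = 1\<^sub>m (v i) \<and> gi i * g i = 1\<^sub>m (v i) \<and> gi i \<in> carrier_mat (v i) (v i)"
    if i: "i \<in> vertices n" for i
  proof (cases "mat_inverse (g i)")
    case (Some B)
    then show ?thesis using mat_inverse(2)[of "g i" "v i" B] gc[OF i] by (simp add: gi_def)
  next
    case None
    obtain B where B: "g i * B = 1\<^sub>m (v i)" "B * g i = 1\<^sub>m (dim_row B)"
      using gc[OF i] unfolding invertible_mat_def inverts_mat_def by auto
    have "dim_col B = v i" using arg_cong[OF B(1), of dim_col] by simp
    moreover have rB: "dim_row B = v i"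
      using arg_cong[OF B(2), of dim_col] carrier_matD(2)[OF conjunct1[OF gc[OF i]]] by simp
    ultimately have "B \<in> carrier_mat (v i) (v i)" by (rule carrier_matI[rotated])
    then have "g i \<in> Units (ring_mat TYPE(complex) (v i) ())"
      unfolding Units_def mem_Collect_eq ring_mat_simps
      by (intro conjI bexI[of _ B] conjunct1[OF gc[OF i]] B(1) B(2)[unfolded rB]) assumption
    then show ?thesis using mat_inverse(1)[OF conjunct1[OF gc[OF i]] None] by (rule notE[rotated])
  qed
  have Gg: "blk (Gt g) i = g i" "blk (Gt gi) i = gi i" if "i \<in> vertices n" for i
    using blk_Gt gc inv that by auto
  have "mul (Gt g) (Gt gi) = I1"
    by (rule blk_eqI) (simp_all add: mul_EG_EG blk_mul Gg blk_one inv)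
  moreover have "mul (Gt gi) (Gt g) = I1"
    by (rule blk_eqI) (simp_all add: mul_EG_EG blk_mul Gg blk_one inv)
  ultimately show "inverses (Gt g) (Gt gi)" by (simp add: inverses_def)
  show "i \<in> vertices n \<Longrightarrow> g i \<in> carrier_mat (v i) (v i)"
    "i \<in> vertices n \<Longrightarrow> gi i \<in> carrier_mat (v i) (v i)" using gc inv by auto
qed

lemma gauge_act_eq:
  assumes g: "g \<in> gauge_group n v" and J: "J \<in> EJ"
  shows "gauge_act n g (rp X Z, fr J) =
    (rp (mul (mul (Gt g) X) (minv (Gt g))) (mul (mul (Gt g) Z) (minv (Gt g))), fr (rm P J (minv (Gt g))))"
proof -
  define gi where "gi = (\<lambda>i. the (mat_inverse (g i)))"
  note gg = gauge_inverse[OF g, folded gi_def]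
  have H: "minv (Gt g) = Gt gi" using inverses_dlt(2)[OF gg(1)] by simp
  have gic: "gi i \<in> carrier_mat (v i) (v i)" if "i \<in> vertices n" for i
    using gg(3)[OF that] by (simp add: gi_def)
  have Gg: "blk (Gt g) i = g i" "blk (Gt gi) i = gi i" if "i \<in> vertices n" for i
    using blk_Gt gg(2) gic that by auto
  have "(\<lambda>h\<in>arrows n. g (in_vertex n h) * rp X Z h * gi (out_vertex n h))
    = rp (mul (mul (Gt g) X) (Gt gi)) (mul (mul (Gt g) Z) (Gt gi))"
  proof (rule extensionalityI[of _ "arrows n"])
    fix h assume "h \<in> arrows n"
    then obtain i where i: "i \<in> vertices n" "h = Down i \<or> h = Up i" by (auto simp: in_arrows)
    from i(2) show "(\<lambda>h\<in>arrows n. g (in_vertex n h) * rp X Z h * gi (out_vertex n h)) h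
      = rp (mul (mul (Gt g) X) (Gt gi)) (mul (mul (Gt g) Z) (Gt gi)) h"
    proof
      assume "h = Down i"
      then show ?thesis using i(1) by (simp add: rp_blk blk_conj Gg)
    next
      assume "h = Up i"
      then show ?thesis using i(1) by (simp add: rp_blk blk_conj Gg)
    qed
  qed (auto simp: rp_def)
  moreover have "(\<lambda>i\<in>vertices n. fr J i * gi i) = fr (rm P J (Gt gi))"
  proof (rule extensionalityI[of _ "vertices n"])
    fix i assume i: "i \<in> vertices n"
    have "fr J i * gi i = mat (w0 n i) (v i) (\<lambda>(a, b). \<Sum>c<v i. J (i, c) * Gt gi ((i, c), (i, b)))"
      using i unfolding Gg(2)[OF i, symmetric] by (simp add: fr_def blk_def mult_mat_eq)
    also have "(\<lambda>(a, b). \<Sum>c<v i. J (i, c) * Gt gi ((i, c), (i, b))) = (\<lambda>(a, b). rm P J (Gt gi) (i, b))"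
      unfolding rm_def
    proof (intro ext, clarify, rule sum_block[symmetric, OF i])
      fix b r assume "J r * Gt gi (r, (i, b)) \<noteq> 0"
      then have "(r, (i, b)) \<in> K0" using supportedD[OF Gt_EG] by fastforce
      then show "fst r = i" by (simp add: K0_def)
    qed
    finally show "(\<lambda>i\<in>vertices n. fr J i * gi i) i = fr (rm P J (Gt gi)) i"
      using i by (simp add: fr_def)
  qed (auto simp: fr_def)
  ultimately show ?thesis unfolding gauge_act_def H by (simp add: gi_def)
qed

lemma gauge_exists:
  assumes "s \<in> EG" "dlt s \<noteq> 0"
  obtains g where "g \<in> gauge_group n v" "Gt g = s"
proof
  define g where "g = (\<lambda>i\<in>vertices n. blk s i)"
  have inv: "inverses s (minv s)" by (rule inverses_minv[OF assms])
  have "invertible_mat (blk s i)" if "i \<in> vertices n" for i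
    unfolding invertible_mat_def inverts_mat_def
  proof (intro conjI exI)
    show "blk s i * blk (minv s) i = 1\<^sub>m (dim_row (blk s i))"
      "blk (minv s) i * blk s i = 1\<^sub>m (dim_row (blk (minv s) i))"
      using blk_mul[of s "minv s" i] blk_mul[of "minv s" s i] blk_one[OF that] inv that
      by (auto simp: inverses_def blk_def)
  qed (simp add: blk_def)
  then show "g \<in> gauge_group n v" by (auto simp: g_def gauge_group_def)
  show "Gt g = s"
    by (rule blk_eqI[OF Gt_EG assms(1)]) (simp add: blk_Gt g_def)
qed

lemma gauge_dlt: "g \<in> gauge_group n v \<Longrightarrow> dlt (Gt g) \<noteq> 0"
  using gauge_inverse(1) inverses_dlt(1) by blast

end

section \<open>Boxes of Young diagrams\<close>

definition boxes :: "nat list \<Rightarrow> (nat \<times> nat) set" where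
  "boxes Y = {(k, m). m < length Y \<and> k < Y ! m}"

lemma finite_boxes [simp]: "finite (boxes Y)"
proof (rule finite_subset)
  show "boxes Y \<subseteq> (\<Union>m\<in>{..<length Y}. (\<lambda>k. (k, m)) ` {..<Y ! m})" by (auto simp: boxes_def)
qed auto

lemma young_nth_mono: "Y \<in> young_diagrams \<Longrightarrow> m' \<le> m \<Longrightarrow> m < length Y \<Longrightarrow> Y ! m \<le> Y ! m'"
  unfolding young_diagrams_def using sorted_wrt_nth_less[of "(\<ge>)" Y m' m] by (cases "m' = m") auto

lemma boxes_down:
  "Y \<in> young_diagrams \<Longrightarrow> (k, m) \<in> boxes Y \<Longrightarrow> k' \<le> k \<Longrightarrow> m' \<le> m \<Longrightarrow> (k', m') \<in> boxes Y"
  using young_nth_mono[of Y m' m] by (auto simp: boxes_def)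

lemma young_pos: "Y \<in> young_diagrams \<Longrightarrow> m < length Y \<Longrightarrow> 0 < Y ! m"
  by (auto simp: young_diagrams_def)

lemma boxes_inject:
  assumes "Y \<in> young_diagrams" "Y' \<in> young_diagrams" "boxes Y = boxes Y'"
  shows "Y = Y'"
proof (rule nth_equalityI)
  have "m < length Y \<longleftrightarrow> (0, m) \<in> boxes Y" "m < length Y' \<longleftrightarrow> (0, m) \<in> boxes Y'" for m
    using young_pos[OF assms(1), of m] young_pos[OF assms(2), of m] unfolding boxes_def by auto
  then have h: "m < length Y \<longleftrightarrow> m < length Y'" for m using assms(3) by simp
  show len: "length Y = length Y'" using h[of "length Y"] h[of "length Y'"] by simp
  fix m assume m: "m < length Y"
  have h: "k < Y ! m \<longleftrightarrow> k < Y' ! m" for k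
    using assms(3) m len unfolding boxes_def by (auto simp: set_eq_iff)
  show "Y ! m = Y' ! m" using h[of "Y ! m"] h[of "Y' ! m"] by simp
qed

text \<open>The number of boxes beyond the first \<open>k\<close> columns, which is the rank of the
  \<open>k\<close>-th power of a nilpotent matrix whose Jordan blocks are the rows of
  \<open>Y\<close>.\<close>

definition tail_count :: "nat list \<Rightarrow> nat \<Rightarrow> nat" where
  "tail_count Y k = card {b \<in> boxes Y. k \<le> fst b}"

text \<open>Consecutive differences are the lengths of the columns.\<close>

lemma tail_count_inject:
  assumes Y: "Y \<in> young_diagrams" and Y': "Y' \<in> young_diagrams"
    and eq: "\<And>k. tail_count Y k = tail_count Y' k"
  shows "Y = Y'"
proof -
  have col: "{m. (k, m) \<in> boxes Z} = {..<tail_count Z k - tail_count Z (Suc k)}"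
    if Z: "Z \<in> young_diagrams" for Z k
  proof -
    let ?C = "{m. (k, m) \<in> boxes Z}"
    have fin: "finite ?C" by (rule finite_subset[of _ "{..<length Z}"]) (auto simp: boxes_def)
    have "{b \<in> boxes Z. k \<le> fst b} = {b \<in> boxes Z. Suc k \<le> fst b} \<union> Pair k ` ?C"
      by (auto simp: not_less_eq_eq le_Suc_eq intro: le_antisym)
    moreover have "{b \<in> boxes Z. Suc k \<le> fst b} \<inter> Pair k ` ?C = {}" by auto
    ultimately have "tail_count Z k = tail_count Z (Suc k) + card (Pair k ` ?C)"
      unfolding tail_count_def using fin by (simp add: card_Un_disjoint)
    then have card: "card ?C = tail_count Z k - tail_count Z (Suc k)"
      by (simp add: card_image inj_on_def)
    have down: "m' \<in> ?C" if "m \<in> ?C" "m' \<le> m" for m m'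
      using boxes_down[OF Z] that by blast
    have "?C = {..<card ?C}"
    proof (cases "?C = {}")
      case False
      define M where "M = Max ?C"
      have "?C = {..M}" using down Max_in[OF fin False] Max_ge[OF fin] unfolding M_def by blast
      then show ?thesis by (metis card_atMost lessThan_Suc_atMost)
    qed simp
    then show ?thesis using card by simp
  qed
  have "boxes Y = boxes Y'" using col[OF Y] col[OF Y'] eq by (auto simp: set_eq_iff)
  then show ?thesis using boxes_inject Y Y' by blast
qed

section \<open>Segments and boxes\<close>

text \<open>Rows are counted from \<open>0\<close>; this is the pair
  \<open>(1 - i, l_i - i)\<close> of the row \<open>i = m + 1\<close>.\<close>

definition row_class :: "nat \<Rightarrow> nat list \<Rightarrow> nat \<Rightarrow> (int \<times> int) set" where
  "row_class n Y m = segment_class n (- int m, int (Y ! m) - 1 - int m)"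

lemma f_Y_card: "f_Y n Y c = card {m. m < length Y \<and> row_class n Y m = c}"
proof -
  let ?g = "\<lambda>i. segment_class n (1 - int i, int (Y ! (i - 1)) - int i)"
  have "f_Y n Y c = card {i \<in> {1..length Y}. ?g i = c}"
    unfolding f_Y_def A_multiset_def
    by (simp add: count_image_mset) (auto intro!: arg_cong[where f = card])
  also have "{i \<in> {1..length Y}. ?g i = c} = Suc ` {m. m < length Y \<and> row_class n Y m = c}"
  proof (intro equalityI subsetI)
    fix i assume i: "i \<in> {i \<in> {1..length Y}. ?g i = c}"
    then have "i = Suc (i - 1)" "i - 1 < length Y" by auto
    moreover have "row_class n Y (i - 1) = c" using i by (auto simp: row_class_def of_nat_diff)
    ultimately show "i \<in> Suc ` {m. m < length Y \<and> row_class n Y m = c}" by blast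
  next
    fix i assume "i \<in> Suc ` {m. m < length Y \<and> row_class n Y m = c}"
    then obtain m where m: "i = Suc m" "m < length Y" "row_class n Y m = c" by blast
    have "?g (Suc m) = row_class n Y m"
      unfolding row_class_def by (rule arg_cong[where f = "segment_class n"]) simp
    then show "i \<in> {i \<in> {1..length Y}. ?g i = c}" using m by simp
  qed
  finally show ?thesis by (simp add: card_image)
qed

lemma f_Y_row: "f_Y n Y c \<noteq> 0 \<Longrightarrow> \<exists>m<length Y. row_class n Y m = c"
  unfolding f_Y_card by (metis (mono_tags, lifting) Collect_empty_eq card.empty)

lemma row_class_segment: "Y \<in> young_diagrams \<Longrightarrow> m < length Y \<Longrightarrow> row_class n Y m \<in> segments n"
  unfolding segments_def row_class_def using young_pos[of Y m] by (intro imageI) auto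

lemma f_Y_support: "Y \<in> young_diagrams \<Longrightarrow> f_Y n Y c \<noteq> 0 \<Longrightarrow> c \<in> segments n"
  using f_Y_row row_class_segment by blast

lemma f_Y_Z_tilde: "Y \<in> young_diagrams \<Longrightarrow> f_Y n Y \<in> Z_tilde n"
proof -
  assume Y: "Y \<in> young_diagrams"
  have "{c. f_Y n Y c \<noteq> 0} \<subseteq> row_class n Y ` {..<length Y}"
    using f_Y_row[of n Y] by blast
  then show ?thesis using f_Y_support[OF Y] unfolding Z_tilde_def by (auto intro: finite_subset)
qed

lemma segment_rep_class:
  obtains t where "segment_rep (segment_class n (a, b)) = (a + t * (int n + 1), b + t * (int n + 1))"
proof -
  have "(a, b) \<in> segment_class n (a, b)" by (auto simp: segment_class_def intro!: exI[of _ 0])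
  then have "segment_rep (segment_class n (a, b)) \<in> segment_class n (a, b)"
    unfolding segment_rep_def by (rule someI)
  then show ?thesis using that by (auto simp: segment_class_def)
qed

lemma residue_shift: "residue n (a + t * (int n + 1)) = residue n a"
  by (simp add: residue_def)

lemma row_class_range:
  fixes n k :: nat
  assumes Y: "Y \<in> young_diagrams" and m: "m < length Y"
  defines "a \<equiv> fst (segment_rep (row_class n Y m))"
  shows "segment_range (row_class n Y m) = {a..a + int (Y ! m) - 1}"
    and "residue n (a + int k) = residue n (int k - int m)"
proof -
  obtain t where t: "segment_rep (row_class n Y m) =
      (- int m + t * (int n + 1), int (Y ! m) - 1 - int m + t * (int n + 1))"
    unfolding row_class_def by (rule segment_rep_class)
  show "segment_range (row_class n Y m) = {a..a + int (Y ! m) - 1}"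
    unfolding segment_range_def a_def t by (auto simp: algebra_simps)
  have "a + int k = (int k - int m) + t * (int n + 1)" unfolding a_def t by simp
  then show "residue n (a + int k) = residue n (int k - int m)" by (simp only: residue_shift)
qed

text \<open>The basis vector \<open>e_r\<close> in the \<open>m\<close>-th copy of the segment
  \<open>c\<close> becomes a box: its column is the position of \<open>r\<close> in the segment, its
  row is the \<open>m\<close>-th row of \<open>Y\<close> in the class \<open>c\<close>, for some
  enumeration of these rows.\<close>

definition basis_box :: "nat \<Rightarrow> nat list \<Rightarrow> (int \<times> int) set \<times> nat \<times> int \<Rightarrow> nat \<times> nat" where
  "basis_box n Y = (\<lambda>(c, m, r). (nat (r - fst (segment_rep c)),
     (SOME h. bij_betw h {..<f_Y n Y c} {m. m < length Y \<and> row_class n Y m = c}) m))"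

lemma row_choice:
  obtains \<rho> where "\<forall>c. bij_betw (\<rho> c) {..<f_Y n Y c} {m. m < length Y \<and> row_class n Y m = c}"
    "basis_box n Y = (\<lambda>(c, m, r). (nat (r - fst (segment_rep c)), \<rho> c m))"
proof -
  define \<rho> where "\<rho> = (\<lambda>c. SOME h. bij_betw h {..<f_Y n Y c} {m. m < length Y \<and> row_class n Y m = c})"
  have "bij_betw (\<rho> c) {..<f_Y n Y c} {m. m < length Y \<and> row_class n Y m = c}" for c
  proof -
    have "finite {m. m < length Y \<and> row_class n Y m = c}" by auto
    from ex_bij_betw_nat_finite[OF this]
    have "\<exists>h. bij_betw h {..<f_Y n Y c} {m. m < length Y \<and> row_class n Y m = c}"
      by (simp add: f_Y_card lessThan_atLeast0)
    then show ?thesis unfolding \<rho>_def by (rule someI_ex)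
  qed
  then show ?thesis using that[of \<rho>] by (simp add: basis_box_def \<rho>_def)
qed

lemma basis_box:
  assumes Y: "Y \<in> young_diagrams" and b: "(c, m, r) \<in> sum_basis n (f_Y n Y)"
  shows "basis_box n Y (c, m, r) \<in> boxes Y"
    and "row_class n Y (snd (basis_box n Y (c, m, r))) = c"
    and "r = fst (segment_rep c) + int (fst (basis_box n Y (c, m, r)))"
    and "residue n r = residue n (int (fst (basis_box n Y (c, m, r))) - int (snd (basis_box n Y (c, m, r))))"
proof -
  obtain \<rho> where \<rho>: "\<forall>c. bij_betw (\<rho> c) {..<f_Y n Y c} {m. m < length Y \<and> row_class n Y m = c}"
    "basis_box n Y = (\<lambda>(c, m, r). (nat (r - fst (segment_rep c)), \<rho> c m))" by (rule row_choice[of n Y])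
  have m: "m < f_Y n Y c" "r \<in> segment_range c" using b by (auto simp: sum_basis_def)
  have row: "\<rho> c m < length Y" "row_class n Y (\<rho> c m) = c"
    using bij_betwE[OF spec[OF \<rho>(1), of c]] m(1) by auto
  have r: "fst (segment_rep c) \<le> r" "r < fst (segment_rep c) + int (Y ! \<rho> c m)"
    using m(2) row_class_range(1)[OF Y row(1), of n] row(2) by auto
  show "basis_box n Y (c, m, r) \<in> boxes Y" using row r by (auto simp: boxes_def \<rho>(2))
  show "row_class n Y (snd (basis_box n Y (c, m, r))) = c" using row by (simp add: \<rho>(2))
  show req: "r = fst (segment_rep c) + int (fst (basis_box n Y (c, m, r)))" using r by (simp add: \<rho>(2))
  show "residue n r = residue n (int (fst (basis_box n Y (c, m, r))) - int (snd (basis_box n Y (c, m, r))))"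
    using row_class_range(2)[OF Y row(1), of n "fst (basis_box n Y (c, m, r))"]
    unfolding row(2) req[symmetric] by (simp add: \<rho>(2))
qed

lemma basis_box_bij:
  assumes Y: "Y \<in> young_diagrams"
  shows "bij_betw (basis_box n Y) (sum_basis n (f_Y n Y)) (boxes Y)"
proof -
  obtain \<rho> where \<rho>: "\<forall>c. bij_betw (\<rho> c) {..<f_Y n Y c} {m. m < length Y \<and> row_class n Y m = c}"
    "basis_box n Y = (\<lambda>(c, m, r). (nat (r - fst (segment_rep c)), \<rho> c m))" by (rule row_choice[of n Y])
  show ?thesis
  proof (rule bij_betwI')
    fix b b' assume b: "b \<in> sum_basis n (f_Y n Y)" "b' \<in> sum_basis n (f_Y n Y)"
    obtain c m r c' m' r' where eq: "b = (c, m, r)" "b' = (c', m', r')" by (metis surj_pair)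
    show "(basis_box n Y b = basis_box n Y b') = (b = b')"
    proof
      assume e: "basis_box n Y b = basis_box n Y b'"
      have c: "c = c'" using basis_box(2)[OF Y] b e unfolding eq by metis
      moreover have "r = r'" using basis_box(3)[OF Y] b e c unfolding eq by metis
      moreover have "m = m'"
        using e bij_betw_imp_inj_on[OF spec[OF \<rho>(1), of c]] b c unfolding eq
        by (auto simp: \<rho>(2) sum_basis_def inj_on_def)
      ultimately show "b = b'" unfolding eq by simp
    qed simp
  next
    fix b assume "b \<in> sum_basis n (f_Y n Y)"
    then show "basis_box n Y b \<in> boxes Y" using basis_box(1)[OF Y] by (metis surj_pair)
  next
    fix b assume b: "b \<in> boxes Y"
    then obtain k l where kl: "b = (k, l)" "l < length Y" "k < Y ! l" by (auto simp: boxes_def)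
    define c where "c = row_class n Y l"
    have "l \<in> \<rho> c ` {..<f_Y n Y c}" using bij_betw_imp_surj_on[OF spec[OF \<rho>(1), of c]] kl by (auto simp: c_def)
    then obtain m where m: "m < f_Y n Y c" "\<rho> c m = l" by auto
    have "(c, m, fst (segment_rep c) + int k) \<in> sum_basis n (f_Y n Y)"
      using m row_class_segment[OF Y kl(2)] row_class_range(1)[OF Y kl(2), of n] kl(3)
      by (auto simp: sum_basis_def c_def)
    moreover have "b = basis_box n Y (c, m, fst (segment_rep c) + int k)" using m kl by (simp add: \<rho>(2))
    ultimately show "\<exists>a\<in>sum_basis n (f_Y n Y). b = basis_box n Y a" by blast
  qed
qed

lemma basis_box_pred:
  assumes Y: "Y \<in> young_diagrams" and b: "(c, m, r) \<in> sum_basis n (f_Y n Y)" and r: "r \<noteq> fst (segment_rep c)"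
  shows "(c, m, r - 1) \<in> sum_basis n (f_Y n Y)"
    and "basis_box n Y (c, m, r) = (Suc (fst (basis_box n Y (c, m, r - 1))), snd (basis_box n Y (c, m, r - 1)))"
proof -
  obtain \<rho> where \<rho>: "basis_box n Y = (\<lambda>(c, m, r). (nat (r - fst (segment_rep c)), \<rho> c m))" by (rule row_choice[of n Y])
  show "(c, m, r - 1) \<in> sum_basis n (f_Y n Y)" using b r by (auto simp: sum_basis_def segment_range_def)
  show "basis_box n Y (c, m, r) = (Suc (fst (basis_box n Y (c, m, r - 1))), snd (basis_box n Y (c, m, r - 1)))"
  proof -
    have "fst (segment_rep c) \<le> r" using basis_box(3)[OF Y b] by linarith
    then show ?thesis using r by (simp add: \<rho>)
  qed
qed

text \<open>The degree of a box. Moving one column to the right raises it, moving one row down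
  lowers it.\<close>

definition box_residue :: "nat \<Rightarrow> nat \<times> nat \<Rightarrow> int" where
  "box_residue n b = residue n (int (fst b) - int (snd b))"

lemma v_Y_card:
  assumes Y: "Y \<in> young_diagrams" and i: "i \<in> vertices n"
  shows "v_Y n Y i = card {b \<in> boxes Y. box_residue n b = i}"
proof -
  let ?B = "{b \<in> sum_basis n (f_Y n Y). residue n (snd (snd b)) = i}"
  have fin: "finite {c. f_Y n Y c \<noteq> 0}" using f_Y_Z_tilde[OF Y, of n] by (simp add: Z_tilde_def)
  have finr: "finite (segment_range c)" for c by (simp add: segment_range_def)
  have "v_Y n Y i = (\<Sum>c | f_Y n Y c \<noteq> 0. card ({..<f_Y n Y c} \<times> {r \<in> segment_range c. residue n r = i}))"
    using i by (simp add: v_Y_def graded_dim_def card_cartesian_product)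
  also have "\<dots> = card (SIGMA c:{c. f_Y n Y c \<noteq> 0}. {..<f_Y n Y c} \<times> {r \<in> segment_range c. residue n r = i})"
    using fin finr by (intro card_SigmaI[symmetric]) auto
  also have "(SIGMA c:{c. f_Y n Y c \<noteq> 0}. {..<f_Y n Y c} \<times> {r \<in> segment_range c. residue n r = i}) = ?B"
    using f_Y_support[OF Y] by (auto simp: sum_basis_def)
  also have "card ?B = card (basis_box n Y ` ?B)"
    using bij_betw_imp_inj_on[OF basis_box_bij[OF Y, of n]]
    by (intro card_image[symmetric]) (auto intro: inj_on_subset)
  also have "basis_box n Y ` ?B = {b \<in> boxes Y. box_residue n b = i}"
  proof (intro equalityI subsetI)
    fix b assume "b \<in> basis_box n Y ` ?B"
    then obtain c m r where "(c, m, r) \<in> sum_basis n (f_Y n Y)" "residue n r = i" "b = basis_box n Y (c, m, r)" by auto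
    then show "b \<in> {b \<in> boxes Y. box_residue n b = i}"
      using basis_box(1,4)[OF Y] by (auto simp: box_residue_def)
  next
    fix b assume b: "b \<in> {b \<in> boxes Y. box_residue n b = i}"
    then obtain a where a: "a \<in> sum_basis n (f_Y n Y)" "b = basis_box n Y a"
      using bij_betw_imp_surj_on[OF basis_box_bij[OF Y, of n]] by blast
    obtain c m r where "a = (c, m, r)" by (metis surj_pair)
    then show "b \<in> basis_box n Y ` ?B" using a b basis_box(4)[OF Y, of c m r n] by (auto simp: box_residue_def)
  qed
  finally show ?thesis .
qed

lemma v_Y_dim_vector [simp]: "v_Y n Y \<in> dim_vectors n"
  by (auto simp: v_Y_def graded_dim_def dim_vectors_def)

section \<open>The standard representation of a Young diagram\<close>

text \<open>The orbit is described through bases of the components, the gauge group through matrices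
  with nonzero determinant.\<close>

lemma cols_basis_iff:
  assumes A: "A \<in> carrier_mat k k"
  shows "det A \<noteq> 0 \<longleftrightarrow> distinct (cols A) \<and>
    vectorspace.basis class_ring (module_vec TYPE(complex) k) (set (cols A))"
proof -
  interpret V: vec_space "TYPE(complex)" k .
  have cc: "set (cols A) \<subseteq> carrier_vec k" using A cols_dim by blast
  have "V.basis (set (cols A))" if "distinct (cols A)" "V.lin_indpt (set (cols A))"
    using that A cc by (intro V.dim_li_is_basis) (auto simp: distinct_card V.dim_is_n)
  moreover have "V.lin_indpt (set (cols A))" if "V.basis (set (cols A))" using that by (simp add: V.basis_def)
  moreover have "det A \<noteq> 0 \<longleftrightarrow> distinct (cols A) \<and> V.lin_indpt (set (cols A))"
    using V.det_rank_iff[OF A] V.lin_indpt_full_rank[OF A] V.full_rank_lin_indpt[OF A]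
      V.non_distinct_low_rank[OF A] by (metis less_irrefl)
  ultimately show ?thesis by blast
qed

text \<open>An identification \<open>pos\<close> of the boxes of \<open>Y\<close> with the basis of
  the graded space that respects degrees. It exists exactly when \<open>v\<close> counts the boxes
  of each degree.\<close>

locale young_space = graded_space n v for n v +
  fixes Y :: "nat list" and pos :: "nat \<times> nat \<Rightarrow> int \<times> nat"
  assumes young: "Y \<in> young_diagrams"
    and pos_bij: "bij_betw pos (boxes Y) P"
    and pos_residue: "b \<in> boxes Y \<Longrightarrow> fst (pos b) = box_residue n b"
begin

definition ipos :: "int \<times> nat \<Rightarrow> nat \<times> nat" where
  "ipos = the_inv_into (boxes Y) pos"

lemma ipos_pos [simp]: "b \<in> boxes Y \<Longrightarrow> ipos (pos b) = b"
  unfolding ipos_def using pos_bij by (intro the_inv_into_f_f) (auto simp: bij_betw_def)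

lemma pos_P: "b \<in> boxes Y \<Longrightarrow> pos b \<in> P"
  using pos_bij by (auto simp: bij_betw_def)

lemma pos_surj: "p \<in> P \<Longrightarrow> \<exists>b\<in>boxes Y. p = pos b"
  using pos_bij by (auto simp: bij_betw_def)

lemma ipos_boxes: "p \<in> P \<Longrightarrow> ipos p \<in> boxes Y"
  using pos_surj[of p] by auto

lemma pos_ipos: "p \<in> P \<Longrightarrow> pos (ipos p) = p"
  using pos_surj[of p] by auto

lemma P_cases:
  assumes "p \<in> P"
  obtains k m where "(k, m) \<in> boxes Y" "p = pos (k, m)"
  using assms ipos_boxes pos_ipos by (metis surj_pair)

lemma pos_eq_iff: "b \<in> boxes Y \<Longrightarrow> b' \<in> boxes Y \<Longrightarrow> pos b = pos b' \<longleftrightarrow> b = b'"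
  using ipos_pos by metis

text \<open>On row vectors \<open>x0\<close> moves each box to its right neighbour, or to zero at
  the end of a row; on column vectors it moves boxes to the left. Its Jordan strings are the rows of
  \<open>Y\<close>.\<close>

definition x0 :: "graded_matrix" where
  "x0 = (\<lambda>(p, q). if p \<in> P \<and> q \<in> P \<and> ipos q = (Suc (fst (ipos p)), snd (ipos p)) then 1 else 0)"

lemma x0_entry: "b \<in> boxes Y \<Longrightarrow> b' \<in> boxes Y \<Longrightarrow>
    x0 (pos b, pos b') = (if b' = (Suc (fst b), snd b) then 1 else 0)"
  by (simp add: x0_def pos_P)

lemma x0_ED [simp, intro]: "x0 \<in> ED"
proof (rule supportedI)
  fix p q assume "x0 (p, q) \<noteq> 0"
  then have pq: "p \<in> P" "q \<in> P" "ipos q = (Suc (fst (ipos p)), snd (ipos p))"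
    by (auto simp: x0_def split: if_splits)
  have "fst p = residue n (int (fst (ipos p)) - int (snd (ipos p)))"
    "fst q = residue n (int (Suc (fst (ipos p))) - int (snd (ipos p)))"
    using pos_residue[OF ipos_boxes[OF pq(1)]] pos_residue[OF ipos_boxes[OF pq(2)]]
      pos_ipos[OF pq(1)] pos_ipos[OF pq(2)] pq(3)
    by (metis box_residue_def fst_conv snd_conv)+
  then have "fst p = pd (fst q)" by (simp add: residue_diff_left)
  then show "(p, q) \<in> KD" using pq by (simp add: KD_def)
qed

lemma mul_x0:
  assumes "(k, m) \<in> boxes Y"
  shows "mul A x0 (p, pos (k, m)) = (if k = 0 then 0 else A (p, pos (k - 1, m)))"
proof (cases k)
  case 0
  have "x0 (r, pos (k, m)) = 0" if "r \<in> P" for r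
    using that assms by (auto simp: x0_def 0)
  then show ?thesis using 0 by (simp add: mm_def)
next
  case (Suc j)
  have b: "(j, m) \<in> boxes Y" using boxes_down[OF young assms, of j m] Suc by simp
  have "x0 (r, pos (k, m)) = (if r = pos (j, m) then 1 else 0)" if r: "r \<in> P" for r
  proof -
    obtain k' m' where "(k', m') \<in> boxes Y" "r = pos (k', m')" using P_cases[OF r] .
    then show ?thesis using assms b by (auto simp: x0_entry pos_eq_iff Suc)
  qed
  then have "mul A x0 (p, pos (k, m)) = (\<Sum>r\<in>P. if r = pos (j, m) then A (p, r) else 0)"
    unfolding mm_apply by (intro sum.cong) auto
  then show ?thesis using pos_P[OF b] Suc by simp
qed

lemma x0_mul:
  assumes "(k, m) \<in> boxes Y"
  shows "mul x0 A (pos (k, m), q) = (if (Suc k, m) \<in> boxes Y then A (pos (Suc k, m), q) else 0)"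
proof -
  have "x0 (pos (k, m), r) = (if (Suc k, m) \<in> boxes Y \<and> r = pos (Suc k, m) then 1 else 0)" if r: "r \<in> P" for r
  proof -
    obtain k' m' where "(k', m') \<in> boxes Y" "r = pos (k', m')" using P_cases[OF r] .
    then show ?thesis using assms by (auto simp: x0_entry pos_eq_iff)
  qed
  then have "mul x0 A (pos (k, m), q) =
      (\<Sum>r\<in>P. if (Suc k, m) \<in> boxes Y \<and> r = pos (Suc k, m) then A (r, q) else 0)"
    unfolding mm_apply by (intro sum.cong) auto
  then show ?thesis by (auto simp: pos_P)
qed

definition basis_pos :: "(int \<times> int) set \<times> nat \<times> int \<Rightarrow> int \<times> nat" where
  "basis_pos b = pos (basis_box n Y b)"

lemma basis_pos_bij: "bij_betw basis_pos (sum_basis n (f_Y n Y)) P"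
  unfolding basis_pos_def by (rule bij_betw_comp_iff[OF basis_box_bij[OF young], unfolded o_def, THEN iffD1, OF pos_bij])

lemma basis_pos_residue: "(c, m, r) \<in> sum_basis n (f_Y n Y) \<Longrightarrow> fst (basis_pos (c, m, r)) = residue n r"
  unfolding basis_pos_def
  using pos_residue[OF basis_box(1)[OF young]] basis_box(4)[OF young] by (simp add: box_residue_def)

lemma basis_pos_P: "b \<in> sum_basis n (f_Y n Y) \<Longrightarrow> basis_pos b \<in> P"
  using basis_pos_bij by (auto simp: bij_betw_def)

lemma mul_x0_basis_pos:
  assumes "(c, m, r) \<in> sum_basis n (f_Y n Y)"
  shows "mul A x0 (p, basis_pos (c, m, r)) =
    (if r = fst (segment_rep c) then 0 else A (p, basis_pos (c, m, r - 1)))"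
proof (cases "r = fst (segment_rep c)")
  case True
  obtain k l where kl: "basis_box n Y (c, m, r) = (k, l)" by fastforce
  have "k = 0" using basis_box(3)[OF young assms] True kl by simp
  then show ?thesis using mul_x0[of k l] basis_box(1)[OF young assms] True kl by (simp add: basis_pos_def)
next
  case False
  obtain k l where kl: "basis_box n Y (c, m, r - 1) = (k, l)" by fastforce
  have "basis_box n Y (c, m, r) = (Suc k, l)" using basis_box_pred(2)[OF young assms False] kl by simp
  then show ?thesis using mul_x0[of "Suc k" l] basis_box(1)[OF young assms] False kl by (simp add: basis_pos_def)
qed

text \<open>The vectors \<open>e b\<close> are the columns of \<open>g\<close>, so they are bases
  of the components exactly when the blocks of \<open>g\<close> are invertible.\<close>

lemma column_block:
  assumes g: "g \<in> EG" and i: "i \<in> vertices n"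
    and e: "\<And>b. b \<in> sum_basis n (f_Y n Y) \<Longrightarrow> fst (basis_pos b) = i \<Longrightarrow>
       e b = vec (v i) (\<lambda>a. g ((i, a), basis_pos b))"
  defines "B \<equiv> {(c, m, r) \<in> sum_basis n (f_Y n Y). residue n r = i}"
  shows "det (blk g i) \<noteq> 0 \<longleftrightarrow> inj_on e B \<and> vectorspace.basis class_ring (module_vec TYPE(complex) (v i)) (e ` B)"
proof -
  have B: "B = {b \<in> sum_basis n (f_Y n Y). fst (basis_pos b) = i}"
    unfolding B_def using basis_pos_residue by auto
  define F where "F = (\<lambda>b. snd (basis_pos b))"
  have F: "bij_betw F B {..<v i}"
  proof (rule bij_betwI')
    fix b b' assume "b \<in> B" "b' \<in> B"
    then show "(F b = F b') = (b = b')"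
      using bij_betw_imp_inj_on[OF basis_pos_bij] unfolding B F_def inj_on_def
      by (metis (mono_tags, lifting) mem_Collect_eq prod_eqI)
  next
    fix b assume "b \<in> B"
    then show "F b \<in> {..<v i}"
      using basis_pos_P[of b] unfolding B F_def by (cases "basis_pos b") (auto simp: P_iff)
  next
    fix a assume "a \<in> {..<v i}"
    then have "(i, a) \<in> P" using i by (simp add: P_iff)
    then obtain b where "b \<in> sum_basis n (f_Y n Y)" "basis_pos b = (i, a)"
      using bij_betw_imp_surj_on[OF basis_pos_bij] by (metis imageE)
    then show "\<exists>b\<in>B. a = F b" unfolding B F_def by (intro bexI[of _ b]) simp_all
  qed
  have col: "e b = col (blk g i) (F b)" if "b \<in> B" for b
  proof -
    have "basis_pos b = (i, F b)" "F b < v i" using that F unfolding F_def B by (auto simp: bij_betw_def F_def)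
    then show ?thesis using that e[of b] unfolding B by (auto simp: blk_def)
  qed
  have "cols (blk g i) = map (col (blk g i)) [0..<v i]" by (simp add: cols_def blk_def)
  moreover have eB: "e ` B = col (blk g i) ` {..<v i}"
    using col F by (auto simp: bij_betw_def image_iff) (metis lessThan_iff imageE)
  moreover have "inj_on e B \<longleftrightarrow> inj_on (col (blk g i)) {..<v i}"
  proof -
    have "inj_on e B \<longleftrightarrow> inj_on (col (blk g i) \<circ> F) B" using col by (intro inj_on_cong) auto
    also have "\<dots> \<longleftrightarrow> inj_on (col (blk g i)) (F ` B)"
      using F by (intro comp_inj_on_iff[symmetric]) (auto simp: bij_betw_def)
    finally show ?thesis using F by (simp add: bij_betw_def)
  qed
  ultimately show ?thesis unfolding cols_basis_iff[OF blk_carrier]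
    by (simp add: distinct_map lessThan_atLeast0)
qed

text \<open>That the vectors \<open>e b\<close> form strings for \<open>X\<close> means that the
  matrix of these columns intertwines \<open>x0\<close> with \<open>X\<close>.\<close>

lemma orbit_action_iff:
  assumes X: "X \<in> ED" and g: "g \<in> EG"
    and e: "\<And>i b. b \<in> sum_basis n (f_Y n Y) \<Longrightarrow> fst (basis_pos b) = i \<Longrightarrow>
       e b = vec (v i) (\<lambda>a. g ((i, a), basis_pos b))"
  shows "(\<forall>(c, m, r) \<in> sum_basis n (f_Y n Y).
           rp X (\<lambda>_. 0) (Down (residue n r)) *\<^sub>v e (c, m, r) =
             (if r = fst (segment_rep c) then 0\<^sub>v (v (residue n (r - 1)))
              else e (c, m, r - 1))) \<longleftrightarrow> mul X g = mul g x0"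
proof -
  have lhs: "(rp X (\<lambda>_. 0) (Down (residue n r)) *\<^sub>v e (c, m, r)) =
      vec (v (residue n (r - 1))) (\<lambda>a. mul X g ((residue n (r - 1), a), basis_pos (c, m, r)))"
    if b: "(c, m, r) \<in> sum_basis n (f_Y n Y)" for c m r
  proof (rule eq_vecI)
    let ?i = "residue n r"
    have i: "?i \<in> vertices n" by simp
    have pdi: "pd ?i = residue n (r - 1)" by (rule residue_diff_left)
    fix a assume "a < dim_vec (vec (v (residue n (r - 1))) (\<lambda>a. mul X g ((residue n (r - 1), a), basis_pos (c, m, r))))"
    then have a: "a < v (residue n (r - 1))" by simp
    have bp: "basis_pos (c, m, r) = (?i, snd (basis_pos (c, m, r)))"
      using basis_pos_residue[OF b] by (metis prod.collapse)
    have "mul X g ((residue n (r - 1), a), basis_pos (c, m, r))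
        = (\<Sum>k<v ?i. X ((residue n (r - 1), a), (?i, k)) * g ((?i, k), basis_pos (c, m, r)))"
      by (subst bp, subst right_sum[OF g i], subst bp[symmetric], rule refl)
    moreover have "(rp X (\<lambda>_. 0) (Down ?i) *\<^sub>v e (c, m, r)) $ a
        = (\<Sum>k<v ?i. X ((residue n (r - 1), a), (?i, k)) * g ((?i, k), basis_pos (c, m, r)))"
      unfolding rp_blk(1)[OF i] blkD_def pdi e[OF b basis_pos_residue[OF b]]
      using a by (simp add: scalar_prod_def lessThan_atLeast0)
    ultimately show "(rp X (\<lambda>_. 0) (Down ?i) *\<^sub>v e (c, m, r)) $ a =
      vec (v (residue n (r - 1))) (\<lambda>a. mul X g ((residue n (r - 1), a), basis_pos (c, m, r))) $ a"
      using a by simp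
  qed (simp add: rp_blk(1) blkD_def residue_diff_left)
  have rhs: "(if r = fst (segment_rep c) then 0\<^sub>v (v (residue n (r - 1))) else e (c, m, r - 1)) =
      vec (v (residue n (r - 1))) (\<lambda>a. mul g x0 ((residue n (r - 1), a), basis_pos (c, m, r)))"
    if b: "(c, m, r) \<in> sum_basis n (f_Y n Y)" for c m r
  proof (cases "r = fst (segment_rep c)")
    case True
    then show ?thesis using mul_x0_basis_pos[OF b] by (intro eq_vecI) auto
  next
    case False
    then show ?thesis using mul_x0_basis_pos[OF b] e[OF basis_box_pred(1)[OF young b False]]
        basis_pos_residue[OF basis_box_pred(1)[OF young b False]] by (intro eq_vecI) auto
  qed
  have "(\<forall>(c, m, r) \<in> sum_basis n (f_Y n Y).
           rp X (\<lambda>_. 0) (Down (residue n r)) *\<^sub>v e (c, m, r) =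
             (if r = fst (segment_rep c) then 0\<^sub>v (v (residue n (r - 1)))
              else e (c, m, r - 1))) \<longleftrightarrow>
     (\<forall>(c, m, r) \<in> sum_basis n (f_Y n Y). \<forall>a<v (residue n (r - 1)).
        mul X g ((residue n (r - 1), a), basis_pos (c, m, r)) = mul g x0 ((residue n (r - 1), a), basis_pos (c, m, r)))"
  proof (rule ball_cong[OF refl], clarify)
    fix c m r assume b: "(c, m, r) \<in> sum_basis n (f_Y n Y)"
    have vec: "vec k f = vec k g \<longleftrightarrow> (\<forall>a<k. f a = g a)" for k and f g :: "nat \<Rightarrow> complex"
      by (metis eq_vecI dim_vec index_vec)
    show "(rp X (\<lambda>_. 0) (Down (residue n r)) *\<^sub>v e (c, m, r) =
             (if r = fst (segment_rep c) then 0\<^sub>v (v (residue n (r - 1))) else e (c, m, r - 1))) \<longleftrightarrow>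
          (\<forall>a<v (residue n (r - 1)). mul X g ((residue n (r - 1), a), basis_pos (c, m, r)) =
             mul g x0 ((residue n (r - 1), a), basis_pos (c, m, r)))"
      unfolding lhs[OF b] rhs[OF b] by (rule vec)
  qed
  also have "\<dots> \<longleftrightarrow> mul X g = mul g x0"
  proof
    assume h: "\<forall>(c, m, r) \<in> sum_basis n (f_Y n Y). \<forall>a<v (residue n (r - 1)).
        mul X g ((residue n (r - 1), a), basis_pos (c, m, r)) = mul g x0 ((residue n (r - 1), a), basis_pos (c, m, r))"
    have s: "mul X g \<in> ED" "mul g x0 \<in> ED" using X g by auto
    have "mul X g (p, q) = mul g x0 (p, q)" for p q
    proof (cases "(p, q) \<in> KD")
      case False
      then show ?thesis using supportedD[OF s(1)] supportedD[OF s(2)] by metis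
    next
      case True
      then have q: "q \<in> P" "p \<in> P" "fst p = pd (fst q)" by (auto simp: KD_def)
      obtain b where b: "b \<in> sum_basis n (f_Y n Y)" "q = basis_pos b"
        using bij_betw_imp_surj_on[OF basis_pos_bij] q(1) by blast
      obtain c m r where bb: "b = (c, m, r)" by (metis surj_pair)
      have "fst p = residue n (r - 1)"
        using q(3) basis_pos_residue[of c m r] b bb by (simp add: residue_diff_left)
      then obtain a where p: "p = (residue n (r - 1), a)" by (metis prod.collapse)
      then have "a < v (residue n (r - 1))" using q(2) by (simp add: P_iff)
      then show ?thesis using h b unfolding bb p by auto
    qed
    then show "mul X g = mul g x0" by auto
  qed auto
  finally show ?thesis .
qed

theorem orbit_iff:
  assumes X: "X \<in> ED"
  shows "rp X (\<lambda>_. 0) \<in> orbit_of n v (f_Y n Y) \<longleftrightarrow> (\<exists>g h. inverses g h \<and> X = mul (mul g x0) h)"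
proof
  assume "rp X (\<lambda>_. 0) \<in> orbit_of n v (f_Y n Y)"
  then obtain e where e1: "\<And>i. i \<in> vertices n \<Longrightarrow> let B = {(c, m, r) \<in> sum_basis n (f_Y n Y). residue n r = i}
           in inj_on e B \<and> vectorspace.basis class_ring (module_vec TYPE(complex) (v i)) (e ` B)"
    and e2: "(\<forall>(c, m, r) \<in> sum_basis n (f_Y n Y).
           rp X (\<lambda>_. 0) (Down (residue n r)) *\<^sub>v e (c, m, r) =
             (if r = fst (segment_rep c) then 0\<^sub>v (v (residue n (r - 1)))
              else e (c, m, r - 1)))"
    unfolding orbit_of_def iso_to_sum_def by blast
  define \<Phi> where "\<Phi> = the_inv_into (sum_basis n (f_Y n Y)) basis_pos"
  have \<Phi>: "\<Phi> (basis_pos b) = b" if "b \<in> sum_basis n (f_Y n Y)" for b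
    unfolding \<Phi>_def using bij_betw_imp_inj_on[OF basis_pos_bij] that by (rule the_inv_into_f_f)
  define g where "g = (\<lambda>(p, q). if (p, q) \<in> K0 then e (\<Phi> q) $ snd p else 0)"
  have g: "g \<in> EG" by (auto simp: g_def supported_def)
  have eg: "e b = vec (v i) (\<lambda>a. g ((i, a), basis_pos b))"
    if b: "b \<in> sum_basis n (f_Y n Y)" "fst (basis_pos b) = i" for i b
  proof -
    have i: "i \<in> vertices n" using basis_pos_P[OF b(1)] b(2) P_vertex by blast
    obtain c m r where bb: "b = (c, m, r)" by (metis surj_pair)
    have "e b \<in> e ` {(c, m, r) \<in> sum_basis n (f_Y n Y). residue n r = i}"
      using b basis_pos_residue[of c m r] unfolding bb by auto
    moreover have "e ` {(c, m, r) \<in> sum_basis n (f_Y n Y). residue n r = i} \<subseteq> carrier_vec (v i)"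
    proof -
      interpret V: vec_space "TYPE(complex)" "v i" .
      show ?thesis using e1[OF i] by (simp add: Let_def V.basis_def)
    qed
    ultimately have "e b \<in> carrier_vec (v i)" by blast
    moreover have "g ((i, a), basis_pos b) = e b $ a" if "a < v i" for a
      using that b i basis_pos_P[OF b(1)] \<Phi>[OF b(1)] by (simp add: g_def K0_def P_iff)
    ultimately show ?thesis by (intro eq_vecI) auto
  qed
  have "det (blk g i) \<noteq> 0" if "i \<in> vertices n" for i
    using column_block[OF g that, of e] eg e1[OF that] by (simp add: Let_def)
  then have "dlt g \<noteq> 0" by (simp add: dlt_def)
  then have inv: "inverses g (minv g)" using inverses_minv[OF g] by blast
  have "mul X g = mul g x0" using orbit_action_iff[OF X g eg] e2 by blast
  then have "mul (mul g x0) (minv g) = mul (mul X g) (minv g)" by simp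
  also have "\<dots> = mul X (mul g (minv g))" by (rule mm_assoc)
  also have "\<dots> = X" using inv X by (simp add: inverses_def)
  finally show "\<exists>g h. inverses g h \<and> X = mul (mul g x0) h" using inv by metis
next
  assume "\<exists>g h. inverses g h \<and> X = mul (mul g x0) h"
  then obtain g h where inv: "inverses g h" and Xe: "X = mul (mul g x0) h" by blast
  have g: "g \<in> EG" using inv by (simp add: inverses_def)
  define e where "e = (\<lambda>b. vec (v (fst (basis_pos b))) (\<lambda>a. g ((fst (basis_pos b), a), basis_pos b)))"
  have eg: "e b = vec (v i) (\<lambda>a. g ((i, a), basis_pos b))"
    if "b \<in> sum_basis n (f_Y n Y)" "fst (basis_pos b) = i" for i b
    using that by (simp add: e_def)
  have "mul X g = mul (mul g x0) (mul h g)" unfolding Xe by (simp only: mm_assoc)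
  also have "\<dots> = mul g x0" using inv g by (simp add: inverses_def mul_EG_ED)
  finally have act: "mul X g = mul g x0" .
  have "dlt g \<noteq> 0" using inverses_dlt inv by blast
  then have d: "det (blk g i) \<noteq> 0" if "i \<in> vertices n" for i using that by (simp add: dlt_def)
  have "iso_to_sum n v (f_Y n Y) (rp X (\<lambda>_. 0))"
    unfolding iso_to_sum_def
  proof (intro exI[of _ e] conjI ballI)
    fix i assume i: "i \<in> vertices n"
    show "let B = {(c, m, r) \<in> sum_basis n (f_Y n Y). residue n r = i}
           in inj_on e B \<and> vectorspace.basis class_ring (module_vec TYPE(complex) (v i)) (e ` B)"
      using column_block[OF g i, of e] eg d[OF i] by (simp add: Let_def)
  next
    show "\<And>b. b \<in> sum_basis n (f_Y n Y) \<Longrightarrow> case b of (c, m, r) \<Rightarrow>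
           rp X (\<lambda>_. 0) (Down (residue n r)) *\<^sub>v e (c, m, r) =
             (if r = fst (segment_rep c) then 0\<^sub>v (v (residue n (r - 1)))
              else e (c, m, r - 1))"
      using orbit_action_iff[OF X g eg] act by blast
  qed
  moreover have "rp X (\<lambda>_. 0) \<in> rep_supported n v (Omega n)" unfolding rep_supported_Omega using X by blast
  ultimately show "rp X (\<lambda>_. 0) \<in> orbit_of n v (f_Y n Y)" by (simp add: orbit_of_def)
qed

end

lemma young_space_exists:
  assumes Y: "Y \<in> young_diagrams" and v: "\<And>i. i \<in> vertices n \<Longrightarrow> card {b \<in> boxes Y. box_residue n b = i} = v i"
  shows "\<exists>pos. young_space n v Y pos"
proof -
  have "\<forall>i\<in>vertices n. \<exists>h. bij_betw h {b \<in> boxes Y. box_residue n b = i} ({i} \<times> {..<v i})"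
    using v by (auto intro!: finite_same_card_bij simp: card_cartesian_product)
  then obtain h where h: "\<And>i. i \<in> vertices n \<Longrightarrow> bij_betw (h i) {b \<in> boxes Y. box_residue n b = i} ({i} \<times> {..<v i})"
    by (auto dest!: bchoice)
  define pos where "pos = (\<lambda>b. h (box_residue n b) b)"
  have br: "box_residue n b \<in> vertices n" for b by (simp add: box_residue_def)
  have pos: "pos b \<in> {box_residue n b} \<times> {..<v (box_residue n b)}" if "b \<in> boxes Y" for b
    using bij_betw_apply[OF h[OF br[of b]], of b] that by (simp add: pos_def)
  interpret graded_space n v .
  have "bij_betw pos (boxes Y) P"
  proof (rule bij_betwI')
    fix b b' assume b: "b \<in> boxes Y" "b' \<in> boxes Y"
    show "(pos b = pos b') = (b = b')"
    proof
      assume e: "pos b = pos b'"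
      then have "box_residue n b = box_residue n b'" using pos[OF b(1)] pos[OF b(2)] by auto
      then show "b = b'"
        using e b inj_onD[OF bij_betw_imp_inj_on[OF h[OF br[of b]]], of b b'] by (simp add: pos_def)
    qed simp
  next
    fix b assume "b \<in> boxes Y"
    then show "pos b \<in> P" using pos[of b] br[of b] by (cases "pos b") (auto simp: P_iff)
  next
    fix p assume "p \<in> P"
    then obtain i a where p: "p = (i, a)" "i \<in> vertices n" "a < v i" by (cases p) (auto simp: P_iff)
    then have "p \<in> h i ` {b \<in> boxes Y. box_residue n b = i}" using bij_betw_imp_surj_on[OF h[OF p(2)]] by auto
    then show "\<exists>b\<in>boxes Y. p = pos b" by (auto simp: pos_def)
  qed
  moreover have "fst (pos b) = box_residue n b" if "b \<in> boxes Y" for b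
    using pos[OF that] by auto
  ultimately have "young_space n v Y pos" using Y by unfold_locales
  then show ?thesis by blast
qed

section \<open>The Young diagram of a stable point\<close>

context graded_space
begin

lemma rm_supported:
  assumes "A \<in> supported (P \<times> P)"
  shows "rm P \<eta> A \<in> supported P"
proof -
  have "rm P \<eta> A q = 0" if "q \<notin> P" for q
    using supportedD[OF assms] that by (metis mem_Sigma_iff rm_nonzero)
  then show ?thesis by (simp add: supported_def)
qed

lemma mpow_supported: "A \<in> supported (P \<times> P) \<Longrightarrow> mpow P A k \<in> supported (P \<times> P)"
  by (induction k) (auto simp: one_m_supported intro: mm_supported)

definition xpow :: "graded_matrix \<Rightarrow> nat \<Rightarrow> graded_vector \<Rightarrow> graded_vector" where
  "xpow X k \<eta> = ((\<lambda>\<eta>. rm P \<eta> X) ^^ k) \<eta>"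

lemma xpow_simps [simp]: "xpow X 0 \<eta> = \<eta>" "xpow X (Suc k) \<eta> = rm P (xpow X k \<eta>) X"
  by (simp_all add: xpow_def)

lemma xpow_Suc_right: "xpow X (Suc k) \<eta> = xpow X k (rm P \<eta> X)"
  using funpow_swap1[of "\<lambda>\<eta>. rm P \<eta> X" k \<eta>] by (simp add: xpow_def)

lemma xpow_word: "xpow X k (word X Z J j m) = word X Z J (k + j) m"
  by (induction k) simp_all

lemma xpow_mpow:
  assumes X: "X \<in> supported (P \<times> P)"
  shows "\<eta> \<in> supported P \<Longrightarrow> xpow X k \<eta> = rm P \<eta> (mpow P X k)"
proof (induction k arbitrary: \<eta>)
  case (Suc k)
  have "xpow X (Suc k) \<eta> = xpow X k (rm P \<eta> X)" by (rule xpow_Suc_right)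
  also have "\<dots> = rm P (rm P \<eta> X) (mpow P X k)" by (rule Suc.IH[OF rm_supported[OF X]])
  finally show ?case by (simp add: rm_mm)
qed (simp add: rm_one)

lemma xpow_linear:
  "xpow X k (\<lambda>q. f q + g q) = (\<lambda>q. xpow X k f q + xpow X k g q)"
  "xpow X k (\<lambda>q. f q - g q) = (\<lambda>q. xpow X k f q - xpow X k g q)"
  "xpow X k (\<lambda>q. c * f q) = (\<lambda>q. c * xpow X k f q)"
  "xpow X k (\<lambda>q. 0) = (\<lambda>q. 0)"
  by (induction k) (simp_all add: rm_linear)

lemma mpow_conj:
  assumes gh: "inverses g h" and x: "x \<in> ED"
  shows "mpow P (mul (mul g x) h) k = mul (mul g (mpow P x k)) h"
proof (induction k)
  case 0
  then show ?case using gh by (simp add: inverses_def)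
next
  case (Suc k)
  have s: "mpow P x k \<in> supported (P \<times> P)" using mpow_supported ED_P[OF x] by blast
  have "mpow P (mul (mul g x) h) (Suc k) = mul (mul (mul g x) h) (mul (mul g (mpow P x k)) h)"
    by (simp add: Suc.IH)
  also have "\<dots> = mul (mul (mul g x) (mul h g)) (mul (mpow P x k) h)" by (simp only: mm_assoc)
  also have "mul (mul g x) (mul h g) = mul g x" using gh x by (simp add: inverses_def mul_EG_ED)
  finally show ?case by (simp add: mm_assoc)
qed

lemma image_subset_span:
  assumes "\<eta> \<in> fs.span G" "\<And>\<eta>. \<eta> \<in> G \<Longrightarrow> rm P \<eta> A \<in> fs.span G'"
  shows "rm P \<eta> A \<in> fs.span G'"
  using assms(1)
proof (induction rule: fs.span_induct_alt)
  case base
  then show ?case using fs.span_zero by (simp add: rm_linear zero_fun_def)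
next
  case (step c x y)
  have "rm P ((\<lambda>k. c * x k) + y) A = (\<lambda>k. c * rm P x A k) + rm P y A"
    by (simp add: plus_fun_def rm_linear)
  then show ?case using step assms(2) by (metis fs.span_add fs.span_scale)
qed

lemma pairing_span_zero:
  assumes "\<eta> \<in> fs.span G" "\<And>\<eta>. \<eta> \<in> G \<Longrightarrow> pairing P \<eta> U = 0"
  shows "pairing P \<eta> U = 0"
  using assms(1)
proof (induction rule: fs.span_induct_alt)
  case (step c x y)
  then show ?case using assms(2) by (simp add: plus_fun_def pairing_linear)
qed (simp add: pairing_linear zero_fun_def)

end

locale stable_triple = graded_space n v for n v +
  fixes X Z :: "graded_matrix" and J :: "graded_vector"
  assumes X: "X \<in> ED" and Z: "Z \<in> EU" and J: "J \<in> EJ"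
    and comm: "mul X Z = mul Z X" and nilpotent: "\<exists>N. mpow P X N = (\<lambda>_. 0)"
    and sep: "separating X Z J"
begin

abbreviation "e \<equiv> word X Z J"

text \<open>The cyclic submodule generated by \<open>J\<close>.\<close>

definition W :: "graded_vector set" where
  "W = fs.span (range (\<lambda>(k, m). e k m))"

text \<open>What precedes the word \<open>(k, m)\<close>: the words of the same column in earlier
  rows and all multiples of \<open>X^(k+1)\<close>.\<close>

definition lower :: "nat \<Rightarrow> nat \<Rightarrow> graded_vector set" where
  "lower k m = fs.span (e k ` {..<m} \<union> xpow X (Suc k) ` W)"

lemma e_supported: "e k m \<in> supported P"
  unfolding supported_def using word_homogeneous[OF X Z J] by blast

lemma e_W: "e k m \<in> W"
  unfolding W_def by (intro fs.span_base) force

lemma W_rm: "\<eta> \<in> W \<Longrightarrow> rm P \<eta> X \<in> W" "\<eta> \<in> W \<Longrightarrow> rm P \<eta> Z \<in> W"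
  unfolding W_def
proof -
  assume "\<eta> \<in> fs.span (range (\<lambda>(k, m). e k m))"
  then show "rm P \<eta> X \<in> fs.span (range (\<lambda>(k, m). e k m))"
  proof (rule image_subset_span)
    fix \<eta> assume "\<eta> \<in> range (\<lambda>(k, m). e k m)"
    then obtain k m where "\<eta> = e k m" by auto
    then have "rm P \<eta> X = (\<lambda>(k, m). e k m) (Suc k, m)" by simp
    then show "rm P \<eta> X \<in> fs.span (range (\<lambda>(k, m). e k m))" by (metis fs.span_base rangeI)
  qed
next
  assume "\<eta> \<in> fs.span (range (\<lambda>(k, m). e k m))"
  then show "rm P \<eta> Z \<in> fs.span (range (\<lambda>(k, m). e k m))"
  proof (rule image_subset_span)
    fix \<eta> assume "\<eta> \<in> range (\<lambda>(k, m). e k m)"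
    then obtain k m where "\<eta> = e k m" by auto
    then have "rm P \<eta> Z = (\<lambda>(k, m). e k m) (k, Suc m)" by (simp add: word_Suc_right[OF comm])
    then show "rm P \<eta> Z \<in> fs.span (range (\<lambda>(k, m). e k m))" by (metis fs.span_base rangeI)
  qed
qed

lemma xpow_rm_Z: "rm P (xpow X k \<eta>) Z = xpow X k (rm P \<eta> Z)"
proof (induction k)
  case (Suc k)
  have "rm P (rm P (xpow X k \<eta>) X) Z = rm P (rm P (xpow X k \<eta>) Z) X"
    by (simp only: rm_mm comm)
  then show ?case using Suc by simp
qed simp

text \<open>More words of one column than the dimension satisfy a linear relation; the last word in
  it is a combination of the earlier ones.\<close>

lemma lower_exists: "\<exists>m. e k m \<in> lower k m"
proof -
  let ?I = "{..card P}"
  have "e k m \<in> fs.span (unit_fun ` P)" for m using e_supported span_unit_funs[OF finite_P] by blast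
  moreover have "card (unit_fun ` P :: (_ \<Rightarrow> complex) set) < card ?I"
    using card_image_le[OF finite_P, of "unit_fun :: _ \<Rightarrow> _ \<Rightarrow> complex"] by simp
  ultimately obtain c where c: "\<exists>i\<in>?I. c i \<noteq> 0" "\<And>q. (\<Sum>i\<in>?I. c i * e k i q) = 0"
    using family_dependent[of ?I "unit_fun ` P" "e k"] by auto
  define m where "m = Max {i \<in> ?I. c i \<noteq> 0}"
  have fin: "finite {i \<in> ?I. c i \<noteq> 0}" by simp
  have ne: "{i \<in> ?I. c i \<noteq> 0} \<noteq> {}" using c(1) by blast
  have m: "m \<in> ?I" "c m \<noteq> 0" using Max_in[OF fin ne] unfolding m_def by auto
  have gt: "c i = 0" if "i \<in> ?I" "i > m" for i
  proof (rule ccontr)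
    assume "c i \<noteq> 0"
    then have "i \<le> m" unfolding m_def using that(1) by (intro Max_ge[OF fin]) simp
    then show False using that(2) by simp
  qed
  have "e k m = (\<Sum>i<m. (\<lambda>q. (- c i / c m) * e k i q))"
  proof
    fix q
    have "0 = (\<Sum>i\<in>?I. c i * e k i q)" using c(2) by simp
    also have "\<dots> = (\<Sum>i\<in>{..m}. c i * e k i q)"
      using m gt by (intro sum.mono_neutral_right) (auto simp: not_le)
    also have "\<dots> = (\<Sum>i<m. c i * e k i q) + c m * e k m q"
      by (simp add: lessThan_Suc_atMost[symmetric])
    finally have "e k m q = - (\<Sum>i<m. c i * e k i q) / c m" using m(2) by (simp add: field_simps add_eq_0_iff)
    then show "e k m q = (\<Sum>i<m. (\<lambda>q. (- c i / c m) * e k i q)) q"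
      by (simp add: sum_fun_apply sum_negf sum_divide_distrib)
  qed
  also have "\<dots> \<in> lower k m" unfolding lower_def
    by (intro fs.span_sum fs.span_scale fs.span_base) auto
  finally show ?thesis by blast
qed

definition d :: "nat \<Rightarrow> nat" where "d k = (LEAST m. e k m \<in> lower k m)"

lemma d_lower: "e k (d k) \<in> lower k (d k)"
  unfolding d_def using lower_exists by (rule LeastI_ex)

lemma not_lower: "m < d k \<Longrightarrow> e k m \<notin> lower k m"
  unfolding d_def by (rule not_less_Least)

text \<open>Multiplying a relation by \<open>Z\<close> shifts it, so that once a word is redundant
  all later words of the column are.\<close>

lemma e_lower:
  assumes "d k \<le> m"
  shows "e k m \<in> lower k (d k)"
  using assms
proof (induction rule: dec_induct)
  case base
  then show ?case by (rule d_lower)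
next
  case (step m)
  have "rm P (e k m) Z \<in> lower k (d k)"
    using step(3) unfolding lower_def
  proof (rule image_subset_span)
    fix \<eta> assume "\<eta> \<in> e k ` {..<d k} \<union> xpow X (Suc k) ` W"
    then consider m' where "m' < d k" "\<eta> = e k m'" | z where "z \<in> W" "\<eta> = xpow X (Suc k) z" by auto
    then show "rm P \<eta> Z \<in> fs.span (e k ` {..<d k} \<union> xpow X (Suc k) ` W)"
    proof cases
      case 1
      then have "rm P \<eta> Z = e k (Suc m')" by (simp add: word_Suc_right[OF comm])
      moreover have "e k (Suc m') \<in> fs.span (e k ` {..<d k} \<union> xpow X (Suc k) ` W)"
      proof (cases "Suc m' = d k")
        case True
        then show ?thesis using d_lower[of k] unfolding lower_def by simp
      next
        case False
        then show ?thesis using 1 by (intro fs.span_base) auto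
      qed
      ultimately show ?thesis by simp
    next
      case 2
      then have "rm P \<eta> Z = xpow X (Suc k) (rm P z Z)" using xpow_rm_Z by blast
      then show ?thesis using W_rm(2)[OF 2(1)] by (intro fs.span_base) blast
    qed
  qed
  then show ?case by (simp add: word_Suc_right[OF comm])
qed

text \<open>Multiplying a relation in column \<open>k\<close> by \<open>X\<close> gives a relation
  in column \<open>k + 1\<close>.\<close>

lemma d_antimono: "d (Suc k) \<le> d k"
proof -
  have "rm P (e k (d k)) X \<in> lower (Suc k) (d k)"
    using d_lower[of k] unfolding lower_def
  proof (rule image_subset_span)
    fix \<eta> assume "\<eta> \<in> e k ` {..<d k} \<union> xpow X (Suc k) ` W"
    then consider m' where "m' < d k" "\<eta> = e k m'" | z where "z \<in> W" "\<eta> = xpow X (Suc k) z" by auto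
    then show "rm P \<eta> X \<in> fs.span (e (Suc k) ` {..<d k} \<union> xpow X (Suc (Suc k)) ` W)"
    proof cases
      case 1
      then have "rm P \<eta> X = e (Suc k) m'" by simp
      then show ?thesis using 1 by (intro fs.span_base) auto
    next
      case 2
      then have "rm P \<eta> X = xpow X (Suc (Suc k)) z" by simp
      then show ?thesis using 2(1) by (intro fs.span_base) blast
    qed
  qed
  then have "e (Suc k) (d k) \<in> lower (Suc k) (d k)" by simp
  then show ?thesis unfolding d_def by (rule Least_le)
qed

lemma d_mono: "k \<le> k' \<Longrightarrow> d k' \<le> d k"
  using d_antimono by (rule lift_Suc_antimono_le)

lemma e_nilpotent: "\<exists>N. \<forall>k\<ge>N. \<forall>m. e k m = (\<lambda>_. 0)"
proof -
  obtain N where N: "mpow P X N = (\<lambda>_. 0)" using nilpotent by blast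
  have "e k m = (\<lambda>_. 0)" if "k \<ge> N" for k m
  proof -
    have "mpow P X k = (\<lambda>_. 0)" using mpow_zero_mono[OF N that] .
    moreover have "e k m = xpow X k (e 0 m)" using xpow_word[of X k Z J 0 m] by simp
    ultimately show ?thesis
      using xpow_mpow[OF ED_P[OF X] e_supported] by (simp add: rm_def)
  qed
  then show ?thesis by blast
qed

lemma d_zero: "\<exists>N. \<forall>k\<ge>N. d k = 0"
proof -
  obtain N where N: "\<And>k m. k \<ge> N \<Longrightarrow> e k m = (\<lambda>_. 0)" using e_nilpotent by blast
  have "d k = 0" if "k \<ge> N" for k
  proof -
    have "e k 0 \<in> lower k 0" unfolding lower_def N[OF that] using fs.span_zero by (simp add: zero_fun_def)
    then show ?thesis unfolding d_def by (simp add: Least_eq_0)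
  qed
  then show ?thesis by blast
qed

text \<open>The diagram with column lengths \<open>d\<close>, listed by rows.\<close>

definition Y :: "nat list" where
  "Y = map (\<lambda>m. card {k. m < d k}) [0..<d 0]"

lemma columns: "{k. m < d k} = {..<card {k. m < d k}}"
proof -
  obtain N where N: "\<And>k. k \<ge> N \<Longrightarrow> d k = 0" using d_zero by blast
  have fin: "finite {k. m < d k}" by (rule finite_subset[of _ "{..<N}"]) (use N in \<open>force simp: not_le[symmetric]\<close>)+
  show ?thesis
  proof (cases "{k. m < d k} = {}")
    case False
    define M where "M = Max {k. m < d k}"
    have "{k. m < d k} = {..M}"
      using d_mono Max_in[OF fin False] Max_ge[OF fin] unfolding M_def by (force intro: order_less_le_trans)
    then show ?thesis by (metis card_atMost lessThan_Suc_atMost)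
  qed simp
qed

lemma boxes_Y: "boxes Y = {(k, m). m < d k}"
proof -
  have "m < d 0" if "m < d k" for k m using d_mono[of 0 k] that by simp
  moreover have "k < card {k. m < d k} \<longleftrightarrow> m < d k" for k m using columns[of m] by blast
  ultimately show ?thesis by (auto simp: boxes_def Y_def)
qed

lemma young_Y: "Y \<in> young_diagrams"
proof -
  have "card {k. m < d k} \<ge> card {k. m' < d k}" if "m \<le> m'" for m m'
  proof (rule card_mono)
    show "finite {k. m < d k}" by (subst columns) simp
  qed (use that in auto)
  moreover have "0 < card {k. m < d k}" if "m < d 0" for m
  proof -
    have "0 \<in> {k. m < d k}" using that by simp
    then show ?thesis using columns[of m] by blast
  qed
  ultimately show ?thesis by (auto simp: young_diagrams_def Y_def sorted_wrt_iff_nth_less)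
qed

text \<open>If \<open>(l, m)\<close> is not a box, the word \<open>(0, m)\<close> should generate
  a string of length at most \<open>l\<close>, but in general it does not. However, the word
  \<open>(l, m)\<close> is redundant, and the relation it satisfies is the image under
  \<open>X ^ l\<close> of a relation among the words in column \<open>0\<close> modulo multiples
  of \<open>X\<close>. Subtracting the latter corrects the generator.\<close>

lemma row_generator:
  assumes "d l \<le> m"
  shows "\<exists>s z. s \<in> fs.span (e 0 ` {..<d l}) \<and> z \<in> W \<and>
    xpow X l (\<lambda>q. e 0 m q - s q - rm P z X q) = (\<lambda>_. 0)"
proof -
  \<comment> \<open>The images under \<open>X ^ l\<close> of the admissible corrections; they
    contain \<open>lower l (d l)\<close>.\<close>
  define good where "good = {y. \<exists>s z. s \<in> fs.span (e 0 ` {..<d l}) \<and> z \<in> W \<and> y = xpow X l (\<lambda>q. s q + rm P z X q)}"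
  have zero: "(\<lambda>q. 0) \<in> fs.span S" for S :: "graded_vector set"
    using fs.span_zero[of S] by (simp add: zero_fun_def)
  have W0: "(\<lambda>q. 0) \<in> W" unfolding W_def by (rule zero)
  have sub: "fs.subspace good"
    unfolding fs.subspace_def
  proof (intro conjI ballI allI)
    show "0 \<in> good" unfolding good_def
      by (intro CollectI exI[of _ "\<lambda>_. 0"]) (use zero W0 in \<open>simp add: zero_fun_def rm_linear xpow_linear\<close>)
    fix y y' assume "y \<in> good" "y' \<in> good"
    then obtain s z s' z' where
      "s \<in> fs.span (e 0 ` {..<d l})" "z \<in> W" "y = xpow X l (\<lambda>q. s q + rm P z X q)"
      "s' \<in> fs.span (e 0 ` {..<d l})" "z' \<in> W" "y' = xpow X l (\<lambda>q. s' q + rm P z' X q)"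
      unfolding good_def by blast
    then show "y + y' \<in> good" unfolding good_def W_def
      by (intro CollectI exI[of _ "s + s'"] exI[of _ "z + z'"] conjI fs.span_add)
         (simp_all add: plus_fun_def rm_linear xpow_linear algebra_simps)
  next
    fix c y assume "y \<in> good"
    then obtain s z where
      "s \<in> fs.span (e 0 ` {..<d l})" "z \<in> W" "y = xpow X l (\<lambda>q. s q + rm P z X q)"
      unfolding good_def by blast
    then show "(\<lambda>q. c * y q) \<in> good" unfolding good_def W_def
      by (intro CollectI exI[of _ "\<lambda>q. c * s q"] exI[of _ "\<lambda>q. c * z q"] conjI fs.span_scale)
         (simp_all add: rm_linear xpow_linear algebra_simps)
  qed
  have "e l ` {..<d l} \<union> xpow X (Suc l) ` W \<subseteq> good"
  proof
    fix \<eta> assume "\<eta> \<in> e l ` {..<d l} \<union> xpow X (Suc l) ` W"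
    then consider m' where "m' < d l" "\<eta> = e l m'" | z where "z \<in> W" "\<eta> = xpow X (Suc l) z" by auto
    then show "\<eta> \<in> good"
    proof cases
      case 1
      have "e 0 m' \<in> fs.span (e 0 ` {..<d l})" using 1 by (intro fs.span_base) auto
      moreover have "\<eta> = xpow X l (\<lambda>q. e 0 m' q + rm P (\<lambda>_. 0) X q)"
        using xpow_word[of X l Z J 0 m'] 1 by (simp add: rm_linear)
      ultimately show ?thesis unfolding good_def using W0 by blast
    next
      case 2
      have "\<eta> = xpow X l (\<lambda>q. (\<lambda>_. 0) q + rm P z X q)"
        using 2 by (simp add: xpow_Suc_right del: xpow_simps)
      then show ?thesis unfolding good_def using zero 2(1) by blast
    qed
  qed
  then have "lower l (d l) \<subseteq> good" unfolding lower_def by (rule fs.span_minimal[OF _ sub])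
  then have "e l m \<in> good" using e_lower[OF assms] by blast
  then obtain s z where sz: "s \<in> fs.span (e 0 ` {..<d l})" "z \<in> W" "e l m = xpow X l (\<lambda>q. s q + rm P z X q)"
    unfolding good_def by blast
  have "xpow X l (\<lambda>q. e 0 m q - s q - rm P z X q) = (\<lambda>q. xpow X l (e 0 m) q - xpow X l (\<lambda>q. s q + rm P z X q) q)"
    unfolding xpow_linear(2)[symmetric] by (simp add: algebra_simps)
  also have "\<dots> = (\<lambda>_. 0)" using xpow_word[of X l Z J 0 m] sz(3) by simp
  finally show ?thesis using sz(1,2) by blast
qed

text \<open>Induction along the order in which words are reduced: larger \<open>k\<close> first,
  which is well-founded by nilpotency, then smaller \<open>m\<close>. Words outside the diagram
  follow from the earlier ones.\<close>

lemma kill_induct: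
  assumes step: "\<And>k m. m < d k \<Longrightarrow> (\<And>k' m'. k' > k \<Longrightarrow> pairing P (e k' m') U = 0) \<Longrightarrow>
     (\<And>m'. m' < m \<Longrightarrow> pairing P (e k m') U = 0) \<Longrightarrow> pairing P (e k m) U = 0"
  shows "pairing P (e k m) U = 0"
proof -
  obtain N where N: "\<And>k m. k \<ge> N \<Longrightarrow> e k m = (\<lambda>_. 0)" using e_nilpotent by blast
  have "\<forall>m. pairing P (e k m) U = 0" for k
  proof (induction "N - k" arbitrary: k rule: less_induct)
    case less
    show ?case
    proof (cases "k \<ge> N")
      case True
      then show ?thesis by (simp add: N pairing_linear)
    next
      case False
      then have IH: "pairing P (e k' m') U = 0" if "k' > k" for k' m'
        using less[of k'] that by (cases "k' \<ge> N") (auto simp: N pairing_linear)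
      have W: "pairing P (xpow X (Suc k) z) U = 0" if "z \<in> W" for z
        using that unfolding W_def
      proof (induction rule: fs.span_induct_alt)
        case base
        have "xpow X (Suc k) 0 = (\<lambda>_. 0)" unfolding zero_fun_def by (rule xpow_linear(4))
        then show ?case by (simp only: pairing_linear)
      next
        case (step c x y)
        then obtain k' m' where "x = e k' m'" by auto
        then have "pairing P (xpow X (Suc k) x) U = 0" using IH[of "Suc k + k'" m'] xpow_word[of X "Suc k" Z J k' m']
            by (simp del: xpow_simps word_simps)
        moreover have "xpow X (Suc k) ((\<lambda>q. c * x q) + y) = (\<lambda>q. c * xpow X (Suc k) x q + xpow X (Suc k) y q)"
          unfolding plus_fun_def xpow_linear ..
        ultimately show ?case using step by (simp only: pairing_linear) simp
      qed
      have "pairing P (e k m) U = 0" for m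
      proof (induction m rule: less_induct)
        case (less m)
        show ?case
        proof (cases "m < d k")
          case True
          then show ?thesis using step IH less by blast
        next
          case False
          then have "e k m \<in> fs.span (e k ` {..<d k} \<union> xpow X (Suc k) ` W)"
            using e_lower unfolding lower_def by simp
          then show ?thesis
            by (rule pairing_span_zero) (use W less False in auto)
        qed
      qed
      then show ?thesis by blast
    qed
  qed
  then show ?thesis by blast
qed

lemma homogeneous_pairing:
  assumes U: "U \<in> supported ({i} \<times> {..<v i})" and "box_residue n (k, m) \<noteq> i"
  shows "pairing P (e k m) U = 0"
  unfolding pairing_def
proof (intro sum.neutral ballI)
  fix p
  show "e k m p * U p = 0"
  proof (rule ccontr)
    assume "e k m p * U p \<noteq> 0"
    then have "e k m p \<noteq> 0" "U p \<noteq> 0" by auto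
    then show False
      using word_homogeneous[OF X Z J, of k m p] supportedD[OF U, of p] assms(2) by (auto simp: box_residue_def)
  qed
qed

lemma words_kill:
  assumes i: "i \<in> vertices n" and U: "U \<in> supported ({i} \<times> {..<v i})"
    and kill: "\<And>k m. (k, m) \<in> boxes Y \<Longrightarrow> box_residue n (k, m) = i \<Longrightarrow> pairing P (e k m) U = 0"
  shows "U = (\<lambda>_. 0)"
proof -
  have "pairing P (e k m) U = 0" for k m
    by (rule kill_induct) (use kill homogeneous_pairing[OF U] boxes_Y in blast)
  then show ?thesis using sep i U unfolding separating_def by blast
qed

text \<open>The words at the boxes of degree \<open>i\<close> span the dual of the component of
  degree \<open>i\<close> and are independent.\<close>

lemma card_boxes_residue:
  assumes i: "i \<in> vertices n"
  shows "card {b \<in> boxes Y. box_residue n b = i} = v i"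
proof -
  let ?B = "{b \<in> boxes Y. box_residue n b = i}"
  let ?V = "{i} \<times> {..<v i}"
  have finB: "finite ?B" by simp
  have VP: "?V \<subseteq> P" using i by (auto simp: P_def)
  have "\<not> card ?B < v i"
  proof
    assume lt: "card ?B < v i"
    \<comment> \<open>If there were fewer boxes than dimensions, a nonzero vector would be killed by
      all of their words.\<close>
    define f where "f = (\<lambda>a b. if b \<in> ?B then e (fst b) (snd b) (i, a) else 0)"
    have "f a \<in> fs.span (unit_fun ` ?B)" for a
      unfolding span_unit_funs[OF finB] by (auto simp: f_def supported_def)
    moreover have "card (unit_fun ` ?B :: (_ \<Rightarrow> complex) set) < card {..<v i}"
      using card_image_le[OF finB, of "unit_fun :: _ \<Rightarrow> _ \<Rightarrow> complex"] lt by simp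
    ultimately obtain c where c: "\<exists>a\<in>{..<v i}. c a \<noteq> 0" "\<And>b. (\<Sum>a<v i. c a * f a b) = 0"
      using family_dependent[of "{..<v i}" "unit_fun ` ?B" f] finB by auto
    define U where "U = (\<lambda>(j, a). if j = i \<and> a < v i then c a else 0)"
    have U: "U \<in> supported ?V" by (auto simp: U_def supported_def)
    have "U = (\<lambda>_. 0)"
    proof (rule words_kill[OF i U])
      fix k m assume km: "(k, m) \<in> boxes Y" "box_residue n (k, m) = i"
      have "pairing P (e k m) U = (\<Sum>a<v i. e k m (i, a) * U (i, a))"
        unfolding pairing_def using i by (rule sum_block) (auto simp: U_def split: if_splits)
      also have "\<dots> = (\<Sum>a<v i. c a * f a (k, m))" using km by (intro sum.cong) (auto simp: U_def f_def)
      finally show "pairing P (e k m) U = 0" using c(2) by simp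
    qed
    moreover obtain a where "a < v i" "c a \<noteq> 0" using c(1) by blast
    moreover have "U (i, a) = c a" using \<open>a < v i\<close> by (simp add: U_def)
    ultimately show False by simp
  qed
  moreover have "\<not> v i < card ?B"
  proof
    assume lt: "v i < card ?B"
    have finV: "finite ?V" by simp
    have "e (fst b) (snd b) \<in> fs.span (unit_fun ` ?V)" if b: "b \<in> ?B" for b
      unfolding span_unit_funs[OF finV] supported_def
    proof (intro CollectI allI impI)
      fix p assume "p \<notin> ?V"
      then show "e (fst b) (snd b) p = 0"
        using word_homogeneous[OF X Z J, of "fst b" "snd b" p] b
        by (cases p) (auto simp: box_residue_def P_iff)
    qed
    moreover have "card (unit_fun ` ?V :: (_ \<Rightarrow> complex) set) < card ?B"
      using card_image_le[OF finV, of "unit_fun :: _ \<Rightarrow> _ \<Rightarrow> complex"] lt by simp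
    ultimately obtain c where c: "\<exists>b\<in>?B. c b \<noteq> 0" "\<And>q. (\<Sum>b\<in>?B. c b * e (fst b) (snd b) q) = 0"
      using family_dependent[of ?B "unit_fun ` ?V" "\<lambda>b. e (fst b) (snd b)"] finB finV by auto
    define C where "C = {b \<in> ?B. c b \<noteq> 0}"
    have C: "finite C" "C \<noteq> {}" using c(1) by (auto simp: C_def)
    \<comment> \<open>In a relation among the words at boxes, the one in the first column and,
      there, in the last row would be redundant.\<close>
    define k where "k = Min (fst ` C)"
    have k: "k \<in> fst ` C" "\<And>b. b \<in> C \<Longrightarrow> k \<le> fst b" using C by (auto simp: k_def)
    define M where "M = {m. (k, m) \<in> C}"
    have M: "finite M" "M \<noteq> {}"
      using k(1) finite_subset[of M "snd ` C"] C(1) by (force simp: M_def)+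
    define m where "m = Max M"
    have km: "(k, m) \<in> C" using Max_in[OF M] by (simp add: m_def M_def)
    have mmax: "m' \<le> m" if "(k, m') \<in> C" for m' using Max_ge[OF M(1)] that by (simp add: m_def M_def)
    have "e k m = (\<Sum>b\<in>C - {(k, m)}. (\<lambda>q. (- c b / c (k, m)) * e (fst b) (snd b) q))"
    proof
      fix q
      have "0 = (\<Sum>b\<in>C. c b * e (fst b) (snd b) q)"
        unfolding c(2)[of q, symmetric] using finB by (intro sum.mono_neutral_right) (auto simp: C_def)
      also have "\<dots> = c (k, m) * e k m q + (\<Sum>b\<in>C - {(k, m)}. c b * e (fst b) (snd b) q)"
        using km C(1) by (simp add: sum.remove)
      finally have "e k m q = - (\<Sum>b\<in>C - {(k, m)}. c b * e (fst b) (snd b) q) / c (k, m)"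
        using km by (simp add: C_def field_simps add_eq_0_iff)
      then show "e k m q = (\<Sum>b\<in>C - {(k, m)}. (\<lambda>q. (- c b / c (k, m)) * e (fst b) (snd b) q)) q"
        by (simp add: sum_fun_apply sum_negf sum_divide_distrib)
    qed
    also have "\<dots> \<in> lower k m"
      unfolding lower_def
    proof (intro fs.span_sum fs.span_scale fs.span_base)
      fix b assume b: "b \<in> C - {(k, m)}"
      show "e (fst b) (snd b) \<in> e k ` {..<m} \<union> xpow X (Suc k) ` W"
      proof (cases "fst b = k")
        case True
        then have "snd b < m" using mmax[of "snd b"] b by (cases b) force
        then show ?thesis using True by auto
      next
        case False
        then have "Suc k \<le> fst b" using k(2)[of b] b by auto
        then have "e (fst b) (snd b) = xpow X (Suc k) (e (fst b - Suc k) (snd b))"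
          using xpow_word[of X "Suc k" Z J "fst b - Suc k" "snd b"] by simp
        then show ?thesis using e_W by blast
      qed
    qed
    finally have "e k m \<in> lower k m" .
    moreover have "m < d k" using km boxes_Y by (auto simp: C_def)
    ultimately show False using not_lower by blast
  qed
  ultimately show ?thesis by simp
qed

end

section \<open>Word determinants and ranks\<close>

context young_space
begin

text \<open>The matrices of the representations in the orbit attached to \<open>Y\<close>, by
  \<open>orbit_iff\<close>.\<close>

definition orb :: "graded_matrix \<Rightarrow> bool" where
  "orb X \<longleftrightarrow> (\<exists>g h. inverses g h \<and> X = mul (mul g x0) h)"

definition word_matrix :: "graded_matrix \<Rightarrow> graded_matrix \<Rightarrow>
    graded_vector \<Rightarrow> graded_matrix" where
  "word_matrix X Z J = (\<lambda>(p, q). if (p, q) \<in> K0 then word X Z J (fst (ipos p)) (snd (ipos p)) q else 0)"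

definition word_det :: "graded_matrix \<Rightarrow> graded_matrix \<Rightarrow>
    graded_vector \<Rightarrow> complex" where
  "word_det X Z J = dlt (word_matrix X Z J)"

lemma word_matrix_EG [simp, intro]: "word_matrix X Z J \<in> EG"
  by (auto simp: word_matrix_def supported_def)

lemma mv_word_matrix:
  assumes U: "U \<in> supported ({i} \<times> {..<v i})" and p: "p \<in> P" "fst p = i"
  shows "mv P (word_matrix X Z J) U p = pairing P (word X Z J (fst (ipos p)) (snd (ipos p))) U"
  unfolding mv_def pairing_def
proof (rule sum.cong[OF refl])
  fix q assume "q \<in> P"
  then show "word_matrix X Z J (p, q) * U q = word X Z J (fst (ipos p)) (snd (ipos p)) q * U q"
    using supportedD[OF U, of q] p by (cases "U q = 0") (auto simp: word_matrix_def K0_def)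
qed

text \<open>If the words at the boxes form a basis of the dual space, no nonzero vector is killed by
  them.\<close>

lemma word_det_separating:
  assumes "word_det X Z J \<noteq> 0"
  shows "separating X Z J"
  unfolding separating_def
proof (intro ballI impI)
  fix i U assume i: "i \<in> vertices n" and U: "U \<in> supported ({i} \<times> {..<v i})"
    and kill: "\<forall>k m. pairing P (word X Z J k m) U = 0"
  let ?H = "word_matrix X Z J"
  have UP: "U \<in> supported P" using U i by (auto simp: supported_def P_def)
  have z: "mv P ?H U p = 0" for p
  proof (cases "p \<in> P \<and> fst p = i")
    case True
    then show ?thesis using mv_word_matrix[OF U] kill by simp
  next
    case False
    have "?H (p, q) * U q = 0" for q
      using False supportedD[OF U, of q] by (auto simp: word_matrix_def K0_def)
    then show ?thesis by (simp add: mv_def)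
  qed
  have inv: "inverses ?H (minv ?H)" using inverses_minv[OF word_matrix_EG] assms by (simp add: word_det_def)
  have "U = mv P (mul (minv ?H) ?H) U" using inv mv_one[OF finite_P UP] by (simp add: inverses_def)
  also have "\<dots> = mv P (minv ?H) (mv P ?H U)" by (rule mv_mm)
  also have "\<dots> = (\<lambda>_. 0)" using z by (simp add: mv_def)
  finally show "U = (\<lambda>_. 0)" .
qed

lemma rm_x0:
  assumes "(k, m) \<in> boxes Y"
  shows "rm P \<eta> x0 (pos (k, m)) = (if k = 0 then 0 else \<eta> (pos (k - 1, m)))"
  using mul_x0[OF assms, of "\<lambda>k. \<eta> (snd k)" "pos (k, m)"] by (simp add: rm_def mm_def)

lemma xpow_x0:
  assumes "\<eta> \<in> supported P" "(k, m) \<in> boxes Y"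
  shows "xpow x0 j \<eta> (pos (k, m)) = (if j \<le> k then \<eta> (pos (k - j, m)) else 0)"
  using assms(2)
proof (induction j arbitrary: k)
  case (Suc j)
  show ?case
  proof (cases k)
    case 0
    then show ?thesis using Suc.prems by (simp add: rm_x0)
  next
    case (Suc l)
    then have "(l, m) \<in> boxes Y" using boxes_down[OF young Suc.prems] by simp
    then show ?thesis using Suc.prems Suc.IH[of l] Suc by (simp add: rm_x0)
  qed
qed simp

text \<open>The range of \<open>X ^ k\<close> on row vectors is spanned by the basis vectors at
  the boxes that have \<open>k\<close> boxes to their left, transported from \<open>x0\<close> to
  \<open>X\<close>.\<close>

lemma range_power_dim:
  assumes X: "X \<in> ED" and orb: "orb X" and I: "finite I"
    and F: "\<And>b. b \<in> I \<Longrightarrow> \<exists>\<eta>\<in>supported P. F b = xpow X k \<eta>"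
    and indep: "\<And>c. (\<And>q. (\<Sum>b\<in>I. c b * F b q) = 0) \<Longrightarrow> \<forall>b\<in>I. c b = 0"
  shows "card I \<le> tail_count Y k"
proof (rule ccontr)
  assume "\<not> card I \<le> tail_count Y k"
  obtain g h where inv: "inverses g h" and Xe: "X = mul (mul g x0) h" using orb by (auto simp: orb_def)
  define T where "T = {b \<in> boxes Y. k \<le> fst b}"
  define row where "row = (\<lambda>b q. h (pos b, q))"
  have T: "finite T" by (simp add: T_def)
  have "xpow X k \<eta> \<in> fs.span (row ` T)" if \<eta>: "\<eta> \<in> supported P" for \<eta>
  proof -
    have gs: "g \<in> supported (P \<times> P)" "x0 \<in> supported (P \<times> P)"
      using inv EG_P ED_P[OF x0_ED] by (auto simp: inverses_def)
    define \<zeta> where "\<zeta> = xpow x0 k (rm P \<eta> g)"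
    have "xpow X k \<eta> = rm P \<eta> (mul (mul g (mpow P x0 k)) h)"
      using xpow_mpow[OF ED_P[OF X] \<eta>] mpow_conj[OF inv x0_ED] by (simp add: Xe)
    also have "\<dots> = rm P (rm P (rm P \<eta> g) (mpow P x0 k)) h" by (simp only: rm_mm mm_assoc)
    also have "\<dots> = rm P \<zeta> h"
      unfolding \<zeta>_def using xpow_mpow[OF gs(2) rm_supported[OF gs(1)]] by simp
    also have "\<dots> = (\<Sum>b\<in>boxes Y. (\<lambda>q. \<zeta> (pos b) * row b q))"
    proof
      fix q
      have "rm P \<zeta> h q = (\<Sum>b\<in>boxes Y. \<zeta> (pos b) * h (pos b, q))"
        unfolding rm_def
        using sum.reindex_bij_betw[OF pos_bij, of "\<lambda>p. \<zeta> p * h (p, q)"] by simp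
      then show "rm P \<zeta> h q = (\<Sum>b\<in>boxes Y. (\<lambda>q. \<zeta> (pos b) * row b q)) q"
        by (simp add: sum_fun_apply row_def)
    qed
    also have "\<dots> = (\<Sum>b\<in>T. (\<lambda>q. \<zeta> (pos b) * row b q))"
    proof (rule sum.mono_neutral_right)
      show "\<forall>b\<in>boxes Y - T. (\<lambda>q. \<zeta> (pos b) * row b q) = 0"
        unfolding \<zeta>_def T_def using xpow_x0[OF rm_supported[OF gs(1)]] by (auto simp: zero_fun_def)
    qed (auto simp: T_def)
    also have "\<dots> \<in> fs.span (row ` T)" by (intro fs.span_sum fs.span_scale fs.span_base) auto
    finally show ?thesis .
  qed
  then have "F b \<in> fs.span (row ` T)" if "b \<in> I" for b using F[OF that] by auto
  moreover have "card (row ` T) < card I"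
    using card_image_le[OF T, of row] \<open>\<not> card I \<le> tail_count Y k\<close> by (simp add: T_def tail_count_def)
  ultimately obtain c where "\<exists>b\<in>I. c b \<noteq> 0" "\<And>q. (\<Sum>b\<in>I. c b * F b q) = 0"
    using family_dependent[of I "row ` T" F] I T by auto
  then show False using indep by blast
qed

text \<open>A word \<open>(k', m)\<close> with \<open>k' \<ge> k\<close> is in the range of
  \<open>X ^ k\<close>, so independence of the words at the boxes of \<open>Y'\<close> bounds the
  rank of \<open>X ^ k\<close> from below.\<close>

lemma tail_count_le_of_chart:
  assumes S': "young_space n v Y' pos'" and X: "X \<in> ED" "Z \<in> EU" "J \<in> EJ" and orb: "orb X"
    and chart: "young_space.word_det n v Y' pos' X Z J \<noteq> 0"
  shows "tail_count Y' k \<le> tail_count Y k"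
proof -
  interpret S': young_space n v Y' pos' by fact
  let ?H = "S'.word_matrix X Z J"
  let ?e = "\<lambda>b. word X Z J (fst b) (snd b)"
  have inv: "inverses ?H (minv ?H)" using inverses_minv[OF S'.word_matrix_EG] chart by (simp add: S'.word_det_def)
  let ?I = "{b \<in> boxes Y'. k \<le> fst b}"
  have "card ?I \<le> tail_count Y k"
  proof (rule range_power_dim[OF X(1) orb, where F = ?e])
    show "\<exists>\<eta>\<in>supported P. ?e b = xpow X k \<eta>" if "b \<in> ?I" for b
    proof (rule bexI[of _ "word X Z J (fst b - k) (snd b)"])
      show "?e b = xpow X k (word X Z J (fst b - k) (snd b))" using that by (simp add: xpow_word)
      show "word X Z J (fst b - k) (snd b) \<in> supported P"
        unfolding supported_def using word_homogeneous[OF X] by blast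
    qed
    fix c assume c: "\<And>q. (\<Sum>b\<in>?I. c b * ?e b q) = 0"
    define c' where "c' = (\<lambda>p. if p \<in> P \<and> k \<le> fst (S'.ipos p) then c (S'.ipos p) else 0)"
    have c': "c' \<in> supported P" by (auto simp: c'_def supported_def)
    have "rm P c' ?H q = 0" for q
    proof -
      have "rm P c' ?H q = (\<Sum>p\<in>P. c' p * ?e (S'.ipos p) q)"
        unfolding rm_def
      proof (rule sum.cong[OF refl])
        fix p assume p: "p \<in> P"
        have "?e (S'.ipos p) q = 0" if "(p, q) \<notin> K0"
        proof (rule ccontr)
          assume "?e (S'.ipos p) q \<noteq> 0"
          from word_homogeneous[OF X this] show False
            using S'.pos_residue[OF S'.ipos_boxes[OF p]] S'.pos_ipos[OF p] that p
            by (auto simp: K0_def box_residue_def)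
        qed
        then show "c' p * ?H (p, q) = c' p * ?e (S'.ipos p) q" by (auto simp: S'.word_matrix_def)
      qed
      also have "\<dots> = (\<Sum>b\<in>boxes Y'. c' (pos' b) * ?e (S'.ipos (pos' b)) q)"
        using sum.reindex_bij_betw[OF S'.pos_bij, of "\<lambda>p. c' p * ?e (S'.ipos p) q"] by simp
      also have "\<dots> = (\<Sum>b\<in>?I. c b * ?e b q)"
        by (rule sum.mono_neutral_cong_right) (auto simp: c'_def S'.pos_P)
      finally show ?thesis using c by simp
    qed
    then have z: "rm P c' ?H = (\<lambda>_. 0)" by auto
    have "c' = rm P c' (mul ?H (minv ?H))" using inv rm_one[OF finite_P c'] by (simp add: inverses_def)
    also have "\<dots> = rm P (rm P c' ?H) (minv ?H)" by (rule rm_mm[symmetric])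
    also have "\<dots> = (\<lambda>_. 0)" unfolding z by (rule rm_linear)
    finally have c'0: "c' p = 0" for p by simp
    show "\<forall>b\<in>?I. c b = 0"
    proof
      fix b assume "b \<in> ?I"
      then show "c b = 0" using c'0[of "pos' b"] by (simp add: c'_def S'.pos_P)
    qed
  qed simp
  then show ?thesis by (simp add: tail_count_def)
qed

subsection \<open>The base point\<close>

text \<open>On row vectors \<open>z0\<close> moves each box to its lower neighbour;
  \<open>j0\<close> is the corner box. The word \<open>(k, m)\<close> in these is the box
  \<open>(k, m)\<close>.\<close>

definition z0 :: "graded_matrix" where
  "z0 = (\<lambda>(p, q). if p \<in> P \<and> q \<in> P \<and> ipos q = (fst (ipos p), Suc (snd (ipos p))) then 1 else 0)"

definition j0 :: "graded_vector" where
  "j0 = (\<lambda>p. if p \<in> P \<and> ipos p = (0, 0) then 1 else 0)"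

lemma z0_entry: "b \<in> boxes Y \<Longrightarrow> b' \<in> boxes Y \<Longrightarrow>
    z0 (pos b, pos b') = (if b' = (fst b, Suc (snd b)) then 1 else 0)"
  by (simp add: z0_def pos_P)

lemma z0_EU [simp, intro]: "z0 \<in> EU"
proof (rule supportedI)
  fix p q assume "z0 (p, q) \<noteq> 0"
  then have pq: "p \<in> P" "q \<in> P" "ipos q = (fst (ipos p), Suc (snd (ipos p)))"
    by (auto simp: z0_def split: if_splits)
  have "fst p = residue n (int (fst (ipos p)) - int (snd (ipos p)))"
    "fst q = residue n (int (fst (ipos p)) - int (Suc (snd (ipos p))))"
    using pos_residue[OF ipos_boxes[OF pq(1)]] pos_residue[OF ipos_boxes[OF pq(2)]]
      pos_ipos[OF pq(1)] pos_ipos[OF pq(2)] pq(3)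
    by (metis box_residue_def fst_conv snd_conv)+
  moreover have "int (fst (ipos p)) - int (Suc (snd (ipos p))) = int (fst (ipos p)) - int (snd (ipos p)) - 1" by simp
  ultimately have "fst q = pd (fst p)" by (simp only: residue_diff_left)
  then show "(p, q) \<in> KU" using pq by (simp add: KU_def)
qed

lemma j0_EJ [simp, intro]: "j0 \<in> EJ"
  unfolding supported_def
proof (intro CollectI allI impI, rule ccontr)
  fix p assume p: "p \<notin> KJ" "j0 p \<noteq> 0"
  then have "p \<in> P" "ipos p = (0, 0)" by (auto simp: j0_def split: if_splits)
  then have "fst p = box_residue n (0, 0)" using pos_residue[OF ipos_boxes] pos_ipos by metis
  then show False using p \<open>p \<in> P\<close> by (simp add: KJ_def box_residue_def residue_def)
qed

lemma sum_z0:
  assumes "(k, m) \<in> boxes Y"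
  shows "(\<Sum>r\<in>P. f r * z0 (r, pos (k, m))) = (if m = 0 then 0 else f (pos (k, m - 1)))"
proof (cases m)
  case 0
  have "z0 (r, pos (k, m)) = 0" if "r \<in> P" for r
    using that assms by (auto simp: z0_def 0)
  then show ?thesis using 0 by simp
next
  case (Suc j)
  have b: "(k, j) \<in> boxes Y" using boxes_down[OF young assms, of k j] Suc by simp
  have "z0 (r, pos (k, m)) = (if r = pos (k, j) then 1 else 0)" if r: "r \<in> P" for r
  proof -
    obtain k' m' where "(k', m') \<in> boxes Y" "r = pos (k', m')" using P_cases[OF r] .
    then show ?thesis using assms b by (auto simp: z0_entry pos_eq_iff Suc)
  qed
  then have "(\<Sum>r\<in>P. f r * z0 (r, pos (k, m))) = (\<Sum>r\<in>P. if r = pos (k, j) then f r else 0)"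
    by (intro sum.cong) auto
  then show ?thesis using pos_P[OF b] Suc by simp
qed

text \<open>The predecessors of a box in both directions are boxes, so the two shifts commute also
  at the boundary of the diagram.\<close>

lemma base_commute: "mul x0 z0 = mul z0 x0"
proof
  fix k :: "(int \<times> nat) \<times> (int \<times> nat)"
  obtain p q where k: "k = (p, q)" by (cases k)
  have s: "mul x0 z0 \<in> EG" "mul z0 x0 \<in> EG" using mul_ED_EU mul_EU_ED by auto
  show "mul x0 z0 k = mul z0 x0 k"
  proof (cases "p \<in> P \<and> q \<in> P")
    case False
    then have "mul x0 z0 (p, q) = 0" "mul z0 x0 (p, q) = 0"
      using s unfolding supported_def K0_def by blast+
    then show ?thesis unfolding k by simp
  next
    case True
    then obtain a b where p: "(a, b) \<in> boxes Y" "p = pos (a, b)" using P_cases by metis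
    obtain c d where q: "(c, d) \<in> boxes Y" "q = pos (c, d)" using P_cases True by metis
    have "(c, d - 1) \<in> boxes Y" "(c - 1, d) \<in> boxes Y" using boxes_down[OF young q(1)] by auto
    then show ?thesis unfolding k mm_apply q(2) sum_z0[OF q(1)]
      using mul_x0[OF q(1), of z0 p] p q by (auto simp: mm_apply x0_entry z0_entry)
  qed
qed

lemma word_base: "b \<in> boxes Y \<Longrightarrow> word x0 z0 j0 k m (pos b) = (if b = (k, m) then 1 else 0)"
proof (induction k arbitrary: b)
  case 0
  then show ?case
  proof (induction m arbitrary: b)
    case 0
    then show ?case by (simp add: j0_def pos_P)
  next
    case (Suc m)
    obtain k' m' where b: "b = (k', m')" by (cases b)
    have "(k', m' - 1) \<in> boxes Y" using boxes_down[OF young] Suc.prems b by auto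
    then show ?case unfolding word_0_Suc rm_def b sum_z0[OF Suc.prems[unfolded b]]
      using Suc.IH by auto
  qed
next
  case (Suc k)
  obtain k' m' where b: "b = (k', m')" by (cases b)
  have "(k' - 1, m') \<in> boxes Y" using boxes_down[OF young] Suc.prems b by auto
  then show ?case unfolding word_simps b rm_x0[OF Suc.prems[unfolded b]]
    using Suc.IH by auto
qed

lemma word_det_base: "word_det x0 z0 j0 = 1"
proof -
  have "word_matrix x0 z0 j0 (p, q) = I1 (p, q)" for p q
  proof (cases "(p, q) \<in> K0")
    case False
    then show ?thesis by (auto simp: word_matrix_def one_m_def K0_def)
  next
    case True
    then have "p \<in> P" "q \<in> P" by (auto simp: K0_def)
    moreover from this have "ipos q = ipos p \<longleftrightarrow> p = q" using pos_ipos by metis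
    ultimately show ?thesis using True word_base[OF ipos_boxes, of q] pos_ipos
      by (simp add: word_matrix_def one_m_def)
  qed
  then have "word_matrix x0 z0 j0 = I1" by auto
  then show ?thesis by (simp add: word_det_def)
qed

lemma x0_nilpotent: "\<exists>N. mpow P x0 N = (\<lambda>_. 0)"
proof -
  have s: "x0 \<in> supported (P \<times> P)" by (rule ED_P[OF x0_ED])
  define N where "N = Suc (Max (insert 0 (fst ` boxes Y)))"
  have lt: "k < N" if "(k, m) \<in> boxes Y" for k m
    unfolding N_def less_Suc_eq_le using that by (intro Max_ge) force+
  have "mpow P x0 N (p, q) = 0" for p q
  proof (cases "p \<in> P \<and> q \<in> P")
    case False
    then show ?thesis using supportedD[OF mpow_supported[OF s], of N "(p, q)"] by auto
  next
    case True
    then obtain c d where q: "(c, d) \<in> boxes Y" "q = pos (c, d)" using P_cases by metis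
    have u: "unit_fun p \<in> supported P" using True by (auto simp: unit_fun_def supported_def)
    have "rm P (unit_fun p) (mpow P x0 N) q = (\<Sum>r\<in>P. if r = p then mpow P x0 N (r, q) else 0)"
      unfolding rm_def by (rule sum.cong) (auto simp: unit_fun_def)
    also have "\<dots> = mpow P x0 N (p, q)" using True by simp
    finally show ?thesis
      using xpow_x0[OF u q(1), of N] xpow_mpow[OF s u, of N] lt[OF q(1)] q(2) by simp
  qed
  then show ?thesis by (intro exI[of _ N]) auto
qed

lemma orb_nilpotent: "orb X \<Longrightarrow> \<exists>N. mpow P X N = (\<lambda>_. 0)"
proof -
  assume "orb X"
  then obtain g h where gh: "inverses g h" "X = mul (mul g x0) h" by (auto simp: orb_def)
  obtain N where "mpow P x0 N = (\<lambda>_. 0)" using x0_nilpotent by blast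
  then have "mpow P X N = (\<lambda>_. 0)"
    unfolding gh(2) mpow_conj[OF gh(1) x0_ED] by (simp add: mm_zero_left mm_zero_right)
  then show ?thesis by blast
qed

lemma orb_x0: "orb x0"
  unfolding orb_def by (intro exI[of _ I1] conjI inverses_one) simp

lemma orb_ED: "orb X \<Longrightarrow> X \<in> ED"
  unfolding orb_def inverses_def by auto

end

context stable_triple
begin

text \<open>The corrected generators of the rows and their images under powers of \<open>X\<close>,
  placed at the boxes of \<open>Y\<close>, are the rows of a matrix \<open>\<Psi>\<close>. It
  differs from the matrix of the words by a triangular change, so it is invertible, and it satisfies
  \<open>\<Psi> X = x0 \<Psi>\<close> because the strings end where the rows of \<open>Y\<close>
  end.\<close>

theorem stable_orbit:
  assumes S: "young_space n v Y pos"
  shows "young_space.orb n v Y pos X"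
proof -
  interpret S: young_space n v Y pos by fact
  have ge: "d (Y ! m) \<le> m" if "m < length Y" for m
  proof -
    have "(Y ! m, m) \<notin> boxes Y" by (simp add: boxes_def)
    then show ?thesis by (simp add: boxes_Y)
  qed
  define R where "R = (\<lambda>m s z. s \<in> fs.span (e 0 ` {..<d (Y ! m)}) \<and> z \<in> W \<and>
    xpow X (Y ! m) (\<lambda>q. e 0 m q - s q - rm P z X q) = (\<lambda>_. 0))"
  have "\<exists>sz. m < length Y \<longrightarrow> R m (fst sz) (snd sz)" for m
  proof (cases "m < length Y")
    case True
    then obtain s z where "R m s z" using row_generator[OF ge] unfolding R_def by blast
    then show ?thesis by (intro exI[of _ "(s, z)"]) simp
  qed simp
  then obtain f where f: "\<forall>m. m < length Y \<longrightarrow> R m (fst (f m)) (snd (f m))"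
    using choice[of "\<lambda>m sz. m < length Y \<longrightarrow> R m (fst sz) (snd sz)"] by blast
  define s where "s = (\<lambda>m. fst (f m))"
  define z where "z = (\<lambda>m. snd (f m))"
  have sz: "s m \<in> fs.span (e 0 ` {..<d (Y ! m)})" "z m \<in> W"
    "xpow X (Y ! m) (\<lambda>q. e 0 m q - s m q - rm P (z m) X q) = (\<lambda>_. 0)" if "m < length Y" for m
    using f that unfolding R_def s_def z_def by simp_all
  define \<psi> where "\<psi> = (\<lambda>k m. xpow X k (\<lambda>q. e 0 m q - s m q - rm P (z m) X q))"
  have \<psi>: "\<psi> k m = (\<lambda>q. e k m q - xpow X k (s m) q - xpow X (Suc k) (z m) q)" for k m
    unfolding \<psi>_def xpow_linear xpow_Suc_right using xpow_word[of X k Z J 0 m] by simp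
  define \<Psi> where "\<Psi> = (\<lambda>(p, q). if (p, q) \<in> K0 then \<psi> (fst (S.ipos p)) (snd (S.ipos p)) q else 0)"
  have \<Psi>E: "\<Psi> \<in> EG" by (auto simp: \<Psi>_def supported_def)
  have Wkill: "pairing P (xpow X j y) U = 0" if y: "y \<in> W" and k: "\<And>k' m'. k' \<ge> j \<Longrightarrow> pairing P (e k' m') U = 0" for j y U
    using y unfolding W_def
  proof (induction rule: fs.span_induct_alt)
    case base
    have "xpow X j 0 = (\<lambda>_. 0)" unfolding zero_fun_def by (rule xpow_linear(4))
    then show ?case by (simp only: pairing_linear)
  next
    case (step c x y)
    then obtain k' m' where "x = e k' m'" by auto
    then have "pairing P (xpow X j x) U = 0" using k[of "j + k'" m'] xpow_word[of X j Z J k' m'] by simp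
    moreover have "xpow X j ((\<lambda>q. c * x q) + y) = (\<lambda>q. c * xpow X j x q + xpow X j y q)"
      unfolding plus_fun_def xpow_linear ..
    ultimately show ?case using step by (simp only: pairing_linear) simp
  qed
  have "dlt \<Psi> \<noteq> 0"
  proof (rule dlt_nonzeroI[OF \<Psi>E])
    fix i U assume i: "i \<in> vertices n" and U: "U \<in> supported ({i} \<times> {..<v i})"
      and zero: "mv P \<Psi> U = (\<lambda>_. 0)"
    have \<psi>U: "pairing P (\<psi> k m) U = 0" if b: "(k, m) \<in> boxes Y" "box_residue n (k, m) = i" for k m
    proof -
      have p: "pos (k, m) \<in> P" "fst (pos (k, m)) = i" using S.pos_P S.pos_residue b by auto
      have "mv P \<Psi> U (pos (k, m)) = pairing P (\<psi> k m) U"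
        unfolding mv_def pairing_def
      proof (rule sum.cong[OF refl])
        fix q assume "q \<in> P"
        then show "\<Psi> (pos (k, m), q) * U q = \<psi> k m q * U q"
          using supportedD[OF U, of q] p b by (cases "U q = 0") (auto simp: \<Psi>_def K0_def)
      qed
      then show ?thesis using zero by simp
    qed
    have "pairing P (e k m) U = 0" for k m
    proof (rule kill_induct)
      fix k m assume m: "m < d k" and k': "\<And>k' m'. k' > k \<Longrightarrow> pairing P (e k' m') U = 0"
        and m': "\<And>m'. m' < m \<Longrightarrow> pairing P (e k m') U = 0"
      have b: "(k, m) \<in> boxes Y" using m by (simp add: boxes_Y)
      then have len: "m < length Y" by (simp add: boxes_def)
      show "pairing P (e k m) U = 0"
      proof (cases "box_residue n (k, m) = i")
        case False
        then show ?thesis using homogeneous_pairing[OF U] by blast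
      next
        case True
        have "pairing P (xpow X (Suc k) (z m)) U = 0"
          by (rule Wkill[OF sz(2)[OF len]]) (simp add: k')
        moreover have "pairing P (xpow X k (s m)) U = 0"
          using sz(1)[OF len]
        proof (induction rule: fs.span_induct_alt)
          case base
          have "xpow X k 0 = (\<lambda>_. 0)" unfolding zero_fun_def by (rule xpow_linear(4))
          then show ?case by (simp only: pairing_linear)
        next
          case (step c x y)
          then obtain l where "x = e 0 l" "l < m" using ge[OF len] by auto
          then have "pairing P (xpow X k x) U = 0" using m' xpow_word[of X k Z J 0 l] by simp
          moreover have "xpow X k ((\<lambda>q. c * x q) + y) = (\<lambda>q. c * xpow X k x q + xpow X k y q)"
            unfolding plus_fun_def xpow_linear ..
          ultimately show ?case using step by (simp only: pairing_linear) simp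
        qed
        ultimately show ?thesis using \<psi>U[OF b True] unfolding \<psi> pairing_linear by simp
      qed
    qed
    then show "U = (\<lambda>_. 0)" using sep i U unfolding separating_def by blast
  qed
  then have inv: "inverses \<Psi> (minv \<Psi>)" by (rule inverses_minv[OF \<Psi>E])
  have "mul \<Psi> X (p, q) = mul S.x0 \<Psi> (p, q)" for p q
  proof (cases "(p, q) \<in> KD")
    case False
    have "mul \<Psi> X \<in> ED" "mul S.x0 \<Psi> \<in> ED" using \<Psi>E X by auto
    then show ?thesis using False supportedD by metis
  next
    case True
    then have pq: "p \<in> P" "q \<in> P" "fst p = pd (fst q)" by (auto simp: KD_def)
    obtain k m where km: "(k, m) \<in> boxes Y" "p = pos (k, m)" using S.P_cases[OF pq(1)] .
    have "mul \<Psi> X (p, q) = (\<Sum>r\<in>P. \<psi> k m r * X (r, q))"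
      unfolding mm_apply
    proof (rule sum.cong[OF refl])
      fix r assume r: "r \<in> P"
      show "\<Psi> (p, r) * X (r, q) = \<psi> k m r * X (r, q)"
        using supportedD[OF X, of "(r, q)"] r pq km by (cases "X (r, q) = 0") (auto simp: \<Psi>_def K0_def KD_def)
    qed
    also have "\<dots> = \<psi> (Suc k) m q" by (simp add: \<psi>_def rm_def)
    also have "\<dots> = mul S.x0 \<Psi> (p, q)"
    proof (cases "(Suc k, m) \<in> boxes Y")
      case True
      have "(p, pos (Suc k, m)) \<in> KD"
        using supportedD[OF S.x0_ED, of "(p, pos (Suc k, m))"] km True by (simp add: S.x0_entry)
      then have "fst (pos (Suc k, m)) = fst q" using pq pd_inj P_vertex by (auto simp: KD_def)
      then show ?thesis using S.x0_mul[OF km(1)] km True pq S.pos_P[OF True] by (simp add: \<Psi>_def K0_def)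
    next
      case False
      have "Suc k = Y ! m" "m < length Y" using False km(1) by (auto simp: boxes_def)
      then have "\<psi> (Suc k) m = (\<lambda>_. 0)" unfolding \<psi>_def using sz(3) by simp
      then show ?thesis using S.x0_mul[OF km(1)] km False by simp
    qed
    finally show ?thesis .
  qed
  then have rel: "mul \<Psi> X = mul S.x0 \<Psi>" by auto
  have "X = mul (mul (minv \<Psi>) \<Psi>) X" using inv X by (simp add: inverses_def)
  also have "\<dots> = mul (mul (minv \<Psi>) S.x0) \<Psi>" by (simp only: mm_assoc rel)
  finally show ?thesis unfolding S.orb_def using inverses_sym[OF inv] by blast
qed

end

section \<open>Dual systems\<close>

lemma supported_zero: "f \<in> supported K \<Longrightarrow> k \<notin> K \<Longrightarrow> f k = 0"
  by (auto simp: supported_def)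

context graded_space
begin

text \<open>The commutator, which is the velocity of the gauge action at \<open>x\<close> in the
  direction \<open>\<xi>\<close>.\<close>

definition br :: "graded_matrix \<Rightarrow> graded_matrix \<Rightarrow> graded_matrix" where
  "br \<xi> x = (\<lambda>k. mul \<xi> x k - mul x \<xi> k)"

lemma br_ED: "\<xi> \<in> EG \<Longrightarrow> x \<in> ED \<Longrightarrow> br \<xi> x \<in> ED"
  unfolding br_def by (intro supported_lin) auto

lemma br_one: "x \<in> ED \<Longrightarrow> br I1 x = (\<lambda>_. 0)"
  by (simp add: br_def)

lemma br_linear:
  "br (\<lambda>k. \<xi> k + \<eta> k) x = (\<lambda>k. br \<xi> x k + br \<eta> x k)"
  "br (\<lambda>k. c * \<xi> k) x = (\<lambda>k. c * br \<xi> x k)"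
  by (auto simp: br_def mm_add_left mm_add_right mm_scale_left mm_scale_right algebra_simps)

lemma br_sum: "br (\<lambda>k. \<Sum>i\<in>I. c i * F i k) x = (\<lambda>k. \<Sum>i\<in>I. c i * br (F i) x k)"
  by (simp add: br_def mm_sum_left mm_sum_right sum_subtractf algebra_simps)

text \<open>Invariance of the trace form: pairing with all velocities detects the commutator of
  \<open>x\<close> and \<open>z\<close>.\<close>

lemma tr_br: "tr P z (br \<xi> x) = tr P \<xi> (\<lambda>k. mul x z k - mul z x k)"
proof -
  have "tr P z (mul \<xi> x) = tr P \<xi> (mul x z)" by (rule tr_cyclic)
  moreover have "tr P z (mul x \<xi>) = tr P \<xi> (mul z x)" by (metis tr_cyclic)
  ultimately show ?thesis unfolding br_def tr_linear by simp
qed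

abbreviation dimE :: nat where "dimE \<equiv> fs.dim ED"

text \<open>A basis \<open>w\<close> of \<open>ED\<close> whose first \<open>p\<close> members are a
  basis of the velocities \<open>[\<xi>, x]\<close>, together with the dual basis
  \<open>\<zeta>\<close> of \<open>EU\<close> under the trace form.\<close>

definition dual_system where
  "dual_system x p \<sigma> w \<zeta> \<longleftrightarrow> p \<le> dimE \<and>
     (\<forall>i<dimE. w i \<in> ED \<and> \<zeta> i \<in> EU) \<and>
     (\<forall>i<dimE. \<forall>j<dimE. tr P (\<zeta> i) (w j) = (if i = j then 1 else 0)) \<and>
     (\<forall>i<p. \<sigma> i \<in> EG \<and> w i = br (\<sigma> i) x) \<and>
     (\<forall>y\<in>ED. y = (\<lambda>k. \<Sum>i<dimE. tr P (\<zeta> i) y * w i k)) \<and>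
     (\<forall>\<xi>\<in>EG. br \<xi> x = (\<lambda>k. \<Sum>i<p. tr P (\<zeta> i) (br \<xi> x) * w i k))"

lemma tr_KD:
  assumes "y \<in> ED" "z \<in> EU"
  shows "tr P z y = (\<Sum>k\<in>KD. y k * z (snd k, fst k))"
proof -
  have "tr P z y = (\<Sum>q\<in>P. \<Sum>p\<in>P. y (p, q) * z (q, p))"
    unfolding tr_def by (simp add: mult.commute)
  also have "\<dots> = (\<Sum>p\<in>P. \<Sum>q\<in>P. y (p, q) * z (q, p))" by (rule sum.swap)
  also have "\<dots> = (\<Sum>k\<in>P \<times> P. y k * z (snd k, fst k))" by (simp add: sum.cartesian_product case_prod_unfold)
  also have "\<dots> = (\<Sum>k\<in>KD. y k * z (snd k, fst k))"
    using supportedD[OF assms(1)] by (intro sum.mono_neutral_right) (auto simp: KD_def)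
  finally show ?thesis .
qed

text \<open>Extend a basis of the space of velocities to a basis of \<open>ED\<close>; the dual
  basis consists of the coordinate functions, which the trace form represents by matrices in
  \<open>EU\<close>.\<close>

lemma dual_system_exists:
  assumes x: "x \<in> ED"
  shows "\<exists>p \<sigma> w \<zeta>. dual_system x p \<sigma> w \<zeta>"
proof -
  define T where "T = (\<lambda>\<xi>. br \<xi> x) ` EG"
  have TE: "T \<subseteq> ED" using br_ED[OF _ x] by (auto simp: T_def)
  obtain B where B: "B \<subseteq> T" "fs.independent B" "T \<subseteq> fs.span B"
    using fs.maximal_independent_subset[of T] by blast
  obtain B' where B': "B \<subseteq> B'" "B' \<subseteq> ED" "fs.independent B'" "ED \<subseteq> fs.span B'"
    using fs.maximal_independent_subset_extend[of B ED] B TE by blast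
  have fin': "finite B'"
    using fs.independent_span_bound[OF _ B'(3), of "unit_fun ` KD"] B'(2) span_unit_funs[of KD] by simp
  have fin: "finite B" using fin' B'(1) finite_subset by blast
  obtain xs where xs: "set xs = B" "distinct xs" using finite_distinct_list[OF fin] by blast
  obtain ys where ys: "set ys = B' - B" "distinct ys" using finite_distinct_list[of "B' - B"] fin' by blast
  define zs where "zs = xs @ ys"
  have zs: "set zs = B'" "distinct zs" using xs ys B'(1) by (auto simp: zs_def)
  have D: "length zs = dimE"
    using fs.basis_card_eq_dim[OF B'(2,4,3)] zs distinct_card by metis
  define p where "p = length xs"
  define w where "w = (\<lambda>i. zs ! i)"
  have p: "p \<le> dimE" using D by (simp add: p_def zs_def flip: D)
  have wB: "w i \<in> B'" if "i < dimE" for i using that zs D unfolding w_def by (metis nth_mem)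
  have wp: "w i \<in> B" if "i < p" for i using that xs by (auto simp: w_def zs_def nth_append p_def)
  define \<sigma> where "\<sigma> = (\<lambda>i. SOME \<xi>. \<xi> \<in> EG \<and> w i = br \<xi> x)"
  have \<sigma>: "\<sigma> i \<in> EG \<and> w i = br (\<sigma> i) x" if "i < p" for i
  proof -
    have "\<exists>\<xi>. \<xi> \<in> EG \<and> w i = br \<xi> x" using wp[OF that] B(1) by (auto simp: T_def)
    then show ?thesis unfolding \<sigma>_def by (rule someI_ex)
  qed
  let ?rep = "fs.representation B'"
  define \<zeta> where "\<zeta> = (\<lambda>i (q, r). if (r, q) \<in> KD then ?rep (unit_fun (r, q)) (w i) else 0)"
  have \<zeta>E: "\<zeta> i \<in> EU" for i by (auto simp: \<zeta>_def supported_def KD_def KU_def)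
  have unit_span: "unit_fun k \<in> fs.span B'" if "k \<in> KD" for k :: "(int \<times> nat) \<times> (int \<times> nat)"
    using that B'(4) by (auto simp: unit_fun_def supported_def)
  have rep: "tr P (\<zeta> i) y = ?rep y (w i)" if y: "y \<in> ED" for i y
  proof -
    have "tr P (\<zeta> i) y = (\<Sum>k\<in>KD. y k * \<zeta> i (snd k, fst k))" by (rule tr_KD[OF y \<zeta>E])
    also have "\<dots> = (\<Sum>k\<in>KD. y k * ?rep (unit_fun k) (w i))"
      by (rule sum.cong) (auto simp: \<zeta>_def)
    also have "\<dots> = (\<Sum>k\<in>KD. ?rep (\<lambda>l. y k * unit_fun k l) (w i))"
      using fs.representation_scale[OF B'(3) unit_span] by (intro sum.cong refl) simp
    also have "\<dots> = ?rep (\<Sum>k\<in>KD. (\<lambda>l. y k * unit_fun k l)) (w i)"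
      using fs.representation_sum[OF B'(3), of KD "\<lambda>k l. y k * unit_fun k l"] fs.span_scale[OF unit_span]
      by simp
    also have "(\<Sum>k\<in>KD. (\<lambda>l. y k * unit_fun k l)) = y"
      by (rule supported_expand[OF _ y, symmetric]) simp
    finally show ?thesis .
  qed
  have winj: "w i = w j \<longleftrightarrow> i = j" if "i < dimE" "j < dimE" for i j
    using that zs(2) D by (simp add: w_def nth_eq_iff_index_eq)
  have dual: "tr P (\<zeta> i) (w j) = (if i = j then 1 else 0)" if ij: "i < dimE" "j < dimE" for i j
  proof -
    have "w j \<in> ED" using wB[OF ij(2)] B'(2) by blast
    then show ?thesis using rep[of "w j" i] fs.representation_basis[OF B'(3) wB[OF ij(2)]] winj[OF ij] by auto
  qed
  have expand: "y = (\<lambda>k. \<Sum>i<dimE. tr P (\<zeta> i) y * w i k)" if y: "y \<in> ED" for y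
  proof
    fix k
    have "y = (\<Sum>b\<in>B'. (\<lambda>k. ?rep y b * b k))"
      using fs.sum_representation_eq[OF B'(3) _ fin' order_refl, of y] y B'(4) by auto
    from fun_cong[OF this, of k] have "y k = (\<Sum>b\<in>B'. ?rep y b * b k)"
      unfolding sum_fun_apply .
    also have "\<dots> = (\<Sum>i<dimE. ?rep y (w i) * w i k)"
    proof -
      have "bij_betw w {..<dimE} B'" unfolding w_def D[symmetric] zs(1)[symmetric]
        by (rule bij_betw_nth[OF zs(2) refl refl])
      from sum.reindex_bij_betw[OF this, of "\<lambda>b. ?rep y b * b k"] show ?thesis by simp
    qed
    finally show "y k = (\<Sum>i<dimE. tr P (\<zeta> i) y * w i k)" using rep[OF y] by simp
  qed
  have tangent: "br \<xi> x = (\<lambda>k. \<Sum>i<p. tr P (\<zeta> i) (br \<xi> x) * w i k)" if \<xi>: "\<xi> \<in> EG" for \<xi>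
  proof -
    let ?y = "br \<xi> x"
    have y: "?y \<in> ED" by (rule br_ED[OF \<xi> x])
    have yB: "?y \<in> fs.span B" using \<xi> B(3) by (auto simp: T_def)
    have "tr P (\<zeta> i) ?y = 0" if "p \<le> i" "i < dimE" for i
    proof -
      have "w i \<notin> B"
        using that ys D nth_mem[of "i - p" ys] by (auto simp: w_def zs_def nth_append p_def)
      moreover have "?rep ?y = fs.representation B ?y"
        by (rule fs.representation_extend[OF B'(3) yB B'(1)])
      ultimately have "?rep ?y (w i) = 0" using fs.representation_ne_zero by metis
      then show ?thesis using rep[OF y] by simp
    qed
    then have "(\<Sum>i<dimE. tr P (\<zeta> i) ?y * w i k) = (\<Sum>i<p. tr P (\<zeta> i) ?y * w i k)" for k
      using p by (intro sum.mono_neutral_right) (auto simp: not_less)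
    then show ?thesis using expand[OF y] by metis
  qed
  have wED: "w i \<in> ED" if "i < dimE" for i using wB[OF that] B'(2) by blast
  have "dual_system x p \<sigma> w \<zeta>"
    unfolding dual_system_def using p wED \<zeta>E dual \<sigma> expand tangent by blast
  then show ?thesis by blast
qed

lemma trace_separates:
  assumes z: "z \<in> EU" and zero: "\<And>y. y \<in> ED \<Longrightarrow> tr P z y = 0"
  shows "z = (\<lambda>_. 0)"
proof
  fix k :: "(int \<times> nat) \<times> (int \<times> nat)"
  obtain q r where k: "k = (q, r)" by (cases k)
  show "z k = 0"
  proof (cases "(r, q) \<in> KD")
    case False
    then have "(q, r) \<notin> KU" by (auto simp: KD_def KU_def)
    then show ?thesis using supported_zero[OF z] k by simp
  next
    case True
    have u: "unit_fun (r, q) \<in> ED" using True by (auto simp: unit_fun_def supported_def)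
    have "tr P z (unit_fun (r, q)) = (\<Sum>l\<in>KD. if l = (r, q) then z (q, r) else 0)"
      unfolding tr_KD[OF u z] by (intro sum.cong) (auto simp: unit_fun_def)
    also have "\<dots> = z (q, r)" using True by simp
    finally show ?thesis using zero[OF u] k by simp
  qed
qed

lemma trace_separates_EG:
  assumes A: "A \<in> EG" and zero: "\<And>p q. (p, q) \<in> K0 \<Longrightarrow> tr P (unit_fun (p, q)) A = 0"
  shows "A = (\<lambda>_. 0)"
proof
  fix k :: "(int \<times> nat) \<times> (int \<times> nat)"
  obtain q r where k: "k = (q, r)" by (cases k)
  show "A k = 0"
  proof (cases "(q, r) \<in> K0")
    case False
    then show ?thesis using supported_zero[OF A] k by simp
  next
    case True
    then have qr: "q \<in> P" "r \<in> P" "(r, q) \<in> K0" by (auto simp: K0_def)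
    have "tr P (unit_fun (r, q)) A = (\<Sum>a\<in>P. \<Sum>b\<in>P. if a = r then if b = q then A (b, a) else 0 else 0)"
      unfolding tr_def by (intro sum.cong refl) (auto simp: unit_fun_def)
    also have "\<dots> = (\<Sum>a\<in>P. if a = r then A (q, a) else 0)"
    proof (rule sum.cong[OF refl])
      fix a
      show "(\<Sum>b\<in>P. if a = r then if b = q then A (b, a) else 0 else 0) = (if a = r then A (q, a) else 0)"
        using qr by (cases "a = r") simp_all
    qed
    also have "\<dots> = A (q, r)" using qr by simp
    finally show ?thesis using zero[OF qr(3)] k by simp
  qed
qed

text \<open>By the invariance of the trace form, the commutant of \<open>x\<close> is the
  annihilator of the velocities.\<close>

lemma commutant_iff:
  assumes ds: "dual_system x p \<sigma> w \<zeta>" and x: "x \<in> ED" and z: "z \<in> EU"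
  shows "mul x z = mul z x \<longleftrightarrow> (\<forall>i<p. tr P z (w i) = 0)"
proof
  assume c: "mul x z = mul z x"
  show "\<forall>i<p. tr P z (w i) = 0"
    using ds tr_br[of z _ x] unfolding dual_system_def by (simp add: c tr_linear)
next
  assume o: "\<forall>i<p. tr P z (w i) = 0"
  let ?A = "\<lambda>k. mul x z k - mul z x k"
  have A: "?A \<in> EG" using mul_ED_EU[OF x z] mul_EU_ED[OF z x] by (intro supported_lin)
  have "?A = (\<lambda>_. 0)"
  proof (rule trace_separates_EG[OF A])
    fix a b assume ab: "(a, b) \<in> K0"
    let ?\<xi> = "unit_fun (a, b) :: _ \<Rightarrow> complex"
    have u: "?\<xi> \<in> EG" using ab by (auto simp: unit_fun_def supported_def)
    have "br ?\<xi> x = (\<lambda>k. \<Sum>i<p. tr P (\<zeta> i) (br ?\<xi> x) * w i k)"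
      using ds u unfolding dual_system_def by blast
    from arg_cong[OF this, of "tr P z"]
    have "tr P z (br ?\<xi> x) = (\<Sum>i<p. tr P (\<zeta> i) (br ?\<xi> x) * tr P z (w i))"
      unfolding tr_sum_right .
    then show "tr P ?\<xi> ?A = 0" using o tr_br by simp
  qed
  then show "mul x z = mul z x" by (auto simp: fun_eq_iff)
qed

lemma dual_expand:
  assumes ds: "dual_system x p \<sigma> w \<zeta>" and z: "z \<in> EU"
  shows "z = (\<lambda>k. \<Sum>i<dimE. tr P z (w i) * \<zeta> i k)"
proof -
  let ?y = "\<lambda>k. \<Sum>i<dimE. tr P z (w i) * \<zeta> i k"
  have yE: "?y \<in> EU" by (rule supported_lin) (use ds in \<open>auto simp: dual_system_def\<close>)
  have "(\<lambda>k. z k - ?y k) = (\<lambda>_. 0)"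
  proof (rule trace_separates)
    show "(\<lambda>k. z k - ?y k) \<in> EU" by (rule supported_lin(2)[OF z yE])
    fix y assume y: "y \<in> ED"
    have ye: "y = (\<lambda>k. \<Sum>i<dimE. tr P (\<zeta> i) y * w i k)" using ds y unfolding dual_system_def by blast
    have "tr P z y = (\<Sum>i<dimE. tr P (\<zeta> i) y * tr P z (w i))" by (subst ye) (rule tr_sum_right)
    moreover have "tr P ?y y = (\<Sum>i<dimE. tr P z (w i) * tr P (\<zeta> i) y)"
      by (subst tr_commute, subst tr_sum_right) (simp add: tr_commute)
    ultimately show "tr P (\<lambda>k. z k - ?y k) y = 0" unfolding tr_linear by (simp add: mult.commute)
  qed
  then show ?thesis by (auto simp: fun_eq_iff)
qed

end

section \<open>The conormal bundle\<close>

context graded_space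
begin

text \<open>Only the arrows opposite to \<open>Omega\<close> contribute, all with sign
  \<open>-1\<close>.\<close>

lemma form_rp:
  assumes z: "z \<in> EU" and y: "y \<in> Rp"
  shows "form n (rp (\<lambda>_. 0) z) y = - tr P z (Xt y)"
proof -
  let ?f = "\<lambda>h. eps h * (let A = rp (\<lambda>_. 0) z h * y (bar h) in \<Sum>k<dim_row A. A $$ (k, k))"
  have yc: "y (Down i) \<in> carrier_mat (v (pd i)) (v i)" "y (Up i) \<in> carrier_mat (v i) (v (pd i))" if i: "i \<in> vertices n" for i
  proof -
    have "y h \<in> carrier_mat (v (in_vertex n h)) (v (out_vertex n h))" if "h \<in> arrows n" for h
      using y that unfolding rep_space_def by (rule PiE_mem)
    from this[of "Down i"] this[of "Up i"]
    show "y (Down i) \<in> carrier_mat (v (pd i)) (v i)" "y (Up i) \<in> carrier_mat (v i) (v (pd i))" using i by simp_all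
  qed
  have d: "?f (Down i) = 0" if i: "i \<in> vertices n" for i
  proof -
    have "rp (\<lambda>_. 0) z (Down i) = 0\<^sub>m (v (pd i)) (v i)" unfolding rp_blk(1)[OF i] blkD_def by (intro eq_matI) auto
    then have "rp (\<lambda>_. 0) z (Down i) * y (Up i) = 0\<^sub>m (v (pd i)) (v (pd i))" using yc(2)[OF i] by simp
    then show ?thesis by simp
  qed
  have u: "?f (Up i) = - (\<Sum>a<v i. \<Sum>q\<in>P. z ((i, a), q) * Xt y (q, (i, a)))" if i: "i \<in> vertices n" for i
  proof -
    have yD: "y (Down i) = mat (v (pd i)) (v i) (\<lambda>(a, b). Xt y ((pd i, a), (i, b)))"
      using yc(1)[OF i] i by (intro eq_matI) (auto simp: Xt_def KD_def P_iff)
    have "rp (\<lambda>_. 0) z (Up i) * y (Down i) =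
        mat (v i) (v i) (\<lambda>(a, b). \<Sum>c<v (pd i). z ((i, a), (pd i, c)) * Xt y ((pd i, c), (i, b)))"
      unfolding rp_blk(2)[OF i] blkU_def yD by (rule mult_mat_eq)
    then have "?f (Up i) = - (\<Sum>a<v i. \<Sum>c<v (pd i). z ((i, a), (pd i, c)) * Xt y ((pd i, c), (i, a)))"
      by simp
    also have "(\<Sum>a<v i. \<Sum>c<v (pd i). z ((i, a), (pd i, c)) * Xt y ((pd i, c), (i, a))) =
        (\<Sum>a<v i. \<Sum>q\<in>P. z ((i, a), q) * Xt y (q, (i, a)))"
    proof (rule sum.cong[OF refl])
      fix a
      show "(\<Sum>c<v (pd i). z ((i, a), (pd i, c)) * Xt y ((pd i, c), (i, a))) = (\<Sum>q\<in>P. z ((i, a), q) * Xt y (q, (i, a)))"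
      proof (rule sum_block[symmetric])
        fix r assume "z ((i, a), r) * Xt y (r, (i, a)) \<noteq> 0"
        then have "((i, a), r) \<in> KU" using supportedD[OF z] by fastforce
        then show "fst r = pd i" by (simp add: KU_def)
      qed simp
    qed
    finally show ?thesis .
  qed
  have "form n (rp (\<lambda>_. 0) z) y = (\<Sum>h\<in>Down ` vertices n. ?f h) + (\<Sum>h\<in>Up ` vertices n. ?f h)"
    unfolding form_def arrows_def Omega_def Omega_bar_def by (rule sum.union_disjoint) auto
  also have "(\<Sum>h\<in>Down ` vertices n. ?f h) = 0" using d by (intro sum.neutral) auto
  also have "(\<Sum>h\<in>Up ` vertices n. ?f h) = (\<Sum>i\<in>vertices n. ?f (Up i))"
    by (subst sum.reindex) (auto simp: inj_on_def)
  also have "\<dots> = - (\<Sum>i\<in>vertices n. \<Sum>a<v i. \<Sum>q\<in>P. z ((i, a), q) * Xt y (q, (i, a)))"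
    using u by (simp add: sum_negf[symmetric])
  also have "(\<Sum>i\<in>vertices n. \<Sum>a<v i. \<Sum>q\<in>P. z ((i, a), q) * Xt y (q, (i, a))) = tr P z (Xt y)"
  proof -
    have "(\<Sum>p\<in>P. F p) = (\<Sum>i\<in>vertices n. \<Sum>a<v i. F (i, a))" for F :: "graded_vector"
      unfolding P_def by (subst sum.Sigma) auto
    from this[of "\<lambda>p. \<Sum>q\<in>P. z (p, q) * Xt y (q, p)"] show ?thesis by (simp add: tr_def)
  qed
  finally show ?thesis by simp
qed

text \<open>The tangent space is tested along straight lines, which leave the orbit. A straight line
  may be replaced by a curve in the orbit with the same velocity.\<close>

lemma derivative_depends_on_velocity:
  assumes p: "p \<in> RC"
    and X: "\<And>k. c1 0 k = c2 0 k"
      "\<And>k. ((\<lambda>t. c1 t k) has_field_derivative d k) (at 0)"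
      "\<And>k. ((\<lambda>t. c2 t k) has_field_derivative d k) (at 0)"
  shows "\<exists>D. ((\<lambda>t. p (rp (c1 t) (\<lambda>_. 0))) has_field_derivative D) (at 0) \<and>
    ((\<lambda>t. p (rp (c2 t) (\<lambda>_. 0))) has_field_derivative D) (at 0)"
proof -
  \<comment> \<open>Both curves are treated as one map on two copies of the line, so that the
    functions for which the claim holds form an algebra.\<close>
  define R where "R = {f :: bool \<times> complex \<Rightarrow> complex. f (True, 0) = f (False, 0) \<and>
    (\<exists>D. ((\<lambda>t. f (True, t)) has_field_derivative D) (at 0) \<and>
      ((\<lambda>t. f (False, t)) has_field_derivative D) (at 0))}"
  have R: "subalg R"
    unfolding subalg_def
  proof (intro conjI allI ballI)
    fix a show "(\<lambda>_. a) \<in> R" unfolding R_def by (auto intro!: exI[of _ 0] DERIV_const)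
  next
    fix f g assume "f \<in> R" "g \<in> R"
    then obtain D E where f: "f (True, 0) = f (False, 0)"
      "((\<lambda>t. f (True, t)) has_field_derivative D) (at 0)" "((\<lambda>t. f (False, t)) has_field_derivative D) (at 0)"
      and g: "g (True, 0) = g (False, 0)"
      "((\<lambda>t. g (True, t)) has_field_derivative E) (at 0)" "((\<lambda>t. g (False, t)) has_field_derivative E) (at 0)"
      unfolding R_def by blast
    show "(\<lambda>u. f u + g u) \<in> R" unfolding R_def
      using f(1) g(1) DERIV_add[OF f(2) g(2)] DERIV_add[OF f(3) g(3)] by auto
    have "((\<lambda>t. f (False, t) * g (False, t)) has_field_derivative D * g (True, 0) + E * f (True, 0)) (at 0)"
      using DERIV_mult[OF f(3) g(3)] f(1) g(1) by simp
    then show "(\<lambda>u. f u * g u) \<in> R" unfolding R_def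
      using f(1) g(1) DERIV_mult[OF f(2) g(2)] by auto
  qed
  define c where "c = (\<lambda>(b, t). if b then c1 t else c2 t)"
  have "(\<lambda>u. p (rp (c u) (\<lambda>_. 0))) \<in> R"
  proof (rule rep_poly_comp[OF p R])
    show "(\<lambda>u. c u k) \<in> R" for k
      unfolding R_def c_def using X(1)[of k] X(2)[of k] X(3)[of k] by auto
    show "(\<lambda>u. 0) \<in> R" by (rule subalg_const[OF R])
  qed
  then show ?thesis unfolding R_def c_def by auto
qed

end

context young_space
begin

lemma orbit_rp: "x' \<in> orbit_of n v (f_Y n Y) \<longleftrightarrow> (\<exists>X. orb X \<and> x' = rp X (\<lambda>_. 0))"
proof
  assume x: "x' \<in> orbit_of n v (f_Y n Y)"
  then obtain X where X: "X \<in> ED" "x' = rp X (\<lambda>_. 0)"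
    unfolding orbit_of_def rep_supported_Omega by blast
  then show "\<exists>X. orb X \<and> x' = rp X (\<lambda>_. 0)" using x orbit_iff[OF X(1)] by (auto simp: orb_def)
next
  assume "\<exists>X. orb X \<and> x' = rp X (\<lambda>_. 0)"
  then show "x' \<in> orbit_of n v (f_Y n Y)" using orbit_iff orb_ED by (auto simp: orb_def)
qed

lemma orb_conj:
  assumes "orb X" "inverses g h"
  shows "orb (mul (mul g X) h)"
proof -
  obtain g' h' where gh: "inverses g' h'" "X = mul (mul g' x0) h'" using assms(1) by (auto simp: orb_def)
  have "mul (mul g X) h = mul (mul (mul g g') x0) (mul h' h)" unfolding gh(2) by (simp only: mm_assoc)
  then show ?thesis unfolding orb_def using inverses_mul[OF assms(2) gh(1)] by blast
qed

lemma orb_transitive: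
  assumes "orb X" "orb X'"
  obtains g h where "inverses g h" "X' = mul (mul g X) h"
proof -
  obtain g1 h1 where 1: "inverses g1 h1" "X = mul (mul g1 x0) h1" using assms(1) by (auto simp: orb_def)
  obtain g2 h2 where 2: "inverses g2 h2" "X' = mul (mul g2 x0) h2" using assms(2) by (auto simp: orb_def)
  have "mul (mul (mul g2 h1) X) (mul g1 h2) = mul (mul g2 (mul (mul h1 g1) x0)) (mul (mul h1 g1) h2)"
    unfolding 1(2) by (simp only: mm_assoc)
  also have "\<dots> = X'" using 1(1) 2 by (simp add: inverses_def)
  finally show ?thesis using that[OF inverses_mul[OF 2(1) inverses_sym[OF 1(1)]]] by simp
qed

text \<open>For an elementary matrix \<open>E\<close> the curve \<open>1 + t E\<close> in the
  gauge group has an explicit inverse. Moving \<open>X\<close> along it stays in the orbit and has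
  velocity \<open>[E, X]\<close>.\<close>

lemma velocity_in_tangent_space:
  assumes X: "orb X" and ab: "(a, b) \<in> K0"
  shows "rp (br (unit_fun (a, b)) X) (\<lambda>_. 0) \<in> tangent_space n v (orbit_of n v (f_Y n Y)) (rp X (\<lambda>_. 0))"
  unfolding tangent_space_def
proof (intro CollectI conjI ballI impI)
  let ?E = "unit_fun (a, b) :: _ \<Rightarrow> complex"
  define \<epsilon> where "\<epsilon> = (if a = b then 1 else 0 :: complex)"
  fix p assume p: "p \<in> RC" and van: "\<forall>z\<in>orbit_of n v (f_Y n Y). p z = 0"
  have XE: "X \<in> ED" by (rule orb_ED[OF X])
  have E: "?E \<in> EG" using ab by (auto simp: unit_fun_def supported_def)
  have EE: "mul ?E ?E = (\<lambda>k. \<epsilon> * ?E k)"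
  proof
    fix k :: "(int \<times> nat) \<times> (int \<times> nat)"
    obtain c d where k: "k = (c, d)" by (cases k)
    have "mul ?E ?E k = (\<Sum>r\<in>P. if r = b then (if c = a \<and> b = a \<and> d = b then 1 else 0) else 0)"
      unfolding k mm_apply by (intro sum.cong refl) (auto simp: unit_fun_def)
    then show "mul ?E ?E k = \<epsilon> * ?E k" using ab by (auto simp: k \<epsilon>_def unit_fun_def K0_def)
  qed
  \<comment> \<open>\<open>E * E = \<epsilon> * E\<close>, so the inverse of
    \<open>1 + t * E\<close> is \<open>1 - \<tau> t * E\<close>.\<close>
  define \<tau> where "\<tau> = (\<lambda>t. t / (1 + t * \<epsilon>))"
  define g where "g = (\<lambda>t k. I1 k + t * ?E k)"
  define h where "h = (\<lambda>t k. I1 k - \<tau> t * ?E k)"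
  have inv: "inverses (g t) (h t)" if t: "1 + t * \<epsilon> \<noteq> 0" for t
  proof -
    have "\<tau> t * (1 + t * \<epsilon>) = t" using t by (simp add: \<tau>_def)
    then have \<tau>: "t - \<tau> t - t * \<tau> t * \<epsilon> = 0" by (simp add: algebra_simps)
    have "mul (g t) (h t) = (\<lambda>k. I1 k + (t - \<tau> t - t * \<tau> t * \<epsilon>) * ?E k)"
      unfolding g_def h_def using E
      by (simp add: mm_add_left mm_diff_right mm_scale_left mm_scale_right EE) (simp add: algebra_simps)
    moreover have "mul (h t) (g t) = (\<lambda>k. I1 k + (t - \<tau> t - t * \<tau> t * \<epsilon>) * ?E k)"
      unfolding g_def h_def using E
      by (simp add: mm_diff_left mm_add_right mm_scale_left mm_scale_right EE) (simp add: algebra_simps)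
    ultimately show ?thesis using \<tau> E unfolding inverses_def g_def h_def
      by (auto intro: supported_lin)
  qed
  define c1 where "c1 = (\<lambda>t k. X k + t * br ?E X k)"
  define c2 where "c2 = (\<lambda>t. mul (mul (g t) X) (h t))"
  have c2e: "c2 t = (\<lambda>k. X k + t * mul ?E X k - \<tau> t * mul X ?E k - t * \<tau> t * mul (mul ?E X) ?E k)" for t
    unfolding c2_def g_def h_def using XE E mul_EG_ED[OF E XE]
    by (simp add: mm_add_left mm_diff_right mm_scale_left mm_scale_right) (simp add: algebra_simps)
  have d\<tau>: "(\<tau> has_field_derivative 1) (at 0)"
    unfolding \<tau>_def by (auto intro!: derivative_eq_intros)
  have "\<exists>D. ((\<lambda>t. p (rp (c1 t) (\<lambda>_. 0))) has_field_derivative D) (at 0) \<and>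
      ((\<lambda>t. p (rp (c2 t) (\<lambda>_. 0))) has_field_derivative D) (at 0)"
  proof (rule derivative_depends_on_velocity[OF p, where d = "br ?E X"])
    show "c1 0 k = c2 0 k" for k by (simp add: c1_def c2e \<tau>_def)
    show "((\<lambda>t. c1 t k) has_field_derivative br ?E X k) (at 0)" for k
      unfolding c1_def by (auto intro!: derivative_eq_intros)
    show "((\<lambda>t. c2 t k) has_field_derivative br ?E X k) (at 0)" for k
      unfolding c2e br_def by (auto intro!: derivative_eq_intros d\<tau> simp: \<tau>_def)
  qed
  then obtain D where D: "((\<lambda>t. p (rp (c1 t) (\<lambda>_. 0))) has_field_derivative D) (at 0)"
      "((\<lambda>t. p (rp (c2 t) (\<lambda>_. 0))) has_field_derivative D) (at 0)" by blast
  have ev: "eventually (\<lambda>t. p (rp (c2 t) (\<lambda>_. 0)) = 0) (nhds 0)"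
  proof -
    have "isCont (\<lambda>t. 1 + t * \<epsilon>) 0" by (intro continuous_intros)
    then have "((\<lambda>t. 1 + t * \<epsilon>) \<longlongrightarrow> 1) (nhds 0)"
      using tendsto_at_iff_tendsto_nhds[of "\<lambda>t. 1 + t * \<epsilon>" 0] by (simp add: isCont_def)
    then have "eventually (\<lambda>t. 1 + t * \<epsilon> \<noteq> 0) (nhds 0)" by (rule tendsto_imp_eventually_ne) simp
    then show ?thesis
    proof eventually_elim
      case (elim t)
      then have "orb (c2 t)" unfolding c2_def by (intro orb_conj[OF X] inv)
      then show ?case using van orbit_rp by blast
    qed
  qed
  have "((\<lambda>t. p (rp (c2 t) (\<lambda>_. 0))) has_field_derivative 0) (at 0)"
    by (subst DERIV_cong_ev[OF refl ev refl]) simp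
  then have "D = 0" using D(2) DERIV_unique by blast
  then show "((\<lambda>t. p (rep_add n (rp X (\<lambda>_. 0)) (rep_scale n t (rp (br ?E X) (\<lambda>_. 0))))) has_field_derivative 0) (at 0)"
    using D(1) unfolding c1_def by (simp add: rp_linear)
qed simp

text \<open>The tangent space is defined by all equations of the orbit, so one has to exhibit an
  equation whose derivative at \<open>X\<close> is the pairing with \<open>z\<close>. Let
  \<open>\<eta> 0 = 1\<close> and let \<open>[\<eta> j, X]\<close>,
  \<open>1 \<le> j \<le> p\<close>, be the basis of velocities in a dual system. For
  \<open>X' = g X g^-1\<close> the \<open>p + 1\<close> matrices \<open>\<eta> j * X' - X *
  \<eta> j = [\<eta> j * g, X] * g^-1\<close> lie in a space of dimension \<open>p\<close>; hence
  the determinant of their pairings with \<open>z\<close> and the first \<open>p\<close> dual basis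
  vectors vanishes on the orbit. At \<open>X' = X + t A\<close> its column \<open>0\<close> is
  \<open>t\<close> times the pairings with \<open>A\<close>, while the other columns form at
  \<open>t = 0\<close> an identity matrix below a row of zeros, because \<open>z\<close>
  annihilates the velocities. So the derivative is the pairing of \<open>z\<close> with
  \<open>A\<close>.\<close>

lemma tangent_space_annihilated:
  assumes X: "orb X" and z: "z \<in> EU" and comm: "mul X z = mul z X"
    and y: "y \<in> tangent_space n v (orbit_of n v (f_Y n Y)) (rp X (\<lambda>_. 0))"
  shows "tr P z (Xt y) = 0"
proof -
  have XE: "X \<in> ED" by (rule orb_ED[OF X])
  obtain p \<sigma> w \<zeta> where ds: "dual_system X p \<sigma> w \<zeta>" using dual_system_exists[OF XE] by blast
  have pD: "p \<le> dimE" and \<sigma>E: "\<And>i. i < p \<Longrightarrow> \<sigma> i \<in> EG" and w\<sigma>: "\<And>i. i < p \<Longrightarrow> w i = br (\<sigma> i) X"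
    and dual: "\<And>i j. i < dimE \<Longrightarrow> j < dimE \<Longrightarrow> tr P (\<zeta> i) (w j) = (if i = j then 1 else 0)"
    and span: "\<And>\<xi>. \<xi> \<in> EG \<Longrightarrow> br \<xi> X = (\<lambda>k. \<Sum>i<p. tr P (\<zeta> i) (br \<xi> X) * w i k)"
    using ds unfolding dual_system_def by blast+
  have zw: "tr P z (w i) = 0" if "i < p" for i using commutant_iff[OF ds XE z] comm that by blast
  \<comment> \<open>\<open>q\<close> is the equation; row \<open>i\<close> pairs with
    \<open>\<beta> i\<close>, column \<open>j\<close> comes from \<open>\<eta> j\<close>.\<close>
  define \<beta> where "\<beta> = (\<lambda>i. case i of 0 \<Rightarrow> z | Suc i \<Rightarrow> \<zeta> i)"
  define \<eta> where "\<eta> = (\<lambda>j. case j of 0 \<Rightarrow> I1 | Suc j \<Rightarrow> \<sigma> j)"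
  have \<eta>E: "\<eta> j \<in> EG" if "j < Suc p" for j using that \<sigma>E by (auto simp: \<eta>_def split: nat.split)
  define m where "m = (\<lambda>X' i j. tr P (\<beta> i) (\<lambda>k. mul (\<eta> j) X' k - mul X (\<eta> j) k))"
  define q where "q = (\<lambda>x. det (mat (Suc p) (Suc p) (\<lambda>(i, j). m (Xt x) i j)))"
  have qp: "q \<in> RC"
    unfolding q_def m_def
    by (intro subalg_det subalg_tr subalg_diff subalg_mm subalg_const subalg_poly_funs Xt_poly)
  have van: "q z' = 0" if z': "z' \<in> orbit_of n v (f_Y n Y)" for z'
  proof -
    obtain X' where X': "orb X'" "z' = rp X' (\<lambda>_. 0)" using z' orbit_rp by blast
    obtain g h where gh: "inverses g h" "X' = mul (mul g X) h" using orb_transitive[OF X X'(1)] .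
    have g: "g \<in> EG" "h \<in> EG" "mul g h = I1" using gh(1) by (auto simp: inverses_def)
    have rel: "(\<lambda>k. mul (\<eta> j) X' k - mul X (\<eta> j) k) = mul (br (mul (\<eta> j) g) X) h" if j: "j < Suc p" for j
    proof -
      have "mul (mul X (mul (\<eta> j) g)) h = mul (mul X (\<eta> j)) (mul g h)" by (simp only: mm_assoc)
      also have "\<dots> = mul X (\<eta> j)" using g \<eta>E[OF j] XE by (simp add: mul_ED_EG)
      finally show ?thesis unfolding br_def mm_diff_left gh(2) by (simp only: mm_assoc)
    qed
    define f where "f = (\<lambda>j i. if i < p then tr P (\<zeta> i) (br (mul (\<eta> j) g) X) else 0)"
    have "f j \<in> fs.span (unit_fun ` {..<p})" for j
      unfolding span_unit_funs[OF finite_lessThan] by (auto simp: f_def supported_def)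
    moreover have "card (unit_fun ` {..<p} :: (nat \<Rightarrow> complex) set) < card {..<Suc p}"
      using card_image_le[of "{..<p}" "unit_fun :: nat \<Rightarrow> nat \<Rightarrow> complex"] by simp
    ultimately obtain c where c: "\<exists>j\<in>{..<Suc p}. c j \<noteq> 0" "\<And>i. (\<Sum>j<Suc p. c j * f j i) = 0"
      using family_dependent[of "{..<Suc p}" "unit_fun ` {..<p}" f] by auto
    have z0: "(\<Sum>j<Suc p. c j * br (mul (\<eta> j) g) X k) = 0" for k
    proof -
      have "(\<Sum>j<Suc p. c j * br (mul (\<eta> j) g) X k) = (\<Sum>j<Suc p. \<Sum>i<p. c j * f j i * w i k)"
      proof (rule sum.cong[OF refl])
        fix j assume "j \<in> {..<Suc p}"
        then have "mul (\<eta> j) g \<in> EG" using \<eta>E[of j] g(1) by auto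
        from fun_cong[OF span[OF this], of k]
        have "br (mul (\<eta> j) g) X k = (\<Sum>i<p. tr P (\<zeta> i) (br (mul (\<eta> j) g) X) * w i k)" .
        then show "c j * br (mul (\<eta> j) g) X k = (\<Sum>i<p. c j * f j i * w i k)"
          by (simp add: f_def sum_distrib_left mult.assoc)
      qed
      also have "\<dots> = (\<Sum>i<p. (\<Sum>j<Suc p. c j * f j i) * w i k)"
        by (subst sum.swap) (simp only: sum_distrib_right)
      finally show ?thesis using c(2) by simp
    qed
    have "(\<Sum>j<Suc p. c j * m X' i j) = 0" for i
    proof -
      have "(\<Sum>j<Suc p. c j * m X' i j) = (\<Sum>j<Suc p. c j * tr P (\<beta> i) (mul (br (mul (\<eta> j) g) X) h))"
        unfolding m_def using rel by (intro sum.cong refl) simp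
      also have "\<dots> = tr P (\<beta> i) (\<lambda>k. \<Sum>j<Suc p. c j * mul (br (mul (\<eta> j) g) X) h k)"
        by (rule tr_sum_right[symmetric])
      also have "(\<lambda>k. \<Sum>j<Suc p. c j * mul (br (mul (\<eta> j) g) X) h k) = mul (\<lambda>k. \<Sum>j<Suc p. c j * br (mul (\<eta> j) g) X k) h"
        by (rule mm_sum_left[symmetric])
      finally show ?thesis unfolding z0 by (simp add: mm_zero_left tr_linear)
    qed
    note kernel = this
    let ?M = "mat (Suc p) (Suc p) (\<lambda>(i, j). m X' i j)"
    let ?c = "vec (Suc p) c"
    have "?M *\<^sub>v ?c = 0\<^sub>v (Suc p)"
      using kernel by (intro eq_vecI) (simp_all add: scalar_prod_def lessThan_atLeast0[symmetric] mult.commute)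
    moreover have "?c \<noteq> 0\<^sub>v (Suc p)"
    proof
      assume "?c = 0\<^sub>v (Suc p)"
      then have "c j = 0" if "j < Suc p" for j using that by (metis index_vec index_zero_vec(1))
      then show False using c(1) by auto
    qed
    moreover have "?c \<in> carrier_vec (Suc p)" "?M \<in> carrier_mat (Suc p) (Suc p)" by simp_all
    ultimately have "det ?M = 0" using det_0_iff_vec_prod_zero by blast
    then show ?thesis unfolding q_def X'(2) Xt_rp[OF orb_ED[OF X'(1)]] .
  qed
  have yR: "y \<in> Rp" and der0: "((\<lambda>t. q (rep_add n (rp X (\<lambda>_. 0)) (rep_scale n t y))) has_field_derivative 0) (at 0)"
    using y qp van unfolding tangent_space_def by blast+
  define A where "A = Xt y"
  have AE: "A \<in> ED" by (simp add: A_def)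
  have line: "Xt (rep_add n (rp X (\<lambda>_. 0)) (rep_scale n t y)) = (\<lambda>k. X k + t * A k)" for t
  proof -
    have "rep_add n (rp X (\<lambda>_. 0)) (rep_scale n t (rp A (Zt y))) = rp (\<lambda>k. X k + t * A k) (\<lambda>k. 0 + t * Zt y k)"
      by (simp only: rp_linear)
    then have "Xt (rep_add n (rp X (\<lambda>_. 0)) (rep_scale n t (rp A (Zt y)))) = (\<lambda>k. X k + t * A k)"
      using Xt_rp[OF supported_lin(1)[OF XE supported_lin(3)[OF AE]]] by simp
    then show ?thesis using rp_inverse[OF yR] by (simp add: A_def)
  qed
  have m0: "m (\<lambda>k. X k + t * A k) i 0 = t * tr P (\<beta> i) A" for t i
  proof -
    have "(\<lambda>k. X k + t * A k) \<in> ED" by (intro supported_lin XE AE)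
    then show ?thesis using XE by (simp add: m_def \<eta>_def tr_linear)
  qed
  define N where "N = (\<lambda>t. mat (Suc p) (Suc p) (\<lambda>(i, j). if j = 0 then tr P (\<beta> i) A else m (\<lambda>k. X k + t * A k) i j))"
  have detN: "det (mat (Suc p) (Suc p) (\<lambda>(i, j). m (\<lambda>k. X k + t * A k) i j)) = t * det (N t)" for t
  proof -
    let ?M = "mat (Suc p) (Suc p) (\<lambda>(i, j). m (\<lambda>k. X k + t * A k) i j)"
    have "mat_delete ?M i 0 = mat_delete (N t) i 0" for i
      by (rule eq_matI) (auto simp: mat_delete_def N_def)
    then have cof: "cofactor ?M i 0 = cofactor (N t) i 0" for i by (simp add: cofactor_def)
    have "det ?M = (\<Sum>i<Suc p. ?M $$ (i, 0) * cofactor ?M i 0)" by (rule laplace_expansion_column) auto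
    also have "\<dots> = (\<Sum>i<Suc p. t * (N t $$ (i, 0) * cofactor (N t) i 0))"
      by (intro sum.cong refl) (simp add: cof m0 N_def)
    also have "\<dots> = t * (\<Sum>i<Suc p. N t $$ (i, 0) * cofactor (N t) i 0)" by (simp only: sum_distrib_left)
    also have "(\<Sum>i<Suc p. N t $$ (i, 0) * cofactor (N t) i 0) = det (N t)"
      by (rule laplace_expansion_column[symmetric]) (auto simp: N_def)
    finally show ?thesis .
  qed
  have detN0: "det (N 0) = tr P z A"
  proof -
    have ent: "m X i (Suc j) = (if i = 0 then 0 else if i = Suc j then 1 else 0)" if "i < Suc p" "j < p" for i j
    proof -
      have "m X i (Suc j) = tr P (\<beta> i) (w j)" using w\<sigma>[OF that(2)] by (simp add: m_def \<eta>_def br_def)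
      then show ?thesis using zw[OF that(2)] dual[of "i - 1" j] that pD by (cases i) (auto simp: \<beta>_def)
    qed
    have "det (N 0) = prod_list (diag_mat (N 0))"
    proof (rule det_lower_triangular)
      fix i j assume "i < j" "j < Suc p"
      then show "N 0 $$ (i, j) = 0" using ent[of i "j - 1"] by (cases j) (auto simp: N_def)
    qed (simp add: N_def)
    also have "diag_mat (N 0) = tr P z A # map (\<lambda>i. 1) [1..<Suc p]"
    proof -
      have "N 0 $$ (i, i) = 1" if "i \<in> set [1..<Suc p]" for i
      proof (cases i)
        case (Suc j)
        then have "j < p" using that by auto
        then show ?thesis using Suc ent[of "Suc j" j] by (simp add: N_def)
      qed (use that in auto)
      moreover have "N 0 $$ (0, 0) = tr P z A" by (simp add: N_def \<beta>_def)
      moreover have "diag_mat (N 0) = map (\<lambda>i. N 0 $$ (i, i)) (0 # [1..<Suc p])"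
        by (simp add: diag_mat_def N_def upt_conv_Cons del: upt_Suc)
      ultimately show ?thesis by simp
    qed
    also have "prod_list (tr P z A # map (\<lambda>i. 1) [1..<Suc p]) = tr P z A" by (simp add: map_replicate_const)
    finally show ?thesis .
  qed
  have cont: "isCont (\<lambda>t. det (N t)) 0"
  proof (rule curve_funs_isCont)
    have tt: "(\<lambda>t. X k + t * A k) \<in> curve_funs" for k
      by (intro subalg_add subalg_mult subalg_const subalg_poly_funs poly_funs.coord) simp
    have "(\<lambda>t. if j = 0 then tr P (\<beta> i) A else m (\<lambda>k. X k + t * A k) i j) \<in> curve_funs" for i j
    proof (cases "j = 0")
      case True
      then show ?thesis by (simp add: poly_funs.const)
    next
      case False
      have "(\<lambda>t. m (\<lambda>k. X k + t * A k) i j) \<in> curve_funs" unfolding m_def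
        by (intro subalg_tr subalg_diff subalg_mm subalg_const subalg_poly_funs tt)
      then show ?thesis using False by simp
    qed
    then show "(\<lambda>t. det (N t)) \<in> curve_funs" unfolding N_def
      by (intro subalg_det subalg_poly_funs)
  qed
  have "((\<lambda>t. t * det (N t)) has_field_derivative det (N 0)) (at 0)"
  proof -
    have "(\<lambda>t. (t * det (N t) - 0 * det (N 0)) / (t - 0)) \<midarrow>0\<rightarrow> det (N 0)"
    proof (rule Lim_transform_eventually)
      show "(\<lambda>t. det (N t)) \<midarrow>0\<rightarrow> det (N 0)" using cont by (simp add: isCont_def)
      show "\<forall>\<^sub>F t in at 0. det (N t) = (t * det (N t) - 0 * det (N 0)) / (t - 0)"
        by (auto simp: eventually_at_filter)
    qed
    then show ?thesis unfolding has_field_derivative_iff by simp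
  qed
  moreover have "q (rep_add n (rp X (\<lambda>_. 0)) (rep_scale n t y)) = t * det (N t)" for t
    unfolding q_def line by (rule detN)
  ultimately have "((\<lambda>t. q (rep_add n (rp X (\<lambda>_. 0)) (rep_scale n t y))) has_field_derivative det (N 0)) (at 0)" by simp
  then have "det (N 0) = 0" using der0 DERIV_unique by blast
  then show ?thesis using detN0 by (simp add: A_def)
qed

text \<open>Orthogonality to the velocities of elementary matrices already forces \<open>x''\<close>
  to commute with \<open>x'\<close>; the converse is
  \<open>tangent_space_annihilated\<close>.\<close>

theorem conormal_eq:
  "conormal n v (f_Y n Y) = {rp X Z | X Z. orb X \<and> Z \<in> EU \<and> mul X Z = mul Z X}"
proof (intro equalityI subsetI)
  fix x assume "x \<in> conormal n v (f_Y n Y)"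
  then obtain x' Z where x': "x' \<in> orbit_of n v (f_Y n Y)" and Z: "Z \<in> EU" and x: "x = rep_add n x' (rp (\<lambda>_. 0) Z)"
    and o: "\<And>y. y \<in> tangent_space n v (orbit_of n v (f_Y n Y)) x' \<Longrightarrow> form n (rp (\<lambda>_. 0) Z) y = 0"
    unfolding conormal_def rep_supported_Omega_bar by blast
  obtain X where X: "orb X" "x' = rp X (\<lambda>_. 0)" using x' orbit_rp by blast
  have XE: "X \<in> ED" by (rule orb_ED[OF X(1)])
  let ?A = "\<lambda>k. mul X Z k - mul Z X k"
  have A: "?A \<in> EG" using mul_ED_EU[OF XE Z] mul_EU_ED[OF Z XE] by (intro supported_lin)
  have "?A = (\<lambda>_. 0)"
  proof (rule trace_separates_EG[OF A])
    fix a b assume ab: "(a, b) \<in> K0"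
    let ?E = "unit_fun (a, b) :: _ \<Rightarrow> complex"
    have E: "?E \<in> EG" using ab by (auto simp: unit_fun_def supported_def)
    have "form n (rp (\<lambda>_. 0) Z) (rp (br ?E X) (\<lambda>_. 0)) = 0"
      using o velocity_in_tangent_space[OF X(1) ab] X(2) by blast
    then have "tr P Z (br ?E X) = 0" using form_rp[OF Z rp_Rp] Xt_rp[OF br_ED[OF E XE]] by simp
    then show "tr P ?E ?A = 0" by (simp add: tr_br)
  qed
  then have "mul X Z = mul Z X" by (auto simp: fun_eq_iff)
  then show "x \<in> {rp X Z | X Z. orb X \<and> Z \<in> EU \<and> mul X Z = mul Z X}"
    using X Z x rep_add_rp by blast
next
  fix x assume "x \<in> {rp X Z | X Z. orb X \<and> Z \<in> EU \<and> mul X Z = mul Z X}"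
  then obtain X Z where XZ: "orb X" "Z \<in> EU" "mul X Z = mul Z X" "x = rp X Z" by blast
  have "form n (rp (\<lambda>_. 0) Z) y = 0" if y: "y \<in> tangent_space n v (orbit_of n v (f_Y n Y)) (rp X (\<lambda>_. 0))" for y
  proof -
    have "y \<in> Rp" using y by (simp add: tangent_space_def)
    then show ?thesis using form_rp[OF XZ(2)] tangent_space_annihilated[OF XZ(1-3) y] by simp
  qed
  moreover have "rp X (\<lambda>_. 0) \<in> orbit_of n v (f_Y n Y)" using orbit_rp XZ(1) by blast
  moreover have "rp (\<lambda>_. 0) Z \<in> rep_supported n v (Omega_bar n)" unfolding rep_supported_Omega_bar using XZ(2) by blast
  ultimately show "x \<in> conormal n v (f_Y n Y)"
    unfolding conormal_def XZ(4) using rep_add_rp[of X Z]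
    by (intro CollectI exI[of _ "rp X (\<lambda>_. 0)"] exI[of _ "rp (\<lambda>_. 0) Z"]) auto
qed

end

section \<open>Irreducibility of the conormal bundles\<close>

context graded_space
begin

lemma conj_mul:
  assumes gh: "inverses g h" and a: "a \<in> supported (P \<times> P)" and b: "b \<in> supported (P \<times> P)"
  shows "mul (mul (mul g a) h) (mul (mul g b) h) = mul (mul g (mul a b)) h"
proof -
  have "mul (mul (mul g a) h) (mul (mul g b) h) = mul (mul g a) (mul (mul h g) (mul b h))"
    by (simp only: mm_assoc)
  also have "mul h g = I1" using gh by (simp add: inverses_def)
  also have "mul I1 (mul b h) = mul (mul I1 b) h" by (simp only: mm_assoc)
  also have "mul I1 b = b" by (rule mm_one(1)[OF finite_P b])
  finally show ?thesis by (simp only: mm_assoc)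
qed

lemma conj_inverse:
  assumes gh: "inverses g h" and a: "a \<in> supported (P \<times> P)"
  shows "mul (mul h (mul (mul g a) h)) g = a"
proof -
  have "mul (mul h (mul (mul g a) h)) g = mul (mul (mul h g) a) (mul h g)" by (simp only: mm_assoc)
  then show ?thesis using gh mm_one[OF finite_P a] by (simp add: inverses_def)
qed

lemma inverses_scale:
  assumes "inverses (\<lambda>k. c * s k) h" "c \<noteq> 0"
  shows "inverses s (\<lambda>k. c * h k)"
proof -
  have "s = (\<lambda>k. inverse c * (c * s k))" using assms(2) by (simp add: mult.assoc[symmetric])
  then have "s \<in> EG" using assms(1) supported_lin(3) by (metis inverses_def)
  then show ?thesis using assms unfolding inverses_def mm_scale_left mm_scale_right
    by (auto intro: supported_lin)
qed

end

context young_space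
begin

text \<open>The point with \<open>x'\<close> conjugate to \<open>x0\<close> under \<open>g\<close>;
  the fibre coordinate \<open>z\<close> is taken over \<open>x0\<close>, where its constraint is
  linear and does not depend on \<open>g\<close>.\<close>

definition pt where
  "pt g h z J = (rp (mul (mul g x0) h) (mul (mul g z) h), fr J)"

text \<open>The conormal bundle times the framings, by \<open>conormal_eq\<close>.\<close>

definition CF :: "framed_rep set" where
  "CF = {(rp X Z, fr J) | X Z J. orb X \<and> Z \<in> EU \<and> mul X Z = mul Z X \<and> J \<in> EJ}"

lemma pt_CF:
  assumes gh: "inverses g h" and z: "z \<in> EU" "mul x0 z = mul z x0" and J: "J \<in> EJ"
  shows "pt g h z J \<in> CF"
proof -
  have s: "x0 \<in> supported (P \<times> P)" "z \<in> supported (P \<times> P)" using ED_P EU_P z by auto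
  have "orb (mul (mul g x0) h)" using gh by (auto simp: orb_def)
  moreover have "mul (mul g z) h \<in> EU" using gh z by (auto simp: inverses_def)
  moreover have "mul (mul (mul g x0) h) (mul (mul g z) h) = mul (mul (mul g z) h) (mul (mul g x0) h)"
    using conj_mul[OF gh s] conj_mul[OF gh s(2,1)] z(2) by simp
  ultimately show ?thesis unfolding CF_def pt_def using J by blast
qed

lemma CF_cases:
  assumes "x \<in> CF"
  obtains g h z J where "inverses g h" "z \<in> EU" "mul x0 z = mul z x0" "J \<in> EJ" "x = pt g h z J"
proof -
  obtain X Z J where x: "orb X" "Z \<in> EU" "mul X Z = mul Z X" "J \<in> EJ" "x = (rp X Z, fr J)"
    using assms unfolding CF_def by blast
  obtain g h where gh: "inverses g h" "X = mul (mul g x0) h" using x(1) by (auto simp: orb_def)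
  note hg = inverses_sym[OF gh(1)]
  define z where "z = mul (mul h Z) g"
  have s: "X \<in> supported (P \<times> P)" "Z \<in> supported (P \<times> P)" "x0 \<in> supported (P \<times> P)"
    using ED_P EU_P x(2) orb_ED[OF x(1)] by auto
  have x0: "x0 = mul (mul h X) g" unfolding gh(2) by (rule conj_inverse[OF gh(1) s(3), symmetric])
  have "z \<in> EU" using hg x(2) by (auto simp: z_def inverses_def)
  moreover have "mul x0 z = mul z x0"
    unfolding x0 z_def using conj_mul[OF hg s(1,2)] conj_mul[OF hg s(2,1)] x(3) by simp
  moreover have "mul (mul g z) h = Z" unfolding z_def by (rule conj_inverse[OF hg s(2)])
  ultimately show ?thesis using that[OF gh(1), of z J] x gh(2) by (simp add: pt_def)
qed

lemma pt_subalg: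
  assumes f: "f \<in> FC" and R: "subalg R" and "\<And>k. (\<lambda>u. g u k) \<in> R" "\<And>k. (\<lambda>u. h u k) \<in> R"
    "\<And>k. (\<lambda>u. z u k) \<in> R" "\<And>k. (\<lambda>u. J u k) \<in> R"
  shows "(\<lambda>u. f (pt (g u) (h u) (z u) (J u))) \<in> R"
  unfolding pt_def
  by (rule framed_poly_comp[OF f R]) (intro subalg_mm subalg_const R assms)+

text \<open>Two points of the bundle lie on a rational curve inside it, the image of the segment
  between their parameters \<open>(g, z, J)\<close>. A polynomial that does not vanish at one of
  its points vanishes at only finitely many, so a product of two such polynomials cannot vanish
  identically.\<close>

theorem CF_prime:
  assumes f: "f \<in> FC" and f': "f' \<in> FC" and zero: "\<And>x. x \<in> CF \<Longrightarrow> f x * f' x = 0"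
  shows "(\<forall>x\<in>CF. f x = 0) \<or> (\<forall>x\<in>CF. f' x = 0)"
proof (rule ccontr)
  assume "\<not> ?thesis"
  then obtain a b where a: "a \<in> CF" "f a \<noteq> 0" and b: "b \<in> CF" "f' b \<noteq> 0" by blast
  obtain g1 h1 z1 J1 where 1: "inverses g1 h1" "z1 \<in> EU" "mul x0 z1 = mul z1 x0" "J1 \<in> EJ" "a = pt g1 h1 z1 J1"
    using CF_cases[OF a(1)] .
  obtain g2 h2 z2 J2 where 2: "inverses g2 h2" "z2 \<in> EU" "mul x0 z2 = mul z2 x0" "J2 \<in> EJ" "b = pt g2 h2 z2 J2"
    using CF_cases[OF b(1)] .
  define g where "g = (\<lambda>t k. (1 - t) * g1 k + t * g2 k)"
  define z where "z = (\<lambda>t k. (1 - t) * z1 k + t * z2 k)"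
  define J where "J = (\<lambda>t k. (1 - t) * J1 k + t * J2 k)"
  define Q where "Q = (\<lambda>t. dlt (g t))"
  have lin: "(\<lambda>t. (1 - t) * c + t * d) \<in> curve_funs" for c d
    by (intro subalg_add subalg_mult subalg_diff subalg_const subalg_poly_funs poly_funs.coord) auto
  have gE: "g t \<in> EG" for t unfolding g_def using 1(1) 2(1) by (intro supported_lin) (auto simp: inverses_def)
  have Q: "Q \<in> curve_funs" unfolding Q_def by (intro subalg_dlt subalg_poly_funs) (simp add: g_def lin)
  let ?R = "rational_funs {\<lambda>t. t} Q"
  have R: "subalg ?R" by (rule subalg_rational_funs[OF Q])
  define \<gamma> where "\<gamma> = (\<lambda>t. pt (g t) (minv (g t)) (z t) (J t))"
  have rat: "(\<lambda>t. F (\<gamma> t)) \<in> ?R" if F: "F \<in> FC" for F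
    unfolding \<gamma>_def
  proof (rule pt_subalg[OF F R])
    show "(\<lambda>t. minv (g t) k) \<in> ?R" for k
      unfolding Q_def by (rule rational_minv) (simp add: g_def lin)
  qed (simp_all add: g_def z_def J_def lin poly_imp_rational)
  have in_CF: "\<gamma> t \<in> CF" if "Q t \<noteq> 0" for t
    unfolding \<gamma>_def
  proof (rule pt_CF)
    show "inverses (g t) (minv (g t))" using inverses_minv[OF gE] that by (simp add: Q_def)
    show "z t \<in> EU" "J t \<in> EJ" unfolding z_def J_def using 1 2 by (auto intro!: supported_lin)
    show "mul x0 (z t) = mul (z t) x0" unfolding z_def
      by (simp add: mm_add_left mm_add_right mm_scale_left mm_scale_right 1(3) 2(3))
  qed
  have "g 0 = g1" "g 1 = g2" "z 0 = z1" "z 1 = z2" "J 0 = J1" "J 1 = J2" by (simp_all add: g_def z_def J_def)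
  then have ends: "\<gamma> 0 = a" "\<gamma> 1 = b" "Q 0 \<noteq> 0" "Q 1 \<noteq> 0"
    using 1(1,5) 2(1,5) inverses_dlt by (simp_all add: \<gamma>_def Q_def)
  have fin: "finite {t. Q t = 0 \<or> f (\<gamma> t) = 0}"
    by (rule rational_curve_finite_zeros[OF Q rat[OF f], of 0]) (use ends a in auto)
  have fin': "finite {t. Q t = 0 \<or> f' (\<gamma> t) = 0}"
    by (rule rational_curve_finite_zeros[OF Q rat[OF f'], of 1]) (use ends b in auto)
  have "UNIV = {t. Q t = 0 \<or> f (\<gamma> t) = 0} \<union> {t. Q t = 0 \<or> f' (\<gamma> t) = 0}"
  proof -
    have "Q t = 0 \<or> f (\<gamma> t) = 0 \<or> f' (\<gamma> t) = 0" for t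
    proof (cases "Q t = 0")
      case False
      then show ?thesis using zero[OF in_CF[OF False]] by simp
    qed simp
    then show ?thesis by blast
  qed
  then have "finite (UNIV :: complex set)" using finite_UnI[OF fin fin'] by (rule ssubst)
  then show False using infinite_UNIV_char_0[where 'a = complex] by simp
qed

end

section \<open>Dimension of the conormal bundles\<close>

locale young_dual = young_space n v Y pos for n v Y pos +
  fixes p :: nat and \<sigma> w \<zeta> :: "nat \<Rightarrow> graded_matrix" and kj :: "nat \<Rightarrow> int \<times> nat"
  assumes ds: "dual_system x0 p \<sigma> w \<zeta>" and kj: "bij_betw kj {..<card KJ} KJ"
begin

abbreviation dimF :: nat where "dimF \<equiv> dimE + card KJ"

lemma pD: "p \<le> dimE" and \<sigma>E: "\<And>i. i < p \<Longrightarrow> \<sigma> i \<in> EG" and w\<sigma>: "\<And>i. i < p \<Longrightarrow> w i = br (\<sigma> i) x0"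
  and wE: "\<And>i. i < dimE \<Longrightarrow> w i \<in> ED" and \<zeta>E: "\<And>i. i < dimE \<Longrightarrow> \<zeta> i \<in> EU"
  and dual: "\<And>i j. i < dimE \<Longrightarrow> j < dimE \<Longrightarrow> tr P (\<zeta> i) (w j) = (if i = j then 1 else 0)"
  and span: "\<And>\<xi>. \<xi> \<in> EG \<Longrightarrow> br \<xi> x0 = (\<lambda>k. \<Sum>i<p. tr P (\<zeta> i) (br \<xi> x0) * w i k)"
  using ds unfolding dual_system_def by blast+

text \<open>The first \<open>p\<close> parameters are directions in the gauge group transversal to
  the stabilizer of \<open>x0\<close>, the parameters from \<open>p\<close> up to
  \<open>dimE\<close> are coordinates on the commutant of \<open>x0\<close>, and the remaining ones
  are the framing. Hence the dimension of the bundle is that of \<open>ED\<close> plus that of the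
  framings, whatever the orbit.\<close>

definition slice :: "(nat \<Rightarrow> complex) \<Rightarrow> graded_matrix" where
  "slice u = (\<lambda>k. I1 k + (\<Sum>i<p. u i * \<sigma> i k))"

definition fibre :: "(nat \<Rightarrow> complex) \<Rightarrow> graded_matrix" where
  "fibre u = (\<lambda>k. \<Sum>i<dimE. (if i < p then 0 else u i) * \<zeta> i k)"

definition framing :: "(nat \<Rightarrow> complex) \<Rightarrow> graded_vector" where
  "framing u = (\<lambda>q. \<Sum>i<card KJ. u (dimE + i) * unit_fun (kj i) q)"

definition chart :: "(nat \<Rightarrow> complex) \<Rightarrow> framed_rep" where
  "chart u = pt (slice u) (minv (slice u)) (fibre u) (framing u)"

lemma slice_EG: "slice u \<in> EG"
  unfolding slice_def using \<sigma>E by (intro supported_lin) auto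

lemma fibre_EU: "fibre u \<in> EU"
  unfolding fibre_def using \<zeta>E by (intro supported_lin) auto

lemma framing_EJ: "framing u \<in> EJ"
  unfolding framing_def
proof (rule supported_lin)
  fix i assume "i \<in> {..<card KJ}"
  then have "kj i \<in> KJ" using kj by (auto simp: bij_betw_def)
  then show "unit_fun (kj i) \<in> EJ" by (auto simp: unit_fun_def supported_def)
qed

lemma fibre_commutes: "mul x0 (fibre u) = mul (fibre u) x0"
  unfolding commutant_iff[OF ds x0_ED fibre_EU]
proof (intro allI impI)
  fix j assume j: "j < p"
  have "tr P (fibre u) (w j) = (\<Sum>i<dimE. (if i < p then 0 else u i) * tr P (\<zeta> i) (w j))"
    unfolding fibre_def by (subst tr_commute, subst tr_sum_right) (simp add: tr_commute)
  also have "\<dots> = 0" using j pD dual by (intro sum.neutral) auto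
  finally show "tr P (fibre u) (w j) = 0" .
qed

lemma fibre_expand:
  assumes "z \<in> EU" "mul x0 z = mul z x0" "\<And>i. p \<le> i \<Longrightarrow> i < dimE \<Longrightarrow> u i = tr P z (w i)"
  shows "fibre u = z"
proof -
  have "tr P z (w i) = 0" if "i < p" for i using commutant_iff[OF ds x0_ED assms(1)] assms(2) that by blast
  then have "fibre u = (\<lambda>k. \<Sum>i<dimE. tr P z (w i) * \<zeta> i k)"
    unfolding fibre_def using assms(3) by (intro ext sum.cong) auto
  then show ?thesis using dual_expand[OF ds assms(1)] by (rule trans[OF _ sym])
qed

lemma framing_expand:
  assumes "J \<in> EJ" "\<And>i. i < card KJ \<Longrightarrow> u (dimE + i) = J (kj i)"
  shows "framing u = J"
proof -
  have fin: "finite KJ" by (simp add: KJ_def)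
  have "framing u q = J q" for q
  proof -
    have "framing u q = (\<Sum>i<card KJ. J (kj i) * unit_fun (kj i) q)"
      unfolding framing_def using assms(2) by (intro sum.cong) auto
    also have "\<dots> = (\<Sum>k\<in>KJ. J k * unit_fun k q)"
      by (rule sum.reindex_bij_betw[OF kj])
    also have "\<dots> = J q" using fun_cong[OF supported_expand[OF fin assms(1)], of q] by (simp add: sum_fun_apply)
    finally show ?thesis .
  qed
  then show ?thesis by auto
qed

lemma chart_CF: "dlt (slice u) \<noteq> 0 \<Longrightarrow> chart u \<in> CF"
  unfolding chart_def by (intro pt_CF inverses_minv slice_EG fibre_EU fibre_commutes framing_EJ)

subsection \<open>The charts are dense\<close>

text \<open>If \<open>b = h s\<close> stabilizes \<open>x0\<close>, where \<open>h\<close> is the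
  inverse of \<open>g\<close> and \<open>s\<close> is in the slice, then
  \<open>g = s b^-1\<close>, and \<open>b^-1\<close> can be absorbed in the fibre
  coordinate.\<close>

lemma chart_through:
  assumes hh: "inverses g h" and u: "dlt (slice u) \<noteq> 0"
    and stab: "\<And>i. i < p \<Longrightarrow> tr P (\<zeta> i) (br (mul h (slice u)) x0) = 0"
    and z: "z \<in> EU" "mul x0 z = mul z x0" and J: "J \<in> EJ"
  shows "\<exists>u'. dlt (slice u') \<noteq> 0 \<and> pt g h z J = chart u'"
proof -
  let ?s = "slice u"
  let ?s' = "minv ?s"
  let ?b = "mul h ?s"
  let ?b' = "mul ?s' g"
  have s: "inverses ?s ?s'" by (rule inverses_minv[OF slice_EG u])
  have b: "inverses ?b ?b'" by (rule inverses_mul[OF inverses_sym[OF hh] s])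
  have "br ?b x0 = (\<lambda>k. \<Sum>i<p. tr P (\<zeta> i) (br ?b x0) * w i k)"
    using span b by (simp add: inverses_def)
  also have "\<dots> = (\<lambda>_. 0)" using stab by simp
  finally have bx: "mul ?b x0 = mul x0 ?b" unfolding br_def by (auto simp: fun_eq_iff)
  have ids: "mul g h = I1" "mul h g = I1" "mul ?s ?s' = I1" "mul ?s' ?s = I1" "h \<in> EG" "g \<in> EG" "?s \<in> EG" "?s' \<in> EG"
    using hh s by (simp_all add: inverses_def)
  have gb: "mul g ?b = ?s"
  proof -
    have "mul g ?b = mul (mul g h) ?s" by (simp only: mm_assoc)
    then show ?thesis using ids by simp
  qed
  have b'h: "mul ?b' h = ?s'"
  proof -
    have "mul ?b' h = mul ?s' (mul g h)" by (simp only: mm_assoc)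
    then show ?thesis using ids by simp
  qed
  define z' where "z' = mul (mul ?b' z) ?b"
  have zs: "z \<in> supported (P \<times> P)" "x0 \<in> supported (P \<times> P)" using EU_P z(1) ED_P by auto
  have bE: "?b \<in> EG" "?b' \<in> EG" "mul ?b ?b' = I1" "mul ?b' ?b = I1" using b by (simp_all add: inverses_def)
  have x0b: "x0 = mul (mul ?b' x0) ?b"
  proof -
    have "mul (mul ?b' x0) ?b = mul ?b' (mul x0 ?b)" by (rule mm_assoc)
    also have "\<dots> = mul ?b' (mul ?b x0)" by (simp only: bx)
    also have "\<dots> = mul (mul ?b' ?b) x0" by (simp only: mm_assoc)
    finally show ?thesis using bE by simp
  qed
  have z': "z' \<in> EU" using bE z(1) by (auto simp: z'_def)
  have cz': "mul x0 z' = mul z' x0"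
    using conj_mul[OF inverses_sym[OF b] zs(2,1)] conj_mul[OF inverses_sym[OF b] zs]
    by (simp only: x0b[symmetric] z'_def[symmetric] z(2))
  define u' where "u' = (\<lambda>i. if i < p then u i else if i < dimE then tr P z' (w i) else J (kj (i - dimE)))"
  have sl: "slice u' = ?s" by (simp add: slice_def u'_def)
  have fi: "fibre u' = z'" using pD by (intro fibre_expand[OF z' cz']) (auto simp: u'_def)
  have fj: "framing u' = J" using pD by (intro framing_expand[OF J]) (auto simp: u'_def)
  have "mul (mul ?s x0) ?s' = mul (mul g x0) h"
  proof -
    have "mul (mul (mul g ?b) x0) ?s' = mul (mul g (mul ?b x0)) ?s'" by (simp only: mm_assoc)
    from this[unfolded gb] have "mul (mul ?s x0) ?s' = mul (mul g (mul ?b x0)) ?s'" .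
    also have "\<dots> = mul (mul g (mul x0 ?b)) ?s'" by (simp only: bx)
    also have "\<dots> = mul (mul g x0) (mul ?b ?s')" by (simp only: mm_assoc)
    also have "mul ?b ?s' = mul h (mul ?s ?s')" by (simp only: mm_assoc)
    also have "\<dots> = h" using ids by simp
    finally show ?thesis .
  qed
  moreover have "mul (mul ?s z') ?s' = mul (mul g z) h"
  proof -
    have "mul (mul (mul g ?b) z') ?s' = mul (mul g (mul (mul ?b ?b') z)) (mul ?b ?s')"
      unfolding z'_def by (simp only: mm_assoc)
    from this[unfolded gb] have "mul (mul ?s z') ?s' = mul (mul g (mul (mul ?b ?b') z)) (mul ?b ?s')" .
    also have "mul ?b ?s' = mul h (mul ?s ?s')" by (simp only: mm_assoc)
    also have "mul ?b ?b' = I1" by (rule bE(3))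
    finally show ?thesis using ids z(1) by simp
  qed
  ultimately have "pt g h z J = chart u'" unfolding chart_def pt_def sl fi fj by simp
  then show ?thesis using u sl by (intro exI[of _ u']) simp
qed

text \<open>The elements \<open>s\<close> of the slice for which \<open>h s\<close> stabilizes
  \<open>x0\<close> are the solutions of a system of \<open>p\<close> linear equations, which is the
  identity for \<open>h = 1\<close>. So it can be solved for almost all points of the line from
  \<open>1\<close> to a given \<open>h\<close>, and a function that vanishes on the chart vanishes
  at the end of the line.\<close>

theorem chart_dense:
  assumes f: "f \<in> FC" and zero: "\<And>u. dlt (slice u) \<noteq> 0 \<Longrightarrow> f (chart u) = 0"
  shows "\<forall>x\<in>CF. f x = 0"
proof
  fix x assume "x \<in> CF"
  then obtain g h z J where gh: "inverses g h" and z: "z \<in> EU" "mul x0 z = mul z x0" and J: "J \<in> EJ"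
    and x: "x = pt g h z J" using CF_cases by metis
  have gE: "g \<in> EG" "h \<in> EG" using gh by (auto simp: inverses_def)
  define H where "H = (\<lambda>t k. I1 k + t * (h k - I1 k))"
  define Q where "Q = (\<lambda>t. dlt (H t))"
  have HE: "H t \<in> EG" for t unfolding H_def using gE by (intro supported_lin) auto
  have Hp: "(\<lambda>t. H t k) \<in> curve_funs" for k
    unfolding H_def by (intro subalg_add subalg_mult subalg_const subalg_poly_funs poly_funs.coord) auto
  have Qp: "Q \<in> curve_funs" unfolding Q_def by (intro subalg_dlt subalg_poly_funs Hp)
  define K where "K = (\<lambda>t i j. tr P (\<zeta> i) (br (mul (H t) (\<sigma> j)) x0))"
  define \<kappa> where "\<kappa> = (\<lambda>t i. tr P (\<zeta> i) (br (H t) x0))"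
  have Kp: "(\<lambda>t. K t i j) \<in> curve_funs" and \<kappa>p: "(\<lambda>t. \<kappa> t i) \<in> curve_funs" for i j
    unfolding K_def \<kappa>_def br_def
    by (intro subalg_tr subalg_diff subalg_mm subalg_const subalg_poly_funs Hp)+
  define M where "M = (\<lambda>t. mat p p (\<lambda>(i, j). K t i j))"
  define dK where "dK = (\<lambda>t. det (M t))"
  define c where "c = (\<lambda>t j. - (\<Sum>i<p. adj_mat (M t) $$ (j, i) * \<kappa> t i))"
  have dKp: "dK \<in> curve_funs" unfolding dK_def M_def by (intro subalg_det subalg_poly_funs Kp)
  have cp: "(\<lambda>t. c t j) \<in> curve_funs" if "j < p" for j
  proof -
    have "(\<lambda>t. 0 - (\<Sum>i<p. adj_mat (M t) $$ (j, i) * \<kappa> t i)) \<in> curve_funs"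
      unfolding M_def
      by (intro subalg_diff subalg_sum subalg_mult subalg_adj_mat subalg_const subalg_poly_funs Kp \<kappa>p that) auto
    then show ?thesis by (simp add: c_def)
  qed
  \<comment> \<open>The solution by Cramer's rule, multiplied by the determinant
    \<open>dK t\<close> to remain polynomial in \<open>t\<close>.\<close>
  define S where "S = (\<lambda>t k. dK t * I1 k + (\<Sum>j<p. c t j * \<sigma> j k))"
  define dS where "dS = (\<lambda>t. dlt (S t))"
  have Sp: "(\<lambda>t. S t k) \<in> curve_funs" for k
    unfolding S_def by (intro subalg_add subalg_sum subalg_mult subalg_const subalg_poly_funs dKp cp) auto
  have dSp: "dS \<in> curve_funs" unfolding dS_def by (intro subalg_dlt subalg_poly_funs Sp)
  have H0: "H 0 = I1" by (simp add: H_def)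
  have M0: "M 0 = 1\<^sub>m p"
  proof (rule eq_matI)
    fix i j assume ij: "i < dim_row (1\<^sub>m p)" "j < dim_col (1\<^sub>m p)"
    then have "mul I1 (\<sigma> j) = \<sigma> j" using \<sigma>E by simp
    then have "K 0 i j = tr P (\<zeta> i) (w j)" using w\<sigma>[of j] ij by (simp add: K_def H0)
    then show "M 0 $$ (i, j) = 1\<^sub>m p $$ (i, j)" using dual[of i j] ij pD by (simp add: M_def)
  qed (simp_all add: M_def)
  have "\<kappa> 0 i = 0" for i by (simp add: \<kappa>_def H0 br_one tr_linear)
  then have c0: "c 0 j = 0" for j by (simp add: c_def)
  have d0: "dK 0 = 1" by (simp add: dK_def M0)
  have "S 0 = I1" by (simp add: S_def c0 d0)
  then have dS0: "dS 0 = 1" by (simp add: dS_def)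
  have good: "f (pt (minv (H t)) (H t) z J) = 0" if t: "Q t \<noteq> 0" "dK t \<noteq> 0" "dS t \<noteq> 0" for t
  proof -
    define u where "u = (\<lambda>j. c t j / dK t)"
    have SE: "S t \<in> EG" unfolding S_def using \<sigma>E by (intro supported_lin) auto
    have Su: "S t = (\<lambda>k. dK t * slice u k)"
      using t(2) by (auto simp: S_def slice_def u_def sum_distrib_left algebra_simps)
    have "inverses (S t) (minv (S t))" using inverses_minv[OF SE] t(3) by (simp add: dS_def)
    then have "inverses (slice u) (\<lambda>k. dK t * minv (S t) k)" unfolding Su using t(2) by (rule inverses_scale)
    then have du: "dlt (slice u) \<noteq> 0" by (rule inverses_dlt)
    have Hinv: "inverses (minv (H t)) (H t)"
      using inverses_sym[OF inverses_minv[OF HE]] t(1) by (simp add: Q_def)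
    have stab: "tr P (\<zeta> i) (br (mul (H t) (slice u)) x0) = 0" if i: "i < p" for i
    proof -
      have "mul (H t) (slice u) = (\<lambda>k. H t k + (\<Sum>j<p. u j * mul (H t) (\<sigma> j) k))"
        unfolding slice_def mm_add_right mm_sum_right using HE by simp
      then have "tr P (\<zeta> i) (br (mul (H t) (slice u)) x0) = \<kappa> t i + (\<Sum>j<p. u j * K t i j)"
        by (simp add: br_linear br_sum tr_linear tr_sum_right \<kappa>_def K_def)
      also have "(\<Sum>j<p. u j * K t i j) = - \<kappa> t i"
      proof -
        have "(\<Sum>j<p. K t i j * adj_mat (M t) $$ (j, l)) = (if i = l then dK t else 0)" if l: "l < p" for l
        proof -
          have M: "M t \<in> carrier_mat p p" by (simp add: M_def)
          have "(M t * adj_mat (M t)) $$ (i, l) = (\<Sum>j<p. K t i j * adj_mat (M t) $$ (j, l))"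
            using adj_mat(1)[OF M] i l by (simp add: M_def scalar_prod_def lessThan_atLeast0)
          then show ?thesis unfolding adj_mat(2)[OF M] using i l by (cases "i = l") (auto simp: dK_def)
        qed
        note adj = this
        have "(\<Sum>j<p. c t j * K t i j) = - (\<Sum>j<p. \<Sum>l<p. K t i j * adj_mat (M t) $$ (j, l) * \<kappa> t l)"
          unfolding c_def by (simp add: sum_negf sum_distrib_left sum_distrib_right algebra_simps)
        also have "\<dots> = - (\<Sum>l<p. (\<Sum>j<p. K t i j * adj_mat (M t) $$ (j, l)) * \<kappa> t l)"
          by (subst sum.swap) (simp only: sum_distrib_right)
        also have "\<dots> = - (\<Sum>l<p. if i = l then dK t * \<kappa> t l else 0)"
          using adj by (intro arg_cong[where f = uminus] sum.cong) auto
        also have "\<dots> = - (dK t * \<kappa> t i)" using i by simp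
        finally have "(\<Sum>j<p. c t j * K t i j) = - (dK t * \<kappa> t i)" .
        moreover have "(\<Sum>j<p. u j * K t i j) = (\<Sum>j<p. c t j * K t i j) / dK t"
          by (simp add: u_def sum_divide_distrib)
        ultimately show ?thesis using t(2) by simp
      qed
      finally show ?thesis by simp
    qed
    show ?thesis using chart_through[OF Hinv du stab z J] zero by metis
  qed
  have rat: "(\<lambda>t. f (pt (minv (H t)) (H t) z J)) \<in> rational_funs {\<lambda>t. t} Q"
  proof (rule pt_subalg[OF f subalg_rational_funs[OF Qp]])
    show "(\<lambda>t. minv (H t) k) \<in> rational_funs {\<lambda>t. t} Q" for k unfolding Q_def by (rule rational_minv[OF Hp])
  qed (simp_all add: Hp poly_imp_rational poly_funs.const)
  have H1: "H 1 = h" by (simp add: H_def)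
  have hinv: "inverses h g" by (rule inverses_sym[OF gh])
  have g: "minv h = g" using inverses_dlt(2)[OF hinv] by simp
  have "f (pt (minv (H 1)) (H 1) z J) = 0"
  proof (rule rational_curve_vanishes[OF Qp rat])
    show "Q 1 \<noteq> 0" using inverses_dlt(1)[OF hinv] by (simp add: Q_def H1)
    have "finite ({t. dK t = 0} \<union> {t. dS t = 0})"
      using curve_funs_finite_zeros[OF dKp, of 0] curve_funs_finite_zeros[OF dSp, of 0] d0 dS0 by simp
    then show "finite {s. Q s \<noteq> 0 \<and> f (pt (minv (H s)) (H s) z J) \<noteq> 0}"
      by (rule finite_subset[rotated]) (use good in blast)
  qed
  then show "f x = 0" by (simp add: x H1 g)
qed

subsection \<open>The charts are immersions\<close>

text \<open>Affine functions whose differentials at the base of the chart are dual to the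
  parameters.\<close>

definition coordF :: "nat \<Rightarrow> framed_rep \<Rightarrow> complex" where
  "coordF i xj = (if i < p then tr P (\<zeta> i) (\<lambda>k. Xt (fst xj) k - x0 k)
     else if i < dimE then tr P (w i) (Zt (fst xj)) else Jt (snd xj) (kj (i - dimE)))"

lemma coordF_FC: "coordF i \<in> FC"
proof -
  have 1: "(\<lambda>xj. tr P (\<zeta> i) (\<lambda>k. Xt (fst xj) k - x0 k)) \<in> FC" "(\<lambda>xj. tr P (w i) (Zt (fst xj))) \<in> FC"
    by (intro subalg_tr subalg_diff subalg_const subalg_poly_funs framed_entries_poly)+
  show ?thesis
  proof (cases "i < p")
    case True
    then show ?thesis using 1(1) by (simp add: coordF_def[abs_def])
  next
    case False
    then show ?thesis using 1(2) framed_entries_poly(3) by (cases "i < dimE") (simp_all add: coordF_def[abs_def])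
  qed
qed

text \<open>Along a line through the origin in the parameter space, \<open>coordF i\<close>
  vanishes at the origin to first order with the \<open>i\<close>-th component of the direction as
  derivative; stated without derivatives, by splitting off a factor \<open>t\<close>.\<close>

lemma coordF_velocity:
  fixes c :: "nat \<Rightarrow> complex"
  assumes i: "i < dimF"
  defines "Q \<equiv> \<lambda>t. dlt (slice (\<lambda>j. t * c j))"
  shows "\<exists>L\<in>rational_funs {\<lambda>t. t} Q. L 0 = c i \<and>
    (\<forall>t. Q t \<noteq> 0 \<longrightarrow> coordF i (chart (\<lambda>j. t * c j)) = t * L t)"
proof -
  define s where "s = (\<lambda>t. slice (\<lambda>j. t * c j))"
  have sp: "(\<lambda>t. s t k) \<in> curve_funs" for k
    unfolding s_def slice_def
    by (intro subalg_add subalg_sum subalg_mult subalg_const subalg_poly_funs poly_funs.coord) auto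
  have Qs: "Q = (\<lambda>t. dlt (s t))" by (simp add: Q_def s_def)
  have Qp: "Q \<in> curve_funs" unfolding Qs by (intro subalg_dlt subalg_poly_funs sp)
  have R: "subalg (rational_funs {\<lambda>t. t} Q)" by (rule subalg_rational_funs[OF Qp])
  have mp: "(\<lambda>t. minv (s t) k) \<in> rational_funs {\<lambda>t. t} Q" for k unfolding Qs by (rule rational_minv[OF sp])
  have s0: "s 0 = I1" by (simp add: s_def slice_def)
  have minv1: "minv I1 = I1" using inverses_dlt(2)[OF inverses_one] by simp
  have XE: "mul (mul (s t) x0) (minv (s t)) \<in> ED" and ZE: "mul (mul (s t) (fibre u)) (minv (s t)) \<in> EU" for t u
    using slice_EG fibre_EU adjt_EG supported_lin(3)[OF adjt_EG, of "inverse (dlt (s t))" "s t"]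
    unfolding minv_def s_def by (auto simp: divide_inverse mult.commute)
  show ?thesis
  proof (cases "i < p")
    case True
    define A where "A = (\<lambda>k. \<Sum>j<p. c j * w j k)"
    define L where "L = (\<lambda>t. tr P (\<zeta> i) (mul A (minv (s t))))"
    have AE: "A \<in> ED" unfolding A_def using wE pD by (intro supported_lin) auto
    have "L \<in> rational_funs {\<lambda>t. t} Q"
      unfolding L_def by (intro subalg_tr subalg_mm R mp subalg_const)
    moreover have "L 0 = c i"
    proof -
      have "L 0 = (\<Sum>j<p. c j * tr P (\<zeta> i) (w j))"
        unfolding L_def s0 minv1 one_mul(4)[OF AE] unfolding A_def by (rule tr_sum_right)
      also have "\<dots> = (\<Sum>j<p. if j = i then c j else 0)" using dual True pD by (intro sum.cong) auto
      finally show ?thesis using True by simp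
    qed
    moreover have "coordF i (chart (\<lambda>j. t * c j)) = t * L t" if "Q t \<noteq> 0" for t
    proof -
      have inv: "inverses (s t) (minv (s t))" using inverses_minv[OF slice_EG] that by (simp add: Qs s_def)
      have "br (s t) x0 = (\<lambda>k. t * A k)"
      proof -
        have "s t = (\<lambda>k. I1 k + (\<Sum>j<p. (t * c j) * \<sigma> j k))" by (simp add: s_def slice_def)
        then have "br (s t) x0 = (\<lambda>k. br I1 x0 k + (\<Sum>j<p. (t * c j) * br (\<sigma> j) x0 k))"
          by (simp only: br_linear br_sum)
        also have "\<dots> = (\<lambda>k. t * A k)" using w\<sigma> by (simp add: br_one A_def sum_distrib_left mult.assoc)
        finally show ?thesis .
      qed
      moreover have "(\<lambda>k. mul (mul (s t) x0) (minv (s t)) k - x0 k) = mul (br (s t) x0) (minv (s t))"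
      proof -
        have "mul (mul x0 (s t)) (minv (s t)) = mul x0 (mul (s t) (minv (s t)))" by (rule mm_assoc)
        also have "\<dots> = x0" using inv by (simp add: inverses_def)
        finally show ?thesis unfolding br_def mm_diff_left by simp
      qed
      ultimately have "tr P (\<zeta> i) (\<lambda>k. mul (mul (s t) x0) (minv (s t)) k - x0 k) = t * L t"
        by (simp add: mm_scale_left tr_linear L_def)
      then show ?thesis using True XE[of t] by (simp add: coordF_def chart_def pt_def Xt_rp s_def)
    qed
    ultimately show ?thesis by blast
  next
    case False
    show ?thesis
    proof (cases "i < dimE")
      case True
      define L where "L = (\<lambda>t. tr P (w i) (mul (mul (s t) (fibre c)) (minv (s t))))"
      have "L \<in> rational_funs {\<lambda>t. t} Q"
        unfolding L_def by (intro subalg_tr subalg_mm R mp subalg_const poly_imp_rational sp)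
      moreover have "L 0 = c i"
      proof -
        have "L 0 = tr P (w i) (fibre c)"
          unfolding L_def s0 minv1 using fibre_EU by simp
        also have "\<dots> = (\<Sum>j<dimE. (if j < p then 0 else c j) * tr P (w i) (\<zeta> j))"
          unfolding fibre_def by (rule tr_sum_right)
        also have "\<dots> = (\<Sum>j<dimE. if j = i then c j else 0)"
          using dual True False by (intro sum.cong) (auto simp: tr_commute[of P "w i"])
        finally show ?thesis using True by simp
      qed
      moreover have "coordF i (chart (\<lambda>j. t * c j)) = t * L t" for t
      proof -
        have "fibre (\<lambda>j. t * c j) = (\<lambda>k. t * fibre c k)"
          unfolding fibre_def sum_distrib_left by (intro ext sum.cong) auto
        then have "mul (mul (s t) (fibre (\<lambda>j. t * c j))) (minv (s t)) = (\<lambda>k. t * mul (mul (s t) (fibre c)) (minv (s t)) k)"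
          by (simp add: mm_scale_left mm_scale_right)
        moreover have "Zt (fst (chart (\<lambda>j. t * c j))) = mul (mul (s t) (fibre (\<lambda>j. t * c j))) (minv (s t))"
          using ZE[of t "\<lambda>j. t * c j"] unfolding chart_def pt_def s_def fst_conv by (rule Zt_rp)
        ultimately show ?thesis using True False by (simp add: coordF_def L_def tr_linear)
      qed
      ultimately show ?thesis by blast
    next
      case F: False
      have "(\<lambda>_. c i) \<in> rational_funs {\<lambda>t. t} Q" by (rule subalg_const[OF R])
      moreover have "coordF i (chart (\<lambda>j. t * c j)) = t * c i" for t
      proof -
        have ik: "i - dimE < card KJ" using i F by simp
        have "framing (\<lambda>j. t * c j) (kj (i - dimE)) = (\<Sum>l<card KJ. if l = i - dimE then t * c (dimE + l) else 0)"
          unfolding framing_def using ik bij_betw_imp_inj_on[OF kj]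
          by (intro sum.cong) (auto simp: unit_fun_def inj_on_def)
        then show ?thesis using F False ik framing_EJ by (simp add: coordF_def chart_def pt_def Jt_fr)
      qed
      ultimately show ?thesis by (intro bexI[of _ "\<lambda>_. c i"]) auto
    qed
  qed
qed

text \<open>Restrict a relation to a line through the origin in direction \<open>u\<close>. Its
  lowest-order term in \<open>t\<close> is the part of lowest degree of the relation, evaluated at
  \<open>u\<close>; so this part is zero.\<close>

theorem coordF_independent:
  assumes A: "finite A" "\<And>\<alpha> \<beta>. \<alpha> \<in> A \<Longrightarrow> \<beta> \<in> A \<Longrightarrow> (\<forall>i<dimF. \<alpha> i = \<beta> i) \<Longrightarrow> \<alpha> = \<beta>"
    and zero: "\<And>x. x \<in> CF \<Longrightarrow> (\<Sum>\<alpha>\<in>A. c \<alpha> * (\<Prod>i<dimF. coordF i x ^ \<alpha> i)) = 0"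
    and \<alpha>: "\<alpha> \<in> A"
  shows "c \<alpha> = 0"
proof (rule ccontr)
  assume "c \<alpha> \<noteq> 0"
  define deg where "deg = (\<lambda>\<alpha> :: nat \<Rightarrow> nat. \<Sum>i<dimF. \<alpha> i)"
  define B where "B = {\<alpha> \<in> A. c \<alpha> \<noteq> 0}"
  have B: "finite B" "B \<noteq> {}" using A(1) \<alpha> \<open>c \<alpha> \<noteq> 0\<close> by (auto simp: B_def)
  define e where "e = Min (deg ` B)"
  have e: "e \<in> deg ` B" "\<And>\<beta>. \<beta> \<in> B \<Longrightarrow> e \<le> deg \<beta>" using B by (auto simp: e_def)
  define C where "C = {\<beta> \<in> B. deg \<beta> = e}"
  have "(\<Sum>\<beta>\<in>C. c \<beta> * monom_fun dimF \<beta> u) = 0" for u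
  proof -
    define Q where "Q = (\<lambda>t. dlt (slice (\<lambda>j. t * u j)))"
    have Qp: "Q \<in> curve_funs" unfolding Q_def slice_def
      by (intro subalg_dlt subalg_add subalg_sum subalg_mult subalg_const subalg_poly_funs poly_funs.coord) auto
    have R: "subalg (rational_funs {\<lambda>t. t} Q)" by (rule subalg_rational_funs[OF Qp])
    have "\<forall>i\<in>{..<dimF}. \<exists>L. L \<in> rational_funs {\<lambda>t. t} Q \<and> L 0 = u i \<and>
        (\<forall>t. Q t \<noteq> 0 \<longrightarrow> coordF i (chart (\<lambda>j. t * u j)) = t * L t)"
    proof
      fix i assume "i \<in> {..<dimF}"
      then show "\<exists>L. L \<in> rational_funs {\<lambda>t. t} Q \<and> L 0 = u i \<and>
          (\<forall>t. Q t \<noteq> 0 \<longrightarrow> coordF i (chart (\<lambda>j. t * u j)) = t * L t)"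
        using coordF_velocity[of i u] unfolding Q_def Bex_def by simp
    qed
    then obtain L where L: "\<And>i. i < dimF \<Longrightarrow> L i \<in> rational_funs {\<lambda>t. t} Q" "\<And>i. i < dimF \<Longrightarrow> L i 0 = u i"
        "\<And>i t. i < dimF \<Longrightarrow> Q t \<noteq> 0 \<Longrightarrow> coordF i (chart (\<lambda>j. t * u j)) = t * L i t"
      by (auto dest!: bchoice)
    define h where "h = (\<lambda>t. \<Sum>\<beta>\<in>B. c \<beta> * t ^ (deg \<beta> - e) * (\<Prod>i<dimF. L i t ^ \<beta> i))"
    have h: "h \<in> rational_funs {\<lambda>t. t} Q" unfolding h_def
      by (intro subalg_sum subalg_mult subalg_const subalg_prod subalg_power R L(1) poly_imp_rational poly_funs.coord) auto
    have "h t = 0" if t: "Q t \<noteq> 0" "t \<noteq> 0" for t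
    proof -
      let ?x = "chart (\<lambda>j. t * u j)"
      have x: "?x \<in> CF" using t(1) by (intro chart_CF) (simp add: Q_def)
      have pr: "(\<Prod>i<dimF. coordF i ?x ^ \<beta> i) = t ^ deg \<beta> * (\<Prod>i<dimF. L i t ^ \<beta> i)" for \<beta>
      proof -
        have "(\<Prod>i<dimF. coordF i ?x ^ \<beta> i) = (\<Prod>i<dimF. t ^ \<beta> i * L i t ^ \<beta> i)"
          using L(3) t(1) by (intro prod.cong) (auto simp: power_mult_distrib)
        then show ?thesis by (simp only: prod.distrib power_sum deg_def)
      qed
      have "0 = (\<Sum>\<beta>\<in>A. c \<beta> * (\<Prod>i<dimF. coordF i ?x ^ \<beta> i))" using zero[OF x] by simp
      also have "\<dots> = (\<Sum>\<beta>\<in>B. c \<beta> * (t ^ deg \<beta> * (\<Prod>i<dimF. L i t ^ \<beta> i)))"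
        unfolding pr using A(1) by (intro sum.mono_neutral_right) (auto simp: B_def)
      also have "\<dots> = (\<Sum>\<beta>\<in>B. t ^ e * (c \<beta> * t ^ (deg \<beta> - e) * (\<Prod>i<dimF. L i t ^ \<beta> i)))"
      proof (rule sum.cong[OF refl])
        fix \<beta> assume "\<beta> \<in> B"
        then have "t ^ deg \<beta> = t ^ e * t ^ (deg \<beta> - e)" using e(2) by (simp add: power_add[symmetric])
        then show "c \<beta> * (t ^ deg \<beta> * (\<Prod>i<dimF. L i t ^ \<beta> i)) = t ^ e * (c \<beta> * t ^ (deg \<beta> - e) * (\<Prod>i<dimF. L i t ^ \<beta> i))"
          by simp
      qed
      also have "\<dots> = t ^ e * h t" unfolding h_def by (rule sum_distrib_left[symmetric])
      finally show ?thesis using t(2) by simp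
    qed
    then have "{s. Q s \<noteq> 0 \<and> h s \<noteq> 0} \<subseteq> {0}" by blast
    then have "finite {s. Q s \<noteq> 0 \<and> h s \<noteq> 0}" by (rule finite_subset) simp
    moreover have "Q 0 \<noteq> 0" by (simp add: Q_def slice_def)
    ultimately have "h 0 = 0" by (intro rational_curve_vanishes[OF Qp h])
    moreover have "h 0 = (\<Sum>\<beta>\<in>C. c \<beta> * monom_fun dimF \<beta> u)"
    proof -
      have "h 0 = (\<Sum>\<beta>\<in>B. if deg \<beta> = e then c \<beta> * monom_fun dimF \<beta> u else 0)"
        unfolding h_def
      proof (rule sum.cong[OF refl])
        fix \<beta> assume "\<beta> \<in> B"
        then have "deg \<beta> - e = 0 \<longleftrightarrow> deg \<beta> = e" using e(2)[of \<beta>] by auto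
        moreover have "(\<Prod>i<dimF. L i 0 ^ \<beta> i) = monom_fun dimF \<beta> u"
          unfolding monom_fun_def using L(2) by (intro prod.cong) auto
        ultimately show "c \<beta> * 0 ^ (deg \<beta> - e) * (\<Prod>i<dimF. L i 0 ^ \<beta> i) = (if deg \<beta> = e then c \<beta> * monom_fun dimF \<beta> u else 0)"
          by (simp add: power_0_left)
      qed
      also have "\<dots> = (\<Sum>\<beta>\<in>C. c \<beta> * monom_fun dimF \<beta> u)"
        unfolding C_def using B(1) by (simp add: sum.If_cases Int_def conj_commute)
      finally show ?thesis .
    qed
    ultimately show ?thesis by simp
  qed
  moreover obtain \<beta> where "\<beta> \<in> C" using e(1) by (auto simp: C_def)
  moreover have "finite C" using B(1) by (simp add: C_def)
  moreover have "\<alpha> = \<beta>" if "\<alpha> \<in> C" "\<beta> \<in> C" "\<forall>i<dimF. \<alpha> i = \<beta> i" for \<alpha> \<beta>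
    using A(2) that by (auto simp: C_def B_def)
  ultimately have "c \<beta> = 0" using polynomial_identity[of C dimF c \<beta>] by blast
  then show False using \<open>\<beta> \<in> C\<close> by (simp add: C_def B_def)
qed

text \<open>The bundle has a dense subset with \<open>dimF\<close> parameters.\<close>

theorem CF_dependent:
  assumes G: "\<And>i. i \<le> dimF \<Longrightarrow> G i \<in> FC"
  shows "\<exists>d c. (\<exists>\<alpha>\<in>exponents (Suc dimF) d. c \<alpha> \<noteq> 0) \<and>
     (\<forall>x\<in>CF. (\<Sum>\<alpha>\<in>exponents (Suc dimF) d. c \<alpha> * (\<Prod>i<Suc dimF. G i x ^ \<alpha> i)) = 0)"
proof -
  define Q where "Q = (\<lambda>u. dlt (slice u))"
  have co: "(\<lambda>u. u i) \<in> poly_funs (coord_funs dimF)" if "i < dimF" for i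
    using that by (intro poly_funs.coord) auto
  have sp: "(\<lambda>u. slice u k) \<in> poly_funs (coord_funs dimF)" for k
    unfolding slice_def using pD
    by (intro subalg_add subalg_sum subalg_mult subalg_const subalg_poly_funs co) auto
  have Qp: "Q \<in> poly_funs (coord_funs dimF)" unfolding Q_def by (intro subalg_dlt subalg_poly_funs sp)
  let ?R = "rational_funs (coord_funs dimF) Q"
  have R: "subalg ?R" by (rule subalg_rational_funs[OF Qp])
  have rat: "(\<lambda>u. F (chart u)) \<in> ?R" if F: "F \<in> FC" for F
    unfolding chart_def
  proof (rule pt_subalg[OF F R])
    show "(\<lambda>u. slice u k) \<in> ?R" for k by (rule poly_imp_rational[OF sp])
    show "(\<lambda>u. minv (slice u) k) \<in> ?R" for k unfolding Q_def by (rule rational_minv[OF sp])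
    have if_co: "(\<lambda>u. if i < p then 0 else u i) \<in> ?R" if "i < dimE" for i
      using that co[of i] by (cases "i < p") (auto intro: poly_imp_rational poly_funs.const)
    show "(\<lambda>u. fibre u k) \<in> ?R" for k unfolding fibre_def
      by (intro subalg_sum subalg_mult subalg_const R if_co) auto
    show "(\<lambda>u. framing u k) \<in> ?R" for k unfolding framing_def
      by (intro subalg_sum subalg_mult subalg_const R poly_imp_rational co) auto
  qed
  obtain d c where dc: "\<exists>\<alpha>\<in>exponents (Suc dimF) d. c \<alpha> \<noteq> 0"
    "\<And>u. Q u \<noteq> 0 \<Longrightarrow> (\<Sum>\<alpha>\<in>exponents (Suc dimF) d. c \<alpha> * (\<Prod>i<Suc dimF. G i (chart u) ^ \<alpha> i)) = 0"
    using algebraic_dependence[OF Qp, of "\<lambda>i u. G i (chart u)"] rat G by blast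
  have "(\<lambda>x. \<Sum>\<alpha>\<in>exponents (Suc dimF) d. c \<alpha> * (\<Prod>i<Suc dimF. G i x ^ \<alpha> i)) \<in> FC"
    by (intro subalg_sum subalg_mult subalg_const subalg_prod subalg_power subalg_poly_funs G) auto
  from chart_dense[OF this] dc show ?thesis unfolding Q_def by blast
qed

end

section \<open>The strata of the stable locus\<close>

lemma zariski_closure_iff:
  assumes "T \<subseteq> S"
  shows "x \<in> zariski S F closure_of T \<longleftrightarrow> x \<in> S \<and> (\<forall>p\<in>poly_funs F. (\<forall>z\<in>T. p z = 0) \<longrightarrow> p x = 0)"
proof
  assume x: "x \<in> zariski S F closure_of T"
  have "p x = 0" if p: "p \<in> poly_funs F" "\<forall>z\<in>T. p z = 0" for p
  proof -
    have "closedin (zariski S F) {z \<in> S. p z = 0}"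
      unfolding closedin_zariski using p(1) by (intro exI[of _ "{p}"]) auto
    then have "zariski S F closure_of T \<subseteq> {z \<in> S. p z = 0}" using p(2) assms by (intro closure_of_minimal) auto
    then show ?thesis using x by blast
  qed
  moreover have "x \<in> S" using x closure_of_subset_topspace[of "zariski S F" T] by auto
  ultimately show "x \<in> S \<and> (\<forall>p\<in>poly_funs F. (\<forall>z\<in>T. p z = 0) \<longrightarrow> p x = 0)" by blast
next
  assume x: "x \<in> S \<and> (\<forall>p\<in>poly_funs F. (\<forall>z\<in>T. p z = 0) \<longrightarrow> p x = 0)"
  have "closedin (zariski S F) (zariski S F closure_of T)" by simp
  then obtain A where A: "A \<subseteq> poly_funs F" "zariski S F closure_of T = {z \<in> S. \<forall>p\<in>A. p z = 0}"
    unfolding closedin_zariski by blast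
  have "T \<subseteq> zariski S F closure_of T" using assms by (intro closure_of_subset) simp
  then have "\<forall>p\<in>A. \<forall>z\<in>T. p z = 0" unfolding A(2) by blast
  then show "x \<in> zariski S F closure_of T" unfolding A(2) using x A(1) by blast
qed

context graded_space
begin

abbreviation Lst :: "framed_rep set" where "Lst \<equiv> Lambda_stable n v (w0 n)"

lemma Lst_cases:
  assumes "x \<in> Lst"
  obtains X Z J where "stable_triple n v X Z J" "x = (rp X Z, fr J)"
proof -
  have x: "fst x \<in> Lambda_tilde n v" "snd x \<in> Fr" using assms by (auto simp: Lambda_stable_def)
  obtain X Z where XZ: "X \<in> ED" "Z \<in> EU" "fst x = rp X Z" using rep_cases[OF Lambda_Rp[OF x(1)]] by metis
  obtain J where J: "J \<in> EJ" "snd x = fr J" using framing_cases[OF x(2)] by metis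
  have xe: "x = (rp X Z, fr J)" using XZ J by (metis prod.collapse)
  have "stable_triple n v X Z J"
    using assms unfolding xe Lambda_stable_iff[OF XZ(1,2) J(1)]
    by unfold_locales (use XZ J in auto)
  then show ?thesis using that xe by blast
qed

lemma Lst_subset: "Lst \<subseteq> Rp \<times> Fr"
  using Lst_cases by (auto elim!: Lst_cases)

lemma word_subalg:
  assumes R: "subalg R" and X: "\<And>k. (\<lambda>u. X u k) \<in> R" and Z: "\<And>k. (\<lambda>u. Z u k) \<in> R" and J: "\<And>k. (\<lambda>u. J u k) \<in> R"
  shows "(\<lambda>u. word (X u) (Z u) (J u) k m q) \<in> R"
proof (induction k arbitrary: q)
  case 0
  show ?case
  proof (induction m arbitrary: q)
    case (Suc m)
    then show ?case unfolding word_0_Suc by (intro subalg_rm R Z)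
  qed (simp add: J)
next
  case (Suc k)
  then show ?case unfolding word_simps by (intro subalg_rm R X)
qed

end

context young_space
begin

definition word_det_fun :: "framed_rep \<Rightarrow> complex" where
  "word_det_fun xj = word_det (Xt (fst xj)) (Zt (fst xj)) (Jt (snd xj))"

lemma word_det_fun_FC: "word_det_fun \<in> FC"
proof -
  have "(\<lambda>xj. word_matrix (Xt (fst xj)) (Zt (fst xj)) (Jt (snd xj)) k) \<in> FC" for k
  proof (cases "k \<in> K0")
    case False
    then have "(\<lambda>xj. word_matrix (Xt (fst xj)) (Zt (fst xj)) (Jt (snd xj)) k) = (\<lambda>_. 0)" by (cases k) (auto simp: word_matrix_def)
    then show ?thesis by (simp add: poly_funs.const)
  next
    case True
    then have "(\<lambda>xj. word_matrix (Xt (fst xj)) (Zt (fst xj)) (Jt (snd xj)) k) =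
        (\<lambda>xj. word (Xt (fst xj)) (Zt (fst xj)) (Jt (snd xj)) (fst (ipos (fst k))) (snd (ipos (fst k))) (snd k))"
      by (cases k) (auto simp: word_matrix_def)
    then show ?thesis using word_subalg[OF subalg_poly_funs framed_entries_poly] by simp
  qed
  then show ?thesis unfolding word_det_fun_def[abs_def] word_det_def by (intro subalg_dlt subalg_poly_funs)
qed

lemma word_det_fun_rp: "X \<in> ED \<Longrightarrow> Z \<in> EU \<Longrightarrow> J \<in> EJ \<Longrightarrow> word_det_fun (rp X Z, fr J) = word_det X Z J"
  by (simp add: word_det_fun_def Xt_rp Zt_rp Jt_fr)

lemma base_CF: "(rp x0 z0, fr j0) \<in> CF"
  unfolding CF_def using orb_x0 base_commute by blast

lemma word_det_fun_base: "word_det_fun (rp x0 z0, fr j0) = 1"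
  by (simp add: word_det_fun_rp word_det_base)

lemma CF_stableI:
  assumes "x \<in> CF" "word_det_fun x \<noteq> 0"
  shows "x \<in> Lst"
proof -
  obtain X Z J where x: "orb X" "Z \<in> EU" "mul X Z = mul Z X" "J \<in> EJ" "x = (rp X Z, fr J)"
    using assms(1) unfolding CF_def by blast
  have X: "X \<in> ED" by (rule orb_ED[OF x(1)])
  then have "separating X Z J" using assms(2) x word_det_fun_rp word_det_separating by simp
  then show ?thesis unfolding x(5) Lambda_stable_iff[OF X x(2,4)] using x orb_nilpotent by blast
qed

lemma base_Lst: "(rp x0 z0, fr j0) \<in> Lst"
  by (rule CF_stableI[OF base_CF]) (simp add: word_det_fun_base)

text \<open>The word determinant is nonzero somewhere, and the points where it is nonzero are
  stable.\<close>

lemma stable_dense: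
  assumes f: "f \<in> FC" and zero: "\<And>x. x \<in> CF \<Longrightarrow> x \<in> Lst \<Longrightarrow> f x = 0"
  shows "\<forall>x\<in>CF. f x = 0"
proof -
  have "f x * word_det_fun x = 0" if "x \<in> CF" for x using zero[OF that] CF_stableI[OF that] by auto
  then have "(\<forall>x\<in>CF. f x = 0) \<or> (\<forall>x\<in>CF. word_det_fun x = 0)" by (rule CF_prime[OF f word_det_fun_FC])
  then show ?thesis using base_CF word_det_fun_base by auto
qed

lemma young_dual_exists: "\<exists>p \<sigma> w \<zeta> kj. young_dual n v Y pos p \<sigma> w \<zeta> kj"
proof -
  obtain p \<sigma> w \<zeta> where ds: "dual_system x0 p \<sigma> w \<zeta>" using dual_system_exists[OF x0_ED] by blast
  have "finite KJ" by (simp add: KJ_def)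
  then obtain kj where "bij_betw kj {..<card KJ} KJ"
    using ex_bij_betw_nat_finite by (metis lessThan_atLeast0)
  then have "young_dual n v Y pos p \<sigma> w \<zeta> kj" using ds by unfold_locales
  then show ?thesis by blast
qed

lemma word_det_fun_CF_tail_count:
  assumes S': "young_space n v Y' pos'" and x: "x \<in> CF" "young_space.word_det_fun n v Y' pos' x \<noteq> 0"
  shows "tail_count Y' k \<le> tail_count Y k"
proof -
  interpret S': young_space n v Y' pos' by fact
  obtain X Z J where xe: "orb X" "Z \<in> EU" "mul X Z = mul Z X" "J \<in> EJ" "x = (rp X Z, fr J)"
    using x(1) unfolding CF_def by blast
  have X: "X \<in> ED" by (rule orb_ED[OF xe(1)])
  have "S'.word_det X Z J \<noteq> 0" using x(2) S'.word_det_fun_rp[OF X xe(2,4)] by (simp add: xe(5))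
  then show ?thesis by (rule tail_count_le_of_chart[OF S' X xe(2,4,1)])
qed

text \<open>A proper closed subset of an irreducible set has smaller dimension, but both bundles
  have dimension \<open>dimF\<close>. Suppose that the bundle of \<open>Y\<close> is contained in
  the closure of that of \<open>Y' \<noteq> Y\<close>, and let \<open>q\<close> be the word
  determinant of \<open>Y'\<close>, which vanishes on the former bundle but not on the latter. On
  the larger bundle the coordinates \<open>coordF\<close> of the smaller one and \<open>q\<close>
  satisfy a relation. After division by a power of \<open>q\<close>, some of its terms do not
  contain \<open>q\<close>, and on the smaller bundle they are a relation among the coordinates
  alone.\<close>

theorem closure_incomparable:
  assumes S': "young_space n v Y' pos'"
    and sub: "\<And>f. f \<in> FC \<Longrightarrow> \<forall>x\<in>young_space.CF n v Y' pos'. f x = 0 \<Longrightarrow> \<forall>x\<in>CF. f x = 0"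
  shows "Y = Y'"
proof (rule ccontr)
  assume ne: "Y \<noteq> Y'"
  interpret S': young_space n v Y' pos' by fact
  have "\<exists>x\<in>S'.CF. word_det_fun x \<noteq> 0" using sub[OF word_det_fun_FC] base_CF word_det_fun_base by force
  then have le: "tail_count Y k \<le> tail_count Y' k" for k
    using S'.word_det_fun_CF_tail_count[OF young_space_axioms] by blast
  let ?q = "S'.word_det_fun"
  have q0: "?q x = 0" if "x \<in> CF" for x
  proof (rule ccontr)
    assume "?q x \<noteq> 0"
    then have "tail_count Y' k \<le> tail_count Y k" for k using word_det_fun_CF_tail_count[OF S' that] by blast
    then have "Y = Y'" using le by (intro tail_count_inject young S'.young antisym)
    then show False using ne by simp
  qed
  obtain p \<sigma> w \<zeta> kj where "young_dual n v Y pos p \<sigma> w \<zeta> kj" using young_dual_exists by blast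
  then interpret D: young_dual n v Y pos p \<sigma> w \<zeta> kj .
  obtain p' \<sigma>' w' \<zeta>' kj' where "young_dual n v Y' pos' p' \<sigma>' w' \<zeta>' kj'" using S'.young_dual_exists by blast
  then interpret D': young_dual n v Y' pos' p' \<sigma>' w' \<zeta>' kj' .
  let ?N = "dimE + card KJ"
  define G where "G = (\<lambda>i. if i < ?N then D.coordF i else ?q)"
  have GF: "G i \<in> FC" for i unfolding G_def using D.coordF_FC S'.word_det_fun_FC by simp
  obtain d c where c: "\<exists>\<alpha>\<in>exponents (Suc ?N) d. c \<alpha> \<noteq> 0"
    "\<And>x. x \<in> S'.CF \<Longrightarrow> (\<Sum>\<alpha>\<in>exponents (Suc ?N) d. c \<alpha> * (\<Prod>i<Suc ?N. G i x ^ \<alpha> i)) = 0"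
    using D'.CF_dependent[of G] GF by blast
  have G_split: "(\<Prod>i<Suc ?N. G i x ^ \<alpha> i) = (\<Prod>i<?N. D.coordF i x ^ \<alpha> i) * ?q x ^ \<alpha> ?N" for x \<alpha>
    by (simp add: G_def)
  define B where "B = {\<alpha> \<in> exponents (Suc ?N) d. c \<alpha> \<noteq> 0}"
  have finE: "finite (exponents (Suc ?N) d)" by (intro finite_PiE) auto
  have B: "finite B" "B \<noteq> {}" using finE c(1) by (auto simp: B_def)
  \<comment> \<open>The largest power of \<open>q\<close> that divides the relation;
    \<open>R\<close> is the quotient.\<close>
  define b where "b = Min ((\<lambda>\<alpha>. \<alpha> ?N) ` B)"
  have b: "b \<in> (\<lambda>\<alpha>. \<alpha> ?N) ` B" "\<And>\<alpha>. \<alpha> \<in> B \<Longrightarrow> b \<le> \<alpha> ?N" using B by (auto simp: b_def)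
  define R where "R = (\<lambda>x. \<Sum>\<alpha>\<in>B. c \<alpha> * (\<Prod>i<?N. D.coordF i x ^ \<alpha> i) * ?q x ^ (\<alpha> ?N - b))"
  have RF: "R \<in> FC" unfolding R_def
    by (intro subalg_sum subalg_mult subalg_const subalg_prod subalg_power subalg_poly_funs D.coordF_FC S'.word_det_fun_FC)
  have "R x * ?q x ^ b = 0" if x: "x \<in> S'.CF" for x
  proof -
    have "0 = (\<Sum>\<alpha>\<in>exponents (Suc ?N) d. c \<alpha> * ((\<Prod>i<?N. D.coordF i x ^ \<alpha> i) * ?q x ^ \<alpha> ?N))"
      using c(2)[OF x] unfolding G_split by simp
    also have "\<dots> = (\<Sum>\<alpha>\<in>B. c \<alpha> * ((\<Prod>i<?N. D.coordF i x ^ \<alpha> i) * ?q x ^ \<alpha> ?N))"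
      using finE by (intro sum.mono_neutral_right) (auto simp: B_def)
    also have "\<dots> = (\<Sum>\<alpha>\<in>B. c \<alpha> * (\<Prod>i<?N. D.coordF i x ^ \<alpha> i) * ?q x ^ (\<alpha> ?N - b) * ?q x ^ b)"
      using b(2) by (intro sum.cong refl) (simp add: mult.assoc power_add[symmetric])
    also have "\<dots> = R x * ?q x ^ b" unfolding R_def by (rule sum_distrib_right[symmetric])
    finally show ?thesis by simp
  qed
  moreover have "(\<lambda>x. ?q x ^ b) \<in> FC" by (intro subalg_power subalg_poly_funs S'.word_det_fun_FC)
  ultimately have "(\<forall>x\<in>S'.CF. R x = 0) \<or> (\<forall>x\<in>S'.CF. ?q x ^ b = 0)" using S'.CF_prime[OF RF] by blast
  then have "\<forall>x\<in>S'.CF. R x = 0" using S'.base_CF S'.word_det_fun_base by force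
  then have R0: "\<forall>x\<in>CF. R x = 0" by (rule sub[OF RF])
  define C where "C = {\<alpha> \<in> B. \<alpha> ?N = b}"
  obtain \<alpha> where \<alpha>: "\<alpha> \<in> C" using b(1) by (auto simp: C_def)
  have "c \<alpha> = 0"
  proof (rule D.coordF_independent[where A = C and c = c and \<alpha> = \<alpha>])
    show "finite C" using B(1) by (simp add: C_def)
    show "\<alpha> = \<beta>" if "\<alpha> \<in> C" "\<beta> \<in> C" "\<forall>i<?N. \<alpha> i = \<beta> i" for \<alpha> \<beta>
    proof (rule PiE_ext[of _ "{..<Suc ?N}" "\<lambda>_. {..d}"])
      show "\<alpha> \<in> exponents (Suc ?N) d" "\<beta> \<in> exponents (Suc ?N) d" using that by (auto simp: C_def B_def)
      show "\<alpha> i = \<beta> i" if "i \<in> {..<Suc ?N}" for i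
        using that \<open>\<alpha> \<in> C\<close> \<open>\<beta> \<in> C\<close> \<open>\<forall>i<?N. \<alpha> i = \<beta> i\<close> by (auto simp: C_def less_Suc_eq)
    qed
    fix x assume x: "x \<in> CF"
    have "0 = (\<Sum>\<alpha>\<in>B. c \<alpha> * (\<Prod>i<?N. D.coordF i x ^ \<alpha> i) * ?q x ^ (\<alpha> ?N - b))"
      using R0 x by (simp add: R_def)
    also have "\<dots> = (\<Sum>\<alpha>\<in>B. if \<alpha> ?N = b then c \<alpha> * (\<Prod>i<?N. D.coordF i x ^ \<alpha> i) else 0)"
    proof (rule sum.cong[OF refl])
      fix \<alpha> assume "\<alpha> \<in> B"
      then have "\<alpha> ?N - b = 0 \<longleftrightarrow> \<alpha> ?N = b" using b(2)[of \<alpha>] by auto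
      then show "c \<alpha> * (\<Prod>i<?N. D.coordF i x ^ \<alpha> i) * ?q x ^ (\<alpha> ?N - b) =
          (if \<alpha> ?N = b then c \<alpha> * (\<Prod>i<?N. D.coordF i x ^ \<alpha> i) else 0)"
        using q0[OF x] by (simp add: power_0_left)
    qed
    also have "\<dots> = (\<Sum>\<alpha>\<in>C. c \<alpha> * (\<Prod>i<?N. D.coordF i x ^ \<alpha> i))"
      unfolding C_def by (rule sum.inter_filter[OF B(1), symmetric])
    finally show "(\<Sum>\<alpha>\<in>C. c \<alpha> * (\<Prod>i<?N. D.coordF i x ^ \<alpha> i)) = 0" by simp
  qed (rule \<alpha>)
  then show False using \<alpha> by (simp add: C_def B_def)
qed

section \<open>The components\<close>

text \<open>The part of the stable locus whose quotient is \<open>X_var\<close>.\<close>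

definition KY :: "framed_rep set" where
  "KY = (conormal_closure n v (f_Y n Y) \<times> Fr) \<inter> Lst"

lemma CF_conormal: "CF = conormal n v (f_Y n Y) \<times> Fr"
proof (intro equalityI subsetI)
  fix x assume "x \<in> CF"
  then obtain X Z J where "orb X" "Z \<in> EU" "mul X Z = mul Z X" "J \<in> EJ" "x = (rp X Z, fr J)"
    unfolding CF_def by blast
  then have "rp X Z \<in> conormal n v (f_Y n Y)" "x = (rp X Z, fr J)" unfolding conormal_eq by blast+
  then show "x \<in> conormal n v (f_Y n Y) \<times> Fr" by simp
next
  fix x assume "x \<in> conormal n v (f_Y n Y) \<times> Fr"
  then obtain X Z where XZ: "orb X" "Z \<in> EU" "mul X Z = mul Z X" "fst x = rp X Z" "snd x \<in> Fr"
    unfolding conormal_eq by auto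
  obtain J where "J \<in> EJ" "snd x = fr J" using framing_cases[OF XZ(5)] by metis
  then have "x = (rp X Z, fr J)" using XZ(4) by (cases x) simp
  then show "x \<in> CF" unfolding CF_def using XZ(1-3) \<open>J \<in> EJ\<close> by blast
qed

lemma KY_iff: "x \<in> KY \<longleftrightarrow> x \<in> Lst \<and> (\<forall>f\<in>FC. (\<forall>y\<in>CF. f y = 0) \<longrightarrow> f x = 0)"
proof -
  obtain a j where x: "x = (a, j)" by (cases x)
  have sub: "conormal n v (f_Y n Y) \<subseteq> Rp" unfolding conormal_eq by auto
  show ?thesis
  proof
    assume k: "x \<in> KY"
    then have a: "a \<in> conormal_closure n v (f_Y n Y)" "j \<in> Fr" "x \<in> Lst" by (auto simp: KY_def x)
    have "f x = 0" if f: "f \<in> FC" "\<forall>y\<in>CF. f y = 0" for f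
    proof -
      have p: "(\<lambda>a. f (a, j)) \<in> RC" by (rule framed_poly_rep[OF f(1)])
      have "\<forall>z\<in>conormal n v (f_Y n Y). f (z, j) = 0"
      proof
        fix z assume "z \<in> conormal n v (f_Y n Y)"
        then have "(z, j) \<in> CF" unfolding CF_conormal using a(2) by (rule SigmaI)
        then show "f (z, j) = 0" by (rule bspec[OF f(2)])
      qed
      then show ?thesis unfolding x
        by (rule a(1)[unfolded conormal_closure_def zariski_closure_iff[OF sub], THEN conjunct2, THEN bspec, OF p, THEN mp])
    qed
    then show "x \<in> Lst \<and> (\<forall>f\<in>FC. (\<forall>y\<in>CF. f y = 0) \<longrightarrow> f x = 0)" using a(3) by blast
  next
    assume r: "x \<in> Lst \<and> (\<forall>f\<in>FC. (\<forall>y\<in>CF. f y = 0) \<longrightarrow> f x = 0)"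
    then have a: "a \<in> Rp" "j \<in> Fr" using Lst_subset x by auto
    have "f a = 0" if f: "f \<in> RC" "\<forall>z\<in>conormal n v (f_Y n Y). f z = 0" for f
    proof -
      have "\<forall>y\<in>CF. f (fst y) = 0"
      proof
        fix y assume "y \<in> CF"
        then have "fst y \<in> conormal n v (f_Y n Y)" unfolding CF_conormal by (rule mem_Times_iff[THEN iffD1, THEN conjunct1])
        then show "f (fst y) = 0" by (rule bspec[OF f(2)])
      qed
      then show ?thesis using r rep_poly_framed[OF f(1)] by (auto simp: x)
    qed
    then have "a \<in> conormal_closure n v (f_Y n Y)"
      unfolding conormal_closure_def zariski_closure_iff[OF sub] using a(1) by blast
    then show "x \<in> KY" using a(2) r by (simp add: KY_def x)
  qed
qed

lemma CF_KY: "x \<in> CF \<Longrightarrow> x \<in> Lst \<Longrightarrow> x \<in> KY"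
  by (auto simp: KY_iff)

text \<open>An equation of \<open>KY\<close> holds on the stable points of the bundle, hence on the
  whole bundle.\<close>

lemma KY_closure_CF:
  assumes "f \<in> FC" "\<forall>x\<in>KY. f x = 0"
  shows "\<forall>x\<in>CF. f x = 0"
  using stable_dense[OF assms(1)] assms(2) CF_KY by blast

end

context graded_space
begin

text \<open>The stable locus, of which \<open>L_tilde\<close> is the quotient by the gauge
  group.\<close>

definition TS :: "framed_rep topology" where
  "TS = subtopology (zariski (Rp \<times> Fr) (framed_coords n v (w0 n))) Lst"

lemma topspace_TS [simp]: "topspace TS = Lst"
  using Lst_subset by (auto simp: TS_def)

lemma closedin_TS: "closedin TS C \<longleftrightarrow> (\<exists>A\<subseteq>FC. C = {x \<in> Lst. \<forall>p\<in>A. p x = 0})"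
proof
  assume "closedin TS C"
  then obtain T where "closedin (zariski (Rp \<times> Fr) (framed_coords n v (w0 n))) T" "C = T \<inter> Lst"
    unfolding TS_def closedin_subtopology by blast
  then obtain A where "A \<subseteq> FC" "C = {x \<in> Rp \<times> Fr. \<forall>p\<in>A. p x = 0} \<inter> Lst" unfolding closedin_zariski by blast
  then show "\<exists>A\<subseteq>FC. C = {x \<in> Lst. \<forall>p\<in>A. p x = 0}" using Lst_subset by (intro exI[of _ A]) blast
next
  assume "\<exists>A\<subseteq>FC. C = {x \<in> Lst. \<forall>p\<in>A. p x = 0}"
  then obtain A where A: "A \<subseteq> FC" "C = {x \<in> Lst. \<forall>p\<in>A. p x = 0}" by blast
  have "closedin (zariski (Rp \<times> Fr) (framed_coords n v (w0 n))) {x \<in> Rp \<times> Fr. \<forall>p\<in>A. p x = 0}"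
    unfolding closedin_zariski using A(1) by blast
  moreover have "C = {x \<in> Rp \<times> Fr. \<forall>p\<in>A. p x = 0} \<inter> Lst" using A(2) Lst_subset by blast
  ultimately show "closedin TS C" unfolding TS_def closedin_subtopology by blast
qed

lemma L_tilde_eq: "L_tilde n v (w0 n) = quotient_topology TS (gauge_orbit n v)"
  by (simp add: L_tilde_def TS_def)

lemma in_gauge_orbit:
  assumes "x \<in> Rp \<times> Fr"
  shows "x \<in> gauge_orbit n v x"
proof -
  have "fst x \<in> Rp" "snd x \<in> Fr" using assms by (auto simp: mem_Times_iff)
  obtain X Z where XZ: "X \<in> ED" "Z \<in> EU" "fst x = rp X Z" using rep_cases[OF \<open>fst x \<in> Rp\<close>] .
  obtain J where J: "J \<in> EJ" "snd x = fr J" using framing_cases[OF \<open>snd x \<in> Fr\<close>] .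
  have x: "X \<in> ED" "Z \<in> EU" "J \<in> EJ" "x = (rp X Z, fr J)" using XZ J by (simp_all add: prod_eq_iff)
  obtain g where g: "g \<in> gauge_group n v" "Gt g = I1" using gauge_exists[OF one_EG] by auto
  have "minv I1 = I1" using inverses_dlt(2)[OF inverses_one] by simp
  moreover have "J \<in> supported P" using x(3) by (auto simp: supported_def KJ_def)
  then have "rm P J I1 = J" by (rule rm_one[OF finite_P])
  ultimately have "gauge_act n g x = x" unfolding x(4) gauge_act_eq[OF g(1) x(3)] g(2)
    using x by simp
  then show ?thesis unfolding gauge_orbit_def using g(1) by force
qed

end

context young_space
begin

lemma CF_gauge:
  assumes x: "x \<in> CF" and g: "g \<in> gauge_group n v"
  shows "gauge_act n g x \<in> CF"
proof -
  obtain X Z J where xe: "orb X" "Z \<in> EU" "mul X Z = mul Z X" "J \<in> EJ" "x = (rp X Z, fr J)"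
    using x unfolding CF_def by blast
  let ?G = "Gt g" and ?H = "minv (Gt g)"
  have inv: "inverses ?G ?H" by (rule inverses_minv[OF Gt_EG gauge_dlt[OF g]])
  have s: "X \<in> supported (P \<times> P)" "Z \<in> supported (P \<times> P)" using ED_P EU_P orb_ED xe by auto
  have "mul (mul (mul ?G X) ?H) (mul (mul ?G Z) ?H) = mul (mul (mul ?G Z) ?H) (mul (mul ?G X) ?H)"
    using conj_mul[OF inv s] conj_mul[OF inv s(2,1)] xe(3) by simp
  moreover have "mul (mul ?G Z) ?H \<in> EU" using inv xe(2) by (auto simp: inverses_def)
  moreover have "rm P J ?H \<in> EJ"
    unfolding supported_def
  proof (intro CollectI allI impI, rule ccontr)
    fix q assume q: "q \<notin> KJ" "rm P J ?H q \<noteq> 0"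
    then obtain r where r: "J r \<noteq> 0" "?H (r, q) \<noteq> 0" by (elim rm_nonzero)
    then have "r \<in> KJ" "(r, q) \<in> K0"
      using supportedD[OF xe(4) r(1)] supportedD[of ?H K0, OF _ r(2)] inv[unfolded inverses_def] by simp_all
    then show False using q(1) by (auto simp: KJ_def K0_def)
  qed
  ultimately show ?thesis
    unfolding xe(5) gauge_act_eq[OF g xe(4)] CF_def using orb_conj[OF xe(1) inv] by blast
qed

text \<open>The gauge group acts by polynomial maps that preserve the conormal bundle, hence it
  preserves the equations of the bundle.\<close>

lemma KY_saturated:
  assumes x: "x \<in> Lst" and k: "k \<in> KY" and orbit: "gauge_orbit n v x = gauge_orbit n v k"
  shows "x \<in> KY"
proof -
  have kL: "k \<in> Lst" using k by (simp add: KY_iff)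
  have "x \<in> gauge_orbit n v k" using in_gauge_orbit orbit x Lst_subset by blast
  then obtain g where g: "g \<in> gauge_group n v" "x = gauge_act n g k" by (auto simp: gauge_orbit_def)
  let ?G = "Gt g" and ?H = "minv (Gt g)"
  define \<phi> where "\<phi> = (\<lambda>y :: framed_rep. (rp (mul (mul ?G (Xt (fst y))) ?H) (mul (mul ?G (Zt (fst y))) ?H), fr (rm P (Jt (snd y)) ?H)))"
  have \<phi>: "gauge_act n g y = \<phi> y" if "y \<in> Rp \<times> Fr" for y
  proof -
    have "y = (rp (Xt (fst y)) (Zt (fst y)), fr (Jt (snd y)))"
      using that rp_inverse[of "fst y"] fr_inverse[of "snd y"] by (cases y) auto
    then show ?thesis unfolding \<phi>_def using gauge_act_eq[OF g(1) Jt_EJ] by metis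
  qed
  have CFR: "CF \<subseteq> Rp \<times> Fr" unfolding CF_def by auto
  have "f x = 0" if f: "f \<in> FC" "\<forall>y\<in>CF. f y = 0" for f
  proof -
    have "(\<lambda>y. f (\<phi> y)) \<in> FC"
      unfolding \<phi>_def
      by (rule framed_poly_comp[OF f(1) subalg_poly_funs])
         (intro subalg_mm subalg_rm subalg_const subalg_poly_funs framed_entries_poly)+
    moreover have "\<forall>y\<in>CF. f (\<phi> y) = 0"
    proof
      fix y assume y: "y \<in> CF"
      have "f (gauge_act n g y) = 0" using f(2) CF_gauge[OF y g(1)] by blast
      then show "f (\<phi> y) = 0" unfolding \<phi>[OF subsetD[OF CFR y]] .
    qed
    ultimately have "f (\<phi> k) = 0" using k[unfolded KY_iff, THEN conjunct2] by (metis (lifting))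
    moreover have "x = \<phi> k" unfolding g(2) by (rule \<phi>[OF subsetD[OF Lst_subset kL]])
    ultimately show ?thesis by simp
  qed
  then show ?thesis using x unfolding KY_iff by blast
qed

lemma KY_closed: "closedin TS KY"
  unfolding closedin_TS by (intro exI[of _ "{f \<in> FC. \<forall>y\<in>CF. f y = 0}"]) (auto simp: KY_iff)

lemma KY_irreducible: "irreducible_in TS KY"
  unfolding irreducible_in_def
proof (intro conjI allI impI)
  show "KY \<subseteq> topspace TS" by (auto simp: KY_iff)
  show "KY \<noteq> {}" using CF_KY[OF base_CF base_Lst] by blast
  fix A B assume AB: "closedin TS A" "closedin TS B" "KY \<subseteq> A \<union> B"
  obtain p where p: "p \<subseteq> FC" "A = {x \<in> Lst. \<forall>f\<in>p. f x = 0}" using AB(1) unfolding closedin_TS by blast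
  obtain q where q: "q \<subseteq> FC" "B = {x \<in> Lst. \<forall>f\<in>q. f x = 0}" using AB(2) unfolding closedin_TS by blast
  show "KY \<subseteq> A \<or> KY \<subseteq> B"
  proof (rule ccontr)
    assume "\<not> (KY \<subseteq> A \<or> KY \<subseteq> B)"
    then obtain x y where xy: "x \<in> KY" "x \<notin> A" "y \<in> KY" "y \<notin> B" by blast
    then obtain f f' where f: "f \<in> p" "f x \<noteq> 0" "f' \<in> q" "f' y \<noteq> 0" using p(2) q(2) by (auto simp: KY_iff)
    have fF: "f \<in> FC" "f' \<in> FC" using f p(1) q(1) by auto
    have "\<forall>z\<in>CF. f z * f' z = 0"
    proof (rule stable_dense)
      show "(\<lambda>z. f z * f' z) \<in> FC" using fF by (rule poly_funs.mult)
      fix z assume "z \<in> CF" "z \<in> Lst"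
      then have "z \<in> A \<union> B" using AB(3) CF_KY by blast
      then show "f z * f' z = 0" using p(2) q(2) f by auto
    qed
    then have "(\<forall>z\<in>CF. f z = 0) \<or> (\<forall>z\<in>CF. f' z = 0)" using CF_prime[OF fF] by blast
    then show False using xy f fF unfolding KY_iff by blast
  qed
qed

text \<open>Saturation makes closed sets of the quotient correspond to closed unions of
  orbits.\<close>

lemma KY_preimage: "{x \<in> topspace TS. gauge_orbit n v x \<in> gauge_orbit n v ` KY} = KY"
proof (intro equalityI subsetI)
  fix x assume "x \<in> {x \<in> topspace TS. gauge_orbit n v x \<in> gauge_orbit n v ` KY}"
  then obtain k where "x \<in> Lst" "k \<in> KY" "gauge_orbit n v x = gauge_orbit n v k" by auto
  then show "x \<in> KY" by (rule KY_saturated)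
qed (auto simp: KY_iff)

lemma X_var_KY: "X_var n v (w0 n) (f_Y n Y) = gauge_orbit n v ` KY"
  by (simp add: X_var_def KY_def)

lemma X_var_closed: "closedin (L_tilde n v (w0 n)) (X_var n v (w0 n) (f_Y n Y))"
proof -
  have "gauge_orbit n v ` KY \<subseteq> topspace (quotient_topology TS (gauge_orbit n v))"
    using KY_iff by auto
  moreover have "closedin TS {x \<in> topspace TS. gauge_orbit n v x \<in> gauge_orbit n v ` KY}"
    unfolding KY_preimage by (rule KY_closed)
  ultimately show ?thesis
    using quotient_map_quotient_topology[of TS "gauge_orbit n v"]
    unfolding X_var_KY L_tilde_eq quotient_map_closedin by blast
qed

lemma X_var_irreducible: "irreducible_in (L_tilde n v (w0 n)) (X_var n v (w0 n) (f_Y n Y))"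
  unfolding irreducible_in_def X_var_KY L_tilde_eq
proof (intro conjI allI impI)
  let ?\<pi> = "gauge_orbit n v" and ?Q = "quotient_topology TS (gauge_orbit n v)"
  show "?\<pi> ` KY \<subseteq> topspace ?Q" using KY_iff by auto
  show "?\<pi> ` KY \<noteq> {}" using KY_irreducible by (auto simp: irreducible_in_def)
  fix A B assume AB: "closedin ?Q A" "closedin ?Q B" "?\<pi> ` KY \<subseteq> A \<union> B"
  have pre: "closedin TS {x \<in> topspace TS. ?\<pi> x \<in> C}" if "closedin ?Q C" for C
    using quotient_map_quotient_topology[of TS ?\<pi>] that closedin_subset[OF that]
    unfolding quotient_map_closedin by blast
  have "KY \<subseteq> {x \<in> topspace TS. ?\<pi> x \<in> A} \<union> {x \<in> topspace TS. ?\<pi> x \<in> B}"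
    using AB(3) KY_iff by auto
  then have "KY \<subseteq> {x \<in> topspace TS. ?\<pi> x \<in> A} \<or> KY \<subseteq> {x \<in> topspace TS. ?\<pi> x \<in> B}"
    using KY_irreducible pre[OF AB(1)] pre[OF AB(2)] unfolding irreducible_in_def by blast
  then show "?\<pi> ` KY \<subseteq> A \<or> ?\<pi> ` KY \<subseteq> B" by blast
qed

lemma X_var_incomparable:
  assumes S': "young_space n v Y' pos'"
    and sub: "X_var n v (w0 n) (f_Y n Y) \<subseteq> X_var n v (w0 n) (f_Y n Y')"
  shows "Y = Y'"
proof (rule closure_incomparable[OF S'])
  interpret S': young_space n v Y' pos' by fact
  have KK: "KY \<subseteq> S'.KY"
  proof
    fix x assume "x \<in> KY"
    then have "x \<in> Lst" "gauge_orbit n v x \<in> gauge_orbit n v ` S'.KY"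
      using sub unfolding X_var_KY S'.X_var_KY by (auto simp: KY_iff)
    then show "x \<in> S'.KY" using S'.KY_preimage by auto
  qed
  fix f assume f: "f \<in> FC" "\<forall>x\<in>S'.CF. f x = 0"
  then have "\<forall>x\<in>S'.KY. f x = 0" using S'.KY_iff by blast
  then show "\<forall>x\<in>CF. f x = 0" using KY_closure_CF[OF f(1)] KK by blast
qed

lemma card_boxes: "card (boxes Y) = card P"
  by (rule bij_betw_same_card[OF pos_bij])

lemma length_bounds: "length Y \<le> card P" "l \<in> set Y \<Longrightarrow> l \<le> card P"
proof -
  have "(\<lambda>m. (0, m)) ` {..<length Y} \<subseteq> boxes Y" using young_pos[OF young] by (auto simp: boxes_def)
  from card_mono[OF finite_boxes this] show "length Y \<le> card P"
    by (simp add: card_boxes card_image inj_on_def)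
  assume "l \<in> set Y"
  then obtain m where m: "m < length Y" "l = Y ! m" by (metis in_set_conv_nth)
  have "(\<lambda>k. (k, m)) ` {..<l} \<subseteq> boxes Y" using m by (auto simp: boxes_def)
  from card_mono[OF finite_boxes this] show "l \<le> card P"
    by (simp add: card_boxes card_image inj_on_def)
qed

end

lemma young_space_of_v_Y:
  assumes "Y \<in> young_diagrams" "v_Y n Y = v"
  shows "\<exists>pos. young_space n v Y pos"
  using young_space_exists[OF assms(1)] v_Y_card[OF assms(1)] assms(2) by metis

lemma stable_cover:
  assumes v: "v \<in> dim_vectors n" and x: "x \<in> Lambda_stable n v (w0 n)"
  shows "\<exists>Y\<in>young_diagrams. v_Y n Y = v \<and> gauge_orbit n v x \<in> X_var n v (w0 n) (f_Y n Y)"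
proof -
  interpret graded_space n v .
  obtain X Z J where t: "stable_triple n v X Z J" "x = (rp X Z, fr J)" using Lst_cases[OF x] .
  interpret T: stable_triple n v X Z J by fact
  have "v_Y n T.Y = v"
  proof (rule extensionalityI[of _ "vertices n"])
    show "v_Y n T.Y i = v i" if "i \<in> vertices n" for i
      using v_Y_card[OF T.young_Y that] T.card_boxes_residue[OF that] by simp
  qed (use v v_Y_dim_vector[of n T.Y] in \<open>auto simp: dim_vectors_def PiE_def\<close>)
  moreover obtain pos where S: "young_space n v T.Y pos"
    using young_space_exists[OF T.young_Y T.card_boxes_residue] by blast
  interpret S: young_space n v T.Y pos by fact
  have "x \<in> S.CF" unfolding S.CF_def t(2) using T.stable_orbit[OF S] T.Z T.J T.comm by blast
  then have "gauge_orbit n v x \<in> X_var n v (w0 n) (f_Y n T.Y)"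
    unfolding S.X_var_KY using S.CF_KY x by blast
  ultimately show ?thesis using T.young_Y by blast
qed

theorem components_L_tilde:
  assumes v: "v \<in> dim_vectors n"
  shows "irreducible_components (L_tilde n v (w0 n)) =
    (\<lambda>Y. X_var n v (w0 n) (f_Y n Y)) ` {Y \<in> young_diagrams. v_Y n Y = v}"
proof (rule irreducible_components_eqI)
  interpret graded_space n v .
  let ?I = "{Y \<in> young_diagrams. v_Y n Y = v}"
  have "?I \<subseteq> {xs. set xs \<subseteq> {..card P} \<and> length xs \<le> card P}"
  proof
    fix Y assume "Y \<in> ?I"
    then obtain pos where "young_space n v Y pos" using young_space_of_v_Y by blast
    then interpret S: young_space n v Y pos .
    show "Y \<in> {xs. set xs \<subseteq> {..card P} \<and> length xs \<le> card P}" using S.length_bounds by auto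
  qed
  then show "finite ?I" by (rule finite_subset) (simp add: finite_lists_length_le)
  show "topspace (L_tilde n v (w0 n)) \<subseteq> (\<Union>Y\<in>?I. X_var n v (w0 n) (f_Y n Y))"
    using stable_cover[OF v] by (auto simp: L_tilde_eq)
next
  fix Y assume "Y \<in> {Y \<in> young_diagrams. v_Y n Y = v}"
  then obtain pos where "young_space n v Y pos" using young_space_of_v_Y by blast
  then interpret S: young_space n v Y pos .
  show "closedin (L_tilde n v (w0 n)) (X_var n v (w0 n) (f_Y n Y))" by (rule S.X_var_closed)
  show "irreducible_in (L_tilde n v (w0 n)) (X_var n v (w0 n) (f_Y n Y))" by (rule S.X_var_irreducible)
next
  fix Y Y' assume "Y \<in> {Y \<in> young_diagrams. v_Y n Y = v}" "Y' \<in> {Y \<in> young_diagrams. v_Y n Y = v}"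
    and sub: "X_var n v (w0 n) (f_Y n Y) \<subseteq> X_var n v (w0 n) (f_Y n Y')"
  then obtain pos pos' where S: "young_space n v Y pos" "young_space n v Y' pos'" using young_space_of_v_Y by blast
  from S(1) interpret S: young_space n v Y pos .
  show "Y = Y'" by (rule S.X_var_incomparable[OF S(2) sub])
qed

lemma X_var_f_Y_inject:
  assumes "Y \<in> young_diagrams" "Y' \<in> young_diagrams" "v_Y n Y = v" "v_Y n Y' = v"
    and "X_var n v (w0 n) (f_Y n Y) = X_var n v (w0 n) (f_Y n Y')"
  shows "Y = Y'"
proof -
  obtain pos pos' where S: "young_space n v Y pos" "young_space n v Y' pos'" using young_space_of_v_Y assms by blast
  from S(1) interpret S: young_space n v Y pos .
  show ?thesis using S.X_var_incomparable[OF S(2)] assms(5) by simp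
qed

text \<open>Being in \<open>Z_tilde_V\<close> fixes the graded dimension of the multiplicity
  function of \<open>A_Y\<close>, and this is the only condition.\<close>

lemma multiplicity_functions:
  assumes v: "v \<in> dim_vectors n" and Y: "Y \<in> young_diagrams"
  shows "f \<in> Z_tilde_V n v \<and> (\<forall>c\<in>segments n. f c = count (A_multiset n Y) c) \<longleftrightarrow> f = f_Y n Y \<and> v_Y n Y = v"
proof
  assume l: "f \<in> Z_tilde_V n v \<and> (\<forall>c\<in>segments n. f c = count (A_multiset n Y) c)"
  have f: "f = f_Y n Y"
  proof
    fix c
    show "f c = f_Y n Y c"
    proof (cases "c \<in> segments n")
      case False
      then have "f_Y n Y c = 0" "f c = 0"
        using f_Y_support[OF Y] l by (auto simp: Z_tilde_V_def Z_tilde_def)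
      then show ?thesis by simp
    qed (use l in \<open>simp add: f_Y_def\<close>)
  qed
  have "v_Y n Y = v"
  proof (rule extensionalityI[of _ "vertices n"])
    show "v_Y n Y i = v i" if "i \<in> vertices n" for i
      using l that f by (simp add: Z_tilde_V_def v_Y_def)
  qed (use v v_Y_dim_vector[of n Y] in \<open>auto simp: dim_vectors_def PiE_def\<close>)
  then show "f = f_Y n Y \<and> v_Y n Y = v" using f by blast
next
  assume "f = f_Y n Y \<and> v_Y n Y = v"
  then show "f \<in> Z_tilde_V n v \<and> (\<forall>c\<in>segments n. f c = count (A_multiset n Y) c)"
    using f_Y_Z_tilde[OF Y, of n] by (auto simp: Z_tilde_V_def f_Y_def v_Y_def)
qed

theorem theorem4p3p1:
  fixes n :: nat
  assumes "n \<ge> 1"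
  shows "(\<forall>v \<in> dim_vectors n.
            irreducible_components (L_tilde n v (w0 n)) =
              {X_var n v (w0 n) f | f. f \<in> Z_tilde_V n v \<and>
                 (\<exists>Y \<in> young_diagrams. \<forall>c \<in> segments n. f c = count (A_multiset n Y) c)}) \<and>
         bij_betw (\<lambda>Y. (v_Y n Y, X_Y n Y)) young_diagrams
           (SIGMA v : dim_vectors n. irreducible_components (L_tilde n v (w0 n)))"
proof (intro conjI ballI)
  fix v assume v: "v \<in> dim_vectors n"
  have "{X_var n v (w0 n) f | f. f \<in> Z_tilde_V n v \<and>
      (\<exists>Y \<in> young_diagrams. \<forall>c \<in> segments n. f c = count (A_multiset n Y) c)} =
    {X_var n v (w0 n) f | f. \<exists>Y \<in> young_diagrams. f = f_Y n Y \<and> v_Y n Y = v}"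
  proof (intro Collect_cong ex_cong1 conj_cong refl)
    fix f
    have "f \<in> Z_tilde_V n v \<and> (\<exists>Y \<in> young_diagrams. \<forall>c \<in> segments n. f c = count (A_multiset n Y) c) \<longleftrightarrow>
      (\<exists>Y \<in> young_diagrams. f \<in> Z_tilde_V n v \<and> (\<forall>c \<in> segments n. f c = count (A_multiset n Y) c))"
      by (simp only: bex_simps)
    also have "\<dots> \<longleftrightarrow> (\<exists>Y \<in> young_diagrams. f = f_Y n Y \<and> v_Y n Y = v)"
      by (rule bex_cong[OF refl], rule multiplicity_functions[OF v])
    finally show "f \<in> Z_tilde_V n v \<and> (\<exists>Y \<in> young_diagrams. \<forall>c \<in> segments n. f c = count (A_multiset n Y) c) \<longleftrightarrow>
      (\<exists>Y \<in> young_diagrams. f = f_Y n Y \<and> v_Y n Y = v)" .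
  qed
  also have "\<dots> = (\<lambda>Y. X_var n v (w0 n) (f_Y n Y)) ` {Y \<in> young_diagrams. v_Y n Y = v}"
  proof (intro equalityI subsetI)
    fix S assume "S \<in> {X_var n v (w0 n) f | f. \<exists>Y \<in> young_diagrams. f = f_Y n Y \<and> v_Y n Y = v}"
    then obtain f where f: "S = X_var n v (w0 n) f" "\<exists>Y \<in> young_diagrams. f = f_Y n Y \<and> v_Y n Y = v"
      unfolding mem_Collect_eq by (elim exE conjE)
    then obtain Y where "Y \<in> young_diagrams" "f = f_Y n Y" "v_Y n Y = v" by (elim bexE conjE)
    then show "S \<in> (\<lambda>Y. X_var n v (w0 n) (f_Y n Y)) ` {Y \<in> young_diagrams. v_Y n Y = v}"
      using f(1) by (intro image_eqI[of _ _ Y]) simp_all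
  next
    fix S assume "S \<in> (\<lambda>Y. X_var n v (w0 n) (f_Y n Y)) ` {Y \<in> young_diagrams. v_Y n Y = v}"
    then obtain Y where Y: "Y \<in> young_diagrams" "v_Y n Y = v" "S = X_var n v (w0 n) (f_Y n Y)"
      by (elim imageE CollectE conjE)
    then show "S \<in> {X_var n v (w0 n) f | f. \<exists>Y \<in> young_diagrams. f = f_Y n Y \<and> v_Y n Y = v}"
      unfolding mem_Collect_eq by (intro exI[of _ "f_Y n Y"] conjI bexI[of _ Y]) simp_all
  qed
  finally show "irreducible_components (L_tilde n v (w0 n)) = {X_var n v (w0 n) f | f. f \<in> Z_tilde_V n v \<and>
      (\<exists>Y \<in> young_diagrams. \<forall>c \<in> segments n. f c = count (A_multiset n Y) c)}"
    unfolding components_L_tilde[OF v] by (rule sym)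
next
  show "bij_betw (\<lambda>Y. (v_Y n Y, X_Y n Y)) young_diagrams
      (SIGMA v : dim_vectors n. irreducible_components (L_tilde n v (w0 n)))"
    unfolding bij_betw_def
  proof (intro conjI inj_onI)
    fix Y Y' assume Y: "Y \<in> young_diagrams" "Y' \<in> young_diagrams" and eq: "(v_Y n Y, X_Y n Y) = (v_Y n Y', X_Y n Y')"
    from eq[unfolded prod.inject] have v: "v_Y n Y = v_Y n Y'" and "X_Y n Y = X_Y n Y'" by blast+
    then have "X_var n (v_Y n Y') (w0 n) (f_Y n Y) = X_var n (v_Y n Y') (w0 n) (f_Y n Y')"
      unfolding X_Y_def v by -
    then show "Y = Y'" by (rule X_var_f_Y_inject[OF Y v refl])
  next
    show "(\<lambda>Y. (v_Y n Y, X_Y n Y)) ` young_diagrams =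
        (SIGMA v : dim_vectors n. irreducible_components (L_tilde n v (w0 n)))"
    proof (intro equalityI subsetI)
      fix a assume "a \<in> (\<lambda>Y. (v_Y n Y, X_Y n Y)) ` young_diagrams"
      then obtain Y where Y: "Y \<in> young_diagrams" "a = (v_Y n Y, X_Y n Y)" by (elim imageE)
      have "X_Y n Y \<in> irreducible_components (L_tilde n (v_Y n Y) (w0 n))"
        unfolding components_L_tilde[OF v_Y_dim_vector] X_Y_def using Y(1) by (intro image_eqI[OF refl]) simp
      then show "a \<in> (SIGMA v : dim_vectors n. irreducible_components (L_tilde n v (w0 n)))"
        unfolding Y(2) by (intro SigmaI v_Y_dim_vector)
    next
      fix a assume "a \<in> (SIGMA v : dim_vectors n. irreducible_components (L_tilde n v (w0 n)))"
      then obtain v S where a: "a = (v, S)" "v \<in> dim_vectors n" "S \<in> irreducible_components (L_tilde n v (w0 n))" by blast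
      then obtain Y where "Y \<in> young_diagrams" "v_Y n Y = v" "S = X_var n v (w0 n) (f_Y n Y)"
        unfolding components_L_tilde[OF a(2)] by blast
      then show "a \<in> (\<lambda>Y. (v_Y n Y, X_Y n Y)) ` young_diagrams"
        unfolding a(1) by (intro image_eqI[of _ _ Y]) (simp_all add: X_Y_def)
    qed
  qed
qed

end
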